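(* Let $\tfrac12<\sigma<1$, $0<\delta<\sigma-\tfrac12$ and $A>0$. Let $P_1$ be the set of real $x\ge2$ with $\pi(x)>\operatorname{li}(x)$. (i) If $\xi=0$, $\mathcal{B}=\mathcal{B}(\xi,\sigma,\delta,A)$ is a multiset constructed as described in the context, $\zeta(\rho)=0$ for all $\rho\in\mathcal{B}$ (with multiplicities), and $\zeta(s)$ has no other zeros in the region $\{s:\operatorname{Re}(s)\ge\sigma-\delta,\ \operatorname{Im}(s)\ge0\}$, then $\lim_{X\to\infty}\operatorname{meas}(P_1\cap[2,X])/X=0$. (ii) If $\xi=\pi$, $\mathcal{B}=\mathcal{B}(\xi,\sigma,\delta,A)$ is a multiset constructed as described in the context, $\zeta(\rho)=0$ for all $\rho\in\mathcal{B}$ (with multiplicities), and $\zeta(s)$ has no other zeros in the region $\{s:\operatorname{Re}(s)\ge\sigma-\delta,\ \operatorname{Im}(s)\ge0\}$, then $\lim_{X\to\infty}\operatorname{meas}(P_1\cap[2,X])/X=1$.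
   Context: $\pi(x)$ is the number of primes $p\le x$, $\operatorname{li}(x)$ the logarithmic integral, $\zeta$ the Riemann zeta function, and $\operatorname{meas}$ Lebesgue measure. Construction of $\mathcal{B}(\xi,\sigma,\delta,A)$ for $\xi\in[0,2\pi)$: for each integer $j\ge1$ choose real numbers $\gamma_j,\delta_j,\theta_j$ with $\exp(j^8)\le\gamma_j\le 2\exp(j^8)$, $|\delta_j-j^{-8}|\le j^{-9}$, and $|\theta_j-(\xi-\pi/2)j^{-16}|\le j^{-17}$. Choose $j_0$ so large that for all $j\ge j_0$ one has $\gamma_j>A$ and $\delta_j\le\delta$. Then $\mathcal{B}$ is the multiset union, over integers $j\ge j_0$ and $1\le k\le j^3$, of $m(k,j)=k(j^3+1-k)$ copies of $\rho_{j,k}=\sigma-\delta_j+i(k\gamma_j+\theta_j)$. *)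

theory Defs
  imports "HOL-Complex_Analysis.Complex_Analysis"
begin

text \<open>
  The Riemann zeta function as the analytic continuation of its Dirichlet series to the plane
  without 1. The value at the pole is fixed to be 0 only so that the function is unique; this
  value is never treated as a zero below.
\<close>

definition zeta :: "complex \<Rightarrow> complex" where
  "zeta = (THE f. f holomorphic_on (UNIV - {1}) \<and>
                  (\<forall>s. Re s > 1 \<longrightarrow> (\<lambda>n. 1 / of_nat (Suc n) powr s) sums f s) \<and>
                  f 1 = 0)"

definition zeta_zero_mult :: "complex \<Rightarrow> nat" where
  "zeta_zero_mult s = (if s \<noteq> 1 \<and> zeta s = 0 then nat (zorder zeta s) else 0)"

definition prime_pi :: "real \<Rightarrow> nat" where
  "prime_pi x = card {p::nat. prime p \<and> real p \<le> x}"

text \<open>The Cauchy principal value of the integral of \<open>1 / ln t\<close> over \<open>[0, x]\<close>, for \<open>x > 1\<close>.\<close>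

definition li :: "real \<Rightarrow> real" where
  "li x = Lim (at_right 0)
     (\<lambda>\<epsilon>. integral {0..1 - \<epsilon>} (\<lambda>t. 1 / ln t) + integral {1 + \<epsilon>..x} (\<lambda>t. 1 / ln t))"

definition P1 :: "real set" where
  "P1 = {x. x \<ge> 2 \<and> real (prime_pi x) > li x}"

definition rho :: "real \<Rightarrow> (nat \<Rightarrow> real) \<Rightarrow> (nat \<Rightarrow> real) \<Rightarrow> (nat \<Rightarrow> real) \<Rightarrow> nat \<Rightarrow> nat \<Rightarrow> complex" where
  "rho \<sigma> \<gamma> d \<theta> j k = Complex (\<sigma> - d j) (real k * \<gamma> j + \<theta> j)"

text \<open>
  The multisets in question are infinite, so they are represented by their multiplicity
  functions: a multiset union becomes a sum of multiplicities. The index set of the sum below is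
  finite for all admissible parameters (see \<open>finite_rho_fibre\<close>).
\<close>

definition B_mult ::
  "real \<Rightarrow> (nat \<Rightarrow> real) \<Rightarrow> (nat \<Rightarrow> real) \<Rightarrow> (nat \<Rightarrow> real) \<Rightarrow> nat \<Rightarrow> complex \<Rightarrow> nat" where
  "B_mult \<sigma> \<gamma> d \<theta> j0 s =
     (\<Sum>(j, k) \<in> {(j, k). j \<ge> j0 \<and> 1 \<le> k \<and> k \<le> j ^ 3 \<and> rho \<sigma> \<gamma> d \<theta> j k = s}.
        k * (j ^ 3 + 1 - k))"

definition admissible_params ::
  "real \<Rightarrow> (nat \<Rightarrow> real) \<Rightarrow> (nat \<Rightarrow> real) \<Rightarrow> (nat \<Rightarrow> real) \<Rightarrow> bool" where
  "admissible_params \<xi> \<gamma> d \<theta> \<longleftrightarrow> (\<forall>j\<ge>1.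
     exp (real j ^ 8) \<le> \<gamma> j \<and> \<gamma> j \<le> 2 * exp (real j ^ 8) \<and>
     \<bar>d j - 1 / real j ^ 8\<bar> \<le> 1 / real j ^ 9 \<and>
     \<bar>\<theta> j - (\<xi> - pi / 2) / real j ^ 16\<bar> \<le> 1 / real j ^ 17)"

definition is_B :: "real \<Rightarrow> real \<Rightarrow> real \<Rightarrow> real \<Rightarrow> (complex \<Rightarrow> nat) \<Rightarrow> bool" where
  "is_B \<xi> \<sigma> \<delta> A B \<longleftrightarrow> (\<exists>\<gamma> d \<theta> j0.
     admissible_params \<xi> \<gamma> d \<theta> \<and>
     j0 \<ge> 1 \<and> (\<forall>j\<ge>j0. \<gamma> j > A \<and> d j \<le> \<delta>) \<and>
     B = B_mult \<sigma> \<gamma> d \<theta> j0)"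

lemma finite_rho_fibre:
  assumes "admissible_params \<xi> \<gamma> d \<theta>" and "j0 \<ge> 1"
  shows "finite {(j, k). j \<ge> j0 \<and> 1 \<le> k \<and> k \<le> j ^ 3 \<and> rho \<sigma> \<gamma> d \<theta> j k = s}"
proof -
  define N where "N = nat \<lceil>\<bar>Im s\<bar> + \<bar>\<xi> - pi / 2\<bar> + 1\<rceil>"
  have "j \<le> N" if j: "j \<ge> j0" and k: "1 \<le> k" and eq: "rho \<sigma> \<gamma> d \<theta> j k = s" for j k
  proof -
    have j1: "real j \<ge> 1" using j assms(2) by simp
    have g: "exp (real j ^ 8) \<le> \<gamma> j"
      and t: "\<bar>\<theta> j - (\<xi> - pi / 2) / real j ^ 16\<bar> \<le> 1 / real j ^ 17"
      using assms j by (auto simp: admissible_params_def)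
    have "real j \<le> real j ^ 8" using power_increasing[of 1 8 "real j"] j1 by simp
    also have "\<dots> \<le> exp (real j ^ 8)" using exp_ge_add_one_self[of "real j ^ 8"] by linarith
    finally have jg: "real j \<le> \<gamma> j" using g by linarith
    have "1 * \<gamma> j \<le> real k * \<gamma> j"
      using k jg j1 by (intro mult_right_mono) auto
    moreover have "real k * \<gamma> j + \<theta> j = Im s" using eq by (auto simp: rho_def)
    moreover have "\<bar>(\<xi> - pi / 2) / real j ^ 16\<bar> \<le> \<bar>\<xi> - pi / 2\<bar>"
    proof -
      have "1 \<le> real j ^ 16" using j1 by (rule one_le_power)
      then have "\<bar>\<xi> - pi / 2\<bar> * 1 \<le> \<bar>\<xi> - pi / 2\<bar> * real j ^ 16" by (intro mult_left_mono) auto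
      then show ?thesis using \<open>1 \<le> real j ^ 16\<close>
        by (simp add: abs_divide divide_le_eq)
    qed
    moreover have "1 / real j ^ 17 \<le> 1" using one_le_power[OF j1, of 17] by (simp add: divide_le_eq)
    ultimately have "real j \<le> \<bar>Im s\<bar> + \<bar>\<xi> - pi / 2\<bar> + 1" using jg t by linarith
    then show ?thesis unfolding N_def by linarith
  qed
  then have "{(j, k). j \<ge> j0 \<and> 1 \<le> k \<and> k \<le> j ^ 3 \<and> rho \<sigma> \<gamma> d \<theta> j k = s}
               \<subseteq> {..N} \<times> {..N ^ 3}"
    by (auto intro: order_trans power_mono)
  then show ?thesis by (rule finite_subset) auto
qed

end

theory Submission
  imports Defs "HOL-Number_Theory.Number_Theory" "HOL-Probability.Probability" "HOL-Real_Asymp.Real_Asymp"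
begin

text \<open>
  If \<open>c\<close> is slightly smaller than \<open>\<sigma>\<close>, then \<open>\<psi>(x) - x\<close> differs from the sum of \<open>- x\<^sup>\<rho> / \<rho>\<close> over the zeros with
  real part above \<open>c\<close> by a function \<open>E\<close> with \<open>\<integral> E(x)\<^sup>2 x\<^sup>-\<^sup>2\<^sup>c\<^sup>-\<^sup>1 dx < \<infinity>\<close>: the Laplace transform of \<open>E(exp v)\<close>
  continues to the line \<open>Re s = c\<close> and is square integrable there, because the zeros in \<open>\<B>\<close> are sparse. Hence
  \<open>|E(x)| \<le> x\<^sup>c\<^sup>'\<close> off a set of density 0 for each \<open>c' > c\<close>, and the race is decided by \<open>\<B>\<close>.

  For \<open>u = ln x\<close> the zeros \<open>\<rho>\<^sub>j\<^sub>,\<^sub>k\<close> with fixed \<open>j\<close> contribute \<open>V\<^sub>j(u)\<close> times a sum over \<open>k\<close> with weights \<open>j\<^sup>3 + 1 - k\<close>,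
  that is, a Fejer kernel at \<open>\<gamma>\<^sub>j u\<close> minus \<open>j\<^sup>3 + 1\<close>, with a small phase error coming from \<open>\<theta>\<^sub>j\<close>. Only the indices \<open>j\<close> with
  \<open>|j - Y| = O(sqrt Y)\<close>, where \<open>u\<close> is about \<open>Y^16\<close>, matter. The Fejer kernel is \<open>O(1)\<close> unless \<open>\<gamma>\<^sub>j u\<close> is close to a
  multiple of \<open>2\<pi>\<close>, which happens for few \<open>x\<close>, so that almost always every relevant block has the sign given by \<open>\<xi>\<close>.

  The construction allows \<open>\<delta>\<^sub>1 = 0\<close>, in which case a zero would lie on the line \<open>Re s = \<sigma>\<close>. This is excluded
  because \<open>\<zeta>\<close> has no zeros with \<open>1/2 < Re s < 1\<close> and \<open>0.14 \<le> Im s \<le> 8.02\<close>, by Euler-Maclaurin summation.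
\<close>

section \<open>Continuation of the zeta function\<close>

lemma holomorphic_on_suminf:
  fixes f :: "nat \<Rightarrow> complex \<Rightarrow> complex"
  assumes S: "open S" and f: "\<And>n. f n holomorphic_on S"
    and M: "\<And>x. x \<in> S \<Longrightarrow> \<exists>d>0. \<exists>M. summable M \<and> (\<forall>n. \<forall>y\<in>ball x d. norm (f n y) \<le> M n)"
  shows "(\<lambda>x. \<Sum>n. f n x) holomorphic_on S"
proof (rule holomorphic_uniform_sequence[OF S])
  fix n
  show "(\<lambda>x. \<Sum>i<n. f i x) holomorphic_on S"
    by (intro holomorphic_intros f)
next
  fix x assume x: "x \<in> S"
  obtain d M where d: "d > 0" "summable M" "\<And>n y. y \<in> ball x d \<Longrightarrow> norm (f n y) \<le> M n"
    using M[OF x] by blast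
  obtain d' where d': "d' > 0" "cball x d' \<subseteq> S"
    using S x open_contains_cball by blast
  define e where "e = min d' (d / 2)"
  have e: "e > 0" "cball x e \<subseteq> S" "cball x e \<subseteq> ball x d"
    using d d' by (auto simp: e_def)
  have "uniform_limit (cball x e) (\<lambda>n x. \<Sum>i<n. f i x) (\<lambda>x. \<Sum>n. f n x) sequentially"
    using e d by (intro Weierstrass_m_test[of _ _ M]) auto
  thus "\<exists>d>0. cball x d \<subseteq> S \<and> uniform_limit (cball x d) (\<lambda>n x. \<Sum>i<n. f i x) (\<lambda>x. \<Sum>n. f n x) sequentially"
    using e by blast
qed

lemma gbinomial_norm_le:
  fixes z :: complex
  assumes "norm z \<le> b"
  shows "norm (z gchoose k) \<le> pochhammer b k / fact k"
proof -
  have "norm (z gchoose k) = (\<Prod>i=0..<k. norm (z - of_nat i)) / fact k"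
    by (simp add: gbinomial_prod_rev norm_divide prod_norm)
  also have "... \<le> (\<Prod>i=0..<k. b + of_nat i) / fact k"
  proof (intro divide_right_mono prod_mono)
    fix i assume "i \<in> {0..<k}"
    show "0 \<le> norm (z - of_nat i) \<and> norm (z - of_nat i) \<le> b + of_nat i"
      using norm_triangle_ineq4[of z "of_nat i"] assms by auto
  qed auto
  also have "... = pochhammer b k / fact k"
    by (simp add: pochhammer_prod)
  finally show ?thesis .
qed

lemma pochhammer_half_sums: "(\<lambda>k. pochhammer b k / fact k * (1/2) ^ k) sums (2 powr (b::real))"
proof -
  have "(\<lambda>k. ((-b) gchoose k) * (-1/2) ^ k) sums (1 + (-1/2)) powr (-b)"
    by (rule gen_binomial_real) auto
  moreover have "(1 + (-1/2)) powr (-b) = 2 powr b" by (simp add: powr_minus_divide powr_divide)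
  moreover have "((-b) gchoose k) * (-1/2) ^ k = pochhammer b k / fact k * (1/2) ^ k" for k
  proof -
    have "((-b) gchoose k) * (-1/2) ^ k = pochhammer b k / fact k * ((-1) ^ k * (-1/2) ^ k)"
      by (simp add: gbinomial_pochhammer)
    also have "(-1) ^ k * (-1/2) ^ k = ((1/2) ^ k :: real)"
      by (simp add: power_mult_distrib[symmetric])
    finally show ?thesis .
  qed
  ultimately show ?thesis by simp
qed

lemma binomial_series_tail_norm_le:
  fixes z :: complex
  assumes z: "norm z \<le> b" and t: "0 \<le> t" "t \<le> 1/2"
  shows "norm (\<Sum>k. (z gchoose (k + m)) * of_real t ^ (k + m)) \<le> (2 * t) ^ m * 2 powr b"
proof -
  define majorant where "majorant = (\<lambda>k. pochhammer b k / fact k * (1/2) ^ k)"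
  have nonneg: "pochhammer b k / fact k \<ge> 0" for k
    using gbinomial_norm_le[OF z, of k] norm_ge_zero order_trans by blast
  have majorant_sums: "majorant sums (2 powr b)" unfolding majorant_def by (rule pochhammer_half_sums)
  have shifted: "summable (\<lambda>k. majorant (k + m))"
    using majorant_sums by (intro summable_ignore_initial_segment) (rule sums_summable)
  have term_le: "norm ((z gchoose (k + m)) * of_real t ^ (k + m)) \<le> (2 * t) ^ m * majorant (k + m)" for k
  proof -
    have "t ^ (k + m) \<le> (1/2) ^ k * t ^ m"
      unfolding power_add using t by (intro mult_right_mono power_mono) auto
    also have "... = (2 * t) ^ m * (1/2) ^ (k + m)" by (simp add: power_add power_mult_distrib power_one_over)
    finally have "pochhammer b (k + m) / fact (k + m) * t ^ (k + m)
        \<le> pochhammer b (k + m) / fact (k + m) * ((2 * t) ^ m * (1/2) ^ (k + m))"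
      by (intro mult_left_mono nonneg)
    moreover have "norm ((z gchoose (k + m)) * of_real t ^ (k + m)) \<le> pochhammer b (k + m) / fact (k + m) * t ^ (k + m)"
      unfolding norm_mult norm_power using t gbinomial_norm_le[OF z] by (intro mult_mono) (auto simp: nonneg)
    ultimately show ?thesis by (simp add: majorant_def mult_ac)
  qed
  have "norm (\<Sum>k. (z gchoose (k + m)) * of_real t ^ (k + m)) \<le> (\<Sum>k. (2 * t) ^ m * majorant (k + m))"
    by (intro norm_suminf_le term_le summable_mult shifted)
  also have "... = (2 * t) ^ m * (\<Sum>k. majorant (k + m))" by (rule suminf_mult[OF shifted])
  also have "... \<le> (2 * t) ^ m * 2 powr b"
  proof (rule mult_left_mono)
    have "(\<Sum>k. majorant (k + m)) = 2 powr b - (\<Sum>k<m. majorant k)"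
      using majorant_sums suminf_minus_initial_segment[of majorant m] by (simp add: sums_iff)
    moreover have "(\<Sum>k<m. majorant k) \<ge> 0" unfolding majorant_def by (intro sum_nonneg mult_nonneg_nonneg nonneg) auto
    ultimately show "(\<Sum>k. majorant (k + m)) \<le> 2 powr b" by linarith
  qed (use t in simp)
  finally show ?thesis .
qed

text \<open>The remainder of the Taylor expansion of \<open>x powr (1 - s)\<close> at \<open>n + 2\<close>. Summing over \<open>n\<close> expresses \<open>\<zeta>(s)\<close> by the
  values \<open>\<zeta>(s + 1), \<dots>, \<zeta>(s + m)\<close>, up to a remainder that converges for \<open>Re s > - m\<close>.\<close>

definition powr_remainder :: "nat \<Rightarrow> nat \<Rightarrow> complex \<Rightarrow> complex" where
  "powr_remainder m n s = of_nat (n + 3) powr (1 - s) -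
     (\<Sum>k\<le>m+1. ((1 - s) gchoose k) * of_nat (n + 2) powr (1 - s - of_nat k))"

lemma powr_remainder_eq:
  "powr_remainder m n s = of_nat (n + 2) powr (1 - s) *
    (\<Sum>k. ((1 - s) gchoose (k + (m + 2))) * of_real (1 / real (n + 2)) ^ (k + (m + 2)))"
proof -
  define N where "N = real (n + 2)"
  have N: "N \<ge> 2" "of_nat (n + 2) = (of_real N :: complex)" by (simp_all add: N_def)
  define a where "a = (\<lambda>k. ((1 - s) gchoose k) * of_real (1 / N) ^ k)"
  have a_sums: "a sums (1 + of_real (1/N)) powr (1 - s)"
    unfolding a_def using N by (intro gen_binomial_complex) (simp add: norm_divide)
  have shifted: "of_nat (n + 3) powr (1 - s) = of_real N powr (1 - s) * (1 + of_real (1/N)) powr (1 - s)"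
  proof -
    have "real (n + 3) = N * (1 + 1 / N)" using N by (simp add: N_def field_simps)
    hence "of_real (real (n + 3)) = (of_real (N * (1 + 1/N)) :: complex)" by (rule arg_cong)
    hence "of_nat (n + 3) = (of_real N * of_real (1 + 1/N) :: complex)" by (simp only: of_real_mult of_real_of_nat_eq)
    also have "... powr (1 - s) = of_real N powr (1 - s) * of_real (1 + 1/N) powr (1 - s)"
      using N by (intro powr_times_real) auto
    finally show ?thesis by simp
  qed
  have "of_real N powr (1 - s - of_nat k) = of_real N powr (1 - s) * of_real (1 / N) ^ k" for k
    using N by (simp add: powr_diff powr_nat' power_one_over divide_simps)
  hence "powr_remainder m n s = of_real N powr (1 - s) * ((1 + of_real (1/N)) powr (1 - s) - (\<Sum>k\<le>m+1. a k))"
    unfolding powr_remainder_def shifted N(2) a_def by (simp add: algebra_simps sum_distrib_left)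
  also have "(1 + of_real (1/N)) powr (1 - s) - (\<Sum>k\<le>m+1. a k) = (\<Sum>k. a (k + (m + 2)))"
    using a_sums suminf_minus_initial_segment[of a "m + 2"] by (simp add: sums_iff lessThan_Suc_atMost)
  finally show ?thesis by (simp add: a_def N_def)
qed

lemma norm_powr_remainder_le:
  assumes "norm (1 - s) \<le> b"
  shows "norm (powr_remainder m n s) \<le> 2 ^ (m + 2) * 2 powr b * real (n + 2) powr (- Re s - real m - 1)"
proof -
  define N where "N = real (n + 2)"
  have N: "N \<ge> 2" by (simp add: N_def)
  have "norm (powr_remainder m n s) = N powr (1 - Re s) *
      norm (\<Sum>k. ((1 - s) gchoose (k + (m + 2))) * of_real (1 / N) ^ (k + (m + 2)))"
    unfolding powr_remainder_eq norm_mult N_def using norm_powr_real_powr[of "of_real (real (n + 2))" "1 - s"] by simp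
  also have "... \<le> N powr (1 - Re s) * ((2 * (1 / N)) ^ (m + 2) * 2 powr b)"
    using N by (intro mult_left_mono binomial_series_tail_norm_le assms) auto
  also have "(2 * (1 / N)) ^ (m + 2) = 2 ^ (m + 2) * N powr (- real (m + 2))"
    using N by (simp only: power_mult_distrib powr_minus_divide powr_realpow power_one_over)
  also have "N powr (1 - Re s) * (2 ^ (m + 2) * N powr (- real (m + 2)) * 2 powr b)
      = 2 ^ (m + 2) * 2 powr b * (N powr (1 - Re s) * N powr (- real (m + 2)))" by (simp only: mult_ac)
  also have "N powr (1 - Re s) * N powr (- real (m + 2)) = N powr (- Re s - real m - 1)"
    by (simp add: powr_add[symmetric])
  finally show ?thesis unfolding N_def .
qed

lemma summable_shift_powr:
  fixes a :: real
  assumes "a < -1"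
  shows "summable (\<lambda>n. real (n + m) powr a)"
proof -
  have "summable (\<lambda>n. real n powr a)" using assms summable_real_powr_iff by blast
  thus ?thesis by (rule summable_ignore_initial_segment)
qed

lemma powr_remainder_holomorphic: "powr_remainder m n holomorphic_on UNIV"
  unfolding powr_remainder_def gbinomial_prod_rev
  by (intro holomorphic_intros) auto

lemma sum_powr_remainder_holomorphic: "(\<lambda>s. \<Sum>n. powr_remainder m n s) holomorphic_on {s. Re s > - real m}"
proof (rule holomorphic_on_suminf)
  show "open {s. Re s > - real m}" by (rule open_halfspace_Re_gt)
  show "powr_remainder m n holomorphic_on {s. Re s > - real m}" for n
    using powr_remainder_holomorphic by (rule holomorphic_on_subset) auto
next
  fix x assume x: "x \<in> {s. Re s > - real m}"
  define d where "d = (Re x + real m) / 2"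
  have d: "d > 0" using x by (auto simp: d_def)
  define b where "b = norm (1 - x) + d"
  define M where "M = (\<lambda>n. 2 ^ (m + 2) * 2 powr b * real (n + 2) powr (- (Re x - d) - real m - 1))"
  have "summable M" unfolding M_def d_def using x
    by (intro summable_mult summable_shift_powr) (auto simp: field_simps)
  moreover have "norm (powr_remainder m n y) \<le> M n" if "y \<in> ball x d" for n y
  proof -
    have "norm (1 - y) \<le> norm (1 - x) + norm (x - y)" using norm_triangle_ineq[of "1 - x" "x - y"] by simp
    hence "norm (1 - y) \<le> b" using that by (auto simp: b_def dist_norm)
    hence "norm (powr_remainder m n y) \<le> 2 ^ (m + 2) * 2 powr b * real (n + 2) powr (- Re y - real m - 1)"
      by (rule norm_powr_remainder_le)
    also have "... \<le> M n" unfolding M_def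
    proof (intro mult_left_mono powr_mono)
      have "\<bar>Re (x - y)\<bar> < d" using that abs_Re_le_cmod[of "x - y"] by (auto simp: dist_norm)
      thus "- Re y - real m - 1 \<le> - (Re x - d) - real m - 1" by simp
    qed auto
    finally show ?thesis .
  qed
  ultimately show "\<exists>d>0. \<exists>M. summable M \<and> (\<forall>n. \<forall>y\<in>ball x d. norm (powr_remainder m n y) \<le> M n)"
    using d by blast
qed

lemma norm_Suc_powr: "norm (of_nat (Suc n) powr s :: complex) = real (Suc n) powr Re s"
  using norm_powr_real_powr[of "of_real (real (Suc n))" s] by simp

lemma dirichlet_series_summable:
  assumes "Re s > 1"
  shows "summable (\<lambda>n. norm (1 / of_nat (n + Suc m) powr s :: complex))"
proof -
  have "norm (1 / of_nat (n + Suc m) powr s :: complex) = real (n + Suc m) powr (- Re s)" for n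
    unfolding norm_divide add_Suc_right norm_Suc_powr by (simp add: powr_minus_divide)
  thus ?thesis using summable_shift_powr[of "- Re s" "Suc m"] assms by simp
qed

definition zeta_tail :: "complex \<Rightarrow> complex" where
  "zeta_tail s = (\<Sum>n. 1 / of_nat (n + 2) powr s)"

lemma zeta_tail_sums: "Re s > 1 \<Longrightarrow> (\<lambda>n. 1 / of_nat (n + 2) powr s) sums zeta_tail s"
  using summable_norm_cancel[OF dirichlet_series_summable[of s 1]] unfolding zeta_tail_def by (simp add: summable_sums numeral_2_eq_2)

lemma dirichlet_series_sums:
  assumes "Re s > 1"
  shows "(\<lambda>n. 1 / of_nat (Suc n) powr s) sums (1 + zeta_tail s)"
proof -
  have "(\<lambda>n. 1 / of_nat (Suc (Suc n)) powr s) sums zeta_tail s" using zeta_tail_sums[OF assms] by simp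
  hence "(\<lambda>n. 1 / of_nat (Suc n) powr s) sums (zeta_tail s + 1)" by (subst (asm) sums_Suc_iff) simp
  thus ?thesis by (simp add: add.commute)
qed

lemma sum_powr_remainder_eq:
  assumes s: "Re s > 1"
  shows "(\<Sum>n. powr_remainder m n s) = - (2 powr (1 - s)) - (\<Sum>k=1..m+1. ((1 - s) gchoose k) * zeta_tail (s + of_nat k - 1))"
proof -
  have telescope: "(\<lambda>n. of_nat (Suc n + 2) powr (1 - s) - of_nat (n + 2) powr (1 - s)) sums (0 - of_nat (0 + 2) powr (1 - s))"
    using s by (intro telescope_sums tendsto_neg_powr_complex_of_nat filterlim_add_const_nat_at_top) auto
  have binomial_term: "(\<lambda>n. ((1 - s) gchoose k) * of_nat (n + 2) powr (1 - s - of_nat k)) sums (((1 - s) gchoose k) * zeta_tail (s + of_nat k - 1))"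
    if "k \<ge> 1" for k
  proof -
    have "(\<lambda>n. 1 / of_nat (n + 2) powr (s + of_nat k - 1)) sums zeta_tail (s + of_nat k - 1)"
      using that s by (intro zeta_tail_sums) auto
    moreover have "1 / of_nat (n + 2) powr (s + of_nat k - 1) = (of_nat (n + 2) powr (1 - s - of_nat k) :: complex)" for n
      using powr_minus_divide[of "of_nat (n + 2)" "s + of_nat k - 1"] by (simp add: algebra_simps)
    ultimately show ?thesis by (intro sums_mult) simp
  qed
  have "(\<lambda>n. (of_nat (Suc n + 2) powr (1 - s) - of_nat (n + 2) powr (1 - s)) -
      (\<Sum>k=1..m+1. ((1 - s) gchoose k) * of_nat (n + 2) powr (1 - s - of_nat k)))
    sums (0 - of_nat (0 + 2) powr (1 - s) - (\<Sum>k=1..m+1. ((1 - s) gchoose k) * zeta_tail (s + of_nat k - 1)))"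
    by (intro sums_diff telescope sums_sum binomial_term) auto
  moreover have "(of_nat (Suc n + 2) powr (1 - s) - of_nat (n + 2) powr (1 - s)) -
      (\<Sum>k=1..m+1. ((1 - s) gchoose k) * of_nat (n + 2) powr (1 - s - of_nat k)) = powr_remainder m n s" for n
  proof -
    have "{..m+1} = insert 0 {1..m+1}" by auto
    thus ?thesis by (simp add: powr_remainder_def numeral_3_eq_3 algebra_simps)
  qed
  ultimately show ?thesis by (simp add: sums_iff)
qed

lemma zeta_tail_recurrence:
  assumes s: "Re s > 1"
  shows "(s - 1) * zeta_tail s = 2 powr (1 - s)
    - (\<Sum>k=2..m+1. ((1 - s) gchoose (k - 1)) / of_nat k * ((s + of_nat k - 2) * zeta_tail (s + of_nat k - 1)))
    + (\<Sum>n. powr_remainder m n s)"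
proof -
  have "((1 - s) gchoose (k - 1)) / of_nat k * ((s + of_nat k - 2) * zeta_tail (s + of_nat k - 1))
      = - (((1 - s) gchoose k) * zeta_tail (s + of_nat k - 1))" if k: "k \<in> {2..m+1}" for k
  proof -
    obtain i where i: "k = Suc i" using k by (cases k) auto
    have "((1 - s) gchoose k) = ((1 - s) gchoose (k - 1)) * (1 - s - of_nat i) / of_nat k"
      unfolding i by (simp add: gbinomial_prod_rev field_simps del: of_nat_Suc)
    moreover have "s + of_nat k - 2 = - (1 - s - of_nat i)" by (simp add: i)
    ultimately show ?thesis by (simp only: times_divide_eq_left times_divide_eq_right minus_divide_left mult_minus_left mult_minus_right mult_ac)
  qed
  hence "(\<Sum>k=2..m+1. ((1 - s) gchoose (k - 1)) / of_nat k * ((s + of_nat k - 2) * zeta_tail (s + of_nat k - 1))) =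
      - (\<Sum>k=2..m+1. ((1 - s) gchoose k) * zeta_tail (s + of_nat k - 1))"
    by (simp add: sum_negf)
  moreover have "(\<Sum>k=1..m+1. ((1 - s) gchoose k) * zeta_tail (s + of_nat k - 1)) =
    (1 - s) * zeta_tail s + (\<Sum>k=2..m+1. ((1 - s) gchoose k) * zeta_tail (s + of_nat k - 1))"
    by (subst sum.atLeast_Suc_atMost) (auto simp: numeral_2_eq_2)
  ultimately show ?thesis unfolding sum_powr_remainder_eq[OF s] by (simp add: algebra_simps)
qed

lemma zeta_tail_continuation:
  "\<exists>g. g holomorphic_on {s. Re s > 1 - real m} \<and> (\<forall>s. Re s > 1 \<longrightarrow> g s = (s - 1) * zeta_tail s)"
proof (induction m)
  case 0
  have "(\<lambda>s. 2 powr (1 - s) + (\<Sum>n. powr_remainder 0 n s)) holomorphic_on {s. Re s > - real 0}"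
    by (intro holomorphic_intros sum_powr_remainder_holomorphic) auto
  hence "(\<lambda>s. 2 powr (1 - s) + (\<Sum>n. powr_remainder 0 n s)) holomorphic_on {s. Re s > 1 - real 0}"
    by (rule holomorphic_on_subset) auto
  thus ?case using zeta_tail_recurrence[of _ 0] by (intro exI[of _ "\<lambda>s. 2 powr (1 - s) + (\<Sum>n. powr_remainder 0 n s)"]) auto
next
  case (Suc m)
  then obtain g where g: "g holomorphic_on {s. Re s > 1 - real m}" "\<And>s. Re s > 1 \<Longrightarrow> g s = (s - 1) * zeta_tail s"
    by blast
  define f where "f = (\<lambda>s. 2 powr (1 - s) - (\<Sum>k=2..m+1. ((1 - s) gchoose (k - 1)) / of_nat k * g (s + of_nat k - 1))
    + (\<Sum>n. powr_remainder m n s))"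
  have "f holomorphic_on {s. Re s > - real m}" unfolding f_def
  proof (intro holomorphic_intros sum_powr_remainder_holomorphic)
    show "(\<lambda>s. ((1 - s) gchoose (k - 1))) holomorphic_on {s. - real m < Re s}" for k
      unfolding gbinomial_prod_rev by (intro holomorphic_intros) auto
    fix k :: nat assume k: "k \<in> {2..m+1}"
    have "(g \<circ> (\<lambda>s. s + of_nat k - 1)) holomorphic_on {s. Re s > - real m}"
      using k by (intro holomorphic_on_compose_gen[OF _ g(1)] holomorphic_intros) auto
    thus "(\<lambda>s. g (s + of_nat k - 1)) holomorphic_on {s. - real m < Re s}" by (simp add: o_def)
  qed auto
  moreover have "f s = (s - 1) * zeta_tail s" if s: "Re s > 1" for s
  proof -
    have "(\<Sum>k=2..m+1. ((1 - s) gchoose (k - 1)) / of_nat k * g (s + of_nat k - 1))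
        = (\<Sum>k=2..m+1. ((1 - s) gchoose (k - 1)) / of_nat k * ((s + of_nat k - 2) * zeta_tail (s + of_nat k - 1)))"
      using s by (intro sum.cong refl) (simp add: g(2))
    thus ?thesis unfolding f_def zeta_tail_recurrence[OF s, of m] by (simp only:)
  qed
  ultimately show ?case by (intro exI[of _ f]) auto
qed

lemma connected_Diff_one: "connected (UNIV - {1::complex})"
  using connected_punctured_universe[of "1::complex"] by (simp add: Compl_eq_Diff_UNIV)

lemma holomorphic_halfplane_unique:
  assumes "f holomorphic_on {s. Re s > a}" "g holomorphic_on {s. Re s > a}" "\<And>s. Re s > 1 \<Longrightarrow> f s = g s" "Re z > a"
  shows "f z = g z"
proof -
  have conn: "connected {s. Re s > a}" by (intro convex_connected convex_halfspace_Re_gt)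
  show ?thesis
    by (rule analytic_continuation_open[where s = "{s. Re s > max a 1}" and s' = "{s. Re s > a}" and f = f and g = g])
       (use assms conn open_halfspace_Re_gt[of a] open_halfspace_Re_gt[of "max a 1"] in \<open>auto intro!: exI[of _ "of_real (max a 1 + 1)"]\<close>)
qed

lemma entire_if_continued_to_halfplanes:
  assumes "\<And>m::nat. \<exists>g. g holomorphic_on {s. Re s > 1 - real m} \<and> (\<forall>s. Re s > 1 \<longrightarrow> g s = h s)"
  shows "\<exists>G. G holomorphic_on UNIV \<and> (\<forall>s. Re s > 1 \<longrightarrow> G s = h s)"
proof -
  obtain g where g: "\<And>m. g m holomorphic_on {s. Re s > 1 - real m}" "\<And>m s. Re s > 1 \<Longrightarrow> g m s = h s"
    using assms by metis
  define G where "G = (\<lambda>s. g (nat \<lceil>2 - Re s\<rceil>) s)"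
  have G: "G s = g m s" if "Re s > 1 - real m" for s m
  proof -
    define n where "n = nat \<lceil>2 - Re s\<rceil>"
    define k where "k = min m n"
    have "Re s > 1 - real n" unfolding n_def by linarith
    hence halfplane: "Re s > 1 - real k" using that by (auto simp: k_def min_def)
    have holomorphic: "g m holomorphic_on {s. Re s > 1 - real k}" "g n holomorphic_on {s. Re s > 1 - real k}"
      by (auto intro!: holomorphic_on_subset[OF g(1)] simp: k_def)
    have "g m s = g n s" by (rule holomorphic_halfplane_unique[OF holomorphic _ halfplane]) (simp add: g(2))
    thus ?thesis by (simp add: G_def n_def)
  qed
  have "G holomorphic_on UNIV"
    unfolding holomorphic_on_def
  proof safe
    fix x :: complex
    define m where "m = nat \<lceil>2 - Re x\<rceil>"
    have "x \<in> {s. Re s > 1 - real m}" unfolding m_def by (simp, linarith)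
    moreover have "G holomorphic_on {s. Re s > 1 - real m}"
      by (rule holomorphic_transform[OF g(1)[of m]]) (simp add: G)
    ultimately have "G field_differentiable at x"
      using open_halfspace_Re_gt by (auto intro: holomorphic_on_imp_differentiable_at)
    thus "G field_differentiable at x within UNIV" by simp
  qed
  moreover have "G s = h s" if "Re s > 1" for s using G[of 0 s] g(2)[of s 0] that by simp
  ultimately show ?thesis by blast
qed

lemma zeta_exists:
  "\<exists>f. f holomorphic_on (UNIV - {1}) \<and>
      (\<forall>s. Re s > 1 \<longrightarrow> (\<lambda>n. 1 / of_nat (Suc n) powr s) sums f s) \<and> f 1 = (0::complex)"
proof -
  obtain G where G: "G holomorphic_on UNIV" "\<And>s. Re s > 1 \<Longrightarrow> G s = (s - 1) * zeta_tail s"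
    using entire_if_continued_to_halfplanes[OF zeta_tail_continuation] by blast
  define f where "f = (\<lambda>s. if s = 1 then 0 else 1 + G s / (s - 1))"
  have "(\<lambda>s. 1 + G s / (s - 1)) holomorphic_on UNIV - {1}"
    by (intro holomorphic_intros holomorphic_on_subset[OF G(1)]) auto
  hence "f holomorphic_on UNIV - {1}"
    by (rule holomorphic_transform) (auto simp: f_def)
  moreover have "(\<lambda>n. 1 / of_nat (Suc n) powr s) sums f s" if s: "Re s > 1" for s
  proof -
    have "s \<noteq> 1" using s by auto
    hence "f s = 1 + zeta_tail s" using G(2)[OF s] by (simp add: f_def)
    thus ?thesis using dirichlet_series_sums[OF s] by simp
  qed
  ultimately show ?thesis by (intro exI[of _ f]) (auto simp: f_def)
qed

lemma zeta_props:
  "zeta holomorphic_on (UNIV - {1}) \<and>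
      (\<forall>s. Re s > 1 \<longrightarrow> (\<lambda>n. 1 / of_nat (Suc n) powr s) sums zeta s) \<and> zeta 1 = 0"
proof -
  have "\<exists>!f. f holomorphic_on (UNIV - {1}) \<and>
      (\<forall>s. Re s > 1 \<longrightarrow> (\<lambda>n. 1 / of_nat (Suc n) powr s) sums f s) \<and> f 1 = (0::complex)"
  proof (rule ex_ex1I[OF zeta_exists])
    fix f g :: "complex \<Rightarrow> complex"
    assume f: "f holomorphic_on (UNIV - {1}) \<and>
      (\<forall>s. Re s > 1 \<longrightarrow> (\<lambda>n. 1 / of_nat (Suc n) powr s) sums f s) \<and> f 1 = 0"
    assume g: "g holomorphic_on (UNIV - {1}) \<and>
      (\<forall>s. Re s > 1 \<longrightarrow> (\<lambda>n. 1 / of_nat (Suc n) powr s) sums g s) \<and> g 1 = 0"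
    show "f = g"
    proof
      fix z
      show "f z = g z"
      proof (cases "z = 1")
        case False
        show ?thesis
          by (rule analytic_continuation_open[where s = "{s. Re s > 1}" and s' = "UNIV - {1}" and f = f and g = g])
             (use f g connected_Diff_one False in \<open>auto intro: open_halfspace_Re_gt sums_unique2 intro!: exI[of _ 2]\<close>)
      qed (use f g in auto)
    qed
  qed
  from theI'[OF this] show ?thesis unfolding zeta_def .
qed

lemma zeta_holomorphic: "zeta holomorphic_on (UNIV - {1})"
  and zeta_sums: "Re s > 1 \<Longrightarrow> (\<lambda>n. 1 / of_nat (Suc n) powr s) sums zeta s"
  using zeta_props by auto

lemma zeta_eq_zeta_tail: "Re s > 1 \<Longrightarrow> zeta s = 1 + zeta_tail s"
  using dirichlet_series_sums zeta_sums sums_unique2 by blast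

lemma zeta_eq_sum_powr_remainder:
  assumes "Re s > 0" "s \<noteq> 1"
  shows "(s - 1) * (zeta s - 1) = 2 powr (1 - s) + (\<Sum>n. powr_remainder 0 n s)"
proof (rule analytic_continuation_open[where s = "{s. Re s > 1}" and s' = "{s. Re s > 0} - {1}"
  and f = "\<lambda>s. (s - 1) * (zeta s - 1)" and g = "\<lambda>s. 2 powr (1 - s) + (\<Sum>n. powr_remainder 0 n s)"])
  show "connected ({s. Re s > 0} - {1::complex})"
    by (rule connected_open_delete) (auto intro: open_halfspace_Re_gt convex_connected convex_halfspace_Re_gt)
  show "(\<lambda>s. (s - 1) * (zeta s - 1)) holomorphic_on ({s. Re s > 0} - {1})"
    by (intro holomorphic_intros holomorphic_on_subset[OF zeta_holomorphic]) auto
  show "(\<lambda>s. 2 powr (1 - s) + (\<Sum>n. powr_remainder 0 n s)) holomorphic_on ({s. Re s > 0} - {1})"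
    by (intro holomorphic_intros holomorphic_on_subset[OF sum_powr_remainder_holomorphic[of 0]]) auto
  show "(z - 1) * (zeta z - 1) = 2 powr (1 - z) + (\<Sum>n. powr_remainder 0 n z)" if "z \<in> {s. Re s > 1}" for z
    using that sum_powr_remainder_eq[of z 0] by (simp add: zeta_eq_zeta_tail algebra_simps)
qed (use assms in \<open>auto intro: open_halfspace_Re_gt intro!: exI[of _ 2] open_Diff\<close>)

lemma zeta_cnj: "zeta (cnj s) = cnj (zeta s)"
proof (cases "s = 1")
  case True
  thus ?thesis using zeta_props by simp
next
  case False
  have "cnj ` (UNIV - {1}) = UNIV - {1}" by (auto simp: image_cnj_conv_vimage_cnj)
  hence conjugate_holomorphic: "(cnj \<circ> zeta \<circ> cnj) holomorphic_on (UNIV - {1})"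
    using zeta_holomorphic by (intro holomorphic_on_compose_cnj_cnj) (auto intro: open_Diff)
  have agree: "(cnj \<circ> zeta \<circ> cnj) z = zeta z" if "Re z > 1" for z
  proof -
    have "(\<lambda>n. cnj (1 / of_nat (Suc n) powr (cnj z))) sums (cnj \<circ> zeta \<circ> cnj) z"
      unfolding o_def using zeta_sums[of "cnj z"] that by (subst sums_cnj) auto
    moreover have "cnj (1 / of_nat (Suc n) powr (cnj z)) = 1 / of_nat (Suc n) powr z" for n
      using cnj_powr[of "of_nat (Suc n)" "cnj z"] by (simp add: complex_nonpos_Reals_iff)
    ultimately show ?thesis using zeta_sums[OF that] sums_unique2 by simp
  qed
  have "(cnj \<circ> zeta \<circ> cnj) s = zeta s"
    by (rule analytic_continuation_open[where s = "{s. Re s > 1}" and s' = "UNIV - {1}" and f = "cnj \<circ> zeta \<circ> cnj" and g = zeta,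
        OF _ _ _ connected_Diff_one _ conjugate_holomorphic zeta_holomorphic agree])
       (use False in \<open>auto intro: open_halfspace_Re_gt intro!: exI[of _ 2]\<close>)
  thus ?thesis by (metis comp_apply complex_cnj_cnj)
qed

lemma norm_powr_minus_diff_le:
  fixes s :: complex
  assumes n: "n > 0" and x: "n \<le> x" "x \<le> n + 1" and s: "Re s \<ge> -1"
  shows "norm (of_real x powr (-s) - of_real n powr (-s)) \<le> norm s * n powr (- Re s - 1)"
proof -
  have "norm (of_real x powr (-s) - of_real n powr (-s)) \<le> norm s * n powr (- Re s - 1) * norm (x - n)"
  proof (rule differentiable_bound[where S = "{n..n+1}" and f' = "\<lambda>x h. h *\<^sub>R (-s * of_real x powr (-s-1))"])
    fix y assume y: "y \<in> {n..n+1}"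
    have "((\<lambda>y. of_real y powr (-s)) has_vector_derivative (-s * of_real y powr (-s-1))) (at y within {n..n+1})"
      using y n by (intro has_vector_derivative_real_field derivative_eq_intros) (auto simp: complex_nonpos_Reals_iff)
    thus "((\<lambda>y. of_real y powr (-s)) has_derivative (\<lambda>h. h *\<^sub>R (-s * of_real y powr (-s-1)))) (at y within {n..n+1})"
      by (simp add: has_vector_derivative_def)
    show "onorm (\<lambda>h. h *\<^sub>R (- s * complex_of_real y powr (- s - 1))) \<le> cmod s * n powr (- Re s - 1)"
    proof (rule onorm_le)
      fix h :: real
      have "norm (of_real y powr (-s-1)) = y powr (- Re s - 1)"
        using y n by (subst norm_powr_real_powr) auto
      also have "... \<le> n powr (- Re s - 1)" using y n s by (intro powr_mono2') auto
      finally show "norm (h *\<^sub>R (- s * complex_of_real y powr (- s - 1))) \<le> cmod s * n powr (- Re s - 1) * norm h"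
        by (auto simp: norm_mult mult_ac intro!: mult_left_mono)
    qed
  qed (use x in auto)
  also have "... \<le> norm s * n powr (- Re s - 1) * 1" using x by (intro mult_left_mono) auto
  finally show ?thesis by simp
qed

lemma norm_powr_remainder_0_le:
  assumes "Re s \<ge> -1"
  shows "norm (powr_remainder 0 n s) \<le> norm s * norm (1 - s) * real (n + 2) powr (- Re s - 1)"
proof -
  define N where "N = real (n + 2)"
  have N: "N > 0" by (simp add: N_def)
  define \<phi> where "\<phi> = (\<lambda>x. of_real x powr (1 - s) - (1 - s) * of_real N powr (-s) * of_real x :: complex)"
  have casts: "of_nat (n + 3) = (of_real (N + 1) :: complex)" "of_nat (n + 2) = (of_real N :: complex)" by (simp_all add: N_def)
  have remainder_eq: "powr_remainder 0 n s = \<phi> (N + 1) - \<phi> N"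
    unfolding powr_remainder_def \<phi>_def casts by (simp add: algebra_simps)
  have "norm (\<phi> (N + 1) - \<phi> N) \<le> (norm (1 - s) * (norm s * N powr (- Re s - 1))) * norm (N + 1 - N)"
  proof (rule differentiable_bound[where S = "{N..N+1}" and f' = "\<lambda>x h. h *\<^sub>R ((1 - s) * (of_real x powr (-s) - of_real N powr (-s)))"])
    fix y assume y: "y \<in> {N..N+1}"
    have "(\<phi> has_vector_derivative ((1 - s) * (of_real y powr (-s) - of_real N powr (-s)))) (at y within {N..N+1})"
      unfolding \<phi>_def
    proof (rule has_vector_derivative_real_field)
      have "((\<lambda>z. z powr (1 - s) - (1 - s) * of_real N powr (-s) * z) has_field_derivative
        (1 - s) * of_real y powr (1 - s - 1) - (1 - s) * of_real N powr (-s) * 1) (at (of_real y))"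
        using y N by (intro DERIV_diff DERIV_cmult DERIV_ident has_field_derivative_powr) (auto simp: complex_nonpos_Reals_iff)
      thus "((\<lambda>z. z powr (1 - s) - (1 - s) * of_real N powr (-s) * z) has_field_derivative
        (1 - s) * (of_real y powr (-s) - of_real N powr (-s))) (at (of_real y))"
        by (simp add: algebra_simps)
    qed
    thus "(\<phi> has_derivative (\<lambda>h. h *\<^sub>R ((1 - s) * (of_real y powr (-s) - of_real N powr (-s))))) (at y within {N..N+1})"
      by (simp add: has_vector_derivative_def)
    show "onorm (\<lambda>h. h *\<^sub>R ((1 - s) * (of_real y powr (-s) - of_real N powr (-s)))) \<le> norm (1 - s) * (norm s * N powr (- Re s - 1))"
    proof (rule onorm_le)
      fix h :: real
      show "norm (h *\<^sub>R ((1 - s) * (of_real y powr (-s) - of_real N powr (-s)))) \<le> norm (1 - s) * (norm s * N powr (- Re s - 1)) * norm h"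
        using mult_left_mono[OF norm_powr_minus_diff_le[OF N, of y s], of "\<bar>h\<bar> * norm (1 - s)"] y assms by (auto simp: norm_mult mult_ac)
    qed
  qed auto
  thus ?thesis by (simp add: remainder_eq N_def mult_ac)
qed

lemma norm_sum_powr_remainder_le:
  assumes s: "Re s \<ge> 1/2"
  shows "norm (\<Sum>n. powr_remainder 0 n s) \<le> norm s * norm (1 - s) * (\<Sum>n. real (n + 2) powr (- 3 / 2))"
proof -
  have majorant: "summable (\<lambda>n. real (n + 2) powr (- 3 / 2))" by (rule summable_shift_powr) auto
  have "norm (powr_remainder 0 n s) \<le> norm s * norm (1 - s) * real (n + 2) powr (- 3 / 2)" for n
    using s by (intro order_trans[OF norm_powr_remainder_0_le] mult_left_mono powr_mono) auto
  hence "norm (\<Sum>n. powr_remainder 0 n s) \<le> (\<Sum>n. norm s * norm (1 - s) * real (n + 2) powr (- 3 / 2))"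
    by (intro norm_suminf_le summable_mult majorant)
  also have "... = norm s * norm (1 - s) * (\<Sum>n. real (n + 2) powr (- 3 / 2))" by (rule suminf_mult[OF majorant])
  finally show ?thesis .
qed

lemma zeta_growth:
  "\<exists>C>0. \<forall>s. Re s \<ge> 1/2 \<and> s \<noteq> 1 \<longrightarrow> norm ((s - 1) * zeta s) \<le> C * (1 + norm s) ^ 2"
proof -
  define D where "D = (\<Sum>n. real (n + 2) powr (- 3 / 2))"
  have D: "D \<ge> 0" unfolding D_def by (intro suminf_nonneg summable_shift_powr) auto
  have "norm ((s - 1) * zeta s) \<le> (D + 4) * (1 + norm s) ^ 2" if s: "Re s \<ge> 1/2" "s \<noteq> 1" for s
  proof -
    have linear: "norm (1 - s) \<le> 1 + norm s" using norm_triangle_ineq4[of 1 s] by simp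
    have "norm (\<Sum>n. powr_remainder 0 n s) \<le> norm s * norm (1 - s) * D"
      unfolding D_def by (rule norm_sum_powr_remainder_le[OF s(1)])
    also have "... \<le> (1 + norm s) * (1 + norm s) * D" using linear D by (intro mult_right_mono mult_mono) auto
    finally have remainder: "norm (\<Sum>n. powr_remainder 0 n s) \<le> (1 + norm s) * (1 + norm s) * D" .
    have "norm (2 powr (1 - s) :: complex) = 2 powr (1 - Re s)" using norm_powr_real_powr[of 2 "1 - s"] by simp
    also have "... \<le> 2 powr 1" using s by (intro powr_mono) auto
    finally have power: "norm (2 powr (1 - s) :: complex) \<le> 2" by simp
    have "(s - 1) * zeta s = (s - 1) + 2 powr (1 - s) + (\<Sum>n. powr_remainder 0 n s)"
      using zeta_eq_sum_powr_remainder[of s] s by (simp add: algebra_simps)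
    hence "norm ((s - 1) * zeta s) \<le> norm (s - 1) + norm (2 powr (1 - s)) + norm (\<Sum>n. powr_remainder 0 n s)"
      by (metis norm_triangle_ineq norm_triangle_mono order_refl)
    also have "... \<le> (1 + norm s) + 2 + (1 + norm s) * (1 + norm s) * D"
      using remainder power linear by (intro add_mono) (simp_all add: norm_minus_commute)
    also have "... \<le> (D + 4) * (1 + norm s) ^ 2"
      using norm_ge_zero[of s] by (simp add: power2_eq_square algebra_simps)
    finally show ?thesis .
  qed
  thus ?thesis using D by (intro exI[of _ "D + 4"]) auto
qed

lemma norm_zeta_3_ge:
  assumes "Re s = 3"
  shows "norm (zeta s) \<ge> 1/4"
proof -
  have term_le: "norm (1 / of_nat (n + 2) powr s :: complex) \<le> 1/2 * (1 / real (Suc n) - 1 / real (Suc (Suc n)))" for n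
  proof -
    have "norm (1 / of_nat (n + 2) powr s :: complex) = 1 / real (n + 2) powr 3"
      using norm_powr_real_powr[of "of_real (real (n + 2))" s] assms by (simp add: norm_divide)
    also have "real (n + 2) powr 3 = real (n + 2) ^ 3" by (subst powr_numeral) auto
    also have "1 / real (n + 2) ^ 3 \<le> 1 / (2 * (real (Suc n) * real (Suc (Suc n))))"
    proof (intro divide_left_mono)
      have "2 * (real (Suc n) * real (Suc (Suc n))) = (2 * real (Suc n)) * real (n + 2)" by simp
      also have "... \<le> (real (n + 2) * real (n + 2)) * real (n + 2)"
        by (intro mult_right_mono mult_mono) auto
      finally show "2 * (real (Suc n) * real (Suc (Suc n))) \<le> real (n + 2) ^ 3" by (simp add: power3_eq_cube)
    qed (auto intro!: mult_pos_pos)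
    also have "... = 1/2 * (1 / real (Suc n) - 1 / real (Suc (Suc n)))"
      by (simp add: field_simps)
    finally show ?thesis .
  qed
  have "(\<lambda>n. 1 / real (Suc n) - 1 / real (Suc (Suc n))) sums (1 / real (Suc 0) - 0)"
    by (intro telescope_sums') real_asymp
  from sums_mult[OF this, of "1/2"] have telescope: "(\<lambda>n. 1/2 * (1 / real (Suc n) - 1 / real (Suc (Suc n)))) sums (1/2)" by simp
  have "norm (zeta_tail s) \<le> (\<Sum>n. 1/2 * (1 / real (Suc n) - 1 / real (Suc (Suc n))))"
    unfolding zeta_tail_def by (rule norm_suminf_le[OF term_le]) (use telescope in \<open>auto simp: sums_iff\<close>)
  also have "... = 1/2" using telescope by (simp only: sums_iff)
  finally have "norm (zeta_tail s) \<le> 1/2" .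
  thus ?thesis using zeta_eq_zeta_tail[of s] norm_triangle_ineq2[of 1 "- zeta_tail s"] assms by simp
qed

lemma zeta_not_identically_zero: "\<exists>s\<in>UNIV - {1}. zeta s \<noteq> 0"
  using norm_zeta_3_ge[of 3] by (intro bexI[of _ 3]) auto

lemma ln_powr_summable:
  assumes "a > (1::real)"
  shows "summable (\<lambda>n. ln (real (Suc n)) * real (Suc n) powr (- a))"
proof (rule summable_comparison_test')
  define e where "e = (a - 1) / 2"
  have e: "e > 0" using assms by (simp add: e_def)
  show "summable (\<lambda>n. 1 / e * real (n + 1) powr (- a + e))"
    using assms by (intro summable_mult summable_shift_powr) (auto simp: e_def field_simps)
  fix n :: nat
  have "ln (real (Suc n)) \<le> real (Suc n) powr e / e" using e by (intro ln_powr_bound) auto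
  hence "ln (real (Suc n)) * real (Suc n) powr (- a) \<le> real (Suc n) powr e / e * real (Suc n) powr (- a)"
    by (intro mult_right_mono) auto
  also have "... = 1 / e * real (n + 1) powr (- a + e)" by (simp add: powr_add[symmetric])
  finally show "norm (ln (real (Suc n)) * real (Suc n) powr (- a)) \<le> 1 / e * real (n + 1) powr (- a + e)"
    by simp
qed

lemma has_field_derivative_Suc_powr_minus:
  "((\<lambda>s. of_nat (Suc n) powr (-s)) has_field_derivative - complex_of_real (ln (real (Suc n))) * of_nat (Suc n) powr (-s)) (at s)"
proof -
  have "Ln (of_nat (Suc n)) = of_real (ln (real (Suc n)))" using Ln_of_real[of "real (Suc n)"] by simp
  hence "((\<lambda>s. exp (- s * Ln (of_nat (Suc n)))) has_field_derivative - complex_of_real (ln (real (Suc n))) * exp (- s * Ln (of_nat (Suc n)))) (at s)"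
    by (auto intro!: derivative_eq_intros simp del: of_nat_Suc)
  thus ?thesis by (simp add: powr_def del: of_nat_Suc)
qed

lemma deriv_zeta_sums:
  assumes "Re s > 1"
  shows "(\<lambda>n. - of_real (ln (real (Suc n))) / of_nat (Suc n) powr s) sums deriv zeta s"
proof -
  have "\<exists>g g'. \<forall>x \<in> {s. Re s > 1}. ((\<lambda>n. (of_nat (Suc n) :: complex) powr (-x)) sums g x) \<and>
      ((\<lambda>n. - of_real (ln (real (Suc n))) * (of_nat (Suc n) :: complex) powr (-x)) sums g' x) \<and> (g has_field_derivative g' x) (at x)"
  proof (rule series_and_derivative_comparison_complex[OF open_halfspace_Re_gt has_field_derivative_Suc_powr_minus])
    fix x assume x: "x \<in> {s. Re s > 1}"
    define d where "d = (Re x - 1) / 2"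
    define h where "h = (\<lambda>n. of_real (real (Suc n) powr (- Re x + d)) :: complex)"
    have "summable h" unfolding h_def summable_of_real_iff using x summable_shift_powr[of "- Re x + d" 1] by (auto simp: d_def field_simps)
    moreover have "range h \<subseteq> \<real>\<^sub>\<ge>\<^sub>0" by (auto simp: h_def)
    moreover have "cmod ((of_nat (Suc n) :: complex) powr (-y)) \<le> cmod (h n)" if "y \<in> ball x d" for n y
    proof -
      have "\<bar>Re (x - y)\<bar> < d" using that abs_Re_le_cmod[of "x - y"] by (auto simp: dist_norm)
      hence "real (Suc n) powr (- Re y) \<le> real (Suc n) powr (- Re x + d)" by (intro powr_mono) auto
      thus ?thesis unfolding norm_Suc_powr h_def by simp
    qed
    ultimately show "\<exists>d h. 0 < d \<and> summable h \<and> range h \<subseteq> \<real>\<^sub>\<ge>\<^sub>0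
        \<and> (\<forall>\<^sub>F n in sequentially. \<forall>y\<in>ball x d \<inter> {s. 1 < Re s}. cmod ((of_nat (Suc n) :: complex) powr (-y)) \<le> cmod (h n))"
      using x by (intro exI[of _ d] exI[of _ h]) (auto simp: d_def)
  qed
  then obtain g g' where g: "\<And>x. Re x > 1 \<Longrightarrow> (\<lambda>n. (of_nat (Suc n) :: complex) powr (-x)) sums g x"
    "\<And>x. Re x > 1 \<Longrightarrow> (\<lambda>n. - of_real (ln (real (Suc n))) * (of_nat (Suc n) :: complex) powr (-x)) sums g' x"
    "\<And>x. Re x > 1 \<Longrightarrow> (g has_field_derivative g' x) (at x)" by blast
  have "g x = zeta x" if "Re x > 1" for x
    using sums_unique2[OF g(1)[OF that]] zeta_sums[OF that] by (simp add: powr_minus_divide)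
  hence "(zeta has_field_derivative g' s) (at s)"
    by (intro has_field_derivative_transform_within_open[OF g(3)[OF assms] open_halfspace_Re_gt[of 1]]) (use assms in auto)
  hence "deriv zeta s = g' s" by (rule DERIV_imp_deriv)
  thus ?thesis using g(2)[OF assms] by (simp add: powr_minus_divide)
qed

lemma mangoldt_series_norm_summable:
  assumes "Re s > 1"
  shows "summable (\<lambda>n. norm (mangoldt (Suc n) / of_nat (Suc n) powr s :: complex))"
proof (rule summable_comparison_test')
  show "summable (\<lambda>n. ln (real (Suc n)) * real (Suc n) powr (- Re s))" by (rule ln_powr_summable[OF assms])
  fix n :: nat
  have "norm (mangoldt (Suc n) / of_nat (Suc n) powr s :: complex) = mangoldt (Suc n) * real (Suc n) powr (- Re s)"
    unfolding norm_divide norm_Suc_powr by (simp add: powr_minus_divide)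
  also have "... \<le> ln (real (Suc n)) * real (Suc n) powr (- Re s)"
    by (intro mult_right_mono mangoldt_le) auto
  finally show "norm (norm (mangoldt (Suc n) / of_nat (Suc n) powr s :: complex)) \<le> ln (real (Suc n)) * real (Suc n) powr (- Re s)" by simp
qed

lemma has_sum_Times:
  fixes p q :: "'a \<Rightarrow> complex"
  assumes p: "(p has_sum P) A" "(\<lambda>x. norm (p x)) summable_on A" and q: "(q has_sum Q) B" "(\<lambda>x. norm (q x)) summable_on B"
  shows "((\<lambda>(x, y). p x * q y) has_sum (P * Q)) (A \<times> B)"
proof (rule has_sum_SigmaI)
  show "((\<lambda>y. case (x, y) of (x, y) \<Rightarrow> p x * q y) has_sum p x * Q) B" for x
    unfolding prod.case by (intro has_sum_cmult_right q)
  show "((\<lambda>x. p x * Q) has_sum P * Q) A" by (intro has_sum_cmult_left p)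
  have "(\<lambda>z. norm (case z of (x, y) \<Rightarrow> p x * q y)) summable_on A \<times> B"
  proof (rule summable_on_SigmaI)
    show "((\<lambda>y. norm (case (x, y) of (x, y) \<Rightarrow> p x * q y)) has_sum norm (p x) * infsum (\<lambda>y. norm (q y)) B) B" for x
      unfolding prod.case norm_mult by (intro has_sum_cmult_right has_sum_infsum q)
    show "(\<lambda>x. norm (p x) * infsum (\<lambda>y. norm (q y)) B) summable_on A"
      by (intro summable_on_cmult_left p)
  qed auto
  thus "(\<lambda>(x, y). p x * q y) summable_on A \<times> B" by (rule abs_summable_summable)
qed

lemma bij_betw_Suc_atLeast_1: "bij_betw Suc UNIV {1..}"
  by (rule bij_betwI[where g = "\<lambda>n. n - 1"]) auto

lemma dirichlet_product_has_sum:
  fixes f g :: "nat \<Rightarrow> complex"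
  assumes f: "((\<lambda>n. f n / of_nat n powr s) has_sum F) {1..}" "(\<lambda>n. norm (f n / of_nat n powr s)) summable_on {1..}"
    and g: "((\<lambda>n. g n / of_nat n powr s) has_sum G) {1..}" "(\<lambda>n. norm (g n / of_nat n powr s)) summable_on {1..}"
  shows "((\<lambda>n. (\<Sum>d | d dvd n. f (n div d) * g d) / of_nat n powr s) has_sum (F * G)) {1..}"
proof -
  define h where "h = (\<lambda>(n, d). f (n div d) * g d / of_nat n powr s)"
  have "((\<lambda>(a, b). f a / of_nat a powr s * (g b / of_nat b powr s)) has_sum (F * G)) ({1..} \<times> {1..})"
    by (rule has_sum_Times[OF f g])
  also have "?this \<longleftrightarrow> (h has_sum (F * G)) (SIGMA n:{1..}. {d. d dvd n})"
  proof (rule has_sum_reindex_bij_witness[where j = "\<lambda>(a, b). (a * b, b)" and i = "\<lambda>(n, d). (n div d, d)"])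
    fix x :: "nat \<times> nat" assume "x \<in> {1..} \<times> {1..}"
    then obtain a b where x: "x = (a, b)" "a \<ge> 1" "b \<ge> 1" by auto
    show "(case (case x of (a, b) \<Rightarrow> (a * b, b)) of (n, d) \<Rightarrow> (n div d, d)) = x" using x by simp
    show "(case x of (a, b) \<Rightarrow> (a * b, b)) \<in> (SIGMA n:{1..}. {d. d dvd n})" using x by auto
    have "of_nat (a * b) powr s = (of_nat a powr s * of_nat b powr s :: complex)"
      using powr_times_real[of "of_nat a" "of_nat b" s] x by simp
    thus "h (case x of (a, b) \<Rightarrow> (a * b, b)) = (case x of (a, b) \<Rightarrow> f a / of_nat a powr s * (g b / of_nat b powr s))"
      using x by (simp add: h_def)
  qed (auto simp: Suc_le_eq dvd_div_eq_0_iff elim!: dvdE intro!: Nat.gr0I)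
  finally show ?thesis
  proof (rule has_sum_SigmaD)
    fix n :: nat assume "n \<in> {1..}"
    thus "((\<lambda>d. h (n, d)) has_sum ((\<Sum>d | d dvd n. f (n div d) * g d) / of_nat n powr s)) {d. d dvd n}"
      by (intro has_sum_finiteI) (auto simp: h_def sum_divide_distrib)
  qed
qed

lemma has_sum_atLeast_1_if_norm_summable:
  fixes f :: "nat \<Rightarrow> complex"
  assumes "summable (\<lambda>n. norm (f (Suc n)))"
  shows "(f has_sum (\<Sum>n. f (Suc n))) {1..}" "(\<lambda>n. norm (f n)) summable_on {1..}"
proof -
  have "((\<lambda>n. f (Suc n)) has_sum (\<Sum>n. f (Suc n))) UNIV"
    by (rule norm_summable_imp_has_sum[OF assms summable_sums[OF summable_norm_cancel[OF assms]]])
  thus "(f has_sum (\<Sum>n. f (Suc n))) {1..}" by (simp only: has_sum_reindex_bij_betw[OF bij_betw_Suc_atLeast_1])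
  have "(\<lambda>n. norm (f (Suc n))) summable_on UNIV"
    using assms by (intro norm_summable_imp_summable_on) simp
  thus "(\<lambda>n. norm (f n)) summable_on {1..}"
    using summable_on_reindex_bij_betw[OF bij_betw_Suc_atLeast_1, of "\<lambda>n. norm (f n)"] by simp
qed

lemma zeta_log_deriv:
  assumes s: "Re s > 1"
  shows "zeta s * (\<Sum>n. mangoldt (Suc n) / of_nat (Suc n) powr s) = - deriv zeta s"
proof -
  define L where "L = (\<Sum>n. mangoldt (Suc n) / of_nat (Suc n) powr s)"
  have "summable (\<lambda>n. norm (1 / of_nat (Suc n) powr s :: complex))"
    using dirichlet_series_summable[OF s, of 0] by simp
  note constant_series = has_sum_atLeast_1_if_norm_summable[of "\<lambda>n. 1 / of_nat n powr s", OF this]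
  note mangoldt_series = has_sum_atLeast_1_if_norm_summable[of "\<lambda>n. mangoldt n / of_nat n powr s", OF mangoldt_series_norm_summable[OF s]]
  have "(\<Sum>n. 1 / of_nat (Suc n) powr s) = zeta s" using zeta_sums[OF s] by (simp add: sums_iff)
  hence "((\<lambda>n. (\<Sum>d | d dvd n. 1 * mangoldt d) / of_nat n powr s) has_sum (zeta s * L)) {1..}"
    using dirichlet_product_has_sum[OF constant_series mangoldt_series] by (simp only: L_def)
  hence "((\<lambda>n. (\<Sum>d | d dvd Suc n. mangoldt d) / of_nat (Suc n) powr s) has_sum (zeta s * L)) UNIV"
    using has_sum_reindex_bij_betw[OF bij_betw_Suc_atLeast_1, of "\<lambda>n. (\<Sum>d | d dvd n. mangoldt d) / of_nat n powr s"] by simp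
  hence "(\<lambda>n. of_real (ln (real (Suc n))) / of_nat (Suc n) powr s) sums (zeta s * L)"
    by (intro has_sum_imp_sums) (simp only: mangoldt_sum[OF nat.simps(3)])
  moreover have "(\<lambda>n. of_real (ln (real (Suc n))) / of_nat (Suc n) powr s) sums (- deriv zeta s)"
    using sums_minus[OF deriv_zeta_sums[OF s]] by simp
  ultimately show ?thesis unfolding L_def by (rule sums_unique2)
qed

section \<open>The logarithmic derivative of the zeta function\<close>

lemma norm_less_norm_reflection:
  assumes "A > 0" "Re w < A"
  shows "norm w < norm (2 * of_real A - w)"
proof -
  have "(2 * A - Re w)^2 - (Re w)^2 = 4 * (A * (A - Re w))" by (simp add: power2_eq_square algebra_simps)
  moreover have "A * (A - Re w) > 0" using assms by simp
  ultimately have "(Re w)^2 < (2 * A - Re w)^2" by linarith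
  thus ?thesis by (simp add: cmod_def)
qed

lemma borel_caratheodory:
  fixes L :: "complex \<Rightarrow> complex"
  assumes R: "R > 0" and A: "A > 0" and q: "0 < q" "q < 1"
    and L: "L holomorphic_on ball z0 R" "L z0 = 0" and Re_L: "\<And>z. z \<in> ball z0 R \<Longrightarrow> Re (L z) < A"
    and z: "dist z0 z \<le> q * R"
  shows "norm (L z) \<le> 2 * A * q / (1 - q)"
proof -
  define l where "l x = L (z0 + of_real R * x)" for x
  define \<Phi> where "\<Phi> x = l x / (2 * of_real A - l x)" for x
  have in_ball: "z0 + of_real R * x \<in> ball z0 R" if "norm x < 1" for x
    using that R by (simp add: dist_norm norm_mult)
  hence Re_l: "Re (l x) < A" if "norm x < 1" for x using Re_L that by (simp add: l_def)
  have denominator_nz: "2 * of_real A - l x \<noteq> 0" if "norm x < 1" for x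
    using Re_l[OF that] A by (auto simp: complex_eq_iff)
  have \<Phi>: "\<Phi> holomorphic_on ball 0 1"
  proof -
    have "(L \<circ> (\<lambda>x. z0 + of_real R * x)) holomorphic_on ball 0 1"
      by (intro holomorphic_on_compose_gen[OF _ L(1)] holomorphic_intros) (use in_ball in auto)
    hence "l holomorphic_on ball 0 1" by (simp add: l_def[abs_def] o_def)
    thus ?thesis unfolding \<Phi>_def by (intro holomorphic_intros) (use denominator_nz in auto)
  qed
  have \<Phi>_less: "norm (\<Phi> x) < 1" if "norm x < 1" for x
    using norm_less_norm_reflection[OF A Re_l[OF that]] unfolding \<Phi>_def by (simp add: norm_divide divide_simps)
  define x where "x = (z - z0) / of_real R"
  have x: "norm x \<le> q" using z R by (simp add: x_def norm_divide dist_norm norm_minus_commute divide_simps)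
  hence x_less: "norm x < 1" using q by simp
  have L_z: "L z = l x" using R by (simp add: l_def x_def)
  have "norm (\<Phi> x) \<le> norm x"
    by (rule Schwarz_Lemma(1)[OF \<Phi> _ \<Phi>_less x_less]) (simp_all add: \<Phi>_def l_def L)
  hence "norm (\<Phi> x) \<le> q" using x by simp
  hence "norm (L z) \<le> q * norm (2 * of_real A - L z)"
    using denominator_nz[OF x_less] unfolding \<Phi>_def L_z by (simp add: norm_divide divide_simps)
  also have "... \<le> q * (2 * A + norm (L z))"
    using norm_triangle_ineq4[of "2 * of_real A" "L z"] A q by (intro mult_left_mono) (auto simp: norm_mult)
  finally have "norm (L z) * (1 - q) \<le> 2 * A * q" by (simp add: algebra_simps)
  thus ?thesis using q by (simp add: divide_simps mult.commute)
qed

lemma borel_caratheodory_deriv: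
  fixes L :: "complex \<Rightarrow> complex"
  assumes r: "0 < r" "r < R" and A: "A > 0"
    and L: "L holomorphic_on ball z0 R" "L z0 = 0" and Re_L: "\<And>z. z \<in> ball z0 R \<Longrightarrow> Re (L z) < A"
    and w: "dist z0 w \<le> r"
  shows "norm (deriv L w) \<le> 8 * R / (R - r)^2 * A"
proof -
  define q e where "q = (r + R) / (2 * R)" and "e = (R - r) / 2"
  have q: "0 < q" "q < 1" using r by (auto simp: q_def field_simps)
  have e: "e > 0" using r by (simp add: e_def)
  have dist_le: "dist z0 x \<le> r + e" if "dist w x \<le> e" for x using that w dist_triangle[of z0 x w] by linarith
  have cball: "cball w e \<subseteq> ball z0 R"
  proof
    fix x assume "x \<in> cball w e"
    hence "dist z0 x \<le> r + e" by (intro dist_le) simp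
    thus "x \<in> ball z0 R" using r by (simp add: e_def field_simps)
  qed
  have "norm ((deriv ^^ 1) L w) \<le> fact 1 * (2 * A * q / (1 - q)) / e ^ 1"
  proof (rule Cauchy_inequality)
    show "L holomorphic_on ball w e" using cball L by (meson ball_subset_cball holomorphic_on_subset)
    show "continuous_on (cball w e) L" using cball L by (meson continuous_on_subset holomorphic_on_imp_continuous_on)
    show "0 < e" by (rule e)
    fix x assume "norm (w - x) = e"
    hence "dist z0 x \<le> r + e" by (intro dist_le) (simp add: dist_norm)
    also have "... = q * R" using r by (simp add: q_def e_def field_simps)
    finally show "norm (L x) \<le> 2 * A * q / (1 - q)" using r by (intro borel_caratheodory[OF _ A q L Re_L]) auto
  qed
  also have "fact 1 * (2 * A * q / (1 - q)) / e ^ 1 = 4 * (r + R) / (R - r)^2 * A"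
  proof -
    have "1 - q = (R - r) / (2 * R)" using r by (simp add: q_def field_simps)
    thus ?thesis using r by (simp add: q_def e_def power2_eq_square)
  qed
  also have "... \<le> 8 * R / (R - r)^2 * A" using r A by (intro mult_right_mono divide_right_mono) auto
  finally show ?thesis by simp
qed

lemma borel_caratheodory_log_deriv:
  fixes g :: "complex \<Rightarrow> complex"
  assumes r: "0 < r" "r < R" and g: "g holomorphic_on ball z0 R" and nz: "\<And>w. w \<in> ball z0 R \<Longrightarrow> g w \<noteq> 0"
    and M: "\<And>w. w \<in> ball z0 R \<Longrightarrow> norm (g w) < M * norm (g z0)" and w: "dist z0 w \<le> r"
  shows "norm (deriv g w / g w) \<le> 8 * R / (R - r)^2 * ln M"
proof -
  obtain l where l: "l holomorphic_on ball z0 R" "\<And>z. z \<in> ball z0 R \<Longrightarrow> g z = exp (l z)"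
    using contractible_imp_holomorphic_log[OF g convex_imp_contractible[OF convex_ball] nz] by metis
  have z0: "z0 \<in> ball z0 R" and w_in: "w \<in> ball z0 R" using r w by simp_all
  have M_gt: "M > 1" using M[OF z0] nz[OF z0] by auto
  have "Re (l z - l z0) < ln M" if "z \<in> ball z0 R" for z
  proof -
    have "exp (Re (l z - l z0)) = norm (g z) / norm (g z0)" using that z0 by (simp add: l exp_diff norm_divide)
    also have "... < M" using M[OF that] nz[OF z0] by (simp add: divide_simps)
    finally show ?thesis using M_gt by (metis exp_gt_zero exp_less_cancel_iff exp_ln less_trans zero_less_one)
  qed
  hence "norm (deriv (\<lambda>z. l z - l z0) w) \<le> 8 * R / (R - r)^2 * ln M"
    using M_gt w r by (intro borel_caratheodory_deriv[of r R _ _ z0]) (auto intro: holomorphic_intros l)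
  moreover have "deriv (\<lambda>z. l z - l z0) w = deriv g w / g w"
  proof -
    have l': "(l has_field_derivative deriv l w) (at w)" using l(1) w_in by (meson holomorphic_derivI open_ball)
    hence "((\<lambda>z. exp (l z)) has_field_derivative exp (l w) * deriv l w) (at w)" by (auto intro!: derivative_eq_intros)
    hence "(g has_field_derivative exp (l w) * deriv l w) (at w)"
      by (rule has_field_derivative_transform_within_open[OF _ open_ball w_in]) (simp add: l)
    moreover have "((\<lambda>z. l z - l z0) has_field_derivative deriv l w) (at w)" using l' by (auto intro!: derivative_eq_intros)
    ultimately show ?thesis using nz[OF w_in] l(2)[OF w_in] by (simp add: DERIV_imp_deriv)
  qed
  ultimately show ?thesis by simp
qed

lemma holomorphic_factor_zero:
  assumes S: "open S" "connected S" and f: "f holomorphic_on S" and z: "z \<in> S" and nz: "\<exists>w\<in>S. f w \<noteq> (0::complex)"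
  obtains h where "h holomorphic_on S" "h z \<noteq> 0" "\<And>w. w \<in> S \<Longrightarrow> f w = (w - z) ^ nat (zorder f z) * h w"
proof -
  define n where "n = nat (zorder f z)"
  obtain r where r: "r > 0" "cball z r \<subseteq> S" "zor_poly f z holomorphic_on cball z r"
     "\<And>w. w \<in> cball z r \<Longrightarrow> f w = zor_poly f z w * (w - z) ^ n \<and> zor_poly f z w \<noteq> 0"
    using zorder_exist_zero[OF f S z nz] unfolding n_def by metis
  define h where "h = (\<lambda>w. if w = z then zor_poly f z z else f w / (w - z) ^ n)"
  have "h holomorphic_on (S - {z}) \<union> ball z r"
  proof (rule holomorphic_on_Un)
    have "(\<lambda>w. f w / (w - z) ^ n) holomorphic_on S - {z}"
      by (intro holomorphic_intros holomorphic_on_subset[OF f]) auto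
    thus "h holomorphic_on S - {z}" by (rule holomorphic_transform) (auto simp: h_def)
    have "zor_poly f z holomorphic_on ball z r" using r(3) ball_subset_cball holomorphic_on_subset by blast
    thus "h holomorphic_on ball z r" by (rule holomorphic_transform) (use r(4) in \<open>auto simp: h_def\<close>)
  qed (use S in auto)
  hence "h holomorphic_on S" by (rule holomorphic_on_subset) (use r in auto)
  moreover have "h z \<noteq> 0" using r by (simp add: h_def)
  moreover have "f w = (w - z) ^ n * h w" if "w \<in> S" for w
    using that r(4)[of z] r(1) by (auto simp: h_def)
  ultimately show ?thesis using that by (simp add: n_def)
qed

lemma holomorphic_factor_single_zero:
  assumes R: "0 < R'" "R' \<le> R" and f: "f holomorphic_on ball s0 R" and f0: "f s0 \<noteq> (0::complex)"
    and unique: "\<And>w w'. w \<in> ball s0 R' \<Longrightarrow> w' \<in> ball s0 R' \<Longrightarrow> f w = 0 \<Longrightarrow> f w' = 0 \<Longrightarrow> w = w'"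
  obtains z m h where "h holomorphic_on ball s0 R" "\<And>w. w \<in> ball s0 R \<Longrightarrow> f w = (w - z) ^ m * h w"
    "\<And>w. w \<in> ball s0 R' \<Longrightarrow> h w \<noteq> 0" "z \<in> ball s0 R'" "m = 0 \<or> f z = 0 \<and> m = nat (zorder f z)"
proof (cases "\<exists>z\<in>ball s0 R'. f z = 0")
  case False
  thus thesis using R f by (intro that[of f s0 0]) auto
next
  case True
  then obtain z where z: "z \<in> ball s0 R'" "f z = 0" by blast
  have "z \<in> ball s0 R" "s0 \<in> ball s0 R" using z R by auto
  then obtain h where h: "h holomorphic_on ball s0 R" "h z \<noteq> 0" "\<And>w. w \<in> ball s0 R \<Longrightarrow> f w = (w - z) ^ nat (zorder f z) * h w"
    using holomorphic_factor_zero[OF open_ball connected_ball f] f0 by metis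
  have "h w \<noteq> 0" if "w \<in> ball s0 R'" for w
    using h(2) h(3)[of w] unique[OF that z(1) _ z(2)] that R by (cases "w = z") auto
  thus thesis using that[OF h(1,3)] z by blast
qed

lemma log_deriv_factor:
  fixes f :: "complex \<Rightarrow> complex"
  assumes S: "open S" "s \<in> S" and f: "\<And>w. w \<in> S \<Longrightarrow> f w = (w - z) ^ m * h w" and h: "h holomorphic_on S" "h s \<noteq> 0"
    and m: "m = 0 \<or> s \<noteq> z"
  shows "deriv f s / f s = of_nat m / (s - z) + deriv h s / h s"
proof -
  have "(h has_field_derivative deriv h s) (at s)" using h(1) S by (rule holomorphic_derivI)
  hence "((\<lambda>w. (w - z) ^ m * h w) has_field_derivative (of_nat m * (s - z) ^ (m - 1)) * h s + (s - z) ^ m * deriv h s) (at s)"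
    by (auto intro!: derivative_eq_intros)
  hence "(f has_field_derivative (of_nat m * (s - z) ^ (m - 1)) * h s + (s - z) ^ m * deriv h s) (at s)"
    by (rule has_field_derivative_transform_within_open[OF _ S]) (simp add: f)
  hence deriv: "deriv f s = (of_nat m * (s - z) ^ (m - 1)) * h s + (s - z) ^ m * deriv h s" by (rule DERIV_imp_deriv)
  show ?thesis
  proof (cases m)
    case 0
    thus ?thesis using deriv f[OF S(2)] by simp
  next
    case (Suc n)
    hence "s - z \<noteq> 0" using m by auto
    thus ?thesis unfolding deriv f[OF S(2)] using Suc h(2) by (simp add: divide_simps) (simp add: algebra_simps)
  qed
qed

context
  fixes f h :: "complex \<Rightarrow> complex" and s0 z :: complex and m :: nat and r \<eta> M a :: real
  assumes r: "0 < r" and \<eta>: "0 < \<eta>" and h: "h holomorphic_on ball s0 (r + \<eta>)"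
    and factor: "\<And>w. w \<in> ball s0 (r + \<eta>) \<Longrightarrow> f w = (w - z) ^ m * h w"
    and h_nz: "\<And>w. w \<in> ball s0 (r + \<eta> / 2) \<Longrightarrow> h w \<noteq> 0" and z: "z \<in> ball s0 (r + \<eta> / 2)"
    and f_le: "\<And>w. w \<in> ball s0 (r + \<eta>) \<Longrightarrow> norm (f w) \<le> M" and a: "0 < a" "a \<le> norm (f s0)"
begin

lemma cofactor_le:
  assumes w: "w \<in> ball s0 (r + \<eta> / 2)"
  shows "norm (h w) \<le> M * (4 / \<eta>) ^ m"
proof (rule maximum_modulus_frontier[of h "cball s0 (r + 3 / 4 * \<eta>)"])
  show "h holomorphic_on interior (cball s0 (r + 3 / 4 * \<eta>))"
    by (rule holomorphic_on_subset[OF h]) (use \<eta> in auto)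
  show "continuous_on (closure (cball s0 (r + 3 / 4 * \<eta>))) h"
    by (rule continuous_on_subset[OF holomorphic_on_imp_continuous_on[OF h]]) (use \<eta> in auto)
  show "w \<in> cball s0 (r + 3 / 4 * \<eta>)" using w \<eta> by auto
  fix x assume "x \<in> frontier (cball s0 (r + 3 / 4 * \<eta>))"
  hence x: "dist s0 x = r + 3 / 4 * \<eta>" using r \<eta> by (simp add: frontier_cball)
  hence x_in: "x \<in> ball s0 (r + \<eta>)" using \<eta> by simp
  have "\<eta> / 4 \<le> norm (x - z)" using x z dist_triangle[of s0 x z] by (auto simp: dist_norm norm_minus_commute)
  hence "norm (h x) * (\<eta> / 4) ^ m \<le> norm (h x) * norm (x - z) ^ m" using \<eta> by (intro mult_left_mono power_mono) auto
  also have "... = norm (f x)" using factor[OF x_in] by (simp add: norm_mult norm_power)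
  also have "... \<le> M" by (rule f_le[OF x_in])
  finally show "norm (h x) \<le> M * (4 / \<eta>) ^ m" using \<eta> by (simp add: power_divide field_simps)
qed simp

lemma cofactor_centre_ge: "a \<le> norm (h s0) * (r + \<eta> / 2) ^ m"
proof -
  have "a \<le> norm (s0 - z) ^ m * norm (h s0)" using a(2) factor[of s0] r \<eta> by (simp add: norm_mult norm_power)
  also have "... \<le> (r + \<eta> / 2) ^ m * norm (h s0)"
    using z by (intro mult_right_mono power_mono) (auto simp: dist_norm)
  finally show ?thesis by (simp add: mult.commute)
qed

lemma log_deriv_single_zero_le:
  assumes s: "dist s0 s \<le> r" and far: "m = 0 \<or> dist s z \<ge> \<eta>"
  shows "norm (deriv f s / f s) \<le> real m / \<eta> + 32 * (r + \<eta> / 2) / \<eta>^2 * (ln (2 * M / a) + real m * ln (4 * (r + \<eta> / 2) / \<eta>))"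
proof -
  define R' Q where "R' = r + \<eta> / 2" and "Q = 2 * M / a * (4 * R' / \<eta>) ^ m"
  have R': "R' > 0" using r \<eta> by (simp add: R'_def)
  have M: "M > 0" using f_le[of s0] a r \<eta> by (auto intro: less_le_trans)
  have "norm (h w) < Q * norm (h s0)" if "w \<in> ball s0 R'" for w
  proof -
    define B where "B = M * (4 / \<eta>) ^ m"
    have B: "B > 0" using M \<eta> by (simp add: B_def)
    hence "norm (h w) < 2 * B" using cofactor_le[of w] that by (simp add: R'_def B_def)
    also have "... \<le> 2 * B * (norm (h s0) * R' ^ m / a)"
      using cofactor_centre_ge a B by (intro mult_left_mono[of 1 _ "2 * B", simplified mult_1_right]) (auto simp: R'_def)
    also have "... = Q * norm (h s0)" by (simp add: Q_def B_def power_mult_distrib power_divide mult_ac)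
    finally show ?thesis .
  qed
  hence "norm (deriv h s / h s) \<le> 8 * R' / (R' - r)^2 * ln Q"
    using r \<eta> h_nz h s by (intro borel_caratheodory_log_deriv[of r R' _ s0]) (auto simp: R'_def intro: holomorphic_on_subset)
  also have "8 * R' / (R' - r)^2 = 32 * R' / \<eta>^2" by (simp add: R'_def power_divide)
  also have "ln Q = ln (2 * M / a) + real m * ln (4 * R' / \<eta>)"
    unfolding Q_def using M a R' \<eta> by (subst ln_mult) (auto simp: ln_realpow)
  finally have cofactor: "norm (deriv h s / h s) \<le> 32 * R' / \<eta>^2 * (ln (2 * M / a) + real m * ln (4 * R' / \<eta>))" .
  have pole: "norm (of_nat m / (s - z)) \<le> real m / \<eta>"
    unfolding norm_divide norm_of_nat using far \<eta> by (cases "m = 0") (auto simp: dist_norm intro!: divide_left_mono mult_pos_pos)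
  have split: "deriv f s / f s = of_nat m / (s - z) + deriv h s / h s"
    using s r \<eta> far h_nz by (intro log_deriv_factor[OF open_ball _ factor h]) auto
  show ?thesis unfolding split by (rule norm_triangle_le[OF add_mono[OF pole cofactor[unfolded R'_def]]])
qed

end

definition zeta_zeros :: "real \<Rightarrow> complex set" where
  "zeta_zeros a = {z. z \<noteq> 1 \<and> zeta z = 0 \<and> Re z > a}"

lemma ln_ge_1: "t \<ge> 3 \<Longrightarrow> ln t \<ge> (1::real)"
  using exp_le by (subst ln_ge_iff) linarith+

lemma high_disc_bounds:
  assumes t: "\<bar>t\<bar> \<ge> 20" and R: "R \<le> 5/2" and w: "w \<in> ball (Complex 3 t) R"
  shows "Re w > 3 - R" "w \<noteq> 1" "1 \<le> norm w" "1 + norm w \<le> 2 * \<bar>t\<bar>" "1 \<le> norm (w - 1)"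
proof -
  have "norm (Complex 3 t - w) < R" using w by (simp add: dist_norm)
  hence "\<bar>Re (Complex 3 t - w)\<bar> < R" "\<bar>Im (Complex 3 t - w)\<bar> < R"
    using abs_Re_le_cmod[of "Complex 3 t - w"] abs_Im_le_cmod[of "Complex 3 t - w"] by linarith+
  hence bounds: "\<bar>3 - Re w\<bar> < R" "\<bar>t - Im w\<bar> < R" by simp_all
  thus "Re w > 3 - R" by linarith
  have "1 < \<bar>Im w\<bar>" using bounds t R by linarith
  thus "w \<noteq> 1" "1 \<le> norm w" "1 \<le> norm (w - 1)" using abs_Im_le_cmod[of w] abs_Im_le_cmod[of "w - 1"] by auto
  show "1 + norm w \<le> 2 * \<bar>t\<bar>" using cmod_le[of w] bounds t R by linarith
qed

lemma zeta_high_disc_le: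
  assumes growth: "\<And>s. Re s \<ge> 1/2 \<Longrightarrow> s \<noteq> 1 \<Longrightarrow> norm ((s - 1) * zeta s) \<le> C0 * (1 + norm s) ^ 2" and C0: "C0 > 0"
    and t: "\<bar>t\<bar> \<ge> 20" and R: "R \<le> 5/2" and w: "w \<in> ball (Complex 3 t) R"
  shows "norm (zeta w) \<le> 4 * C0 * t^2"
proof -
  note disc = high_disc_bounds[OF t R w]
  have "norm (zeta w) \<le> norm (w - 1) * norm (zeta w)"
    using mult_right_mono[OF disc(5), of "norm (zeta w)"] by simp
  also have "... \<le> C0 * (1 + norm w) ^ 2" using growth[of w] disc R by (simp add: norm_mult)
  also have "... \<le> C0 * (2 * \<bar>t\<bar>) ^ 2" using disc C0 by (intro mult_left_mono power_mono) auto
  finally show ?thesis by (simp add: power_mult_distrib)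
qed

context
  fixes c \<eta> C1 :: real
  assumes c: "c - \<eta> > 1/2" "c < 1" and \<eta>: "0 < \<eta>" "\<eta> \<le> 1"
    and sep: "\<And>z z'. z \<in> zeta_zeros (c - \<eta>) \<Longrightarrow> z' \<in> zeta_zeros (c - \<eta>) \<Longrightarrow> z \<noteq> z' \<Longrightarrow> dist z z' \<ge> 10"
    and mult: "\<And>z. z \<in> zeta_zeros (c - \<eta>) \<Longrightarrow> real (zeta_zero_mult z) \<le> C1 * ln (norm z)"
begin

lemma zeta_factor_high_disc:
  assumes t: "\<bar>t\<bar> \<ge> 20"
  obtains z m h where "h holomorphic_on ball (Complex 3 t) (3 - c + \<eta>)"
    "\<And>w. w \<in> ball (Complex 3 t) (3 - c + \<eta>) \<Longrightarrow> zeta w = (w - z) ^ m * h w"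
    "\<And>w. w \<in> ball (Complex 3 t) (3 - c + \<eta> / 2) \<Longrightarrow> h w \<noteq> 0" "z \<in> ball (Complex 3 t) (3 - c + \<eta> / 2)"
    "m = 0 \<or> z \<in> zeta_zeros (c - \<eta>)" "real m \<le> 2 * \<bar>C1\<bar> * ln \<bar>t\<bar>"
proof -
  have radii: "0 < 3 - c + \<eta> / 2" "3 - c + \<eta> / 2 \<le> 3 - c + \<eta>" "3 - c + \<eta> \<le> 5/2" using c \<eta> by auto
  note disc = high_disc_bounds[OF t radii(3)]
  have centre_nz: "zeta (Complex 3 t) \<noteq> 0" using norm_zeta_3_ge[of "Complex 3 t"] by auto
  have holomorphic: "zeta holomorphic_on ball (Complex 3 t) (3 - c + \<eta>)"
    using zeta_holomorphic by (rule holomorphic_on_subset) (use disc(2)[of 1] in auto)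
  have zero: "w \<in> zeta_zeros (c - \<eta>)" if "w \<in> ball (Complex 3 t) (3 - c + \<eta> / 2)" "zeta w = 0" for w
    using disc(1,2)[of w] that \<eta> by (auto simp: zeta_zeros_def)
  have unique: "w = w'" if "w \<in> ball (Complex 3 t) (3 - c + \<eta> / 2)" "w' \<in> ball (Complex 3 t) (3 - c + \<eta> / 2)"
      "zeta w = 0" "zeta w' = 0" for w w'
  proof (rule ccontr)
    assume "w \<noteq> w'"
    hence "dist w w' \<ge> 10" using sep zero that by blast
    thus False using that c \<eta> dist_triangle[of w w' "Complex 3 t"] by (auto simp: dist_commute)
  qed
  obtain z m h where h: "h holomorphic_on ball (Complex 3 t) (3 - c + \<eta>)"
    "\<And>w. w \<in> ball (Complex 3 t) (3 - c + \<eta>) \<Longrightarrow> zeta w = (w - z) ^ m * h w"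
    "\<And>w. w \<in> ball (Complex 3 t) (3 - c + \<eta> / 2) \<Longrightarrow> h w \<noteq> 0" "z \<in> ball (Complex 3 t) (3 - c + \<eta> / 2)"
    "m = 0 \<or> zeta z = 0 \<and> m = nat (zorder zeta z)"
    by (rule holomorphic_factor_single_zero[OF radii(1,2) holomorphic centre_nz unique]) (assumption+, rule that)
  have "real m \<le> 2 * \<bar>C1\<bar> * ln \<bar>t\<bar>"
  proof (cases "m = 0")
    case False
    hence z: "z \<in> zeta_zeros (c - \<eta>)" "m = zeta_zero_mult z" using h(4,5) zero by (auto simp: zeta_zeros_def zeta_zero_mult_def)
    have z_norm: "1 \<le> norm z" "norm z \<le> \<bar>t\<bar> * \<bar>t\<bar>"
      using disc(3,4)[of z] h(4) \<eta> t mult_right_mono[of 2 "\<bar>t\<bar>" "\<bar>t\<bar>"] by auto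
    have "ln (norm z) \<le> ln (\<bar>t\<bar> * \<bar>t\<bar>)" using z_norm by (subst ln_le_cancel_iff) linarith+
    also have "... = 2 * ln \<bar>t\<bar>" using t by (subst ln_mult) auto
    finally have "\<bar>C1\<bar> * ln (norm z) \<le> \<bar>C1\<bar> * (2 * ln \<bar>t\<bar>)" by (intro mult_left_mono) auto
    moreover have "real m \<le> \<bar>C1\<bar> * ln (norm z)"
      using mult[OF z(1)] z(2) mult_right_mono[OF abs_ge_self[of C1], of "ln (norm z)"] z_norm by simp
    ultimately show ?thesis by linarith
  qed (use t in simp)
  moreover have "m = 0 \<or> z \<in> zeta_zeros (c - \<eta>)" using h(4,5) zero by blast
  ultimately show thesis using that[OF h(1-4)] by blast
qed

lemma zeta_log_deriv_bound:
  "\<exists>C. \<forall>s. c \<le> Re s \<and> Re s \<le> 3 \<and> \<bar>Im s\<bar> \<ge> 20 \<and> (\<forall>z\<in>zeta_zeros (c - \<eta>). dist s z \<ge> \<eta>)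
     \<longrightarrow> norm (deriv zeta s / zeta s) \<le> C * ln \<bar>Im s\<bar>"
proof -
  obtain C0 where C0: "C0 > 0" "\<And>s. Re s \<ge> 1/2 \<Longrightarrow> s \<noteq> 1 \<Longrightarrow> norm ((s - 1) * zeta s) \<le> C0 * (1 + norm s) ^ 2"
    using zeta_growth by blast
  define r where "r = 3 - c"
  define Q where "Q = ln (4 * (r + \<eta> / 2) / \<eta>)"
  define D where "D = 2 * \<bar>C1\<bar> / \<eta> + 32 * (r + \<eta> / 2) / \<eta>^2 * (\<bar>ln (32 * C0)\<bar> + 2 + 2 * \<bar>C1\<bar> * Q)"
  have r: "r > 0" "r + \<eta> \<le> 5/2" using c \<eta> by (auto simp: r_def)
  have Q: "Q \<ge> 0" using r \<eta> by (simp add: Q_def divide_simps)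
  have "norm (deriv zeta s / zeta s) \<le> D * ln \<bar>Im s\<bar>"
    if s: "c \<le> Re s" "Re s \<le> 3" "\<bar>Im s\<bar> \<ge> 20" "\<And>z. z \<in> zeta_zeros (c - \<eta>) \<Longrightarrow> dist s z \<ge> \<eta>" for s
  proof -
    define s0 where "s0 = Complex 3 (Im s)"
    have zeta_s0: "norm (zeta s0) \<ge> 1/4" by (rule norm_zeta_3_ge) (simp add: s0_def)
    obtain z m h where h: "h holomorphic_on ball s0 (r + \<eta>)" "\<And>w. w \<in> ball s0 (r + \<eta>) \<Longrightarrow> zeta w = (w - z) ^ m * h w"
      "\<And>w. w \<in> ball s0 (r + \<eta> / 2) \<Longrightarrow> h w \<noteq> 0" "z \<in> ball s0 (r + \<eta> / 2)"
      and m: "m = 0 \<or> z \<in> zeta_zeros (c - \<eta>)" "real m \<le> 2 * \<bar>C1\<bar> * ln \<bar>Im s\<bar>"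
      using zeta_factor_high_disc[OF s(3)] unfolding s0_def r_def by metis
    have ln_ge: "ln \<bar>Im s\<bar> \<ge> 1" using s(3) by (intro ln_ge_1) linarith
    have "s0 - s = of_real (3 - Re s)" by (simp add: s0_def complex_eq_iff)
    hence "dist s0 s = \<bar>3 - Re s\<bar>" by (metis dist_norm norm_of_real)
    hence "dist s0 s \<le> r" using s by (simp add: r_def)
    hence "norm (deriv zeta s / zeta s) \<le> real m / \<eta> + 32 * (r + \<eta> / 2) / \<eta>^2 * (ln (2 * (4 * C0 * (Im s)^2) / (1/4)) + real m * Q)"
      unfolding Q_def using zeta_s0 m(1) s(4)
      by (intro log_deriv_single_zero_le[OF r(1) \<eta>(1) h zeta_high_disc_le[OF C0(2,1) s(3) r(2), folded s0_def]]) auto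
    also have "... \<le> 2 * \<bar>C1\<bar> * ln \<bar>Im s\<bar> / \<eta> + 32 * (r + \<eta> / 2) / \<eta>^2 * ((\<bar>ln (32 * C0)\<bar> + 2) * ln \<bar>Im s\<bar> + 2 * \<bar>C1\<bar> * ln \<bar>Im s\<bar> * Q)"
    proof (intro add_mono divide_right_mono mult_left_mono mult_right_mono)
      have "ln (2 * (4 * C0 * (Im s)^2) / (1/4)) = ln (32 * C0 * \<bar>Im s\<bar>^2)" by (simp add: mult.assoc)
      also have "... = ln (32 * C0) + 2 * ln \<bar>Im s\<bar>" using C0 s(3) ln_realpow[of "\<bar>Im s\<bar>" 2] by (subst ln_mult) auto
      also have "... \<le> (\<bar>ln (32 * C0)\<bar> + 2) * ln \<bar>Im s\<bar>"
        using mult_left_mono[OF ln_ge, of "\<bar>ln (32 * C0)\<bar>"] by (simp add: distrib_right)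
      finally show "ln (2 * (4 * C0 * (Im s)^2) / (1/4)) \<le> (\<bar>ln (32 * C0)\<bar> + 2) * ln \<bar>Im s\<bar>" .
    qed (use m(2) r \<eta> Q in auto)
    also have "... = D * ln \<bar>Im s\<bar>" by (simp add: D_def algebra_simps add_divide_distrib)
    finally show ?thesis .
  qed
  thus ?thesis by blast
qed

end

section \<open>Square-integrable continuation of Laplace transforms\<close>

lemma set_integrable_exp_decay:
  fixes a :: real
  assumes "a > 0"
  shows "set_integrable lborel {0<..} (\<lambda>u. exp (- a * u))"
proof -
  have "set_integrable lborel (einterval 0 \<infinity>) (\<lambda>u. exp (- a * u))"
  proof (rule interval_integral_FTC_nonneg(1)[where F = "\<lambda>u. - exp (- a * u) / a" and A = "-1/a" and B = 0])
    show "DERIV (\<lambda>u. - exp (- a * u) / a) x :> exp (- a * x)" for x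
      using assms by (auto intro!: derivative_eq_intros simp: field_simps)
    show "isCont (\<lambda>u. exp (- a * u)) x" for x by (intro continuous_intros)
    have "((\<lambda>u. - exp (- a * u) / a) \<longlongrightarrow> - exp (- a * 0) / a) (at_right 0)"
      by (intro tendsto_intros) (use assms in auto)
    thus "(((\<lambda>u. - exp (- a * u) / a) \<circ> real_of_ereal) \<longlongrightarrow> -1/a) (at_right 0)"
      by (simp add: ereal_tendsto_simps1 zero_ereal_def)
    have "((\<lambda>u. - exp (- a * u) / a) \<longlongrightarrow> 0) at_top" using assms by real_asymp
    thus "(((\<lambda>u. - exp (- a * u) / a) \<circ> real_of_ereal) \<longlongrightarrow> 0) (at_left \<infinity>)"
      by (simp add: ereal_tendsto_simps1)
  qed auto
  moreover have "einterval 0 \<infinity> = {0<..}" by (auto simp: einterval_def zero_ereal_def)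
  ultimately show ?thesis by simp
qed

lemma laplace_exp:
  fixes w :: complex
  assumes "Re w > 0"
  shows "set_integrable lborel {0<..} (\<lambda>u. exp (- w * of_real u))"
    and "(LINT u:{0<..}|lborel. exp (- w * of_real u)) = 1 / w"
proof -
  have w0: "w \<noteq> 0" using assms by auto
  have integrable: "set_integrable lborel {0<..} (\<lambda>u. exp (- w * of_real u))"
    by (rule set_integrable_bound[OF set_integrable_exp_decay[OF assms]])
       (auto simp: norm_exp_eq_Re set_borel_measurable_def)
  thus "set_integrable lborel {0<..} (\<lambda>u. exp (- w * of_real u))" .
  have positive: "einterval 0 \<infinity> = {0<..}" by (auto simp: einterval_def zero_ereal_def)
  have "(LBINT u=0..\<infinity>. exp (- w * of_real u)) = 0 - (-1/w)"
  proof (rule interval_integral_FTC_integrable[where F = "\<lambda>u. - exp (- w * of_real u) / w"])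
    show "((\<lambda>u. - exp (- w * of_real u) / w) has_vector_derivative exp (- w * of_real x)) (at x)" for x :: real
      by (rule has_vector_derivative_real_field[where f = "\<lambda>z. - exp (- w * z) / w"])
         (use w0 in \<open>auto intro!: derivative_eq_intros simp: field_simps\<close>)
    show "isCont (\<lambda>u. exp (- w * of_real u)) x" for x by (intro continuous_intros)
    show "set_integrable lborel (einterval 0 \<infinity>) (\<lambda>u. exp (- w * of_real u))" unfolding positive by (rule integrable)
    have "((\<lambda>u. - exp (- w * of_real u) / w) \<longlongrightarrow> - exp (- w * of_real 0) / w) (at_right 0)"
      by (intro tendsto_intros) (use w0 in auto)
    thus "(((\<lambda>u. - exp (- w * of_real u) / w) \<circ> real_of_ereal) \<longlongrightarrow> -1/w) (at_right 0)"
      by (simp add: ereal_tendsto_simps1 zero_ereal_def)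
    have "((\<lambda>u. exp (- Re w * u) / norm w) \<longlongrightarrow> 0) at_top" using assms w0 by real_asymp
    hence "((\<lambda>u. norm (- exp (- w * of_real u) / w)) \<longlongrightarrow> 0) at_top" by (simp add: norm_divide norm_exp_eq_Re)
    hence "((\<lambda>u. - exp (- w * of_real u) / w) \<longlongrightarrow> 0) at_top" by (rule tendsto_norm_zero_cancel)
    thus "(((\<lambda>u. - exp (- w * of_real u) / w) \<circ> real_of_ereal) \<longlongrightarrow> 0) (at_left \<infinity>)"
      by (simp add: ereal_tendsto_simps1)
  qed auto
  thus "(LINT u:{0<..}|lborel. exp (- w * of_real u)) = 1 / w"
    by (simp add: interval_lebesgue_integral_def positive)
qed

lemma gauss_fourier:
  fixes r y :: real
  assumes r: "r > 0"
  shows "integrable lborel (\<lambda>t. exp (of_real (- (r^2 * t^2) / 2) + \<i> * of_real (t * y)))"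
    and "(LINT t|lborel. exp (of_real (- (r^2 * t^2) / 2) + \<i> * of_real (t * y))) =
      of_real (sqrt (2 * pi) / r * exp (- (y^2) / (2 * r^2)))"
proof -
  define f where "f = (\<lambda>x. std_normal_density x *\<^sub>R iexp (y / r * x))"
  have f_integrable: "integrable lborel f"
  proof (rule Bochner_Integration.integrable_bound[OF integrable_normal_density[of 1 0]])
    show "AE x in lborel. norm (f x) \<le> norm (std_normal_density x)" by (auto simp: f_def)
  qed (auto simp: f_def)
  have "char std_normal_distribution (y / r) = (LINT x|lborel. f x)"
    unfolding char_def f_def by (subst integral_density) auto
  hence f_integral: "(LINT x|lborel. f x) = of_real (exp (- ((y / r)^2) / 2))" by (simp add: char_std_normal_distribution)
  have rescale: "exp (of_real (- (r^2 * t^2) / 2) + \<i> * of_real (t * y)) = sqrt (2 * pi) *\<^sub>R f (0 + r * t)" for t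
  proof -
    have "f (0 + r * t) = (1 / sqrt (2 * pi) * exp (- (r^2 * t^2) / 2)) *\<^sub>R iexp (t * y)"
      using r by (simp add: f_def std_normal_density_def power_mult_distrib mult_ac)
    thus ?thesis unfolding exp_add exp_of_real by (simp add: scaleR_conv_of_real)
  qed
  have "integrable lborel (\<lambda>t. f (0 + r * t))" using r by (intro lborel_integrable_real_affine[OF f_integrable]) auto
  thus "integrable lborel (\<lambda>t. exp (of_real (- (r^2 * t^2) / 2) + \<i> * of_real (t * y)))"
    unfolding rescale by (rule integrable_scaleR_right)
  have "(LINT x|lborel. f x) = \<bar>r\<bar> *\<^sub>R (LINT t|lborel. f (0 + r * t))"
    using r by (intro lborel_integral_real_affine) auto
  hence "(LINT t|lborel. f (0 + r * t)) = (1 / r) *\<^sub>R of_real (exp (- ((y / r)^2) / 2))"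
    using r f_integral by simp
  thus "(LINT t|lborel. exp (of_real (- (r^2 * t^2) / 2) + \<i> * of_real (t * y))) =
      of_real (sqrt (2 * pi) / r * exp (- (y^2) / (2 * r^2)))"
    unfolding rescale integral_scaleR_right by (simp add: scaleR_conv_of_real power_divide)
qed

lemma integrable_gauss:
  fixes r :: real
  assumes "r > 0"
  shows "integrable lborel (\<lambda>t. exp (- (r^2 * t^2) / 2))"
  using integrable_norm[OF gauss_fourier(1)[OF assms, of 0]] by (simp add: norm_exp_eq_Re)

lemma integrable_pair_bound:
  fixes F :: "real \<times> real \<Rightarrow> complex" and p q :: "real \<Rightarrow> real"
  assumes p: "integrable lborel p" and q: "integrable lborel q"
    and F: "F \<in> borel_measurable (lborel \<Otimes>\<^sub>M lborel)" and bound: "\<And>x y. norm (F (x, y)) \<le> p x * q y"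
  shows "integrable (lborel \<Otimes>\<^sub>M lborel) F"
proof (rule Bochner_Integration.integrable_bound)
  show "integrable (lborel \<Otimes>\<^sub>M lborel) (\<lambda>(x, y). p x * q y)"
  proof (rule lborel_pair.Fubini_integrable)
    show "(\<lambda>(x, y). p x * q y) \<in> borel_measurable (lborel \<Otimes>\<^sub>M lborel)"
      using p q by (auto dest!: borel_measurable_integrable intro!: borel_measurable_times measurable_compose[OF measurable_fst] measurable_compose[OF measurable_snd] simp: split_beta')
    show "integrable lborel (\<lambda>x. LINT y|lborel. norm (case (x, y) of (x, y) \<Rightarrow> p x * q y))"
      using p by (simp add: abs_mult)
    show "AE x in lborel. integrable lborel (\<lambda>y. case (x, y) of (x, y) \<Rightarrow> p x * q y)"
      using q by simp
  qed
  show "AE x in lborel \<Otimes>\<^sub>M lborel. norm (F x) \<le> norm (case x of (x, y) \<Rightarrow> p x * q y)"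
    using bound by (intro always_eventually allI) (auto intro: order_trans[OF bound] abs_ge_self)
qed (rule F)

definition gauss_kernel :: "real \<Rightarrow> real \<Rightarrow> complex \<Rightarrow> complex" where
  "gauss_kernel r u s = exp (of_real (r^2 / 2) * s^2 + s * of_real u)"

lemma gauss_kernel_on_line:
  "gauss_kernel r u (Complex b t) =
     of_real (exp (r^2 * b^2 / 2 + b * u)) * exp (of_real (- (r^2 * t^2) / 2) + \<i> * of_real (t * (r^2 * b + u)))"
proof -
  have "of_real (r^2 / 2) * (Complex b t)^2 + Complex b t * of_real u =
      of_real (r^2 * b^2 / 2 + b * u) + (of_real (- (r^2 * t^2) / 2) + \<i> * of_real (t * (r^2 * b + u)))"
    by (simp add: complex_eq_iff power2_eq_square field_simps)
  thus ?thesis unfolding gauss_kernel_def exp_of_real[symmetric] exp_add[symmetric] by (simp only:)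
qed

lemma norm_gauss_kernel: "norm (gauss_kernel r u (Complex b t)) = exp (r^2 * b^2 / 2 + b * u) * exp (- (r^2 * t^2) / 2)"
  unfolding gauss_kernel_on_line norm_mult norm_exp_eq_Re by simp

lemma gauss_kernel_line_integral:
  assumes "r > 0"
  shows "(LINT t|lborel. gauss_kernel r u (Complex b t)) = of_real (sqrt (2 * pi) / r * exp (- (u^2) / (2 * r^2)))"
proof -
  have "(LINT t|lborel. gauss_kernel r u (Complex b t)) =
    of_real (exp (r^2 * b^2 / 2 + b * u)) * of_real (sqrt (2 * pi) / r * exp (- ((r^2 * b + u)^2) / (2 * r^2)))"
    unfolding gauss_kernel_on_line using gauss_fourier(2)[OF assms, of "r^2 * b + u"] by (simp only: integral_mult_right_zero)
  also have "... = of_real (sqrt (2 * pi) / r * (exp (r^2 * b^2 / 2 + b * u) * exp (- ((r^2 * b + u)^2) / (2 * r^2))))"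
    unfolding of_real_mult by (simp only: mult_ac)
  also have "exp (r^2 * b^2 / 2 + b * u) * exp (- ((r^2 * b + u)^2) / (2 * r^2)) = exp (- (u^2) / (2 * r^2))"
  proof -
    have "r^2 * b^2 / 2 + b * u + - ((r^2 * b + u)^2) / (2 * r^2) = - (u^2) / (2 * r^2)"
      using assms by (simp add: field_simps power2_eq_square)
    thus ?thesis by (simp only: exp_add[symmetric])
  qed
  finally show ?thesis .
qed

lemma integrable_exp_damped:
  fixes e :: "real \<Rightarrow> real"
  assumes e: "e \<in> borel_measurable borel" "\<And>v. v \<le> 0 \<Longrightarrow> e v = 0" "\<And>v. \<bar>e v\<bar> \<le> C * exp (a * v)" and b: "b > a"
  shows "integrable lborel (\<lambda>v. \<bar>e v\<bar> * exp (- b * v))"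
proof (rule Bochner_Integration.integrable_bound)
  show "integrable lborel (\<lambda>v. C * (indicator {0<..} v *\<^sub>R exp (- (b - a) * v)))"
    using set_integrable_exp_decay[of "b - a"] b by (intro integrable_mult_right) (auto simp: set_integrable_def)
  have C: "C \<ge> 0" using e(3)[of 0] by (simp add: order_trans[OF abs_ge_zero])
  have "\<bar>e v\<bar> * exp (- b * v) \<le> C * (indicator {0<..} v *\<^sub>R exp (- (b - a) * v))" for v
  proof (cases "v \<le> 0")
    case False
    have "\<bar>e v\<bar> * exp (- b * v) \<le> C * exp (a * v) * exp (- b * v)" using e(3) by (intro mult_right_mono) auto
    thus ?thesis using False by (simp add: exp_add[symmetric] algebra_simps)
  qed (simp add: e(2))
  thus "AE v in lborel. norm (\<bar>e v\<bar> * exp (- b * v)) \<le> norm (C * (indicator {0<..} v *\<^sub>R exp (- (b - a) * v)))"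
    using C by (simp add: abs_mult)
qed (use e(1) in measurable)

lemma gauss_smoothing_formula:
  fixes e :: "real \<Rightarrow> real" and g :: "complex \<Rightarrow> complex" and r u b C :: real
  assumes e[measurable]: "e \<in> borel_measurable borel" and e0: "\<And>v. v \<le> 0 \<Longrightarrow> e v = 0"
    and e_le: "\<And>v. \<bar>e v\<bar> \<le> C * exp (a * v)" and r: "r > 0" and b: "b > a"
    and g: "\<And>t. g (Complex b t) = (LINT v|lborel. of_real (e v) * exp (- (Complex b t) * of_real v))"
  shows "integrable lborel (\<lambda>t. g (Complex b t) * gauss_kernel r u (Complex b t))"
    and "(LINT t|lborel. g (Complex b t) * gauss_kernel r u (Complex b t)) = of_real (2 * pi * (LINT v|lborel. e v * normal_density u r v))"
proof -
  define F where "F = (\<lambda>t v. of_real (e v) * exp (- (Complex b t) * of_real v) * gauss_kernel r u (Complex b t))"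
  have F: "integrable (lborel \<Otimes>\<^sub>M lborel) (\<lambda>(t, v). F t v)"
  proof (rule integrable_pair_bound)
    show "integrable lborel (\<lambda>t. exp (r^2 * b^2 / 2 + b * u) * exp (- (r^2 * t^2) / 2))"
      by (intro integrable_mult_right integrable_gauss r)
    show "integrable lborel (\<lambda>v. \<bar>e v\<bar> * exp (- b * v))" by (rule integrable_exp_damped[OF e e0 e_le b])
    show "(\<lambda>(t, v). F t v) \<in> borel_measurable (lborel \<Otimes>\<^sub>M lborel)"
      unfolding F_def gauss_kernel_def Complex_eq by measurable
    show "norm (case (t, v) of (t, v) \<Rightarrow> F t v) \<le> exp (r^2 * b^2 / 2 + b * u) * exp (- (r^2 * t^2) / 2) * (\<bar>e v\<bar> * exp (- b * v))" for t v
      unfolding F_def prod.case norm_mult norm_gauss_kernel by (simp add: norm_exp_eq_Re)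
  qed
  have inner_t: "(LINT v|lborel. F t v) = g (Complex b t) * gauss_kernel r u (Complex b t)" for t
    unfolding F_def g by (rule integral_mult_left_zero)
  show "integrable lborel (\<lambda>t. g (Complex b t) * gauss_kernel r u (Complex b t))"
    using lborel_pair.integrable_fst[OF F] by (simp only: inner_t)
  have inner_v: "(LINT t|lborel. F t v) = of_real (2 * pi * (e v * normal_density u r v))" for v
  proof -
    have "F t v = of_real (e v) * gauss_kernel r (u - v) (Complex b t)" for t
      unfolding F_def gauss_kernel_def by (simp add: exp_add[symmetric] exp_diff algebra_simps)
    hence "(LINT t|lborel. F t v) = of_real (e v) * of_real (sqrt (2 * pi) / r * exp (- ((u - v)^2) / (2 * r^2)))"
      by (simp only: integral_mult_right_zero gauss_kernel_line_integral[OF r])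
    also have "sqrt (2 * pi) / r * exp (- ((u - v)^2) / (2 * r^2)) = 2 * pi * normal_density u r v"
    proof -
      have "sqrt (2 * pi) / r = 2 * pi / sqrt (2 * pi * r^2)" using r by (simp add: real_sqrt_mult field_simps)
      thus ?thesis by (simp add: normal_density_def power2_commute)
    qed
    finally show ?thesis by (simp add: mult_ac)
  qed
  have "(LINT t|lborel. (LINT v|lborel. F t v)) = (LINT v|lborel. (LINT t|lborel. F t v))"
    by (rule lborel_pair.Fubini_integral[OF F, symmetric])
  thus "(LINT t|lborel. g (Complex b t) * gauss_kernel r u (Complex b t)) = of_real (2 * pi * (LINT v|lborel. e v * normal_density u r v))"
    unfolding inner_t inner_v by (simp del: of_real_mult)
qed

lemma integral_normal_density_rescale:
  fixes e :: "real \<Rightarrow> real"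
  assumes r: "r > 0"
  shows "(LINT v|lborel. e v * normal_density u r v) = (LINT w|lborel. e (u + r * w) * std_normal_density w)"
proof -
  have "r * normal_density u r (u + r * w) = std_normal_density w" for w
    using r by (simp add: normal_density_def real_sqrt_mult power_mult_distrib)
  hence density: "r * (e (u + r * w) * normal_density u r (u + r * w)) = e (u + r * w) * std_normal_density w" for w
    by (metis mult.left_commute)
  have "(LINT v|lborel. e v * normal_density u r v) = \<bar>r\<bar> *\<^sub>R (LINT w|lborel. e (u + r * w) * normal_density u r (u + r * w))"
    using r by (intro lborel_integral_real_affine) auto
  also have "... = (LINT w|lborel. r * (e (u + r * w) * normal_density u r (u + r * w)))" using r by simp
  finally show ?thesis unfolding density .
qed

lemma integrable_exp_std_normal:
  fixes k :: real
  shows "integrable lborel (\<lambda>w. exp (k * w) * std_normal_density w)"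
proof -
  have "k * w + - (w^2) / 2 = k^2 / 2 + - ((w - k)^2) / 2" for w by (simp add: power2_eq_square field_simps)
  hence "exp (k * w) * exp (- (w^2) / 2) = exp (k^2 / 2) * exp (- ((w - k)^2) / 2)" for w by (simp only: exp_add[symmetric])
  hence "exp (k * w) * std_normal_density w = exp (k^2 / 2) * normal_density k 1 w" for w by (simp add: normal_density_def)
  thus ?thesis by (simp add: integrable_normal_density)
qed

lemma exp_scaled_le:
  fixes x :: real
  assumes q: "0 \<le> q" "q \<le> 1"
  shows "exp (q * x) \<le> exp x + exp (- x) + 1"
proof (cases "x \<ge> 0")
  case True
  hence "exp (q * x) \<le> exp x" using q by (simp add: mult_left_le_one_le)
  thus ?thesis using exp_ge_zero[of "- x"] by linarith
next
  case False
  hence "exp (q * x) \<le> 1" using q by (simp add: mult_nonneg_nonpos)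
  thus ?thesis using exp_ge_zero[of "- x"] exp_ge_zero[of x] by linarith
qed

lemma gauss_smoothing_limit:
  fixes e :: "real \<Rightarrow> real" and u :: real
  assumes e[measurable]: "e \<in> borel_measurable borel"
    and e_le: "\<And>v. \<bar>e v\<bar> \<le> C * exp (a * v)" and cont: "isCont e u"
  shows "(\<lambda>n. LINT v|lborel. e v * normal_density u (1 / real (Suc n)) v) \<longlonglongrightarrow> e u"
proof -
  have C: "C \<ge> 0" using e_le[of 0] by (simp add: order_trans[OF abs_ge_zero])
  define W where "W = (\<lambda>w. C * exp (a * u) * ((exp (a * w) + exp (- a * w) + 1) * std_normal_density w))"
  have W: "integrable lborel W"
    using integrable_exp_std_normal[of a] integrable_exp_std_normal[of "- a"] integrable_exp_std_normal[of 0]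
    unfolding W_def distrib_right by (intro integrable_mult_right Bochner_Integration.integrable_add) simp_all
  have "(\<lambda>n. LINT w|lborel. e (u + 1 / real (Suc n) * w) * std_normal_density w) \<longlonglongrightarrow> (LINT w|lborel. e u * std_normal_density w)"
  proof (rule integral_dominated_convergence[OF _ _ W])
    show "AE w in lborel. (\<lambda>n. e (u + 1 / real (Suc n) * w) * std_normal_density w) \<longlonglongrightarrow> e u * std_normal_density w"
    proof (intro always_eventually allI tendsto_intros)
      fix w
      have "(\<lambda>n. u + 1 / real (Suc n) * w) \<longlonglongrightarrow> u" by real_asymp
      thus "(\<lambda>n. e (u + 1 / real (Suc n) * w)) \<longlonglongrightarrow> e u" by (rule isCont_tendsto_compose[OF cont])
    qed
    have "\<bar>e (u + 1 / real (Suc n) * w)\<bar> * std_normal_density w \<le> W w" for n w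
    proof -
      define q where "q = 1 / real (Suc n)"
      have "exp (q * (a * w)) \<le> exp (a * w) + exp (- a * w) + 1" using exp_scaled_le[of q "a * w"] by (simp add: q_def)
      hence "C * (exp (a * u) * exp (q * (a * w))) \<le> C * (exp (a * u) * (exp (a * w) + exp (- a * w) + 1))"
        by (intro mult_left_mono C) auto
      moreover have "\<bar>e (u + q * w)\<bar> \<le> C * (exp (a * u) * exp (q * (a * w)))"
        using e_le[of "u + q * w"] by (simp add: exp_add[symmetric] algebra_simps)
      ultimately have "\<bar>e (u + q * w)\<bar> \<le> C * (exp (a * u) * (exp (a * w) + exp (- a * w) + 1))" by linarith
      from mult_right_mono[OF this, of "std_normal_density w"] show ?thesis
        unfolding q_def[symmetric] W_def by (simp add: mult_ac)
    qed
    thus "AE w in lborel. norm (e (u + 1 / real (Suc n) * w) * std_normal_density w) \<le> W w" for n by (simp add: abs_mult)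
  qed auto
  moreover have "(LINT v|lborel. e v * normal_density u (1 / real (Suc n)) v)
      = (LINT w|lborel. e (u + 1 / real (Suc n) * w) * std_normal_density w)" for n
    by (rule integral_normal_density_rescale) simp
  moreover have "(LINT w|lborel. e u * std_normal_density w) = e u" by simp
  ultimately show ?thesis by (simp only:)
qed

lemma rectangle_contour_integral_eq_0:
  fixes F :: "complex \<Rightarrow> complex"
  assumes "convex S" "a \<in> S" "b \<in> S" "c \<in> S" "d \<in> S" and F: "F holomorphic_on S"
  shows "contour_integral (linepath a b) F + (contour_integral (linepath b c) F +
      (contour_integral (linepath c d) F + contour_integral (linepath d a) F)) = 0"
proof -
  let ?path = "linepath a b +++ linepath b c +++ linepath c d +++ linepath d a"
  have segments: "closed_segment x y \<subseteq> S" if "x \<in> S" "y \<in> S" for x y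
    using that assms(1) by (rule closed_segment_subset)
  note integrable = contour_integrable_continuous_linepath[OF continuous_on_subset[OF holomorphic_on_imp_continuous_on[OF F] segments]]
  have "(F has_contour_integral (contour_integral (linepath a b) F + (contour_integral (linepath b c) F +
      (contour_integral (linepath c d) F + contour_integral (linepath d a) F)))) ?path"
    by (intro has_contour_integral_join has_contour_integral_integral integrable assms) auto
  moreover have "(F has_contour_integral 0) ?path"
    by (rule Cauchy_theorem_convex_simple[OF F assms(1)]) (use assms segments in \<open>simp_all add: path_image_join\<close>)
  ultimately show ?thesis by (rule has_contour_integral_unique)
qed

lemma vertical_integrals_diff_le:
  fixes F :: "complex \<Rightarrow> complex"
  assumes F: "F holomorphic_on {s. Re s > c0}" and c: "c0 < c" "c \<le> b" and T: "T > 0"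
    and B: "\<And>x y. c \<le> x \<Longrightarrow> x \<le> b \<Longrightarrow> \<bar>y\<bar> = T \<Longrightarrow> norm (F (Complex x y)) \<le> B"
  shows "norm (integral {- T..T} (\<lambda>t. F (Complex b t)) - integral {- T..T} (\<lambda>t. F (Complex c t))) \<le> 2 * (B * (b - c))"
proof -
  define V where "V x = integral {- T..T} (\<lambda>t. F (Complex x t))" for x
  have B_nonneg: "B \<ge> 0" using B[of c T] c T by (auto intro: order_trans[OF norm_ge_zero])
  let ?H = "{s. Re s > c0}"
  let ?a = "Complex c (- T)" and ?b = "Complex b (- T)" and ?c = "Complex b T" and ?d = "Complex c T"
  have corners: "?a \<in> ?H" "?b \<in> ?H" "?c \<in> ?H" "?d \<in> ?H" using c by auto
  have cont: "continuous_on (closed_segment x y) F" if "x \<in> ?H" "y \<in> ?H" for x y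
    using that by (intro continuous_on_subset[OF holomorphic_on_imp_continuous_on[OF F]] closed_segment_subset convex_halfspace_Re_gt)
  note integrable = contour_integrable_continuous_linepath[OF cont]
  note zero = rectangle_contour_integral_eq_0[OF convex_halfspace_Re_gt corners F]
  have right: "contour_integral (linepath ?b ?c) F = \<i> * V b" and "contour_integral (linepath ?a ?d) F = \<i> * V c"
    unfolding V_def using T by (auto intro!: contour_integral_linepath_same_Re)
  hence left: "contour_integral (linepath ?d ?a) F = - (\<i> * V c)"
    using contour_integral_reverse_linepath[OF cont[OF corners(1,4)]] by (metis minus_minus)
  have "\<i> * (V b - V c) = - contour_integral (linepath ?a ?b) F - contour_integral (linepath ?c ?d) F"
    using zero unfolding right left by (simp add: algebra_simps add_eq_0_iff)
  hence "norm (V b - V c) = norm (contour_integral (linepath ?a ?b) F + contour_integral (linepath ?c ?d) F)"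
    by (metis minus_add_distrib norm_ii norm_minus_cancel norm_mult mult_1 uminus_add_conv_diff diff_conv_add_uminus)
  also have "... \<le> B * norm (?b - ?a) + B * norm (?d - ?c)"
  proof (intro norm_triangle_le add_mono contour_integral_bound_linepath integrable corners)
    have edge: "norm (F x) \<le> B" if "x \<in> closed_segment (Complex c y) (Complex b y)" "\<bar>y\<bar> = T" for x y
    proof -
      have "norm (F (Complex (Re x) (Im x))) \<le> B" using that c
        by (intro B) (auto simp: closed_segment_same_Im closed_segment_eq_real_ivl)
      thus ?thesis by simp
    qed
    show "norm (F x) \<le> B" if "x \<in> closed_segment ?a ?b" for x using edge[OF that] T by simp
    show "norm (F x) \<le> B" if "x \<in> closed_segment ?c ?d" for x
      using edge[of x T] that T by (simp add: closed_segment_commute)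
  qed (use B_nonneg in simp_all)
  also have "... = 2 * (B * (b - c))" using c by (simp add: cmod_def)
  finally show ?thesis by (simp add: V_def)
qed

lemma integral_symmetric_intervals_LIMSEQ:
  fixes f :: "real \<Rightarrow> complex"
  assumes f: "integrable lborel f" and T: "filterlim T at_top sequentially"
  shows "(\<lambda>n. integral {- T n..T n} f) \<longlonglongrightarrow> (LINT t|lborel. f t)"
proof -
  have "integral {- T n..T n} f = (LINT t|lborel. indicator {- T n..T n} t *\<^sub>R f t)" for n
  proof -
    have "set_integrable lborel {- T n..T n} f"
      unfolding set_integrable_def by (rule integrable_mult_indicator[OF _ f]) auto
    thus ?thesis by (simp add: set_borel_integral_eq_integral(2)[symmetric] set_lebesgue_integral_def)
  qed
  moreover have "(\<lambda>n. LINT t|lborel. indicator {- T n..T n} t *\<^sub>R f t) \<longlonglongrightarrow> (LINT t|lborel. f t)"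
  proof (rule integral_dominated_convergence)
    show "integrable lborel (\<lambda>t. norm (f t))" using f by (rule integrable_norm)
    show measurable: "f \<in> borel_measurable lborel" using f by (rule borel_measurable_integrable)
    show "(\<lambda>t. indicator {- T n..T n} t *\<^sub>R f t) \<in> borel_measurable lborel" for n
      using measurable by measurable
    show "AE t in lborel. (\<lambda>n. indicator {- T n..T n} t *\<^sub>R f t) \<longlonglongrightarrow> f t"
    proof (rule always_eventually, rule allI, rule tendsto_eventually)
      fix t
      have "\<forall>\<^sub>F n in sequentially. T n > \<bar>t\<bar>" using filterlim_at_top_dense[THEN iffD1, OF T] by blast
      thus "\<forall>\<^sub>F n in sequentially. indicator {- T n..T n} t *\<^sub>R f t = f t"
        by (rule eventually_mono) (auto simp: indicator_def abs_less_iff)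
    qed
  qed (auto simp: indicator_def)
  ultimately show ?thesis by (simp only:)
qed

lemma norm_gauss_kernel_horizontal_le:
  assumes "0 \<le> x" "x \<le> b"
  shows "norm (gauss_kernel r u (Complex x t)) \<le> exp (r^2 * b^2 / 2 + b * \<bar>u\<bar>) * exp (- (r^2 * t^2) / 2)"
proof -
  have "x * u \<le> b * \<bar>u\<bar>"
    using assms by (intro order_trans[OF mult_left_mono[OF abs_ge_self[of u], of x] mult_right_mono[of x b "\<bar>u\<bar>"]]) auto
  moreover have "r^2 * x^2 / 2 \<le> r^2 * b^2 / 2" using assms by (intro divide_right_mono mult_left_mono power_mono) auto
  ultimately show ?thesis unfolding norm_gauss_kernel by (intro mult_right_mono) auto
qed

lemma contour_shift_gauss:
  fixes g :: "complex \<Rightarrow> complex" and c0 c b u r K :: real and T :: "nat \<Rightarrow> real"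
  assumes g: "g holomorphic_on {s. Re s > c0}" and c: "c0 < c" "0 < c" "c < b" and r: "r > 0"
    and T: "filterlim T at_top sequentially"
    and K: "\<And>n x y. c \<le> x \<Longrightarrow> x \<le> b \<Longrightarrow> \<bar>y\<bar> = T n \<Longrightarrow> norm (g (Complex x y)) \<le> K * T n"
    and integrable: "integrable lborel (\<lambda>t. g (Complex c t) * gauss_kernel r u (Complex c t))"
      "integrable lborel (\<lambda>t. g (Complex b t) * gauss_kernel r u (Complex b t))"
  shows "(LINT t|lborel. g (Complex c t) * gauss_kernel r u (Complex c t))
      = (LINT t|lborel. g (Complex b t) * gauss_kernel r u (Complex b t))"
proof -
  define F where "F s = g s * gauss_kernel r u s" for s
  define D where "D = exp (r^2 * b^2 / 2 + b * \<bar>u\<bar>)"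
  define V where "V x n = integral {- T n..T n} (\<lambda>t. F (Complex x t))" for x n
  define B where "B n = K * T n * (D * exp (- (r^2 * (T n)^2) / 2))" for n
  have F: "F holomorphic_on {s. Re s > c0}" unfolding F_def gauss_kernel_def by (intro holomorphic_intros g)
  have F_le: "norm (F (Complex x y)) \<le> B n" if xy: "c \<le> x" "x \<le> b" "\<bar>y\<bar> = T n" for x y n
  proof -
    have "y^2 = (T n)^2" using xy(3) by (metis power2_abs)
    hence "norm (gauss_kernel r u (Complex x y)) \<le> D * exp (- (r^2 * (T n)^2) / 2)"
      unfolding D_def using norm_gauss_kernel_horizontal_le[of x b r u y] xy c by simp
    thus ?thesis unfolding F_def B_def norm_mult using K[OF xy] norm_ge_zero order_trans by (intro mult_mono) blast+
  qed
  have "(\<lambda>n. 2 * (B n * (b - c))) \<longlonglongrightarrow> 0"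
  proof -
    have "((\<lambda>x. x * exp (- (r^2 * x^2) / 2)) \<longlongrightarrow> 0) at_top" using r by real_asymp
    from tendsto_mult_left[OF filterlim_compose[OF this T], of "2 * K * D * (b - c)"] show ?thesis
      unfolding B_def by (simp only: mult_ac mult_zero_right mult_zero_left)
  qed
  moreover have "\<forall>\<^sub>F n in sequentially. norm (V b n - V c n) \<le> 2 * (B n * (b - c))"
    using filterlim_at_top_dense[THEN iffD1, OF T, rule_format, of 0]
    by eventually_elim (use c F_le in \<open>auto simp: V_def intro!: vertical_integrals_diff_le[OF F]\<close>)
  ultimately have "(\<lambda>n. V b n - V c n) \<longlonglongrightarrow> 0" by (rule Lim_null_comparison[rotated])
  moreover have "(\<lambda>n. V b n - V c n) \<longlonglongrightarrow> (LINT t|lborel. F (Complex b t)) - (LINT t|lborel. F (Complex c t))"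
    unfolding V_def F_def using integrable[THEN integral_symmetric_intervals_LIMSEQ[OF _ T]] by (intro tendsto_diff)
  ultimately have "(LINT t|lborel. F (Complex b t)) - (LINT t|lborel. F (Complex c t)) = 0"
    by (rule LIMSEQ_unique[rotated])
  thus ?thesis unfolding F_def by (simp only: right_minus_eq)
qed

definition poisson :: "real \<Rightarrow> real \<Rightarrow> real" where
  "poisson k s = 2 * k / (k^2 + s^2)"

lemma poisson_nonneg: "k > 0 \<Longrightarrow> poisson k s \<ge> 0"
  unfolding poisson_def by (intro divide_nonneg_nonneg add_nonneg_nonneg) auto

lemma poisson_minus [simp]: "poisson k (- s) = poisson k s" by (simp add: poisson_def)

lemma poisson_measurable [measurable]: "poisson k \<in> borel_measurable borel"
  unfolding poisson_def[abs_def] by measurable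

lemma fourier_exp_abs:
  fixes k s :: real
  assumes k: "k > 0"
  shows "integrable lborel (\<lambda>u. exp (- k * \<bar>u\<bar>))"
    and "(LINT u|lborel. of_real (exp (- k * \<bar>u\<bar>)) * exp (\<i> * of_real (s * u))) = of_real (poisson k s)"
proof -
  define A where "A = (\<lambda>w u. indicator {0<..} u *\<^sub>R exp (- w * of_real u) :: complex)"
  have right: "integrable lborel (A w)" "(LINT u|lborel. A w u) = 1 / w" if "Re w > 0" for w
    using laplace_exp[OF that] by (auto simp: set_integrable_def set_lebesgue_integral_def A_def)
  have left: "integrable lborel (\<lambda>u. A w (0 + -1 * u))" "(LINT u|lborel. A w (0 + -1 * u)) = 1 / w" if "Re w > 0" for w
    using lborel_integrable_real_affine[OF right(1)[OF that], of "-1" 0] lborel_integral_real_affine[of "-1" "A w" 0] right(2)[OF that] by auto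
  have sum_integrable: "integrable lborel (\<lambda>u. A (Complex k (-s)) u + A (Complex k s) (0 + -1 * u))" for s
    using right(1)[of "Complex k (-s)"] left(1)[of "Complex k s"] k by (intro Bochner_Integration.integrable_add) auto
  have split: "AE u in lborel. of_real (exp (- k * \<bar>u\<bar>)) * exp (\<i> * of_real (s * u))
      = A (Complex k (-s)) u + A (Complex k s) (0 + -1 * u)" for s
    using AE_lborel_singleton[of 0]
  proof eventually_elim
    case (elim u)
    have "of_real (exp (- k * \<bar>u\<bar>)) * exp (\<i> * of_real (s * u)) = exp (of_real (- k * \<bar>u\<bar>) + \<i> * of_real (s * u))"
      unfolding exp_add exp_of_real ..
    also have "of_real (- k * \<bar>u\<bar>) + \<i> * of_real (s * u) = (if u > 0 then - Complex k (-s) * of_real u else - Complex k s * of_real (- u))"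
      by (auto simp: complex_eq_iff)
    finally show ?case using elim by (auto simp: A_def)
  qed
  have "integrable lborel (\<lambda>u. of_real (exp (- k * \<bar>u\<bar>)) * exp (\<i> * of_real (0 * u)))"
    using sum_integrable[of 0] by (subst integrable_cong_AE[OF _ _ split]) auto
  hence "integrable lborel (\<lambda>u. norm (of_real (exp (- k * \<bar>u\<bar>)) * exp (\<i> * of_real (0 * u)) :: complex))" by (rule integrable_norm)
  thus "integrable lborel (\<lambda>u. exp (- k * \<bar>u\<bar>))" by simp
  have "(LINT u|lborel. of_real (exp (- k * \<bar>u\<bar>)) * exp (\<i> * of_real (s * u)))
      = (LINT u|lborel. A (Complex k (-s)) u + A (Complex k s) (0 + -1 * u))"
    using sum_integrable[of s] by (intro integral_cong_AE split) auto
  also have "... = 1 / Complex k (-s) + 1 / Complex k s"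
    using right[of "Complex k (-s)"] left[of "Complex k s"] k by (subst Bochner_Integration.integral_add) auto
  also have "... = of_real (poisson k s)" using k unfolding poisson_def
    by (simp add: complex_eq_iff Re_divide Im_divide add_divide_distrib power2_eq_square[of "k^2 + s^2"])
  finally show "(LINT u|lborel. of_real (exp (- k * \<bar>u\<bar>)) * exp (\<i> * of_real (s * u))) = of_real (poisson k s)" .
qed

lemma nn_integral_poisson:
  assumes k: "k > 0"
  shows "(\<integral>\<^sup>+ s. ennreal (poisson k (t - s)) \<partial>lborel) = ennreal (2 * pi)"
proof -
  have nz: "k^2 + s^2 > 0" for s :: real using k by (simp add: add_pos_nonneg)
  have line: "einterval (-\<infinity>) \<infinity> = UNIV" by (auto simp: einterval_def)
  have "set_integrable lborel (einterval (-\<infinity>) \<infinity>) (poisson k) \<and> (LBINT s=-\<infinity>..\<infinity>. poisson k s) = pi - (- pi)"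
  proof (intro conjI; rule_tac interval_integral_FTC_nonneg[where F = "\<lambda>s. 2 * arctan (s / k)" and A = "-pi" and B = pi])
    have deriv: "DERIV (\<lambda>s. 2 * arctan (s / k)) x :> poisson k x" for x
      using k nz[of x] unfolding poisson_def by (auto intro!: derivative_eq_intros simp: field_simps power2_eq_square)
    have cont: "isCont (poisson k) x" for x unfolding poisson_def[abs_def] using nz[of x] by (intro continuous_intros) auto
    have "((\<lambda>s. 2 * arctan (s / k)) \<longlongrightarrow> - pi) at_bot" "((\<lambda>s. 2 * arctan (s / k)) \<longlongrightarrow> pi) at_top" using k by real_asymp+
    hence lims: "(((\<lambda>s. 2 * arctan (s / k)) \<circ> real_of_ereal) \<longlongrightarrow> - pi) (at_right (-\<infinity>))"
      "(((\<lambda>s. 2 * arctan (s / k)) \<circ> real_of_ereal) \<longlongrightarrow> pi) (at_left \<infinity>)"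
      by (simp_all add: ereal_tendsto_simps1)
    show "DERIV (\<lambda>s. 2 * arctan (s / k)) x :> poisson k x" "isCont (poisson k) x" for x by (rule deriv cont)+
    thus "DERIV (\<lambda>s. 2 * arctan (s / k)) x :> poisson k x" "isCont (poisson k) x" for x .
    show "(((\<lambda>s. 2 * arctan (s / k)) \<circ> real_of_ereal) \<longlongrightarrow> - pi) (at_right (-\<infinity>))"
      "(((\<lambda>s. 2 * arctan (s / k)) \<circ> real_of_ereal) \<longlongrightarrow> pi) (at_left \<infinity>)" by (rule lims)+
    thus "(((\<lambda>s. 2 * arctan (s / k)) \<circ> real_of_ereal) \<longlongrightarrow> - pi) (at_right (-\<infinity>))"
      "(((\<lambda>s. 2 * arctan (s / k)) \<circ> real_of_ereal) \<longlongrightarrow> pi) (at_left \<infinity>)" .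
  qed (use k in \<open>auto intro: poisson_nonneg\<close>)
  hence "integrable lborel (poisson k)" "(LINT s|lborel. poisson k s) = 2 * pi"
    by (auto simp: set_integrable_def interval_lebesgue_integral_def line set_lebesgue_integral_def)
  hence "(\<integral>\<^sup>+ s. ennreal (poisson k s) \<partial>lborel) = ennreal (2 * pi)"
    using nn_integral_eq_integral[of lborel "poisson k"] poisson_nonneg[OF k] by simp
  thus ?thesis using nn_integral_real_affine[of "\<lambda>s. ennreal (poisson k s)" "-1" t] by simp
qed

lemma nn_integral_poisson_schur:
  fixes f :: "real \<Rightarrow> real"
  assumes [measurable]: "f \<in> borel_measurable borel" and f: "\<And>t. f t \<ge> 0" and k: "k > 0"
  shows "(\<integral>\<^sup>+ t. \<integral>\<^sup>+ t'. ennreal (f t * f t' * poisson k (t - t')) \<partial>lborel \<partial>lborel) \<le> ennreal (2 * pi) * (\<integral>\<^sup>+ t. ennreal ((f t)^2) \<partial>lborel)"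
proof -
  define G where "G t = ennreal ((f t)^2 / 2)" for t
  have [measurable]: "G \<in> borel_measurable borel" unfolding G_def[abs_def] by measurable
  have "(\<integral>\<^sup>+ t. \<integral>\<^sup>+ t'. ennreal (f t * f t' * poisson k (t - t')) \<partial>lborel \<partial>lborel)
      \<le> (\<integral>\<^sup>+ t. \<integral>\<^sup>+ t'. G t * ennreal (poisson k (t - t')) + G t' * ennreal (poisson k (t - t')) \<partial>lborel \<partial>lborel)"
  proof (intro nn_integral_mono)
    fix t t'
    have "f t * f t' * poisson k (t - t') \<le> ((f t)^2 / 2 + (f t')^2 / 2) * poisson k (t - t')"
      using sum_squares_bound[of "f t" "f t'"] by (intro mult_right_mono poisson_nonneg[OF k]) simp
    thus "ennreal (f t * f t' * poisson k (t - t')) \<le> G t * ennreal (poisson k (t - t')) + G t' * ennreal (poisson k (t - t'))"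
      unfolding G_def distrib_right[symmetric]
      by (simp add: ennreal_mult''[OF poisson_nonneg[OF k], symmetric] ennreal_plus[symmetric] ennreal_leI del: ennreal_plus)
  qed
  also have "... = (\<integral>\<^sup>+ t. \<integral>\<^sup>+ t'. G t * ennreal (poisson k (t - t')) \<partial>lborel \<partial>lborel) + (\<integral>\<^sup>+ t. \<integral>\<^sup>+ t'. G t' * ennreal (poisson k (t - t')) \<partial>lborel \<partial>lborel)"
    by (subst nn_integral_add[symmetric]) (auto intro!: nn_integral_cong nn_integral_add)
  also have "(\<integral>\<^sup>+ t. \<integral>\<^sup>+ t'. G t' * ennreal (poisson k (t - t')) \<partial>lborel \<partial>lborel)
      = (\<integral>\<^sup>+ t. \<integral>\<^sup>+ t'. G t * ennreal (poisson k (t' - t)) \<partial>lborel \<partial>lborel)"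
    by (rule lborel_pair.Fubini') measurable
  also have "(\<lambda>t t'. G t * ennreal (poisson k (t' - t))) = (\<lambda>t t'. G t * ennreal (poisson k (t - t')))"
    by (metis minus_diff_eq poisson_minus)
  also have "(\<integral>\<^sup>+ t. \<integral>\<^sup>+ t'. G t * ennreal (poisson k (t - t')) \<partial>lborel \<partial>lborel) = (\<integral>\<^sup>+ t. G t * ennreal (2 * pi) \<partial>lborel)"
    by (simp add: nn_integral_cmult nn_integral_poisson[OF k])
  also have "... + ... = (\<integral>\<^sup>+ t. ennreal (2 * pi) * ennreal ((f t)^2) \<partial>lborel)"
    by (subst nn_integral_add[symmetric]) (auto intro!: nn_integral_cong simp: G_def ennreal_mult'[symmetric] ennreal_plus[symmetric] algebra_simps simp del: ennreal_plus)
  also have "... = ennreal (2 * pi) * (\<integral>\<^sup>+ t. ennreal ((f t)^2) \<partial>lborel)" by (rule nn_integral_cmult) measurable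
  finally show ?thesis .
qed

definition fourier :: "(real \<Rightarrow> complex) \<Rightarrow> real \<Rightarrow> complex" where
  "fourier h u = (LINT t|lborel. h t * exp (\<i> * of_real (t * u)))"

context
  fixes h :: "real \<Rightarrow> complex"
  assumes h: "integrable lborel h"
begin

lemma integrable_measurable [measurable]: "h \<in> borel_measurable borel"
  using borel_measurable_integrable[OF h] by simp

lemma fourier_measurable [measurable]: "fourier h \<in> borel_measurable borel"
proof -
  have "(\<lambda>u. LINT t|lborel. h t * exp (\<i> * of_real (t * u))) \<in> borel_measurable lborel"
    by (rule lborel.borel_measurable_lebesgue_integral) measurable
  thus ?thesis by (simp add: fourier_def[abs_def])
qed

lemma norm_fourier_le: "norm (fourier h u) \<le> (LINT t|lborel. norm (h t))"
  unfolding fourier_def using integral_norm_bound[of lborel "\<lambda>t. h t * exp (\<i> * of_real (t * u))"] by (simp add: norm_mult)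

lemma cnj_fourier: "cnj (fourier h u) = (LINT t|lborel. cnj (h t) * exp (- (\<i> * of_real (t * u))))"
  unfolding fourier_def by (subst Bochner_Integration.integral_cnj[symmetric]) (simp add: exp_cnj)

context
  fixes k :: real
  assumes k: "k > 0"
begin

lemma weighted_fourier_inversion:
  "(LINT u|lborel. of_real (exp (- k * \<bar>u\<bar>)) * cnj (fourier h u) * exp (\<i> * of_real (t * u))) =
     (LINT t'|lborel. cnj (h t') * of_real (poisson k (t - t')))"
proof -
  define F where "F = (\<lambda>u t'. of_real (exp (- k * \<bar>u\<bar>)) * exp (\<i> * of_real (t * u)) * (cnj (h t') * exp (- (\<i> * of_real (t' * u)))))"
  have [measurable]: "cnj \<in> borel_measurable borel" by (intro borel_measurable_continuous_onI continuous_intros)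
  have F: "integrable (lborel \<Otimes>\<^sub>M lborel) (\<lambda>(u, t'). F u t')"
  proof (rule integrable_pair_bound[OF fourier_exp_abs(1)[OF k] integrable_norm[OF h]])
    show "(\<lambda>(u, t'). F u t') \<in> borel_measurable (lborel \<Otimes>\<^sub>M lborel)" unfolding F_def by measurable
    show "norm (case (u, t') of (u, t') \<Rightarrow> F u t') \<le> exp (- k * \<bar>u\<bar>) * norm (h t')" for u t'
      by (simp add: F_def norm_mult norm_exp_eq_Re)
  qed
  have "(LINT t'|lborel. F u t') = of_real (exp (- k * \<bar>u\<bar>)) * exp (\<i> * of_real (t * u)) * cnj (fourier h u)" for u
    unfolding F_def cnj_fourier by (rule integral_mult_right_zero)
  moreover have "(LINT u|lborel. F u t') = cnj (h t') * of_real (poisson k (t - t'))" for t'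
  proof -
    have "F u t' = cnj (h t') * (of_real (exp (- k * \<bar>u\<bar>)) * exp (\<i> * of_real ((t - t') * u)))" for u
    proof -
      have "exp (\<i> * of_real (t * u)) * exp (- (\<i> * of_real (t' * u))) = exp (\<i> * of_real ((t - t') * u))"
        unfolding exp_add[symmetric] by (simp add: algebra_simps)
      thus ?thesis unfolding F_def by (metis mult.assoc mult.left_commute)
    qed
    thus ?thesis by (simp only: integral_mult_right_zero fourier_exp_abs(2)[OF k])
  qed
  ultimately show ?thesis using lborel_pair.Fubini_integral[OF F] by (simp only: mult_ac)
qed

lemma weighted_fourier_parseval:
  shows "integrable lborel (\<lambda>u. (norm (fourier h u))^2 * exp (- k * \<bar>u\<bar>))"
    and "integrable lborel (\<lambda>t. h t * (LINT t'|lborel. cnj (h t') * of_real (poisson k (t - t'))))"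
    and "of_real (LINT u|lborel. (norm (fourier h u))^2 * exp (- k * \<bar>u\<bar>)) =
      (LINT t|lborel. h t * (LINT t'|lborel. cnj (h t') * of_real (poisson k (t - t'))))"
proof -
  define F where "F = (\<lambda>u t. of_real (exp (- k * \<bar>u\<bar>)) * cnj (fourier h u) * (h t * exp (\<i> * of_real (t * u))))"
  have [measurable]: "cnj \<in> borel_measurable borel" by (intro borel_measurable_continuous_onI continuous_intros)
  have F: "integrable (lborel \<Otimes>\<^sub>M lborel) (\<lambda>(u, t). F u t)"
  proof (rule integrable_pair_bound)
    show "integrable lborel (\<lambda>u. exp (- k * \<bar>u\<bar>) * (LINT t|lborel. norm (h t)))"
      by (rule integrable_mult_left[OF fourier_exp_abs(1)[OF k]])
    show "integrable lborel (\<lambda>t. norm (h t))" using h by (rule integrable_norm)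
    show "(\<lambda>(u, t). F u t) \<in> borel_measurable (lborel \<Otimes>\<^sub>M lborel)" unfolding F_def by measurable
    show "norm (case (u, t) of (u, t) \<Rightarrow> F u t) \<le> exp (- k * \<bar>u\<bar>) * (LINT t|lborel. norm (h t)) * norm (h t)" for u t
      using norm_fourier_le[of u] by (simp add: F_def norm_mult norm_exp_eq_Re mult_right_mono mult_left_mono)
  qed
  have in_u: "(LINT t|lborel. F u t) = of_real ((norm (fourier h u))^2 * exp (- k * \<bar>u\<bar>))" for u
  proof -
    have "(LINT t|lborel. F u t) = of_real (exp (- k * \<bar>u\<bar>)) * cnj (fourier h u) * fourier h u"
      unfolding F_def fourier_def by (rule integral_mult_right_zero)
    also have "... = of_real ((norm (fourier h u))^2 * exp (- k * \<bar>u\<bar>))"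
      using complex_norm_square[of "fourier h u"] by (simp add: mult_ac)
    finally show ?thesis .
  qed
  have in_t: "(LINT u|lborel. F u t) = h t * (LINT t'|lborel. cnj (h t') * of_real (poisson k (t - t')))" for t
  proof -
    have "F u t = h t * (of_real (exp (- k * \<bar>u\<bar>)) * cnj (fourier h u) * exp (\<i> * of_real (t * u)))" for u by (simp add: F_def mult_ac)
    thus ?thesis unfolding weighted_fourier_inversion[symmetric] by (simp only: integral_mult_right_zero)
  qed
  show "integrable lborel (\<lambda>t. h t * (LINT t'|lborel. cnj (h t') * of_real (poisson k (t - t'))))"
    using lborel_pair.integrable_snd[OF F] by (simp only: in_t)
  show "integrable lborel (\<lambda>u. (norm (fourier h u))^2 * exp (- k * \<bar>u\<bar>))"
    using integrable_Re[OF lborel_pair.integrable_fst[OF F]] by (simp only: in_u Re_complex_of_real)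
  show "of_real (LINT u|lborel. (norm (fourier h u))^2 * exp (- k * \<bar>u\<bar>)) =
      (LINT t|lborel. h t * (LINT t'|lborel. cnj (h t') * of_real (poisson k (t - t'))))"
    using lborel_pair.Fubini_integral[OF F] by (simp only: in_u in_t integral_complex_of_real)
qed

lemma norm_poisson_integral_le:
  "ennreal (norm (LINT t'|lborel. cnj (h t') * of_real (poisson k (t - t'))))
      \<le> (\<integral>\<^sup>+ t'. ennreal (norm (h t') * poisson k (t - t')) \<partial>lborel)"
proof -
  have [measurable]: "cnj \<in> borel_measurable borel" by (intro borel_measurable_continuous_onI continuous_intros)
  have "poisson k s \<le> 2 * k / k^2" for s
    unfolding poisson_def using k by (intro divide_left_mono mult_pos_pos add_pos_nonneg) auto
  hence "norm (cnj (h t') * of_real (poisson k (t - t'))) \<le> norm (2 * k / k^2 * norm (h t'))" for t'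
    using poisson_nonneg[OF k, of "t - t'"] k mult_right_mono[of "poisson k (t - t')" "2 * k / k^2" "norm (h t')"]
    by (simp add: norm_mult abs_mult mult.commute)
  hence "integrable lborel (\<lambda>t'. cnj (h t') * of_real (poisson k (t - t')))"
    by (intro Bochner_Integration.integrable_bound[OF integrable_mult_right[OF integrable_norm[OF h], of "2 * k / k^2"]] always_eventually allI) auto
  from integral_norm_bound_ennreal[OF this] show ?thesis using poisson_nonneg[OF k] by (simp add: norm_mult)
qed

lemma weighted_fourier_L2_le:
  "(\<integral>\<^sup>+ u. ennreal ((norm (fourier h u))^2 * exp (- k * \<bar>u\<bar>)) \<partial>lborel) \<le> ennreal (2 * pi) * (\<integral>\<^sup>+ t. ennreal ((norm (h t))^2) \<partial>lborel)"
proof -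
  define K where "K t = (LINT t'|lborel. cnj (h t') * of_real (poisson k (t - t')))" for t
  define X where "X = (LINT u|lborel. (norm (fourier h u))^2 * exp (- k * \<bar>u\<bar>))"
  have "(\<integral>\<^sup>+ u. ennreal ((norm (fourier h u))^2 * exp (- k * \<bar>u\<bar>)) \<partial>lborel) = ennreal X"
    unfolding X_def by (rule nn_integral_eq_integral[OF weighted_fourier_parseval(1)]) auto
  also have "of_real X = (LINT t|lborel. h t * K t)" unfolding X_def K_def by (rule weighted_fourier_parseval(3))
  hence "ennreal X \<le> ennreal (norm (LINT t|lborel. h t * K t))" by (metis abs_ge_self ennreal_leI norm_of_real)
  also have "... \<le> (\<integral>\<^sup>+ t. ennreal (norm (h t * K t)) \<partial>lborel)"
    unfolding K_def by (rule integral_norm_bound_ennreal[OF weighted_fourier_parseval(2)])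
  also have "... \<le> (\<integral>\<^sup>+ t. \<integral>\<^sup>+ t'. ennreal (norm (h t) * norm (h t') * poisson k (t - t')) \<partial>lborel \<partial>lborel)"
  proof (rule nn_integral_mono)
    fix t
    have "ennreal (norm (h t * K t)) = ennreal (norm (h t)) * ennreal (norm (K t))" by (simp add: norm_mult ennreal_mult)
    also have "... \<le> ennreal (norm (h t)) * (\<integral>\<^sup>+ t'. ennreal (norm (h t') * poisson k (t - t')) \<partial>lborel)"
      unfolding K_def by (intro mult_left_mono norm_poisson_integral_le) auto
    also have "... = (\<integral>\<^sup>+ t'. ennreal (norm (h t)) * ennreal (norm (h t') * poisson k (t - t')) \<partial>lborel)"
      by (rule nn_integral_cmult[symmetric]) measurable
    also have "... = (\<integral>\<^sup>+ t'. ennreal (norm (h t) * norm (h t') * poisson k (t - t')) \<partial>lborel)"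
      by (intro nn_integral_cong) (simp add: ennreal_mult'[symmetric] mult.assoc)
    finally show "ennreal (norm (h t * K t)) \<le> (\<integral>\<^sup>+ t'. ennreal (norm (h t) * norm (h t') * poisson k (t - t')) \<partial>lborel)" .
  qed
  also have "... \<le> ennreal (2 * pi) * (\<integral>\<^sup>+ t. ennreal ((norm (h t))^2) \<partial>lborel)"
    by (rule nn_integral_poisson_schur[OF _ _ k]) auto
  finally show ?thesis .
qed

end

end

locale laplace_continuation =
  fixes e :: "real \<Rightarrow> real" and g :: "complex \<Rightarrow> complex" and c0 c a b K C :: real and T :: "nat \<Rightarrow> real"
  assumes e [measurable]: "e \<in> borel_measurable borel" and e_eq_0: "\<And>v. v \<le> 0 \<Longrightarrow> e v = 0"
    and e_le: "\<And>v. \<bar>e v\<bar> \<le> C * exp (a * v)" and e_cont: "AE v in lborel. isCont e v"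
    and b: "b > a" and c: "c0 < c" "0 < c" "c < b"
    and laplace: "\<And>t. g (Complex b t) = (LINT v|lborel. of_real (e v) * exp (- (Complex b t) * of_real v))"
    and holomorphic: "g holomorphic_on {s. Re s > c0}"
    and T: "filterlim T at_top sequentially"
    and g_le: "\<And>n x y. c \<le> x \<Longrightarrow> x \<le> b \<Longrightarrow> \<bar>y\<bar> = T n \<Longrightarrow> norm (g (Complex x y)) \<le> K * T n"
    and L2: "integrable lborel (\<lambda>t. (norm (g (Complex c t)))^2)"
begin

definition smoothed :: "real \<Rightarrow> real \<Rightarrow> real" where
  "smoothed r u = (LINT v|lborel. e v * normal_density u r v)"

lemma smoothed_measurable [measurable]: "smoothed r \<in> borel_measurable borel"
proof -
  have "(\<lambda>u. LINT v|lborel. e v * normal_density u r v) \<in> borel_measurable lborel"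
    unfolding normal_density_def by (rule lborel.borel_measurable_lebesgue_integral) measurable
  thus ?thesis by (simp add: smoothed_def[abs_def])
qed

definition damped :: "real \<Rightarrow> real \<Rightarrow> complex" where
  "damped r t = g (Complex c t) * gauss_kernel r 0 (Complex c t)"

lemma damped_measurable [measurable]: "damped r \<in> borel_measurable borel"
proof (rule borel_measurable_continuous_onI)
  have "continuous_on UNIV (\<lambda>t. g (Complex c t))" unfolding Complex_eq
    by (rule continuous_on_compose2[OF holomorphic_on_imp_continuous_on[OF holomorphic]]) (use c in \<open>auto intro!: continuous_intros\<close>)
  thus "continuous_on UNIV (damped r)"
    unfolding damped_def[abs_def] gauss_kernel_on_line by (intro continuous_intros) auto
qed

lemma norm_damped: "norm (damped r t) = exp (r^2 * c^2 / 2) * (norm (g (Complex c t)) * exp (- (r^2 * t^2) / 2))"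
  unfolding damped_def norm_mult norm_gauss_kernel by simp

lemma damped_integrable:
  assumes r: "r > 0"
  shows "integrable lborel (damped r)"
proof (rule Bochner_Integration.integrable_bound)
  show "integrable lborel (\<lambda>t. exp (r^2 * c^2 / 2) * ((norm (g (Complex c t)))^2 + exp (- ((sqrt 2 * r)^2 * t^2) / 2)))"
    using r by (intro integrable_mult_right Bochner_Integration.integrable_add L2 integrable_gauss) simp
  have "norm (damped r t) \<le> exp (r^2 * c^2 / 2) * ((norm (g (Complex c t)))^2 + exp (- ((sqrt 2 * r)^2 * t^2) / 2))" for t
  proof -
    define A B where "A = norm (g (Complex c t))" and "B = exp (- (r^2 * t^2) / 2)"
    have "2 * A * B \<le> A^2 + B^2" "A * B \<ge> 0" by (rule sum_squares_bound) (simp add: A_def B_def)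
    moreover have "B^2 = exp (- ((sqrt 2 * r)^2 * t^2) / 2)" by (simp add: B_def exp_double[symmetric] power_mult_distrib)
    ultimately have "A * B \<le> A^2 + exp (- ((sqrt 2 * r)^2 * t^2) / 2)" by linarith
    thus ?thesis unfolding norm_damped A_def B_def by (intro mult_left_mono) auto
  qed
  thus "AE t in lborel. norm (damped r t) \<le> norm (exp (r^2 * c^2 / 2) * ((norm (g (Complex c t)))^2 + exp (- ((sqrt 2 * r)^2 * t^2) / 2)))"
    unfolding real_norm_def by (intro always_eventually allI order_trans[OF _ abs_ge_self])
qed measurable

lemma norm_damped_square_le:
  assumes r: "0 < r" "r \<le> 1"
  shows "(norm (damped r t))^2 \<le> exp (c^2) * (norm (g (Complex c t)))^2"
proof -
  have "r^2 * c^2 \<le> c^2" using r mult_right_mono[of "r^2" 1 "c^2"] by (simp add: power_le_one)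
  hence "norm (damped r t) \<le> exp (c^2 / 2) * (norm (g (Complex c t)) * 1)"
    unfolding norm_damped by (intro mult_mono) auto
  hence "(norm (damped r t))^2 \<le> (exp (c^2 / 2) * (norm (g (Complex c t)) * 1))^2" by (intro power_mono) auto
  also have "... = exp (c^2) * (norm (g (Complex c t)))^2" by (simp add: power_mult_distrib exp_double[symmetric])
  finally show ?thesis .
qed

lemma fourier_damped:
  assumes r: "r > 0"
  shows "exp (of_real (c * u)) * fourier (damped r) u = of_real (2 * pi * smoothed r u)"
proof -
  have kernel: "g (Complex c t) * gauss_kernel r u (Complex c t) = exp (of_real (c * u)) * (damped r t * exp (\<i> * of_real (t * u)))" for t
    unfolding damped_def gauss_kernel_def Complex_eq by (simp add: exp_add algebra_simps)
  have "integrable lborel (\<lambda>t. damped r t * exp (\<i> * of_real (t * u)))"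
    by (rule Bochner_Integration.integrable_bound[OF damped_integrable[OF r]]) (auto simp: norm_mult norm_exp_eq_Re)
  hence shifted: "integrable lborel (\<lambda>t. g (Complex c t) * gauss_kernel r u (Complex c t))"
    unfolding kernel by (rule integrable_mult_right)
  note on_b = gauss_smoothing_formula[OF e e_eq_0 e_le r b laplace]
  have "exp (of_real (c * u)) * fourier (damped r) u = (LINT t|lborel. g (Complex c t) * gauss_kernel r u (Complex c t))"
    unfolding kernel fourier_def by (rule integral_mult_right_zero[symmetric])
  also have "... = (LINT t|lborel. g (Complex b t) * gauss_kernel r u (Complex b t))"
    by (rule contour_shift_gauss[OF holomorphic c r T g_le shifted on_b(1)])
  also have "... = of_real (2 * pi * smoothed r u)" unfolding smoothed_def by (rule on_b(2))
  finally show ?thesis .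
qed

lemma smoothed_L2_le:
  assumes r: "0 < r" "r \<le> 1"
  shows "(\<integral>\<^sup>+ u. ennreal ((smoothed r u)^2 * exp (- 2 * c * u) * exp (- r * \<bar>u\<bar>)) \<partial>lborel) \<le>
    ennreal (exp (c^2) / (2 * pi) * (LINT t|lborel. (norm (g (Complex c t)))^2))"
proof -
  have square: "(smoothed r u)^2 * exp (- 2 * c * u) = 1 / (2 * pi)^2 * (norm (fourier (damped r) u))^2" for u
  proof -
    have "norm (exp (of_real (c * u)) * fourier (damped r) u) = norm (of_real (2 * pi * smoothed r u) :: complex)"
      using fourier_damped[OF r(1)] by (simp only:)
    hence "exp (c * u) * norm (fourier (damped r) u) = \<bar>2 * pi * smoothed r u\<bar>"
      unfolding norm_mult norm_of_real by (simp add: norm_exp_eq_Re)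
    hence "(exp (c * u) * norm (fourier (damped r) u))^2 = (2 * pi * smoothed r u)^2" by (metis power2_abs)
    hence "exp (2 * c * u) * (norm (fourier (damped r) u))^2 = (2 * pi)^2 * (smoothed r u)^2"
      by (simp add: power_mult_distrib exp_double[symmetric] mult.assoc)
    thus ?thesis by (simp add: exp_minus field_simps)
  qed
  have "(\<integral>\<^sup>+ u. ennreal ((smoothed r u)^2 * exp (- 2 * c * u) * exp (- r * \<bar>u\<bar>)) \<partial>lborel) =
     (\<integral>\<^sup>+ u. ennreal (1 / (2 * pi)^2) * ennreal ((norm (fourier (damped r) u))^2 * exp (- r * \<bar>u\<bar>)) \<partial>lborel)"
    unfolding square by (intro nn_integral_cong) (simp add: ennreal_mult'[symmetric] mult.assoc)
  also have "... = ennreal (1 / (2 * pi)^2) * (\<integral>\<^sup>+ u. ennreal ((norm (fourier (damped r) u))^2 * exp (- r * \<bar>u\<bar>)) \<partial>lborel)"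
  proof (rule nn_integral_cmult)
    show "(\<lambda>u. ennreal ((norm (fourier (damped r) u))^2 * exp (- r * \<bar>u\<bar>))) \<in> borel_measurable lborel"
      using fourier_measurable[OF damped_integrable[OF r(1)]] by simp measurable
  qed
  also have "... \<le> ennreal (1 / (2 * pi)^2) * (ennreal (2 * pi) * (\<integral>\<^sup>+ t. ennreal ((norm (damped r t))^2) \<partial>lborel))"
    by (intro mult_left_mono weighted_fourier_L2_le damped_integrable r(1)) auto
  also have "... \<le> ennreal (1 / (2 * pi)^2) * (ennreal (2 * pi) * (\<integral>\<^sup>+ t. ennreal (exp (c^2) * (norm (g (Complex c t)))^2) \<partial>lborel))"
    by (intro mult_left_mono nn_integral_mono ennreal_leI norm_damped_square_le r) auto
  also have "(\<integral>\<^sup>+ t. ennreal (exp (c^2) * (norm (g (Complex c t)))^2) \<partial>lborel)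
      = ennreal (exp (c^2) * (LINT t|lborel. (norm (g (Complex c t)))^2))"
    using nn_integral_eq_integral[OF integrable_mult_right[OF L2, of "exp (c^2)"]] by simp
  also have "ennreal (1 / (2 * pi)^2) * (ennreal (2 * pi) * ...)
      = ennreal (exp (c^2) / (2 * pi) * (LINT t|lborel. (norm (g (Complex c t)))^2))"
    by (simp add: ennreal_mult'[symmetric] power2_eq_square)
  finally show ?thesis .
qed

lemma laplace_L2_continuation:
  "(\<integral>\<^sup>+ v. ennreal ((e v)^2 * exp (- 2 * c * v)) \<partial>lborel) \<le>
     ennreal (exp (c^2) / (2 * pi) * (LINT t|lborel. (norm (g (Complex c t)))^2))"
proof -
  let ?Q = "\<lambda>n u. (smoothed (1 / real (Suc n)) u)^2 * exp (- 2 * c * u) * exp (- (1 / real (Suc n)) * \<bar>u\<bar>)"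
  have "AE u in lborel. ennreal ((e u)^2 * exp (- 2 * c * u)) = liminf (\<lambda>n. ennreal (?Q n u))"
    using e_cont
  proof eventually_elim
    case (elim u)
    have "(\<lambda>n. smoothed (1 / real (Suc n)) u) \<longlonglongrightarrow> e u"
      unfolding smoothed_def by (rule gauss_smoothing_limit[OF e e_le elim])
    moreover have "(\<lambda>n. exp (- (1 / real (Suc n)) * \<bar>u\<bar>)) \<longlonglongrightarrow> 1" by real_asymp
    ultimately have "(\<lambda>n. ?Q n u) \<longlonglongrightarrow> (e u)^2 * exp (- 2 * c * u) * 1" by (intro tendsto_intros)
    hence "(\<lambda>n. ennreal (?Q n u)) \<longlonglongrightarrow> ennreal ((e u)^2 * exp (- 2 * c * u))" by (intro tendsto_ennrealI) simp
    thus ?case by (rule lim_imp_Liminf[OF sequentially_bot, symmetric])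
  qed
  hence "(\<integral>\<^sup>+ v. ennreal ((e v)^2 * exp (- 2 * c * v)) \<partial>lborel) = (\<integral>\<^sup>+ u. liminf (\<lambda>n. ennreal (?Q n u)) \<partial>lborel)"
    by (rule nn_integral_cong_AE)
  also have "... \<le> liminf (\<lambda>n. \<integral>\<^sup>+ u. ennreal (?Q n u) \<partial>lborel)" by (rule nn_integral_liminf) measurable
  also have "... \<le> ennreal (exp (c^2) / (2 * pi) * (LINT t|lborel. (norm (g (Complex c t)))^2))"
    by (intro Liminf_le always_eventually allI smoothed_L2_le) auto
  finally show ?thesis .
qed

end

section \<open>Mean square of the remainder in the explicit formula\<close>

definition pole_free_zeta :: "complex \<Rightarrow> complex" where
  "pole_free_zeta s = (s - 1) + 2 powr (1 - s) + (\<Sum>n. powr_remainder 0 n s)"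

lemma pole_free_zeta_holomorphic: "pole_free_zeta holomorphic_on {s. Re s > 0}"
  unfolding pole_free_zeta_def using sum_powr_remainder_holomorphic[of 0] by (intro holomorphic_intros) auto

lemma pole_free_zeta_eq: "Re s > 0 \<Longrightarrow> s \<noteq> 1 \<Longrightarrow> pole_free_zeta s = (s - 1) * zeta s"
  using zeta_eq_sum_powr_remainder[of s] by (simp add: pole_free_zeta_def algebra_simps)

lemma pole_free_zeta_1: "pole_free_zeta 1 = 1"
proof -
  have "powr_remainder 0 n 1 = 0" for n
  proof -
    have "(of_nat (n + 3) :: complex) \<noteq> 0" "(of_nat (n + 2) :: complex) \<noteq> 0" by (metis of_nat_eq_0_iff add_is_0 zero_neq_numeral)+
    thus ?thesis by (simp add: powr_remainder_def)
  qed
  thus ?thesis by (simp add: pole_free_zeta_def)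
qed

lemma pole_free_zeta_log_deriv:
  assumes "Re s > 0" "s \<noteq> 1" "zeta s \<noteq> 0"
  shows "deriv pole_free_zeta s / pole_free_zeta s = 1 / (s - 1) + deriv zeta s / zeta s"
proof -
  have "open ({s. Re s > 0} - {1})" by (intro open_Diff open_halfspace_Re_gt) auto
  moreover have "zeta holomorphic_on {s. Re s > 0} - {1}" by (rule holomorphic_on_subset[OF zeta_holomorphic]) auto
  ultimately have "deriv pole_free_zeta s / pole_free_zeta s = of_nat 1 / (s - 1) + deriv zeta s / zeta s"
    using assms pole_free_zeta_eq by (intro log_deriv_factor) auto
  thus ?thesis by simp
qed

lemma zorder_pole_free_zeta:
  assumes w: "Re w > 0"
  shows "zorder pole_free_zeta w = int (zeta_zero_mult w)"
proof (cases "w \<noteq> 1 \<and> zeta w = 0")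
  case False
  hence "pole_free_zeta w \<noteq> 0" using w pole_free_zeta_1 pole_free_zeta_eq[of w] by (cases "w = 1") auto
  moreover have "pole_free_zeta analytic_on {w}"
    using pole_free_zeta_holomorphic w open_halfspace_Re_gt[of 0] by (auto simp: analytic_at)
  ultimately show ?thesis using False by (auto simp: zorder_eq_0I zeta_zero_mult_def)
next
  case True
  have "open (UNIV - {1::complex})" by (intro open_Diff) auto
  moreover have "\<exists>s\<in>UNIV - {1}. zeta s \<noteq> 0" by (rule zeta_not_identically_zero)
  ultimately have zero: "zorder zeta w > 0" and "\<exists>r>0. cball w r \<subseteq> UNIV - {1} \<and> zor_poly zeta w holomorphic_on cball w r \<and>
      (\<forall>v\<in>cball w r. zeta v = zor_poly zeta w v * (v - w) ^ nat (zorder zeta w) \<and> zor_poly zeta w v \<noteq> 0)"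
    using zorder_exist_zero[OF zeta_holomorphic _ connected_Diff_one, of w] True by auto
  then obtain r where r: "r > 0" "cball w r \<subseteq> UNIV - {1}" "zor_poly zeta w holomorphic_on cball w r"
      "\<And>v. v \<in> cball w r \<Longrightarrow> zeta v = zor_poly zeta w v * (v - w) ^ nat (zorder zeta w) \<and> zor_poly zeta w v \<noteq> 0"
    by blast
  define S where "S = ball w r \<inter> {s. Re s > 0}"
  have "zorder pole_free_zeta w = zorder zeta w"
  proof (rule zorder_eqI[where g = "\<lambda>s. (s - 1) * zor_poly zeta w s"])
    show "open S" unfolding S_def by (intro open_Int open_ball open_halfspace_Re_gt)
    show "w \<in> S" "(w - 1) * zor_poly zeta w w \<noteq> 0" using r w True by (auto simp: S_def)
    show "(\<lambda>s. (s - 1) * zor_poly zeta w s) holomorphic_on S"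
      by (intro holomorphic_intros holomorphic_on_subset[OF r(3)]) (auto simp: S_def)
    fix s assume s: "s \<in> S" "s \<noteq> w"
    hence "s \<in> cball w r" by (simp add: S_def)
    hence "s \<noteq> 1" using r(2) by blast
    thus "pole_free_zeta s = (s - 1) * zor_poly zeta w s * (s - w) powi zorder zeta w"
      using s r(4)[of s] pole_free_zeta_eq[of s] zero by (auto simp: S_def power_int_def)
  qed
  thus ?thesis using True zero by (simp add: zeta_zero_mult_def)
qed

lemma pole_free_zeta_log_deriv_local:
  assumes w: "Re w > 0"
  obtains r h where "r > 0" "ball w r \<subseteq> {s. Re s > 0}" "h holomorphic_on ball w r"
    "\<And>s. s \<in> ball w r \<Longrightarrow> s \<noteq> w \<or> zeta_zero_mult w = 0 \<Longrightarrow>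
      deriv pole_free_zeta s / pole_free_zeta s = of_nat (zeta_zero_mult w) / (s - w) + h s"
proof -
  define p where "p = zor_poly pole_free_zeta w"
  have "\<exists>r>0. cball w r \<subseteq> {s. Re s > 0} \<and> p holomorphic_on cball w r \<and>
      (\<forall>s\<in>cball w r. pole_free_zeta s = p s * (s - w) ^ zeta_zero_mult w \<and> p s \<noteq> 0)"
    using zorder_exist_zero[OF pole_free_zeta_holomorphic open_halfspace_Re_gt _ _ bexI[of _ 1], of w] w pole_free_zeta_1
    by (simp add: p_def zorder_pole_free_zeta convex_connected convex_halfspace_Re_gt)
  then obtain r where r: "r > 0" "cball w r \<subseteq> {s. Re s > 0}" "p holomorphic_on cball w r"
      "\<And>s. s \<in> cball w r \<Longrightarrow> pole_free_zeta s = p s * (s - w) ^ zeta_zero_mult w \<and> p s \<noteq> 0" by blast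
  have p: "p holomorphic_on ball w r" using r(3) by (rule holomorphic_on_subset) auto
  show thesis
  proof (rule that)
    show "r > 0" "ball w r \<subseteq> {s. Re s > 0}" using r(1,2) ball_subset_cball[of w r] by blast+
    show "(\<lambda>s. deriv p s / p s) holomorphic_on ball w r" using r(4) by (intro holomorphic_intros holomorphic_deriv p) auto
    fix s assume s: "s \<in> ball w r" "s \<noteq> w \<or> zeta_zero_mult w = 0"
    show "deriv pole_free_zeta s / pole_free_zeta s = of_nat (zeta_zero_mult w) / (s - w) + deriv p s / p s"
      using s r(4) by (intro log_deriv_factor[OF open_ball s(1) _ p]) auto
  qed
qed

definition zero_term :: "complex \<Rightarrow> complex \<Rightarrow> complex" where
  "zero_term s w = of_nat (zeta_zero_mult w) / (w * (s - w))"

definition zero_pole_sum :: "(nat \<Rightarrow> complex) \<Rightarrow> complex \<Rightarrow> complex" where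
  "zero_pole_sum z s = (\<Sum>n. zero_term s (z n))"

definition log_deriv_part :: "complex \<Rightarrow> complex" where
  "log_deriv_part s = - (deriv pole_free_zeta s / pole_free_zeta s) / s - 1 / s"

definition error_transform :: "(nat \<Rightarrow> complex) \<Rightarrow> complex \<Rightarrow> complex" where
  "error_transform z s = log_deriv_part s + zero_pole_sum z s"

locale sparse_zeros =
  fixes c \<eta> C1 :: real and z :: "nat \<Rightarrow> complex"
  assumes c: "c - \<eta> > 1/2" "c < 1" and \<eta>: "0 < \<eta>" "\<eta> \<le> 1"
    and sep: "\<And>w w'. w \<in> zeta_zeros (c - \<eta>) \<Longrightarrow> w' \<in> zeta_zeros (c - \<eta>) \<Longrightarrow> w \<noteq> w' \<Longrightarrow> dist w w' \<ge> 10"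
    and mult: "\<And>w. w \<in> zeta_zeros (c - \<eta>) \<Longrightarrow> real (zeta_zero_mult w) \<le> C1 * ln (norm w)"
    and gap: "\<And>w. w \<in> zeta_zeros (c - \<eta>) \<Longrightarrow> Re w \<ge> c + \<eta> \<and> Re w < 1"
    and inj: "inj z" and range: "range z = zeta_zeros (c - \<eta>)"
    and summable_weight: "summable (\<lambda>n. real (zeta_zero_mult (z n)) / norm (z n))"
begin

abbreviation weight :: "nat \<Rightarrow> real" where "weight n \<equiv> real (zeta_zero_mult (z n)) / norm (z n)"

lemma weight_sum_nonneg: "suminf weight \<ge> 0"
  by (rule suminf_nonneg[OF summable_weight]) auto

lemma z_in: "z n \<in> zeta_zeros (c - \<eta>)" using range by auto

lemma Re_z: "Re (z n) \<ge> c + \<eta>" "Re (z n) < 1" using gap[OF z_in] by auto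

lemma z_nonzero: "z n \<noteq> 0" using Re_z(1)[of n] c \<eta> by auto

lemma norm_zero_term: "norm (zero_term s (z n)) = weight n * (1 / norm (s - z n))"
  by (simp add: zero_term_def norm_divide norm_mult)

lemma zero_term_norm_le:
  assumes "dist s (z n) \<ge> r" "r > 0"
  shows "norm (zero_term s (z n)) \<le> 1 / r * weight n"
proof -
  have "1 / norm (s - z n) \<le> 1 / r" using assms by (intro divide_left_mono mult_pos_pos) (auto simp: dist_norm)
  hence "weight n * (1 / norm (s - z n)) \<le> weight n * (1 / r)" by (intro mult_left_mono) auto
  thus ?thesis unfolding norm_zero_term by (simp only: mult.commute)
qed

lemma zero_pole_sum_part_holomorphic:
  assumes r: "r > 0" and far: "\<And>n. n \<in> A \<Longrightarrow> dist w (z n) \<ge> 2 * r"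
  shows "(\<lambda>s. \<Sum>n. if n \<in> A then zero_term s (z n) else 0) holomorphic_on ball w r"
    and "\<And>s. s \<in> ball w r \<Longrightarrow> summable (\<lambda>n. if n \<in> A then zero_term s (z n) else 0)"
proof -
  have far_ball: "dist s (z n) \<ge> r" if "n \<in> A" "s \<in> ball w r" for n s
    using far[OF that(1)] that(2) dist_triangle[of w "z n" s] by auto
  have bound: "norm (if n \<in> A then zero_term s (z n) else 0) \<le> 1 / r * weight n" if "s \<in> ball w r" for n s
    using zero_term_norm_le[OF far_ball[OF _ that] r, of n] r by auto
  show "summable (\<lambda>n. if n \<in> A then zero_term s (z n) else 0)" if "s \<in> ball w r" for s
    by (rule summable_comparison_test'[OF summable_mult[OF summable_weight]]) (rule bound[OF that])
  show "(\<lambda>s. \<Sum>n. if n \<in> A then zero_term s (z n) else 0) holomorphic_on ball w r"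
  proof (rule holomorphic_on_suminf)
    fix n
    have "s \<noteq> z n" if "n \<in> A" "s \<in> ball w r" for s using far_ball[OF that] r by auto
    thus "(\<lambda>s. if n \<in> A then zero_term s (z n) else 0) holomorphic_on ball w r"
      using z_nonzero[of n] unfolding zero_term_def by (cases "n \<in> A") (auto intro!: holomorphic_intros)
  next
    fix x assume x: "x \<in> ball w r"
    obtain d where d: "d > 0" "ball x d \<subseteq> ball w r" using x by (meson open_ball open_contains_ball)
    show "\<exists>d>0. \<exists>M. summable M \<and> (\<forall>n. \<forall>y\<in>ball x d. norm (if n \<in> A then zero_term y (z n) else 0) \<le> M n)"
      using d bound summable_mult[OF summable_weight, of "1/r"] by (intro exI[of _ d] exI[of _ "\<lambda>n. 1 / r * weight n"]) blast
  qed auto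
qed

lemma zero_free_radius:
  "\<exists>r>0. r \<le> 1 \<and> (\<forall>n. z n \<noteq> w \<longrightarrow> dist w (z n) \<ge> 2 * r)"
proof (cases "\<exists>n. z n \<noteq> w \<and> dist w (z n) < 2")
  case False
  thus ?thesis by (intro exI[of _ 1]) (auto simp: not_less)
next
  case True
  then obtain k where k: "z k \<noteq> w" "dist w (z k) < 2" by blast
  have "dist w (z n) \<ge> 2 * (dist w (z k) / 2)" if "z n \<noteq> w" for n
  proof (cases "z n = z k")
    case False
    have "dist (z n) (z k) \<ge> 10" by (rule sep[OF z_in z_in False])
    thus ?thesis using k(2) dist_triangle[of "z n" "z k" w] by (simp add: dist_commute)
  qed auto
  thus ?thesis using k by (intro exI[of _ "dist w (z k) / 2"]) auto
qed

lemma zeta_zero_mult_eq_0: "Re w > c - \<eta> \<Longrightarrow> w \<notin> zeta_zeros (c - \<eta>) \<Longrightarrow> zeta_zero_mult w = 0"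
  by (auto simp: zeta_zero_mult_def zeta_zeros_def)

lemma zero_pole_sum_local:
  assumes w: "Re w > c - \<eta>"
  obtains r R where "r > 0" "R holomorphic_on ball w r" "\<And>s. s \<in> ball w r \<Longrightarrow> zero_pole_sum z s = zero_term s w + R s"
proof -
  obtain r where r: "r > 0" "\<And>n. z n \<noteq> w \<Longrightarrow> dist w (z n) \<ge> 2 * r" using zero_free_radius by blast
  define A where "A = {n. z n \<noteq> w}"
  define R where "R s = (\<Sum>n. if n \<in> A then zero_term s (z n) else 0)" for s
  note part = zero_pole_sum_part_holomorphic[of r A w, OF r(1) r(2)[of _]]
  have R: "R holomorphic_on ball w r" "\<And>s. s \<in> ball w r \<Longrightarrow> summable (\<lambda>n. if n \<in> A then zero_term s (z n) else 0)"
    unfolding R_def using part by (auto simp: A_def)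
  have "zero_pole_sum z s = zero_term s w + R s" if s: "s \<in> ball w r" for s
  proof (cases "w \<in> zeta_zeros (c - \<eta>)")
    case True
    then obtain k where k: "z k = w" using range by (metis rangeE)
    hence A: "n \<in> A \<longleftrightarrow> n \<noteq> k" for n using inj by (auto simp: A_def dest: injD)
    have "(\<lambda>n. (if n = k then zero_term s (z n) else 0) + (if n \<in> A then zero_term s (z n) else 0)) sums (zero_term s (z k) + R s)"
      unfolding R_def by (intro sums_add sums_single summable_sums R(2) s)
    also have "(\<lambda>n. (if n = k then zero_term s (z n) else 0) + (if n \<in> A then zero_term s (z n) else 0)) = (\<lambda>n. zero_term s (z n))"
      by (auto simp: A)
    finally show ?thesis unfolding zero_pole_sum_def k by (simp add: sums_iff)
  next
    case False
    hence "n \<in> A" for n using z_in[of n] by (auto simp: A_def)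
    thus ?thesis using zeta_zero_mult_eq_0[OF w False] by (simp add: zero_pole_sum_def R_def zero_term_def)
  qed
  thus thesis using that r(1) R(1) by blast
qed

lemma error_transform_local:
  assumes w: "Re w > c - \<eta>"
  shows "\<exists>r>0. \<exists>H. H holomorphic_on ball w r \<and> (\<forall>s\<in>ball w r. s \<noteq> w \<or> w \<notin> zeta_zeros (c - \<eta>) \<longrightarrow> error_transform z s = H s)"
proof -
  define m where "m = zeta_zero_mult w"
  have w_pos: "Re w > 0" "w \<noteq> 0" using w c by auto
  obtain r1 h where h: "r1 > 0" "ball w r1 \<subseteq> {s. Re s > 0}" "h holomorphic_on ball w r1"
    "\<And>s. s \<in> ball w r1 \<Longrightarrow> s \<noteq> w \<or> m = 0 \<Longrightarrow> deriv pole_free_zeta s / pole_free_zeta s = of_nat m / (s - w) + h s"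
    using pole_free_zeta_log_deriv_local[OF w_pos(1)] unfolding m_def by metis
  obtain r2 R where R: "r2 > 0" "R holomorphic_on ball w r2" "\<And>s. s \<in> ball w r2 \<Longrightarrow> zero_pole_sum z s = zero_term s w + R s"
    using zero_pole_sum_local[OF w] by metis
  define r where "r = min r1 r2"
  have balls: "ball w r \<subseteq> ball w r1" "ball w r \<subseteq> ball w r2" by (auto simp: r_def)
  have nz: "s \<noteq> 0" if "s \<in> ball w r" for s
  proof -
    have "s \<in> {s. Re s > 0}" using that balls(1) h(2) by blast
    thus ?thesis by auto
  qed
  define H where "H s = of_nat m / (w * s) - h s / s - 1 / s + R s" for s
  have "H holomorphic_on ball w r" unfolding H_def
    using w_pos nz by (intro holomorphic_intros holomorphic_on_subset[OF h(3) balls(1)] holomorphic_on_subset[OF R(2) balls(2)]) auto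
  moreover have "error_transform z s = H s" if s: "s \<in> ball w r" "s \<noteq> w \<or> w \<notin> zeta_zeros (c - \<eta>)" for s
  proof -
    have regular: "s \<noteq> w \<or> m = 0" using s(2) zeta_zero_mult_eq_0[OF w] by (auto simp: m_def)
    have "of_nat m / (w * (s - w)) - of_nat m / (s - w) / s = of_nat m / (w * s)"
      using regular w_pos(2) nz[OF s(1)] by (cases "m = 0") (auto simp: divide_simps, simp add: algebra_simps)
    moreover have "deriv pole_free_zeta s / pole_free_zeta s = of_nat m / (s - w) + h s"
      using h(4)[OF _ regular] s(1) balls(1) by blast
    hence "log_deriv_part s = - (of_nat m / (s - w) / s) - h s / s - 1 / s"
      unfolding log_deriv_part_def by (simp only:) (simp add: add_divide_distrib diff_divide_distrib)
    moreover have "zero_pole_sum z s = of_nat m / (w * (s - w)) + R s"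
      using R(3)[of s] s(1) balls(2) by (auto simp: zero_term_def m_def)
    moreover have "(- Y - a - b) + (X + q) = (X - Y) - a - b + q" for X Y a b q :: complex by simp
    ultimately show ?thesis unfolding error_transform_def H_def by (simp only:)
  qed
  moreover have "r > 0" using h(1) R(1) by (simp add: r_def)
  ultimately show ?thesis by blast
qed

definition error_transform_ext :: "complex \<Rightarrow> complex" where
  "error_transform_ext = remove_sings (error_transform z)"

lemma error_transform_ext_holomorphic: "error_transform_ext holomorphic_on {s. Re s > c - \<eta>}"
proof -
  have "error_transform_ext analytic_on {w}" if w: "Re w > c - \<eta>" for w
  proof -
    obtain r H where H: "r > 0" "H holomorphic_on ball w r" "\<And>s. s \<in> ball w r \<Longrightarrow> s \<noteq> w \<Longrightarrow> error_transform z s = H s"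
      using error_transform_local[OF w] by blast
    have near: "\<forall>\<^sub>F s in at w. error_transform z s = H s"
      using eventually_at_in_open[of "ball w r" w] H(1,3) by (auto elim!: eventually_mono)
    have H_analytic: "H analytic_on {w}" using H(1) by (intro holomorphic_on_imp_analytic_at[OF H(2) open_ball]) simp
    have "isolated_singularity_at (error_transform z) w"
      using near isolated_singularity_at_analytic[OF H_analytic] isolated_singularity_at_cong by blast
    moreover have "error_transform z \<midarrow>w\<rightarrow> H w"
      using H_analytic near by (simp add: analytic_at_imp_isCont isContD tendsto_cong)
    ultimately show ?thesis unfolding error_transform_ext_def by (rule remove_sings_analytic_at)
  qed
  hence "error_transform_ext analytic_on {s. Re s > c - \<eta>}" by (subst analytic_on_analytic_at) auto
  thus ?thesis by (rule analytic_imp_holomorphic)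
qed

lemma error_transform_ext_eq:
  assumes w: "Re w > c - \<eta>" "w \<notin> zeta_zeros (c - \<eta>)"
  shows "error_transform_ext w = error_transform z w"
proof -
  obtain r H where H: "r > 0" "H holomorphic_on ball w r" "\<And>s. s \<in> ball w r \<Longrightarrow> error_transform z s = H s"
    using error_transform_local[OF w(1)] w(2) by blast
  have "error_transform z holomorphic_on ball w r" using H(2) by (rule holomorphic_transform) (simp add: H(3))
  hence "error_transform z analytic_on {w}" using H(1) by (auto intro: holomorphic_on_imp_analytic_at)
  thus ?thesis unfolding error_transform_ext_def by (rule remove_sings_at_analytic)
qed

end

definition psi :: "real \<Rightarrow> real" where
  "psi x = (\<Sum>n | 0 < n \<and> real n \<le> x. mangoldt n)"

lemma finite_le_real: "finite {n::nat. 0 < n \<and> real n \<le> x}"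
  by (rule finite_subset[of _ "{..nat \<lfloor>x\<rfloor>}"]) (auto simp: le_nat_floor)

lemma psi_nonneg: "psi x \<ge> 0"
  unfolding psi_def by (intro sum_nonneg mangoldt_nonneg)

lemma psi_mono: "x \<le> y \<Longrightarrow> psi x \<le> psi y"
  unfolding psi_def by (intro sum_mono2 finite_le_real) (auto intro: mangoldt_nonneg)

lemma psi_exp_measurable [measurable]: "(\<lambda>v. psi (exp v)) \<in> borel_measurable borel"
  by (rule borel_measurable_mono) (auto intro!: monoI psi_mono)

lemma psi_le:
  assumes "x \<ge> 1"
  shows "psi x \<le> x * ln x"
proof -
  have "psi x \<le> (\<Sum>n | 0 < n \<and> real n \<le> x. ln x)"
    unfolding psi_def
  proof (rule sum_mono)
    fix n assume n: "n \<in> {n. 0 < n \<and> real n \<le> x}"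
    hence "mangoldt n \<le> ln (real n)" by (intro mangoldt_le) auto
    also have "... \<le> ln x" using n by (subst ln_le_cancel_iff) auto
    finally show "mangoldt n \<le> ln x" .
  qed
  also have "... = real (card {n::nat. 0 < n \<and> real n \<le> x}) * ln x" by simp
  also have "... \<le> x * ln x"
  proof (intro mult_right_mono)
    have "{n::nat. 0 < n \<and> real n \<le> x} \<subseteq> {1..nat \<lfloor>x\<rfloor>}" by (auto simp: le_nat_floor)
    hence "card {n::nat. 0 < n \<and> real n \<le> x} \<le> nat \<lfloor>x\<rfloor>" using card_mono[of "{1..nat \<lfloor>x\<rfloor>}"] by force
    thus "real (card {n::nat. 0 < n \<and> real n \<le> x}) \<le> x" using assms by linarith
  qed (use assms in auto)
  finally show ?thesis .
qed

definition exp_step :: "complex \<Rightarrow> real \<Rightarrow> real \<Rightarrow> complex" where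
  "exp_step w a u = indicator {a<..} u *\<^sub>R exp (- w * of_real u)"

lemma laplace_exp_step:
  assumes "Re w > 0"
  shows "integrable lborel (exp_step w a)"
    and "(LINT u|lborel. exp_step w a u) = exp (- w * of_real a) / w"
proof -
  have shift: "exp_step w a (a + 1 * x) = exp (- w * of_real a) * (indicator {0<..} x *\<^sub>R exp (- w * of_real x))" for x
    by (auto simp: exp_step_def indicator_def exp_add[symmetric] algebra_simps)
  have "integrable lborel (\<lambda>x. exp_step w a (a + 1 * x))"
    unfolding shift using laplace_exp(1)[OF assms] by (intro integrable_mult_right) (simp add: set_integrable_def)
  thus "integrable lborel (exp_step w a)" using lborel_integrable_real_affine_iff[of 1 "exp_step w a" a] by simp
  have "(LINT u|lborel. exp_step w a u) = \<bar>1\<bar> *\<^sub>R (LINT x|lborel. exp_step w a (a + 1 * x))"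
    by (rule lborel_integral_real_affine) simp
  also have "... = exp (- w * of_real a) * (1 / w)"
    using laplace_exp(2)[OF assms] unfolding shift set_lebesgue_integral_def by (simp only: integral_mult_right_zero abs_one scaleR_one)
  finally show "(LINT u|lborel. exp_step w a u) = exp (- w * of_real a) / w" by simp
qed

lemma integral_norm_exp_step:
  assumes "Re w > 0"
  shows "(LINT u|lborel. norm (exp_step w a u)) = exp (- Re w * a) / Re w"
proof -
  have "norm (exp_step w a u) = Re (exp_step (of_real (Re w)) a u)" for u
    using Re_exp[of "- of_real (Re w) * of_real u"] by (auto simp: exp_step_def indicator_def norm_exp_eq_Re)
  hence "(LINT u|lborel. norm (exp_step w a u)) = Re (exp (- of_real (Re w) * of_real a) / of_real (Re w))"
    using laplace_exp_step[of "of_real (Re w)" a] assms by (simp only: integral_Re Re_complex_of_real)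
  also have "exp (- of_real (Re w) * of_real a) / of_real (Re w) = complex_of_real (exp (- Re w * a) / Re w)"
    by (simp add: exp_of_real[symmetric])
  finally show ?thesis by (simp only: Re_complex_of_real)
qed

lemma laplace_exp_step_series:
  fixes A w :: "nat \<Rightarrow> complex" and a :: "nat \<Rightarrow> real"
  assumes w: "\<And>n. Re (w n) > 0"
    and pointwise: "AE u in lborel. summable (\<lambda>n. norm (A n * exp_step (w n) (a n) u))"
    and total: "summable (\<lambda>n. norm (A n) * (exp (- Re (w n) * a n) / Re (w n)))"
  shows "integrable lborel (\<lambda>u. \<Sum>n. A n * exp_step (w n) (a n) u)"
    and "(LINT u|lborel. (\<Sum>n. A n * exp_step (w n) (a n) u)) = (\<Sum>n. A n * (exp (- w n * of_real (a n)) / w n))"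
proof -
  have term_integrable: "integrable lborel (\<lambda>u. A n * exp_step (w n) (a n) u)" for n
    by (intro integrable_mult_right laplace_exp_step w)
  have norms: "summable (\<lambda>n. LINT u|lborel. norm (A n * exp_step (w n) (a n) u))"
    unfolding norm_mult by (simp only: integral_mult_right_zero integral_norm_exp_step[OF w] total)
  show "integrable lborel (\<lambda>u. \<Sum>n. A n * exp_step (w n) (a n) u)"
    by (rule integrable_suminf[OF term_integrable pointwise norms])
  show "(LINT u|lborel. (\<Sum>n. A n * exp_step (w n) (a n) u)) = (\<Sum>n. A n * (exp (- w n * of_real (a n)) / w n))"
    by (simp only: integral_suminf[OF term_integrable pointwise norms] integral_mult_right_zero laplace_exp_step(2)[OF w])
qed

lemma AE_not_ln_nat: "AE v in lborel. \<forall>n::nat. v \<noteq> ln (real n)"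
proof -
  have "AE v in lborel. v \<noteq> ln (real n)" for n by (rule AE_lborel_singleton)
  thus ?thesis by (simp add: AE_all_countable)
qed

lemma psi_exp_eq_suminf:
  assumes v: "\<forall>n::nat. v \<noteq> ln (real n)"
  shows "(\<lambda>n. mangoldt (Suc n) * indicator {ln (real (Suc n))<..} v) sums (indicator {0<..} v * psi (exp v) :: real)"
proof -
  define A where "A = {n. real (Suc n) \<le> exp v}"
  have A: "finite A" by (rule finite_subset[of _ "{..nat \<lfloor>exp v\<rfloor>}"]) (auto simp: A_def le_nat_floor)
  have iff: "real (Suc n) \<le> exp v \<longleftrightarrow> ln (real (Suc n)) < v" for n
  proof -
    have "real (Suc n) \<le> exp v \<longleftrightarrow> ln (real (Suc n)) \<le> v" by (subst ln_le_cancel_iff[of "real (Suc n)" "exp v", symmetric]) auto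
    thus ?thesis using v[rule_format, of "Suc n"] by (auto simp del: of_nat_Suc)
  qed
  have "(\<lambda>n. mangoldt (Suc n) * indicator {ln (real (Suc n))<..} v) sums (\<Sum>n\<in>A. mangoldt (Suc n) * indicator {ln (real (Suc n))<..} v :: real)"
    by (rule sums_finite[OF A]) (auto simp: A_def iff indicator_def simp del: of_nat_Suc)
  also have "(\<Sum>n\<in>A. mangoldt (Suc n) * indicator {ln (real (Suc n))<..} v :: real) = (\<Sum>n\<in>A. mangoldt (Suc n))"
    by (rule sum.cong) (auto simp: A_def iff simp del: of_nat_Suc)
  also have "... = psi (exp v)"
    unfolding psi_def A_def by (rule sum.reindex_bij_witness[of _ "\<lambda>n. n - 1" Suc]) auto
  also have "psi (exp v) = indicator {0<..} v * psi (exp v)"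
  proof (cases "v > 0")
    case False
    hence "exp v < 1" using v[rule_format, of 1] by auto
    hence "\<not> (0 < n \<and> real n \<le> exp v)" for n :: nat
      by (metis One_nat_def Suc_leI linorder_not_less of_nat_1 of_nat_mono order_less_le_trans)
    hence "{n::nat. 0 < n \<and> real n \<le> exp v} = {}" by blast
    thus ?thesis by (simp only: psi_def sum.empty mult_zero_right)
  qed auto
  finally show ?thesis .
qed

lemma psi_exp_step_sums:
  fixes s :: complex
  assumes v: "\<forall>n::nat. v \<noteq> ln (real n)"
  defines "f \<equiv> \<lambda>n. mangoldt (Suc n) * exp_step s (ln (real (Suc n))) v"
  shows "f sums (of_real (indicator {0<..} v * psi (exp v)) * exp (- s * of_real v))" "summable (\<lambda>n. norm (f n))"
proof -
  note psi = psi_exp_eq_suminf[OF v]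
  have f_eq: "f n = of_real (mangoldt (Suc n) * indicator {ln (real (Suc n))<..} v) * exp (- s * of_real v)" for n
    by (simp add: f_def exp_step_def indicator_def)
  show "f sums (of_real (indicator {0<..} v * psi (exp v)) * exp (- s * of_real v))"
    unfolding f_eq[abs_def] by (intro sums_mult2 sums_of_real psi)
  have "norm (f n) = mangoldt (Suc n) * indicator {ln (real (Suc n))<..} v * norm (exp (- s * of_real v))" for n
    unfolding f_eq norm_mult norm_of_real by (simp add: abs_mult mangoldt_nonneg)
  thus "summable (\<lambda>n. norm (f n))" using summable_mult2[OF sums_summable[OF psi]] by simp
qed

lemma laplace_psi:
  assumes s: "Re s > 1" and nz: "zeta s \<noteq> 0"
  defines "g \<equiv> \<lambda>v. of_real (indicator {0<..} v * psi (exp v)) * exp (- s * of_real v)"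
  shows "integrable lborel g" and "(LINT v|lborel. g v) = - (deriv zeta s / zeta s) / s"
proof -
  have s_pos: "Re s > 0" using s by simp
  have pointwise: "AE v in lborel. summable (\<lambda>n. norm (mangoldt (Suc n) * exp_step s (ln (real (Suc n))) v))"
    and suminf: "AE v in lborel. g v = (\<Sum>n. mangoldt (Suc n) * exp_step s (ln (real (Suc n))) v)"
    using AE_not_ln_nat psi_exp_step_sums[of _ s] by (auto elim!: eventually_mono simp: sums_iff g_def)
  have "norm (mangoldt (Suc n) :: complex) * (exp (- Re s * ln (real (Suc n))) / Re s)
      = norm (mangoldt (Suc n) / of_nat (Suc n) powr s :: complex) / Re s" for n
    unfolding norm_divide norm_Suc_powr by (simp add: powr_def exp_minus divide_inverse del: of_nat_Suc)
  hence total: "summable (\<lambda>n. norm (mangoldt (Suc n) :: complex) * (exp (- Re s * ln (real (Suc n))) / Re s))"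
    by (simp only: summable_divide mangoldt_series_norm_summable[OF s])
  note series = laplace_exp_step_series[OF s_pos pointwise total]
  have measurable: "g \<in> borel_measurable lborel" unfolding g_def by measurable
  show "integrable lborel g"
    using integrable_cong_AE[OF measurable _ suminf] series(1) by (auto dest: borel_measurable_integrable)
  have "(LINT v|lborel. g v) = (LINT v|lborel. (\<Sum>n. mangoldt (Suc n) * exp_step s (ln (real (Suc n))) v))"
    by (rule integral_cong_AE[OF measurable borel_measurable_integrable[OF series(1)] suminf])
  also have "... = (\<Sum>n. mangoldt (Suc n) / of_nat (Suc n) powr s / s)"
  proof -
    have "exp (- s * of_real (ln (real (Suc n)))) = 1 / of_nat (Suc n) powr s" for n
      using Ln_of_real[of "real (Suc n)"] by (simp add: powr_def exp_minus divide_inverse del: of_nat_Suc)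
    thus ?thesis unfolding series(2) by (simp del: of_nat_Suc)
  qed
  also have "... = (\<Sum>n. mangoldt (Suc n) / of_nat (Suc n) powr s) / s"
    by (rule suminf_divide[OF summable_norm_cancel[OF mangoldt_series_norm_summable[OF s]]])
  also have "(\<Sum>n. mangoldt (Suc n) / of_nat (Suc n) powr s) = - (deriv zeta s / zeta s)"
    using zeta_log_deriv[OF s] nz by (metis minus_divide_left nonzero_mult_div_cancel_left)
  finally show "(LINT v|lborel. g v) = - (deriv zeta s / zeta s) / s" .
qed

lemma psi_cong_floor:
  assumes "\<lfloor>x\<rfloor> = \<lfloor>y\<rfloor>"
  shows "psi x = psi y"
proof -
  have "real n \<le> x \<longleftrightarrow> real n \<le> y" for n
    using assms le_floor_iff[of "int n" x] le_floor_iff[of "int n" y] by simp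
  thus ?thesis by (simp add: psi_def)
qed

lemma isCont_psi_exp:
  assumes v: "\<forall>n::nat. v \<noteq> ln (real n)"
  shows "isCont (\<lambda>v. psi (exp v)) v"
proof -
  define k where "k = \<lfloor>exp v\<rfloor>"
  have k_nonneg: "k \<ge> 0" by (simp add: k_def)
  have "real_of_int k \<noteq> exp v"
  proof
    assume "real_of_int k = exp v"
    hence "real (nat k) = exp v" using k_nonneg by simp
    thus False using v[rule_format, of "nat k"] by simp
  qed
  hence k: "real_of_int k < exp v" "exp v < real_of_int k + 1" unfolding k_def by linarith+
  have "(exp \<longlongrightarrow> exp v) (at v)" by (intro tendsto_intros)
  hence "\<forall>\<^sub>F y in at v. exp y > real_of_int k" "\<forall>\<^sub>F y in at v. exp y < real_of_int k + 1"
    using order_tendstoD k by blast+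
  hence "\<forall>\<^sub>F y in at v. psi (exp v) = psi (exp y)"
  proof eventually_elim
    case (elim y)
    hence "\<lfloor>exp y\<rfloor> = k" by linarith
    thus ?case by (intro psi_cong_floor) (simp add: k_def)
  qed
  thus ?thesis unfolding isCont_def by (rule Lim_transform_eventually[OF tendsto_const])
qed

lemma suminf_Cauchy_Schwarz:
  fixes a b :: "nat \<Rightarrow> real"
  assumes a: "summable a" "\<And>n. a n \<ge> 0" and ab: "summable (\<lambda>n. a n * b n)" and ab2: "summable (\<lambda>n. a n * (b n)^2)"
  shows "(\<Sum>n. a n * b n)^2 \<le> suminf a * (\<Sum>n. a n * (b n)^2)"
proof -
  define A S Q where "A = suminf a" and "S = (\<Sum>n. a n * b n)" and "Q = (\<Sum>n. a n * (b n)^2)"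
  have A_nonneg: "A \<ge> 0" unfolding A_def by (rule suminf_nonneg[OF a])
  have "(\<lambda>n. A^2 * (a n * (b n)^2) - 2 * A * S * (a n * b n) + S^2 * a n) sums (A^2 * Q - 2 * A * S * S + S^2 * A)"
    unfolding A_def S_def Q_def by (intro sums_add sums_diff sums_mult summable_sums a ab ab2)
  moreover have "A^2 * (a n * (b n)^2) - 2 * A * S * (a n * b n) + S^2 * a n = a n * (A * b n - S)^2" for n
    by (simp add: power2_eq_square algebra_simps)
  ultimately have "(\<lambda>n. a n * (A * b n - S)^2) sums (A^2 * Q - 2 * A * S * S + S^2 * A)" by simp
  from sums_le[OF _ sums_zero this] have "0 \<le> A^2 * Q - 2 * A * S * S + S^2 * A" using a(2) by auto
  hence "A * (A * Q - S^2) \<ge> 0" by (simp add: power2_eq_square algebra_simps)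
  hence "A = 0 \<or> A * Q \<ge> S^2" using A_nonneg by (auto simp: zero_le_mult_iff)
  moreover have "S^2 \<le> A * Q" if "A = 0"
  proof -
    have "a n = 0" for n using suminf_eq_zero_iff[OF a] that by (auto simp: A_def)
    thus ?thesis using that by (simp add: S_def)
  qed
  ultimately have "S^2 \<le> A * Q" by blast
  thus ?thesis unfolding A_def S_def Q_def .
qed

lemma integrable_one_plus_abs_powr:
  "integrable lborel (\<lambda>t::real. (1 + \<bar>t\<bar>) powr (-3/2))"
proof -
  define f where "f = (\<lambda>t::real. indicator {0<..} t * (1 + t) powr (-3/2))"
  have "set_integrable lborel (einterval 0 \<infinity>) (\<lambda>t. (1 + t) powr (-3/2))"
  proof (rule interval_integral_FTC_nonneg(1)[where F = "\<lambda>t. -2 * (1 + t) powr (-1/2)" and A = "-2" and B = 0])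
    fix x :: real assume "0 < ereal x"
    hence x: "x > 0" by (simp add: zero_ereal_def)
    show "DERIV (\<lambda>t. -2 * (1 + t) powr (-1/2)) x :> (1 + x) powr (-3/2)"
      using x by (auto intro!: derivative_eq_intros)
    show "isCont (\<lambda>t. (1 + t) powr (-3/2)) x" using x by (intro continuous_intros) auto
  next
    have "((\<lambda>t. -2 * (1 + t) powr (-1/2)) \<longlongrightarrow> -2 * (1 + 0) powr (-1/2)) (at_right (0::real))"
      by (intro tendsto_intros) auto
    thus "(((\<lambda>t. -2 * (1 + t) powr (-1/2)) \<circ> real_of_ereal) \<longlongrightarrow> -2) (at_right 0)"
      by (simp add: ereal_tendsto_simps1 zero_ereal_def)
    have "((\<lambda>t. -2 * (1 + t) powr (-1/2)) \<longlongrightarrow> (0::real)) at_top" by real_asymp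
    thus "(((\<lambda>t. -2 * (1 + t) powr (-1/2)) \<circ> real_of_ereal) \<longlongrightarrow> 0) (at_left \<infinity>)"
      by (simp add: ereal_tendsto_simps1)
  qed auto
  moreover have "einterval 0 \<infinity> = {0<..}" by (auto simp: einterval_def zero_ereal_def)
  ultimately have right: "integrable lborel f" by (simp add: set_integrable_def f_def)
  hence left: "integrable lborel (\<lambda>t. f (0 + -1 * t))" by (intro lborel_integrable_real_affine) auto
  have "integrable lborel (\<lambda>t. f t + f (0 + -1 * t))" by (intro Bochner_Integration.integrable_add right left)
  moreover have "AE t in lborel. (1 + \<bar>t\<bar>) powr (-3/2) = f t + f (0 + -1 * t)"
    using AE_lborel_singleton[of 0] by eventually_elim (auto simp: f_def indicator_def)
  ultimately show ?thesis
    using integrable_cong_AE[of "\<lambda>t. (1 + \<bar>t\<bar>) powr (-3/2)" lborel "\<lambda>t. f t + f (0 + -1 * t)"] by (auto dest: borel_measurable_integrable)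
qed

lemma ln_div_le_powr:
  assumes t: "t \<ge> (1::real)"
  shows "ln t / t \<le> 8 * (1 + t) powr (-3/4)"
proof -
  have "ln t / t \<le> t powr (1/4) / (1/4) / t" using t by (intro divide_right_mono ln_powr_bound) auto
  also have "... = 4 * t powr (-3/4)"
    using t powr_diff[of t "1/4" 1] by simp
  also have "t powr (-3/4) \<le> 2 * (1 + t) powr (-3/4)"
  proof -
    have "(1 + t) powr (3/4) \<le> (2 * t) powr (3/4)" using t by (intro powr_mono2) auto
    also have "... = 2 powr (3/4) * t powr (3/4)" by (rule powr_mult)
    also have "(2::real) powr (3/4) \<le> 2 powr 1" by (intro powr_mono) auto
    finally have "(1 + t) powr (3/4) \<le> 2 * t powr (3/4)" by (simp add: mult_right_mono)
    thus ?thesis using t by (simp add: powr_minus_divide field_simps)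
  qed
  finally show ?thesis by simp
qed

lemma integrable_norm_add_square:
  fixes f g :: "real \<Rightarrow> complex"
  assumes [measurable]: "f \<in> borel_measurable borel" "g \<in> borel_measurable borel"
    and f: "integrable lborel (\<lambda>t. (norm (f t))^2)" and g: "integrable lborel (\<lambda>t. (norm (g t))^2)"
  shows "integrable lborel (\<lambda>t. (norm (f t + g t))^2)"
proof (rule Bochner_Integration.integrable_bound[OF integrable_mult_right[OF Bochner_Integration.integrable_add[OF f g], of 2]])
  have "(norm (f t + g t))^2 \<le> 2 * ((norm (f t))^2 + (norm (g t))^2)" for t
  proof -
    have "(norm (f t + g t))^2 \<le> (norm (f t) + norm (g t))^2" by (intro power_mono norm_triangle_ineq) auto
    also have "... \<le> 2 * ((norm (f t))^2 + (norm (g t))^2)"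
      using sum_squares_bound[of "norm (f t)" "norm (g t)"] by (simp add: power2_sum)
    finally show ?thesis .
  qed
  thus "AE t in lborel. norm ((norm (f t + g t))^2) \<le> norm (2 * ((norm (f t))^2 + (norm (g t))^2))"
    by (intro always_eventually allI) (simp add: abs_mult)
qed measurable

lemma nn_integral_inverse_square_line_le:
  assumes k: "0 < k" "k \<le> Re w - c"
  shows "(\<integral>\<^sup>+ t. ennreal ((1 / norm (Complex c t - w))^2) \<partial>lborel) \<le> ennreal (pi / k)"
proof -
  define l where "l = Re w - c"
  have l: "l > 0" "k \<le> l" using k by (auto simp: l_def)
  have "(1 / norm (Complex c t - w))^2 = 1 / (2 * l) * poisson l (Im w - t)" for t
    using l by (simp add: cmod_power2 power_divide l_def poisson_def power2_commute)
  hence "(\<integral>\<^sup>+ t. ennreal ((1 / norm (Complex c t - w))^2) \<partial>lborel)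
      = (\<integral>\<^sup>+ t. ennreal (1 / (2 * l)) * ennreal (poisson l (Im w - t)) \<partial>lborel)"
    using l by (simp only: ennreal_mult' zero_le_divide_1_iff mult_nonneg_nonneg less_imp_le)
  also have "... = ennreal (1 / (2 * l)) * ennreal (2 * pi)"
    by (subst nn_integral_cmult) (measurable, simp only: nn_integral_poisson[OF l(1)])
  also have "... = ennreal (pi / l)" using l by (subst ennreal_mult'[symmetric]) auto
  also have "... \<le> ennreal (pi / k)" using l k by (intro ennreal_leI divide_left_mono mult_pos_pos) auto
  finally show ?thesis .
qed

context sparse_zeros
begin

lemma cnj_zero: "w \<in> zeta_zeros a \<Longrightarrow> cnj w \<in> zeta_zeros a"
  by (auto simp: zeta_zeros_def zeta_cnj)

lemma line_dist: "norm (Complex c t - z n) \<ge> \<eta>"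
  using Re_z(1)[of n] abs_Re_le_cmod[of "Complex c t - z n"] by simp

lemma zero_pole_sum_line_summable:
  "summable (\<lambda>n. weight n * (1 / norm (Complex c t - z n)))" "summable (\<lambda>n. weight n * (1 / norm (Complex c t - z n))^2)"
proof -
  have inverse_dist_le: "1 / norm (Complex c t - z n) \<le> 1 / \<eta>" for n using line_dist[of t n] \<eta> by (intro divide_left_mono mult_pos_pos) auto
  have "summable (\<lambda>n. weight n * (1 / norm (Complex c t - z n)) ^ p)" for p
  proof (rule summable_comparison_test'[OF summable_mult2[OF summable_weight, of "(1 / \<eta>) ^ p"]])
    fix n
    have "weight n * (1 / norm (Complex c t - z n)) ^ p \<le> weight n * (1 / \<eta>) ^ p" by (intro mult_left_mono power_mono inverse_dist_le) auto
    thus "norm (weight n * (1 / norm (Complex c t - z n)) ^ p) \<le> weight n * (1 / \<eta>) ^ p" by simp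
  qed
  from this[of 1] this[of 2] show "summable (\<lambda>n. weight n * (1 / norm (Complex c t - z n)))" "summable (\<lambda>n. weight n * (1 / norm (Complex c t - z n))^2)"
    by simp_all
qed

lemma zero_pole_sum_line_bound:
  "(norm (zero_pole_sum z (Complex c t)))^2 \<le> suminf weight * (\<Sum>n. weight n * (1 / norm (Complex c t - z n))^2)"
proof -
  have "norm (zero_pole_sum z (Complex c t)) \<le> (\<Sum>n. weight n * (1 / norm (Complex c t - z n)))"
    unfolding zero_pole_sum_def by (rule norm_suminf_le) (simp_all only: norm_zero_term order_refl zero_pole_sum_line_summable)
  hence "(norm (zero_pole_sum z (Complex c t)))^2 \<le> (\<Sum>n. weight n * (1 / norm (Complex c t - z n)))^2" by (intro power_mono) auto
  also have "... \<le> suminf weight * (\<Sum>n. weight n * (1 / norm (Complex c t - z n))^2)"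
    by (rule suminf_Cauchy_Schwarz[OF summable_weight _ zero_pole_sum_line_summable]) auto
  finally show ?thesis .
qed

lemma line_not_zero: "Complex c t \<notin> zeta_zeros (c - \<eta>)"
  using gap[of "Complex c t"] \<eta> by auto

lemma continuous_on_line: "f holomorphic_on {s. Re s > a} \<Longrightarrow> a < c \<Longrightarrow> continuous_on UNIV (\<lambda>t. f (Complex c t))"
  unfolding Complex_eq
  by (rule continuous_on_compose2[OF holomorphic_on_imp_continuous_on]) (auto intro!: continuous_intros)

lemma log_deriv_part_line_continuous: "continuous_on UNIV (\<lambda>t. log_deriv_part (Complex c t))"
proof -
  have c_pos: "c > 0" using c \<eta> by simp
  have "deriv pole_free_zeta holomorphic_on {s. Re s > 0}"
    by (intro holomorphic_deriv pole_free_zeta_holomorphic open_halfspace_Re_gt)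
  note cont = continuous_on_line[OF this c_pos] continuous_on_line[OF pole_free_zeta_holomorphic c_pos]
    continuous_on_line[OF holomorphic_on_ident c_pos]
  have "pole_free_zeta (Complex c t) \<noteq> 0" for t
    using line_not_zero[of t] c c_pos \<eta> pole_free_zeta_1 pole_free_zeta_eq[of "Complex c t"]
    by (cases "Complex c t = 1") (auto simp: zeta_zeros_def)
  moreover have "Complex c t \<noteq> 0" for t using c_pos by (auto simp: complex_eq_iff)
  ultimately show ?thesis unfolding log_deriv_part_def by (intro continuous_intros cont) auto
qed

lemma log_deriv_part_bound:
  "\<exists>C. C \<ge> 0 \<and> (\<forall>s. c \<le> Re s \<and> Re s \<le> 3 \<and> \<bar>Im s\<bar> \<ge> 20 \<and> (\<forall>n. dist s (z n) \<ge> \<eta>)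
     \<longrightarrow> norm (log_deriv_part s) \<le> C * ln \<bar>Im s\<bar> / \<bar>Im s\<bar>)"
proof -
  obtain C where C: "\<And>s. c \<le> Re s \<Longrightarrow> Re s \<le> 3 \<Longrightarrow> \<bar>Im s\<bar> \<ge> 20 \<Longrightarrow> (\<forall>w\<in>zeta_zeros (c - \<eta>). dist s w \<ge> \<eta>)
     \<Longrightarrow> norm (deriv zeta s / zeta s) \<le> C * ln \<bar>Im s\<bar>"
    using zeta_log_deriv_bound[OF c \<eta> sep mult] by blast
  have "norm (log_deriv_part s) \<le> (\<bar>C\<bar> + 2) * ln \<bar>Im s\<bar> / \<bar>Im s\<bar>"
    if s: "c \<le> Re s" "Re s \<le> 3" "\<bar>Im s\<bar> \<ge> 20" "\<forall>n. dist s (z n) \<ge> \<eta>" for s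
  proof -
    have far: "\<forall>w\<in>zeta_zeros (c - \<eta>). dist s w \<ge> \<eta>" using s(4) range[symmetric] by auto
    have s_pos: "Re s > 0" "s \<noteq> 1" using s(1,3) c \<eta> by auto
    have "s \<notin> zeta_zeros (c - \<eta>)" using far[rule_format, of s] \<eta> by auto
    hence nz: "zeta s \<noteq> 0" using s_pos s(1) c \<eta> by (auto simp: zeta_zeros_def)
    hence "log_deriv_part s = - ((1 / (s - 1) + deriv zeta s / zeta s) + 1) / s"
      unfolding log_deriv_part_def pole_free_zeta_log_deriv[OF s_pos nz] by (simp add: add_divide_distrib diff_divide_distrib)
    hence "norm (log_deriv_part s) = norm ((1 / (s - 1) + deriv zeta s / zeta s) + 1) / norm s"
      by (simp only: norm_divide norm_minus_cancel)
    also have "... \<le> (\<bar>C\<bar> + 2) * ln \<bar>Im s\<bar> / \<bar>Im s\<bar>"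
    proof (rule frac_le)
      have ln_ge: "ln \<bar>Im s\<bar> \<ge> 1" using s(3) by (intro ln_ge_1) linarith
      thus "0 \<le> (\<bar>C\<bar> + 2) * ln \<bar>Im s\<bar>" by simp
      have "norm ((1 / (s - 1) + deriv zeta s / zeta s) + 1) \<le> (norm (1 / (s - 1)) + norm (deriv zeta s / zeta s)) + norm (1::complex)"
        by (intro norm_triangle_mono norm_triangle_ineq order_refl)
      also have "norm (deriv zeta s / zeta s) \<le> \<bar>C\<bar> * ln \<bar>Im s\<bar>"
        using order_trans[OF C[OF s(1-3) far] mult_right_mono[OF abs_ge_self[of C]]] ln_ge by simp
      also have "norm (1 / (s - 1)) \<le> 1"
        using abs_Im_le_cmod[of "s - 1"] s(3) by (auto simp: norm_divide divide_le_eq)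
      finally show "norm ((1 / (s - 1) + deriv zeta s / zeta s) + 1) \<le> (\<bar>C\<bar> + 2) * ln \<bar>Im s\<bar>"
        using ln_ge by (simp add: algebra_simps)
    qed (use abs_Im_le_cmod[of s] s(3) in auto)
    finally show ?thesis .
  qed
  thus ?thesis by (intro exI[of _ "\<bar>C\<bar> + 2"]) auto
qed

lemma log_deriv_part_line_le:
  "\<exists>D. \<forall>t. norm (log_deriv_part (Complex c t)) \<le> D * (1 + \<bar>t\<bar>) powr (-3/4)"
proof -
  obtain C where C: "C \<ge> 0" "\<And>s. c \<le> Re s \<Longrightarrow> Re s \<le> 3 \<Longrightarrow> \<bar>Im s\<bar> \<ge> 20 \<Longrightarrow> (\<forall>n. dist s (z n) \<ge> \<eta>)
     \<Longrightarrow> norm (log_deriv_part s) \<le> C * ln \<bar>Im s\<bar> / \<bar>Im s\<bar>"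
    using log_deriv_part_bound by blast
  have "compact ((\<lambda>t. log_deriv_part (Complex c t)) ` {-20..20})"
    by (intro compact_continuous_image continuous_on_subset[OF log_deriv_part_line_continuous]) auto
  from compact_imp_bounded[OF this] obtain B where B: "\<And>t. t \<in> {-20..20} \<Longrightarrow> norm (log_deriv_part (Complex c t)) \<le> B"
    unfolding bounded_iff by blast
  have B_nonneg: "B \<ge> 0" using order_trans[OF norm_ge_zero B[of 0]] by simp
  have "norm (log_deriv_part (Complex c t)) \<le> (63 * B + 8 * C) * (1 + \<bar>t\<bar>) powr (-3/4)" for t
  proof (cases "\<bar>t\<bar> \<le> 20")
    case True
    have "(1 + \<bar>t\<bar>) powr (3/4) \<le> (1 + \<bar>t\<bar>) powr 1" by (intro powr_mono) auto
    hence "1 \<le> 63 * (1 + \<bar>t\<bar>) powr (-3/4)" using True by (simp add: powr_minus field_simps)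
    hence "B * 1 \<le> B * (63 * (1 + \<bar>t\<bar>) powr (-3/4))" by (intro mult_left_mono B_nonneg)
    moreover have "norm (log_deriv_part (Complex c t)) \<le> B" using True by (intro B) auto
    moreover have "0 \<le> C * (1 + \<bar>t\<bar>) powr (-3/4)" using C(1) by simp
    ultimately show ?thesis by (simp add: algebra_simps)
  next
    case False
    have "\<forall>n. dist (Complex c t) (z n) \<ge> \<eta>" using line_dist by (simp add: dist_norm)
    hence "norm (log_deriv_part (Complex c t)) \<le> C * (ln \<bar>t\<bar> / \<bar>t\<bar>)" using C(2)[of "Complex c t"] False c by simp
    also have "... \<le> C * (8 * (1 + \<bar>t\<bar>) powr (-3/4))" using False C(1) by (intro mult_left_mono ln_div_le_powr) auto
    also have "... \<le> (63 * B + 8 * C) * (1 + \<bar>t\<bar>) powr (-3/4)" using B_nonneg by (simp add: algebra_simps)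
    finally show ?thesis .
  qed
  thus ?thesis by blast
qed

lemma log_deriv_part_line_L2: "integrable lborel (\<lambda>t. (norm (log_deriv_part (Complex c t)))^2)"
proof -
  obtain D where D: "\<And>t. norm (log_deriv_part (Complex c t)) \<le> D * (1 + \<bar>t\<bar>) powr (-3/4)"
    using log_deriv_part_line_le by blast
  have "(norm (log_deriv_part (Complex c t)))^2 \<le> D^2 * (1 + \<bar>t\<bar>) powr (-3/2)" for t
  proof -
    have "(norm (log_deriv_part (Complex c t)))^2 \<le> (D * (1 + \<bar>t\<bar>) powr (-3/4))^2" using D by (intro power_mono) auto
    also have "... = D^2 * (1 + \<bar>t\<bar>) powr (-3/2)" by (simp add: power_mult_distrib power2_eq_square powr_add[symmetric])
    finally show ?thesis .
  qed
  thus ?thesis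
    by (intro Bochner_Integration.integrable_bound[OF integrable_mult_right[OF integrable_one_plus_abs_powr, of "D^2"]])
       (use borel_measurable_continuous_onI[OF log_deriv_part_line_continuous] in auto)
qed

lemma nn_integral_zero_term_line_le:
  "(\<integral>\<^sup>+ t. ennreal (weight n * (1 / norm (Complex c t - z n))^2) \<partial>lborel) \<le> ennreal (weight n * (pi / \<eta>))"
proof -
  have "(\<integral>\<^sup>+ t. ennreal (weight n * (1 / norm (Complex c t - z n))^2) \<partial>lborel)
      = ennreal (weight n) * (\<integral>\<^sup>+ t. ennreal ((1 / norm (Complex c t - z n))^2) \<partial>lborel)"
    unfolding Complex_eq by (subst nn_integral_cmult[symmetric]) (measurable, simp only: ennreal_mult' divide_nonneg_nonneg of_nat_0_le_iff norm_ge_zero)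
  also have "... \<le> ennreal (weight n) * ennreal (pi / \<eta>)"
    using Re_z(1)[of n] \<eta> by (intro mult_left_mono nn_integral_inverse_square_line_le) auto
  also have "... = ennreal (weight n * (pi / \<eta>))" by (rule ennreal_mult'[symmetric]) auto
  finally show ?thesis .
qed

lemma zero_pole_sum_line_L2:
  assumes [measurable]: "(\<lambda>t. zero_pole_sum z (Complex c t)) \<in> borel_measurable borel"
  shows "integrable lborel (\<lambda>t. (norm (zero_pole_sum z (Complex c t)))^2)"
proof (rule integrableI_bounded)
  let ?q = "\<lambda>n t. weight n * (1 / norm (Complex c t - z n))^2"
  have "(\<integral>\<^sup>+ t. ennreal (norm ((norm (zero_pole_sum z (Complex c t)))^2)) \<partial>lborel)
      \<le> (\<integral>\<^sup>+ t. ennreal (suminf weight) * (\<Sum>n. ennreal (?q n t)) \<partial>lborel)"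
  proof (rule nn_integral_mono)
    fix t
    have "ennreal (norm ((norm (zero_pole_sum z (Complex c t)))^2)) \<le> ennreal (suminf weight * (\<Sum>n. ?q n t))"
      using zero_pole_sum_line_bound[of t] by (intro ennreal_leI) simp
    also have "... = ennreal (suminf weight) * (\<Sum>n. ennreal (?q n t))"
      using weight_sum_nonneg zero_pole_sum_line_summable(2)[of t] by (subst ennreal_mult') (auto simp: suminf_ennreal2)
    finally show "ennreal (norm ((norm (zero_pole_sum z (Complex c t)))^2)) \<le> ennreal (suminf weight) * (\<Sum>n. ennreal (?q n t))" .
  qed
  also have "... = ennreal (suminf weight) * (\<integral>\<^sup>+ t. (\<Sum>n. ennreal (?q n t)) \<partial>lborel)"
    unfolding Complex_eq by (rule nn_integral_cmult) measurable
  also have "(\<integral>\<^sup>+ t. (\<Sum>n. ennreal (?q n t)) \<partial>lborel) = (\<Sum>n. \<integral>\<^sup>+ t. ennreal (?q n t) \<partial>lborel)"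
    unfolding Complex_eq by (rule nn_integral_suminf) measurable
  also have "... \<le> (\<Sum>n. ennreal (weight n * (pi / \<eta>)))" by (intro suminf_le nn_integral_zero_term_line_le) auto
  also have "(\<Sum>n. ennreal (weight n * (pi / \<eta>))) = ennreal (\<Sum>n. weight n * (pi / \<eta>))"
    using \<eta> by (intro suminf_ennreal2 summable_mult2 summable_weight) auto
  finally have "(\<integral>\<^sup>+ t. ennreal (norm ((norm (zero_pole_sum z (Complex c t)))^2)) \<partial>lborel)
      \<le> ennreal (suminf weight) * ennreal (\<Sum>n. weight n * (pi / \<eta>))"
    by (meson mult_left_mono order_trans zero_le)
  also have "... < \<infinity>" by (simp add: ennreal_mult_less_top)
  finally show "(\<integral>\<^sup>+ t. ennreal (norm ((norm (zero_pole_sum z (Complex c t)))^2)) \<partial>lborel) < \<infinity>" .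
qed measurable

lemma error_transform_line_L2: "integrable lborel (\<lambda>t. (norm (error_transform_ext (Complex c t)))^2)"
proof -
  have split: "error_transform_ext (Complex c t) = log_deriv_part (Complex c t) + zero_pole_sum z (Complex c t)" for t
    using error_transform_ext_eq[of "Complex c t"] line_not_zero \<eta> by (simp add: error_transform_def)
  have log_deriv: "(\<lambda>t. log_deriv_part (Complex c t)) \<in> borel_measurable borel"
    by (rule borel_measurable_continuous_onI[OF log_deriv_part_line_continuous])
  have "zero_pole_sum z (Complex c t) = error_transform_ext (Complex c t) - log_deriv_part (Complex c t)" for t
    by (simp add: split)
  moreover have "(\<lambda>t. error_transform_ext (Complex c t) - log_deriv_part (Complex c t)) \<in> borel_measurable borel"
    using continuous_on_line[OF error_transform_ext_holomorphic] \<eta>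
    by (intro borel_measurable_continuous_onI continuous_on_diff log_deriv_part_line_continuous) auto
  ultimately have "(\<lambda>t. zero_pole_sum z (Complex c t)) \<in> borel_measurable borel" by simp
  thus ?thesis unfolding split
    by (intro integrable_norm_add_square log_deriv log_deriv_part_line_L2 zero_pole_sum_line_L2)
qed

end

lemma zorder_cnj:
  assumes f: "f holomorphic_on S" and S: "open S" "connected S" "w \<in> S" and nz: "\<exists>s\<in>S. f s \<noteq> 0"
  shows "zorder (\<lambda>s. cnj (f (cnj s))) (cnj w) = zorder f w"
proof -
  obtain r where r: "r > 0" "zor_poly f w holomorphic_on cball w r"
      "\<And>s. s \<in> cball w r \<Longrightarrow> f s = zor_poly f w s * (s - w) ^ nat (zorder f w) \<and> zor_poly f w s \<noteq> 0"
      and order: "zorder f w \<ge> 0"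
    using zorder_exist_zero[OF f S nz] by (metis less_imp_le order_refl)
  have cnj_ball: "cnj s \<in> ball w r" if "s \<in> ball (cnj w) r" for s
    using that complex_mod_cnj[of "cnj w - s"] by (simp add: dist_norm del: complex_mod_cnj)
  show ?thesis
  proof (rule zorder_eqI)
    have "zor_poly f w holomorphic_on cnj ` ball (cnj w) r"
      by (rule holomorphic_on_subset[OF r(2)]) (use cnj_ball in force)
    thus "(\<lambda>s. cnj (zor_poly f w (cnj s))) holomorphic_on ball (cnj w) r"
      using holomorphic_on_compose_cnj_cnj[OF _ open_ball] by (simp add: o_def)
    fix s assume "s \<in> ball (cnj w) r"
    hence "cnj s \<in> cball w r" using cnj_ball[of s] by simp
    hence "f (cnj s) = zor_poly f w (cnj s) * (cnj s - w) ^ nat (zorder f w)" using r(3) by blast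
    thus "cnj (f (cnj s)) = cnj (zor_poly f w (cnj s)) * (s - cnj w) powi zorder f w"
      using order by (simp add: power_int_def)
  qed (use r in auto)
qed

lemma zeta_zero_mult_cnj: "zeta_zero_mult (cnj w) = zeta_zero_mult w"
proof (cases "w = 1")
  case False
  have "(\<lambda>s. cnj (zeta (cnj s))) = zeta" by (simp add: zeta_cnj)
  moreover have "\<exists>s\<in>UNIV - {1}. zeta s \<noteq> 0" by (rule zeta_not_identically_zero)
  ultimately have "zorder zeta (cnj w) = zorder zeta w"
    using zorder_cnj[OF zeta_holomorphic _ connected_Diff_one, of w] False by (simp add: open_Diff)
  thus ?thesis by (auto simp: zeta_zero_mult_def zeta_cnj)
qed (simp add: zeta_zero_mult_def)

context sparse_zeros
begin

definition zero_exp_term :: "real \<Rightarrow> complex \<Rightarrow> complex" where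
  "zero_exp_term v w = of_nat (zeta_zero_mult w) * exp (w * of_real v) / w"

definition zero_sum :: "real \<Rightarrow> complex" where
  "zero_sum v = (\<Sum>n. zero_exp_term v (z n))"

lemma norm_zero_exp_term_le: "norm (zero_exp_term v (z n)) \<le> weight n * exp \<bar>v\<bar>"
proof -
  have "Re (z n) * v \<le> Re (z n) * \<bar>v\<bar>" using Re_z(1)[of n] c \<eta> by (intro mult_left_mono) auto
  also have "... \<le> \<bar>v\<bar>" using Re_z[of n] c \<eta> by (intro mult_left_le_one_le) auto
  finally have "weight n * exp (Re (z n) * v) \<le> weight n * exp \<bar>v\<bar>" by (intro mult_left_mono) auto
  thus ?thesis by (simp add: zero_exp_term_def norm_divide norm_mult norm_exp_eq_Re)
qed

lemma summable_norm_zero_exp_term: "summable (\<lambda>n. norm (zero_exp_term v (z n)))"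
  by (rule summable_comparison_test'[OF summable_mult2[OF summable_weight, of "exp \<bar>v\<bar>"]]) (use norm_zero_exp_term_le in auto)

lemma norm_zero_sum_le: "norm (zero_sum v) \<le> suminf weight * exp \<bar>v\<bar>"
  unfolding zero_sum_def suminf_mult2[OF summable_weight]
  by (rule norm_suminf_le[OF norm_zero_exp_term_le summable_mult2[OF summable_weight]])

lemma zero_sum_has_sum: "(zero_exp_term v has_sum zero_sum v) (zeta_zeros (c - \<eta>))"
proof -
  have "((\<lambda>n. zero_exp_term v (z n)) has_sum zero_sum v) UNIV"
    unfolding zero_sum_def by (intro norm_summable_imp_has_sum summable_norm_zero_exp_term summable_sums summable_norm_cancel[OF summable_norm_zero_exp_term])
  thus ?thesis unfolding range[symmetric] has_sum_reindex[OF inj] by (simp add: o_def)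
qed

lemma zero_sum_real: "of_real (Re (zero_sum v)) = zero_sum v"
proof -
  have "((\<lambda>w. cnj (zero_exp_term v w)) has_sum cnj (zero_sum v)) (zeta_zeros (c - \<eta>))"
    using zero_sum_has_sum by simp
  also have "(\<lambda>w. cnj (zero_exp_term v w)) = zero_exp_term v \<circ> cnj" by (auto simp: zero_exp_term_def zeta_zero_mult_cnj exp_cnj)
  finally have "(zero_exp_term v has_sum cnj (zero_sum v)) (cnj ` zeta_zeros (c - \<eta>))"
    by (subst has_sum_reindex) (auto intro: inj_onI simp: o_def)
  moreover have "cnj ` zeta_zeros (c - \<eta>) = zeta_zeros (c - \<eta>)"
    using cnj_zero[of _ "c - \<eta>"] by (auto simp: image_iff) (metis complex_cnj_cnj)
  ultimately have "cnj (zero_sum v) = zero_sum v" using zero_sum_has_sum has_sum_unique by metis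
  thus ?thesis by (simp add: complex_eq_iff)
qed

lemma zero_sum_isCont: "isCont zero_sum v"
proof -
  define V where "V = \<bar>v\<bar> + 1"
  have "uniform_limit {-V..V} (\<lambda>N v. \<Sum>n<N. zero_exp_term v (z n)) (\<lambda>v. \<Sum>n. zero_exp_term v (z n)) sequentially"
  proof (rule Weierstrass_m_test[OF _ summable_mult2[OF summable_weight, of "exp V"]])
    fix n x assume "x \<in> {-V..V}"
    hence "weight n * exp \<bar>x\<bar> \<le> weight n * exp V" by (intro mult_left_mono) auto
    thus "norm (zero_exp_term x (z n)) \<le> weight n * exp V" using norm_zero_exp_term_le[of x n] by linarith
  qed
  hence "continuous_on {-V..V} zero_sum" unfolding zero_sum_def[abs_def] zero_exp_term_def
    by (rule uniform_limit_theorem[rotated]) (use z_nonzero in \<open>auto intro!: always_eventually continuous_intros\<close>)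
  thus ?thesis by (rule continuous_on_interior) (auto simp: V_def interior_atLeastAtMost_real)
qed

definition psi_error :: "real \<Rightarrow> real" where
  "psi_error v = (if v \<le> 0 then 0 else psi (exp v) - exp v + Re (zero_sum v))"

lemma psi_error_measurable [measurable]: "psi_error \<in> borel_measurable borel"
proof -
  have [measurable]: "zero_sum \<in> borel_measurable borel"
    by (rule borel_measurable_continuous_onI) (use zero_sum_isCont in \<open>simp add: continuous_on_eq_continuous_at\<close>)
  show ?thesis unfolding psi_error_def by measurable
qed

lemma abs_psi_error_le: "\<bar>psi_error v\<bar> \<le> (2 + suminf weight) * exp (2 * v)"
proof (cases "v \<le> 0")
  case True
  thus ?thesis using weight_sum_nonneg by (simp add: psi_error_def)
next
  case False
  have v_le: "v \<le> exp v" using exp_ge_add_one_self[of v] by linarith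
  have exp_le: "exp v \<le> exp (2 * v)" using False by simp
  have "psi (exp v) \<le> exp v * v" using psi_le[of "exp v"] False by simp
  also have "... \<le> exp v * exp v" using v_le by (intro mult_left_mono) auto
  finally have "psi (exp v) \<le> exp (2 * v)" by (simp add: exp_add[symmetric])
  moreover have "\<bar>Re (zero_sum v)\<bar> \<le> suminf weight * exp (2 * v)"
  proof -
    have "\<bar>Re (zero_sum v)\<bar> \<le> norm (zero_sum v)" by (rule abs_Re_le_cmod)
    also have "... \<le> suminf weight * exp v" using norm_zero_sum_le[of v] False by simp
    also have "... \<le> suminf weight * exp (2 * v)" by (intro mult_left_mono exp_le weight_sum_nonneg)
    finally show ?thesis .
  qed
  moreover have "psi_error v = psi (exp v) - exp v + Re (zero_sum v)" using False by (simp add: psi_error_def)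
  ultimately show ?thesis using psi_nonneg[of "exp v"] exp_le exp_gt_zero[of v] unfolding distrib_right by linarith
qed

lemma AE_isCont_psi_error: "AE v in lborel. isCont psi_error v"
  using AE_not_ln_nat
proof eventually_elim
  case (elim v)
  hence "v \<noteq> 0" using elim[rule_format, of 1] by simp
  show ?case
  proof (cases "v < 0")
    case True
    have "\<forall>\<^sub>F y in nhds v. 0 = psi_error y"
      by (rule eventually_mono[OF eventually_nhds_in_open[of "{..<0}"]]) (use True in \<open>auto simp: psi_error_def\<close>)
    thus ?thesis using isCont_cong[of "\<lambda>_. 0" psi_error v] by simp
  next
    case False
    hence v: "v > 0" using \<open>v \<noteq> 0\<close> by simp
    have "\<forall>\<^sub>F y in nhds v. psi (exp y) - exp y + Re (zero_sum y) = psi_error y"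
      by (rule eventually_mono[OF eventually_nhds_in_open[of "{0<..}"]]) (use v in \<open>auto simp: psi_error_def\<close>)
    moreover have "isCont (\<lambda>y. psi (exp y) - exp y + Re (zero_sum y)) v"
      by (intro continuous_intros isCont_psi_exp elim bounded_linear.isCont[OF bounded_linear_Re zero_sum_isCont])
    ultimately show ?thesis by (simp only: isCont_cong)
  qed
qed

lemma laplace_zero_sum:
  assumes s: "Re s \<ge> 2"
  shows "integrable lborel (\<lambda>v. zero_sum v * exp_step s 0 v)" "(LINT v|lborel. zero_sum v * exp_step s 0 v) = zero_pole_sum z s"
proof -
  define A where "A n = of_nat (zeta_zero_mult (z n)) / z n" for n
  have Re_pos: "Re (s - z n) > 0" for n using Re_z(2)[of n] s by simp
  have term_eq: "A n * exp_step (s - z n) 0 v = zero_exp_term v (z n) * exp_step s 0 v" for n v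
    by (simp add: A_def exp_step_def zero_exp_term_def exp_add[symmetric] scaleR_conv_of_real algebra_simps)
  have pointwise: "AE v in lborel. summable (\<lambda>n. norm (A n * exp_step (s - z n) 0 v))"
    unfolding term_eq norm_mult by (intro always_eventually allI summable_mult2 summable_norm_zero_exp_term)
  have total: "summable (\<lambda>n. norm (A n) * (exp (- Re (s - z n) * 0) / Re (s - z n)))"
  proof (rule summable_comparison_test'[OF summable_weight])
    fix n
    have "weight n / Re (s - z n) \<le> weight n / 1" using Re_z(2)[of n] s by (intro divide_left_mono) auto
    thus "norm (norm (A n) * (exp (- Re (s - z n) * 0) / Re (s - z n))) \<le> weight n"
      using Re_pos[of n] by (simp add: A_def norm_divide)
  qed
  note series = laplace_exp_step_series[of "\<lambda>n. s - z n" A "\<lambda>_. 0", OF Re_pos pointwise total]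
  have "(\<Sum>n. A n * exp_step (s - z n) 0 v) = zero_sum v * exp_step s 0 v" for v
    unfolding term_eq zero_sum_def by (rule suminf_mult2[symmetric, OF summable_norm_cancel[OF summable_norm_zero_exp_term]])
  thus "integrable lborel (\<lambda>v. zero_sum v * exp_step s 0 v)" "(LINT v|lborel. zero_sum v * exp_step s 0 v) = zero_pole_sum z s"
    using series by (simp_all add: zero_pole_sum_def zero_term_def A_def)
qed

lemma laplace_psi_error: "error_transform_ext (Complex 3 t) = (LINT v|lborel. of_real (psi_error v) * exp (- Complex 3 t * of_real v))"
proof -
  define s where "s = Complex 3 t"
  have s: "Re s = 3" "s \<noteq> 0" "s \<noteq> 1" by (auto simp: s_def complex_eq_iff)
  have nz: "zeta s \<noteq> 0" using norm_zeta_3_ge[OF s(1)] by auto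
  note laplace_psi = laplace_psi[of s, OF _ nz] and laplace_zeros = laplace_zero_sum[of s] and laplace_main = laplace_exp_step[of "s - 1" 0]
  have "of_real (psi_error v) * exp (- s * of_real v) = of_real (indicator {0<..} v * psi (exp v)) * exp (- s * of_real v)
     - exp_step (s - 1) 0 v + zero_sum v * exp_step s 0 v" for v
  proof (cases "v \<le> 0")
    case False
    have "of_real (psi_error v) = of_real (psi (exp v)) - exp (of_real v) + zero_sum v"
      using False zero_sum_real[of v] by (simp add: psi_error_def exp_of_real)
    moreover have "exp (- (s - 1) * of_real v) = exp (of_real v) * exp (- s * of_real v)"
      by (simp add: exp_add[symmetric] algebra_simps)
    ultimately show ?thesis using False by (simp add: exp_step_def distrib_right left_diff_distrib)
  qed (simp add: psi_error_def exp_step_def)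
  hence "(LINT v|lborel. of_real (psi_error v) * exp (- s * of_real v)) = - (deriv zeta s / zeta s) / s - 1 / (s - 1) + zero_pole_sum z s"
    using laplace_psi laplace_zeros laplace_main s
    by (simp only: Bochner_Integration.integral_add Bochner_Integration.integral_diff Bochner_Integration.integrable_diff) simp
  also have "- (deriv zeta s / zeta s) / s - 1 / (s - 1) = log_deriv_part s"
  proof -
    have "1 / (s - 1) / s + 1 / s = 1 / (s - 1)" using s by (simp add: field_simps)
    moreover have "- (q + D) / s - 1 / s = - D / s - (q / s + 1 / s)" for D q by (simp add: add_divide_distrib diff_divide_distrib)
    moreover have "deriv pole_free_zeta s / pole_free_zeta s = 1 / (s - 1) + deriv zeta s / zeta s"
      using s nz by (intro pole_free_zeta_log_deriv) auto
    ultimately show ?thesis unfolding log_deriv_part_def by (simp only:)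
  qed
  also have "... + zero_pole_sum z s = error_transform_ext s"
    using s c \<eta> nz error_transform_ext_eq[of s] by (simp add: zeta_zeros_def error_transform_def)
  finally show ?thesis by (simp add: s_def)
qed

lemma zero_free_heights:
  "\<exists>T. filterlim T at_top sequentially \<and> (\<forall>n. T n \<ge> 20 \<and> (\<forall>w\<in>zeta_zeros (c - \<eta>). \<bar>Im w - T n\<bar> \<ge> 2))"
proof -
  define bad where "bad x \<longleftrightarrow> (\<exists>w\<in>zeta_zeros (c - \<eta>). \<bar>Im w - x\<bar> < 2)" for x
  define T where "T = (\<lambda>n. if bad (20 + real n) then 25 + real n else 20 + real n)"
  have "\<not> bad (T n)" for n
  proof (cases "bad (20 + real n)")
    case True
    then obtain w where w: "w \<in> zeta_zeros (c - \<eta>)" "\<bar>Im w - (20 + real n)\<bar> < 2" by (auto simp: bad_def)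
    show ?thesis
    proof
      assume "bad (T n)"
      then obtain w' where w': "w' \<in> zeta_zeros (c - \<eta>)" "\<bar>Im w' - (25 + real n)\<bar> < 2"
        using True by (auto simp: bad_def T_def)
      have "w \<noteq> w'" using w(2) w'(2) by auto
      hence "dist w w' \<ge> 10" using sep w w' by blast
      moreover have "\<bar>Re (w - w')\<bar> < 1" "\<bar>Im (w - w')\<bar> < 9" using gap[OF w(1)] gap[OF w'(1)] c \<eta> w(2) w'(2) by auto
      ultimately show False using cmod_le[of "w - w'"] by (simp add: dist_norm)
    qed
  qed (simp add: T_def)
  hence "\<forall>n. T n \<ge> 20 \<and> (\<forall>w\<in>zeta_zeros (c - \<eta>). \<bar>Im w - T n\<bar> \<ge> 2)" by (auto simp: bad_def T_def not_less)
  moreover have "filterlim T at_top sequentially"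
  proof (rule filterlim_at_top_mono)
    show "filterlim (\<lambda>n. 20 + real n) at_top sequentially" by real_asymp
  qed (auto simp: T_def)
  ultimately show ?thesis by blast
qed

lemma error_transform_zero_free_height_le:
  obtains K where "\<And>x y. c \<le> x \<Longrightarrow> x \<le> 3 \<Longrightarrow> \<bar>y\<bar> \<ge> 20 \<Longrightarrow> (\<forall>w\<in>zeta_zeros (c - \<eta>). \<bar>Im w - y\<bar> \<ge> 2) \<Longrightarrow>
    norm (error_transform_ext (Complex x y)) \<le> K * \<bar>y\<bar>"
proof -
  obtain C where C: "C \<ge> 0" "\<And>s. c \<le> Re s \<Longrightarrow> Re s \<le> 3 \<Longrightarrow> \<bar>Im s\<bar> \<ge> 20 \<Longrightarrow> (\<forall>n. dist s (z n) \<ge> \<eta>)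
     \<Longrightarrow> norm (log_deriv_part s) \<le> C * ln \<bar>Im s\<bar> / \<bar>Im s\<bar>"
    using log_deriv_part_bound by blast
  have "norm (error_transform_ext (Complex x y)) \<le> (C + suminf weight) * \<bar>y\<bar>"
    if x: "c \<le> x" "x \<le> 3" and y: "\<bar>y\<bar> \<ge> 20" "\<forall>w\<in>zeta_zeros (c - \<eta>). \<bar>Im w - y\<bar> \<ge> 2" for x y
  proof -
    have far: "dist (Complex x y) (z n) \<ge> 2" for n
    proof -
      have "2 \<le> \<bar>Im (z n) - y\<bar>" using y(2) z_in by blast
      thus ?thesis using abs_Im_le_cmod[of "Complex x y - z n"] by (simp add: dist_norm)
    qed
    have "Complex x y \<noteq> z n" for n using far[of n] by auto
    hence not_zero: "Complex x y \<notin> zeta_zeros (c - \<eta>)" unfolding range[symmetric] by blast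
    have "\<eta> \<le> dist (Complex x y) (z n)" for n using far[of n] \<eta> by linarith
    hence "norm (log_deriv_part (Complex x y)) \<le> C * ln \<bar>y\<bar> / \<bar>y\<bar>"
      using C(2)[of "Complex x y"] x y(1) by simp
    also have "... \<le> C"
      using C(1) y(1) ln_bound[of "\<bar>y\<bar>"] mult_left_mono[of "ln \<bar>y\<bar>" "\<bar>y\<bar>" C] by (simp add: divide_simps mult.commute)
    finally have "norm (log_deriv_part (Complex x y)) \<le> C" .
    moreover have "norm (zero_term (Complex x y) (z n)) \<le> weight n" for n
      using zero_term_norm_le[of 1 "Complex x y" n] far[of n] by simp
    hence "norm (zero_pole_sum z (Complex x y)) \<le> suminf weight"
      unfolding zero_pole_sum_def by (rule norm_suminf_le[OF _ summable_weight])
    ultimately have "norm (error_transform_ext (Complex x y)) \<le> C + suminf weight"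
      using error_transform_ext_eq[OF _ not_zero] x \<eta> by (simp add: error_transform_def norm_triangle_le)
    also have "... \<le> (C + suminf weight) * \<bar>y\<bar>"
      using C(1) weight_sum_nonneg y(1) mult_left_mono[of 1 "\<bar>y\<bar>" "C + suminf weight"] by simp
    finally show ?thesis .
  qed
  thus thesis using that by blast
qed

lemma psi_error_L2: "\<exists>M. (\<integral>\<^sup>+ v. ennreal ((psi_error v)^2 * exp (- 2 * c * v)) \<partial>lborel) \<le> ennreal M"
proof -
  obtain T where T: "filterlim T at_top sequentially" "\<And>n. T n \<ge> 20"
    "\<And>n w. w \<in> zeta_zeros (c - \<eta>) \<Longrightarrow> \<bar>Im w - T n\<bar> \<ge> 2" using zero_free_heights by blast
  obtain K where K: "\<And>x y. c \<le> x \<Longrightarrow> x \<le> 3 \<Longrightarrow> \<bar>y\<bar> \<ge> 20 \<Longrightarrow> (\<forall>w\<in>zeta_zeros (c - \<eta>). \<bar>Im w - y\<bar> \<ge> 2) \<Longrightarrow>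
    norm (error_transform_ext (Complex x y)) \<le> K * \<bar>y\<bar>" using error_transform_zero_free_height_le by blast
  have "laplace_continuation psi_error error_transform_ext (c - \<eta>) c 2 3 K (2 + suminf weight) T"
  proof
    fix n x y assume x: "c \<le> x" "x \<le> 3" and y: "\<bar>y\<bar> = T n"
    have "\<bar>Im w - y\<bar> \<ge> 2" if "w \<in> zeta_zeros (c - \<eta>)" for w
      using y T(3)[OF that, of n] T(3)[OF cnj_zero[OF that], of n] by auto
    thus "norm (error_transform_ext (Complex x y)) \<le> K * T n" using K[OF x, of y] T(2)[of n] y by simp
  qed (use c \<eta> T(1) laplace_psi_error psi_error_measurable abs_psi_error_le AE_isCont_psi_error error_transform_ext_holomorphic
        error_transform_line_L2 in \<open>simp_all add: psi_error_def\<close>)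
  from laplace_continuation.laplace_L2_continuation[OF this] show ?thesis by blast
qed

end

section \<open>Passage to the prime counting function\<close>

definition li_regular :: "real \<Rightarrow> real" where
  "li_regular t = (if t = 1 then 1/2 else 1 / ln t - 1 / (t - 1))"

lemma li_regular_continuous: "continuous_on {0..} li_regular"
  unfolding continuous_on_eq_continuous_within
proof
  fix x :: real assume x: "x \<in> {0..}"
  consider (zero) "x = 0" | (one) "x = 1" | (regular) "x > 0" "x \<noteq> 1" using x by force
  thus "continuous (at x within {0..}) li_regular"
  proof cases
    case zero
    have "((\<lambda>t. 1 / ln t - 1 / (t - 1)) \<longlongrightarrow> 1) (at_right (0::real))" by real_asymp
    moreover have "\<forall>\<^sub>F t in at_right (0::real). 1 / ln t - 1 / (t - 1) = li_regular t"
      using eventually_at_right_real[of 0 1] by (auto simp: li_regular_def elim!: eventually_mono)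
    ultimately have "(li_regular \<longlongrightarrow> 1) (at_right 0)" by (rule Lim_transform_eventually)
    moreover have "at (0::real) within {0..} = at_right 0"
      unfolding at_within_def by (intro arg_cong[of _ _ "\<lambda>S. inf (nhds 0) (principal S)"]) auto
    ultimately show ?thesis using zero by (simp add: continuous_within li_regular_def)
  next
    case one
    have "((\<lambda>t. 1 / ln t - 1 / (t - 1)) \<longlongrightarrow> 1/2) (at (1::real))" by real_asymp
    moreover have "\<forall>\<^sub>F t in at (1::real). 1 / ln t - 1 / (t - 1) = li_regular t"
      by (auto simp: eventually_at_filter li_regular_def)
    ultimately have "(li_regular \<longlongrightarrow> 1/2) (at 1)" by (rule Lim_transform_eventually)
    hence "(li_regular \<longlongrightarrow> 1/2) (at 1 within {0..})" by (rule tendsto_within_subset) simp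
    thus ?thesis using one by (simp add: continuous_within li_regular_def)
  next
    case regular
    have "isCont (\<lambda>t. 1 / ln t - 1 / (t - 1)) x" using regular by (intro continuous_intros) auto
    moreover have "\<forall>\<^sub>F t in nhds x. 1 / ln t - 1 / (t - 1) = li_regular t"
      by (rule eventually_mono[OF eventually_nhds_in_open[of "- {1}"]]) (use regular in \<open>auto simp: li_regular_def\<close>)
    ultimately have "isCont li_regular x" by (simp only: isCont_cong)
    thus ?thesis by (rule continuous_at_imp_continuous_at_within)
  qed
qed

lemma li_regular_integrable: "0 \<le> a \<Longrightarrow> li_regular integrable_on {a..b}"
  by (rule integrable_continuous_real, rule continuous_on_subset[OF li_regular_continuous]) auto

lemma integral_inverse_ln_truncated:
  assumes x: "x \<ge> 2" and r: "0 < r" "r < 1"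
  shows "integral {0..1 - r} (\<lambda>t. 1 / ln t) + integral {1 + r..x} (\<lambda>t. 1 / ln t) =
    integral {0..1 - r} li_regular + integral {1 + r..x} li_regular + ln (x - 1)"
proof -
  have pole_left: "((\<lambda>t. 1 / (t - 1)) has_integral (ln \<bar>1 - r - 1\<bar> - ln \<bar>0 - 1\<bar>)) {0..1 - r}"
  proof (rule fundamental_theorem_of_calculus)
    fix t assume t: "t \<in> {0..1 - r}"
    have "((\<lambda>t. ln (1 - t)) has_real_derivative 1 / (t - 1)) (at t within {0..1 - r})"
      using t r by (auto intro!: derivative_eq_intros simp: divide_simps)
    hence "((\<lambda>t. ln \<bar>t - 1\<bar>) has_real_derivative 1 / (t - 1)) (at t within {0..1 - r})"
      by (rule has_field_derivative_transform_within[of _ _ _ _ 1]) (use t r in auto)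
    thus "((\<lambda>t. ln \<bar>t - 1\<bar>) has_vector_derivative 1 / (t - 1)) (at t within {0..1 - r})"
      by (simp add: has_real_derivative_iff_has_vector_derivative)
  qed (use r in auto)
  have pole_right: "((\<lambda>t. 1 / (t - 1)) has_integral (ln (x - 1) - ln (1 + r - 1))) {1 + r..x}"
    using x r by (intro fundamental_theorem_of_calculus)
      (auto intro!: derivative_eq_intros simp: has_real_derivative_iff_has_vector_derivative[symmetric])
  have regular: "(li_regular has_integral integral {p..q} li_regular) {p..q}" if "0 \<le> p" for p q
    by (intro integrable_integral li_regular_integrable that)
  have "((\<lambda>t. 1 / ln t) has_integral (integral {0..1 - r} li_regular + (ln \<bar>1 - r - 1\<bar> - ln \<bar>0 - 1\<bar>))) {0..1 - r}"
    by (rule has_integral_eq[OF _ has_integral_add[OF regular pole_left]]) (use r in \<open>auto simp: li_regular_def\<close>)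
  moreover have "((\<lambda>t. 1 / ln t) has_integral (integral {1 + r..x} li_regular + (ln (x - 1) - ln (1 + r - 1)))) {1 + r..x}"
    by (rule has_integral_eq[OF _ has_integral_add[OF regular pole_right]]) (use r in \<open>auto simp: li_regular_def\<close>)
  ultimately show ?thesis using r by (simp add: integral_unique)
qed

lemma li_eq:
  assumes x: "x \<ge> 2"
  shows "li x = integral {0..x} li_regular + ln (x - 1)"
proof -
  let ?I = "\<lambda>y. integral {0..y} li_regular"
  have "continuous_on {0..x} ?I" by (rule indefinite_integral_continuous_1) (rule li_regular_integrable, simp)
  hence "isCont ?I 1" by (rule continuous_on_interior) (use x in \<open>auto simp: interior_atLeastAtMost_real\<close>)
  hence "((\<lambda>r. ?I (1 - r)) \<longlongrightarrow> ?I 1) (at_right 0)" "((\<lambda>r. ?I (1 + r)) \<longlongrightarrow> ?I 1) (at_right 0)"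
    by (auto intro!: isCont_tendsto_compose[of _ ?I] tendsto_eq_intros)
  hence "((\<lambda>r. ?I (1 - r) + (?I x - ?I (1 + r)) + ln (x - 1)) \<longlongrightarrow> ?I 1 + (?I x - ?I 1) + ln (x - 1)) (at_right 0)"
    by (intro tendsto_intros)
  moreover have "\<forall>\<^sub>F r in at_right 0. ?I (1 - r) + (?I x - ?I (1 + r)) + ln (x - 1) =
      integral {0..1 - r} (\<lambda>t. 1 / ln t) + integral {1 + r..x} (\<lambda>t. 1 / ln t)"
  proof (rule eventually_mono[OF eventually_at_right_real[of 0 1]])
    fix r :: real assume r: "r \<in> {0<..<1}"
    hence "?I (1 + r) + integral {1 + r..x} li_regular = ?I x"
      using x by (intro Henstock_Kurzweil_Integration.integral_combine li_regular_integrable) auto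
    thus "?I (1 - r) + (?I x - ?I (1 + r)) + ln (x - 1) =
        integral {0..1 - r} (\<lambda>t. 1 / ln t) + integral {1 + r..x} (\<lambda>t. 1 / ln t)"
      using integral_inverse_ln_truncated[OF x, of r] r by simp
  qed simp
  ultimately have "((\<lambda>r. integral {0..1 - r} (\<lambda>t. 1 / ln t) + integral {1 + r..x} (\<lambda>t. 1 / ln t)) \<longlongrightarrow> ?I 1 + (?I x - ?I 1) + ln (x - 1)) (at_right 0)"
    by (rule Lim_transform_eventually)
  thus ?thesis unfolding li_def by (intro tendsto_Lim) simp_all
qed

lemma li_has_derivative:
  assumes "x \<ge> 2" "x \<le> b"
  shows "(li has_real_derivative 1 / ln x) (at x within {2..b})"
proof -
  have "((\<lambda>y. integral {0..y} li_regular) has_real_derivative li_regular x) (at x within {0..max x b})"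
    using assms by (intro integral_has_real_derivative continuous_on_subset[OF li_regular_continuous]) auto
  hence "((\<lambda>y. integral {0..y} li_regular) has_real_derivative li_regular x) (at x within {2..b})"
    by (rule DERIV_subset) auto
  moreover have "((\<lambda>y. ln (y - 1)) has_real_derivative 1 / (x - 1)) (at x within {2..b})"
    using assms by (auto intro!: derivative_eq_intros)
  ultimately have "((\<lambda>y. integral {0..y} li_regular + ln (y - 1)) has_real_derivative li_regular x + 1 / (x - 1)) (at x within {2..b})"
    by (rule DERIV_add)
  hence "(li has_real_derivative li_regular x + 1 / (x - 1)) (at x within {2..b})"
    by (rule has_field_derivative_transform_within[OF _ zero_less_one]) (use assms in \<open>auto simp: li_eq\<close>)
  thus ?thesis using assms by (simp add: li_regular_def)
qed

lemma ln2_pos: "ln (2::real) > 0" "ln (2::real) \<ge> 1/2"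
  using ln2_ge_two_thirds by linarith+

lemma exp_ge_2: "u \<ge> ln 2 \<Longrightarrow> exp u \<ge> (2::real)"
  by (metis exp_le_cancel_iff exp_ln zero_less_numeral)

lemma li_exp_integral:
  assumes u: "u \<ge> ln 2"
  shows "((\<lambda>v. exp v / v^2) has_integral (li (exp u) - exp u / u - (li 2 - 2 / ln 2))) {ln 2..u}"
proof -
  have "((\<lambda>v. exp v / v^2) has_integral ((li (exp u) - exp u / u) - (li (exp (ln 2)) - exp (ln 2) / ln 2))) {ln 2..u}"
  proof (rule fundamental_theorem_of_calculus[OF u])
    fix v assume v: "v \<in> {ln 2..u}"
    have v_pos: "v > 0" using v ln2_pos by auto
    have "exp ` {ln 2..u} \<subseteq> {2..exp u}" by (auto simp: exp_ge_2)
    hence "((\<lambda>v. li (exp v)) has_real_derivative 1 / ln (exp v) * exp v) (at v within {ln 2..u})"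
      using li_has_derivative[OF exp_ge_2, of v "exp u"] v
      by (intro DERIV_image_chain[where f = li and g = exp, unfolded o_def])
         (auto intro: DERIV_subset derivative_eq_intros)
    moreover have "((\<lambda>v. exp v / v) has_real_derivative exp v / v - exp v / v^2) (at v within {ln 2..u})"
      using v_pos by (auto intro!: derivative_eq_intros simp: field_simps power2_eq_square)
    ultimately have "((\<lambda>v. li (exp v) - exp v / v) has_real_derivative 1 / ln (exp v) * exp v - (exp v / v - exp v / v^2)) (at v within {ln 2..u})"
      by (rule DERIV_diff)
    thus "((\<lambda>v. li (exp v) - exp v / v) has_vector_derivative exp v / v^2) (at v within {ln 2..u})"
      by (simp add: has_real_derivative_iff_has_vector_derivative)
  qed
  thus ?thesis by simp
qed

definition riemann_Pi :: "real \<Rightarrow> real" where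
  "riemann_Pi x = (\<Sum>n | 0 < n \<and> real n \<le> x. mangoldt n / ln (real n))"

lemma has_integral_inverse_square_from:
  fixes m :: real
  assumes l: "0 < l" "b \<le> l" "l \<le> u"
  shows "((\<lambda>v. if v \<in> {l..u} then m / v^2 else 0) has_integral (m * (1 / l - 1 / u))) {b..u}"
proof -
  have "((\<lambda>v. m / v^2) has_integral ((- m / u) - (- m / l))) {l..u}"
  proof (rule fundamental_theorem_of_calculus[OF l(3)])
    fix v assume "v \<in> {l..u}"
    hence "((\<lambda>v. - m / v) has_real_derivative m / v^2) (at v within {l..u})"
      using l by (auto intro!: derivative_eq_intros simp: field_simps power2_eq_square)
    thus "((\<lambda>v. - m / v) has_vector_derivative m / v^2) (at v within {l..u})"
      by (simp add: has_real_derivative_iff_has_vector_derivative)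
  qed
  hence "((\<lambda>v. m / v^2) has_integral (m * (1 / l - 1 / u))) {l..u}" by (simp add: algebra_simps)
  thus ?thesis by (subst has_integral_restrict) (use l in auto)
qed

lemma sum_le_eq_sum_if:
  fixes f :: "nat \<Rightarrow> real"
  assumes "f 1 = 0" "y \<le> x"
  shows "(\<Sum>n | 0 < n \<and> real n \<le> y. f n) = (\<Sum>n | 2 \<le> n \<and> real n \<le> x. if real n \<le> y then f n else 0)"
proof -
  let ?N = "{n::nat. 2 \<le> n \<and> real n \<le> x}"
  have "(\<Sum>n | 0 < n \<and> real n \<le> y. f n) = (\<Sum>n\<in>{n\<in>?N. real n \<le> y}. f n)"
  proof (rule sum.mono_neutral_right)
    have "i = 1" if "i \<in> {n. 0 < n \<and> real n \<le> y} - {n \<in> ?N. real n \<le> y}" for i using that assms(2) by auto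
    thus "\<forall>i\<in>{n. 0 < n \<and> real n \<le> y} - {n \<in> ?N. real n \<le> y}. f i = 0" using assms(1) by blast
  qed (use finite_le_real in auto)
  also have "... = (\<Sum>n\<in>?N. if real n \<le> y then f n else 0)"
    by (rule sum.inter_filter) (rule finite_subset[OF _ finite_le_real[of x]], auto)
  finally show ?thesis .
qed

lemma riemann_Pi_integral:
  assumes u: "u \<ge> ln 2"
  shows "((\<lambda>v. psi (exp v) / v^2) has_integral (riemann_Pi (exp u) - psi (exp u) / u)) {ln 2..u}"
proof -
  define N where "N = {n::nat. 2 \<le> n \<and> real n \<le> exp u}"
  have N: "finite N" unfolding N_def by (rule finite_subset[OF _ finite_le_real[of "exp u"]]) auto
  have ln_le_iff: "real n \<le> exp v \<longleftrightarrow> ln (real n) \<le> v" if "n \<in> N" for n v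
    using that ln_le_cancel_iff[of "real n" "exp v"] by (auto simp: N_def)
  have "((\<lambda>v. \<Sum>n\<in>N. if v \<in> {ln (real n)..u} then mangoldt n / v^2 else 0) has_integral (\<Sum>n\<in>N. mangoldt n * (1 / ln (real n) - 1 / u))) {ln 2..u}"
  proof (intro has_integral_sum[OF N] has_integral_inverse_square_from)
    fix n assume "n \<in> N"
    thus "0 < ln (real n)" "ln 2 \<le> ln (real n)" "ln (real n) \<le> u" using ln_le_iff[of n u] by (auto simp: N_def)
  qed
  moreover have "(\<Sum>n\<in>N. if v \<in> {ln (real n)..u} then mangoldt n / v^2 else 0) = psi (exp v) / v^2" if v: "v \<in> {ln 2..u}" for v
  proof -
    have "psi (exp v) / v^2 = (\<Sum>n\<in>N. if real n \<le> exp v then mangoldt n else 0) / v^2"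
      unfolding psi_def N_def using v by (subst sum_le_eq_sum_if[of _ "exp v" "exp u"]) auto
    also have "... = (\<Sum>n\<in>N. if v \<in> {ln (real n)..u} then mangoldt n / v^2 else 0)"
      unfolding sum_divide_distrib using v by (intro sum.cong refl) (simp add: ln_le_iff)
    finally show ?thesis by simp
  qed
  ultimately have "((\<lambda>v. psi (exp v) / v^2) has_integral (\<Sum>n\<in>N. mangoldt n * (1 / ln (real n) - 1 / u))) {ln 2..u}"
    by (rule has_integral_eq[rotated])
  moreover have "riemann_Pi (exp u) = (\<Sum>n\<in>N. mangoldt n / ln (real n))" "psi (exp u) = (\<Sum>n\<in>N. mangoldt n)"
    unfolding riemann_Pi_def psi_def N_def by (subst sum_le_eq_sum_if[of _ "exp u" "exp u"]; auto intro!: sum.cong)+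
  ultimately show ?thesis by (simp add: right_diff_distrib sum_subtractf sum_divide_distrib)
qed

lemma riemann_Pi_minus_li:
  assumes u: "u \<ge> ln 2"
  shows "((\<lambda>v. (psi (exp v) - exp v) / v^2) has_integral
    (riemann_Pi (exp u) - li (exp u) - (psi (exp u) - exp u) / u + (li 2 - 2 / ln 2))) {ln 2..u}"
proof -
  have "((\<lambda>v. psi (exp v) / v^2 - exp v / v^2) has_integral
    (riemann_Pi (exp u) - psi (exp u) / u - (li (exp u) - exp u / u - (li 2 - 2 / ln 2)))) {ln 2..u}"
    by (rule has_integral_diff[OF riemann_Pi_integral[OF u] li_exp_integral[OF u]])
  thus ?thesis by (simp add: diff_divide_distrib algebra_simps)
qed

definition proper_prime_powers :: "real \<Rightarrow> nat set" where
  "proper_prime_powers x = {n. 0 < n \<and> real n \<le> x \<and> primepow n \<and> \<not> prime n}"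

lemma card_proper_prime_powers_le:
  assumes x: "x \<ge> 2"
  shows "real (card (proper_prime_powers x)) \<le> sqrt x * log 2 x"
proof -
  define I where "I = {1..nat \<lfloor>sqrt x\<rfloor>} \<times> {1..nat \<lfloor>log 2 x\<rfloor>}"
  have "proper_prime_powers x \<subseteq> (\<lambda>(p, k). p ^ k) ` I"
  proof
    fix n assume n: "n \<in> proper_prime_powers x"
    then obtain p k where pk: "prime p" "k > 0" "n = p ^ k" by (auto simp: proper_prime_powers_def primepow_def)
    have k: "k \<ge> 2" using n pk by (cases "k = 1") (auto simp: proper_prime_powers_def)
    have power_le: "real p ^ k \<le> x" using n pk by (simp add: proper_prime_powers_def)
    have p: "real p \<ge> 2" using prime_ge_2_nat[OF pk(1)] by simp
    have "real p ^ 2 \<le> real p ^ k" using p k by (intro power_increasing) auto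
    hence "real p \<le> sqrt x" using power_le by (intro real_le_rsqrt) simp
    hence p_in: "p \<in> {1..nat \<lfloor>sqrt x\<rfloor>}" using p by (auto simp: le_nat_floor)
    have "2 ^ k \<le> real p ^ k" using p by (intro power_mono) auto
    hence "2 powr real k \<le> x" using power_le by (simp add: powr_realpow)
    hence "real k \<le> log 2 x" using x by (subst le_log_iff) auto
    hence "k \<in> {1..nat \<lfloor>log 2 x\<rfloor>}" using pk by (auto simp: le_nat_floor)
    hence "(p, k) \<in> I" using p_in by (simp add: I_def)
    thus "n \<in> (\<lambda>(p, k). p ^ k) ` I" by (rule rev_image_eqI) (simp add: pk)
  qed
  moreover have "finite I" by (simp add: I_def)
  ultimately have "card (proper_prime_powers x) \<le> card I" by (intro surj_card_le)
  also have "card I = nat \<lfloor>sqrt x\<rfloor> * nat \<lfloor>log 2 x\<rfloor>" by (simp add: I_def)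
  finally have "real (card (proper_prime_powers x)) \<le> real (nat \<lfloor>sqrt x\<rfloor>) * real (nat \<lfloor>log 2 x\<rfloor>)" by (simp flip: of_nat_mult)
  also have "... \<le> sqrt x * log 2 x" using x by (intro mult_mono of_nat_floor) auto
  finally show ?thesis .
qed

lemma riemann_Pi_prime_pi:
  assumes x: "x \<ge> 2"
  shows "real (prime_pi x) \<le> riemann_Pi x" "riemann_Pi x \<le> real (prime_pi x) + sqrt x * log 2 x"
proof -
  define A where "A = {n::nat. 0 < n \<and> real n \<le> x}"
  define P where "P = {p::nat. prime p \<and> real p \<le> x}"
  let ?t = "\<lambda>n. mangoldt n / ln (real n) :: real"
  have A: "finite A" unfolding A_def by (rule finite_le_real)
  have P: "P \<subseteq> A" by (auto simp: P_def A_def prime_gt_0_nat)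
  have "?t p = 1" if "p \<in> P" for p
    using that prime_ge_2_nat[of p] by (auto simp: P_def)
  hence "(\<Sum>n\<in>P. ?t n) = (\<Sum>n\<in>P. 1)" by (intro sum.cong refl)
  also have "... = real (prime_pi x)" by (simp add: prime_pi_def P_def[symmetric])
  finally have split: "riemann_Pi x = real (prime_pi x) + (\<Sum>n\<in>A - P. ?t n)"
    unfolding riemann_Pi_def A_def[symmetric] using sum.subset_diff[OF P A, of ?t] by simp
  have "(\<Sum>n\<in>A - P. ?t n) \<ge> 0"
    by (intro sum_nonneg divide_nonneg_nonneg mangoldt_nonneg) (auto simp: A_def)
  thus "real (prime_pi x) \<le> riemann_Pi x" using split by simp
  have "(\<Sum>n\<in>A - P. ?t n) = (\<Sum>n\<in>proper_prime_powers x. ?t n)"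
    using A by (intro sum.mono_neutral_right) (auto simp: proper_prime_powers_def P_def A_def mangoldt_def)
  also have "... \<le> (\<Sum>n\<in>proper_prime_powers x. 1)"
  proof (rule sum_mono)
    fix n assume "n \<in> proper_prime_powers x"
    hence "n > 0" "n > 1" using primepow_gt_Suc_0[of n] by (auto simp: proper_prime_powers_def)
    thus "?t n \<le> 1" using mangoldt_le[of n] by (simp add: divide_le_eq)
  qed
  also have "... \<le> sqrt x * log 2 x" using card_proper_prime_powers_le[OF x] by simp
  finally show "riemann_Pi x \<le> real (prime_pi x) + sqrt x * log 2 x" using split by simp
qed

lemma riemann_Pi_minus_prime_pi_le:
  assumes u: "u \<ge> ln 2" and c: "c \<ge> 1/2"
  shows "\<bar>riemann_Pi (exp u) - real (prime_pi (exp u))\<bar> \<le> 2 * u * exp (c * u)"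
proof -
  have u_pos: "u > 0" using u ln2_pos by linarith
  have "log 2 (exp u) = u / ln 2" by (simp add: log_def)
  also have "u / ln 2 \<le> u / (1/2)" using ln2_pos u_pos by (intro divide_left_mono) auto
  finally have log_le: "log 2 (exp u) \<le> 2 * u" by simp
  have "sqrt (exp u) = exp (u / 2)" by (rule real_sqrt_unique) (auto simp: exp_double[symmetric])
  also have "exp (u / 2) \<le> exp (c * u)" using mult_right_mono[OF c, of u] u_pos by simp
  finally have "sqrt (exp u) * log 2 (exp u) \<le> exp (c * u) * (2 * u)"
    using log_le exp_ge_2[OF u] u_pos by (intro mult_mono) auto
  thus ?thesis using riemann_Pi_prime_pi[OF exp_ge_2[OF u]] by (simp add: mult_ac)
qed

lemma abs_integral_div_square_le:
  fixes P p :: "real \<Rightarrow> real"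
  assumes a: "0 < a" "a \<le> u" and deriv: "\<And>v. v \<in> {a..u} \<Longrightarrow> (P has_real_derivative p v) (at v within {a..u})"
    and P_le: "\<And>v. v \<in> {a..u} \<Longrightarrow> \<bar>P v\<bar> \<le> Q"
  shows "\<bar>integral {a..u} (\<lambda>v. p v / v^2)\<bar> \<le> 3 * (Q / a^2)"
proof -
  have Q: "Q \<ge> 0" using P_le[of a] a by simp
  have boundary: "((\<lambda>v. p v / v^2 - 2 * P v / v ^ 3) has_integral (P u / u^2 - P a / a^2)) {a..u}"
  proof (rule fundamental_theorem_of_calculus[OF a(2)])
    fix v assume v: "v \<in> {a..u}"
    have "((\<lambda>v. P v / v^2) has_real_derivative (p v * v^2 - P v * (2 * v)) / (v^2 * v^2)) (at v within {a..u})"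
      using v a by (intro DERIV_divide deriv[OF v]) (auto intro!: derivative_eq_intros)
    also have "(p v * v^2 - P v * (2 * v)) / (v^2 * v^2) = p v / v^2 - 2 * P v / v ^ 3"
      using v a by (simp add: field_simps power2_eq_square power3_eq_cube)
    finally show "((\<lambda>v. P v / v^2) has_vector_derivative p v / v^2 - 2 * P v / v ^ 3) (at v within {a..u})"
      by (simp add: has_real_derivative_iff_has_vector_derivative)
  qed
  have "continuous_on {a..u} P" using deriv DERIV_continuous continuous_on_eq_continuous_within by blast
  hence remainder: "(\<lambda>v. 2 * P v / v ^ 3) integrable_on {a..u}"
    using a by (intro integrable_continuous_real continuous_intros) auto
  have dominating: "((\<lambda>v. 2 * Q / v ^ 3) has_integral (- Q / u^2 - (- Q / a^2))) {a..u}"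
  proof (rule fundamental_theorem_of_calculus[OF a(2)])
    fix v assume v: "v \<in> {a..u}"
    have "((\<lambda>v. - Q / v^2) has_real_derivative 2 * Q / v ^ 3) (at v within {a..u})"
      using v a by (auto intro!: derivative_eq_intros simp: field_simps power2_eq_square power3_eq_cube)
    thus "((\<lambda>v. - Q / v^2) has_vector_derivative 2 * Q / v ^ 3) (at v within {a..u})"
      by (simp add: has_real_derivative_iff_has_vector_derivative)
  qed
  have "norm (integral {a..u} (\<lambda>v. 2 * P v / v ^ 3)) \<le> integral {a..u} (\<lambda>v. 2 * Q / v ^ 3)"
    using P_le a dominating
    by (intro integral_norm_bound_integral[OF remainder]) (auto simp: abs_mult intro!: divide_right_mono)
  also have "... = - Q / u^2 - (- Q / a^2)" by (rule integral_unique[OF dominating])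
  also have "... \<le> Q / a^2" using Q by simp
  finally have "\<bar>integral {a..u} (\<lambda>v. 2 * P v / v ^ 3)\<bar> \<le> Q / a^2" by simp
  moreover have "integral {a..u} (\<lambda>v. p v / v^2) = (P u / u^2 - P a / a^2) + integral {a..u} (\<lambda>v. 2 * P v / v ^ 3)"
    using has_integral_add[OF boundary integrable_integral[OF remainder]] by (simp add: integral_unique)
  moreover have "\<bar>P v / v^2\<bar> \<le> Q / a^2" if "v \<in> {a..u}" for v
    unfolding abs_divide using P_le[OF that] that a Q by (intro frac_le) (auto intro!: power_mono)
  from this[of u] this[of a] have "\<bar>P u / u^2\<bar> \<le> Q / a^2" "\<bar>P a / a^2\<bar> \<le> Q / a^2" using a by auto
  ultimately show ?thesis by linarith
qed

lemma abs_integral_le_weighted_L2: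
  fixes f :: "real \<Rightarrow> real"
  assumes c: "c \<ge> 1/2" and f: "f integrable_on {a..u}"
    and L2: "(\<lambda>v. (f v)^2 * exp (- 2 * c * v)) integrable_on {a..u}" "integral {a..u} (\<lambda>v. (f v)^2 * exp (- 2 * c * v)) \<le> M"
    and a: "a \<le> u"
  shows "\<bar>integral {a..u} f\<bar> \<le> (M + 1) * exp (c * u)"
proof -
  define L where "L = exp (c * u)"
  define w where "w v = L * ((f v)^2 * exp (- 2 * c * v)) + exp (2 * c * v) / L" for v
  have L: "L > 0" by (simp add: L_def)
  have f_le: "norm (f v) \<le> w v" for v
  proof -
    define A B where "A = \<bar>f v\<bar> * exp (- c * v)" and "B = exp (c * v) / L"
    have "0 \<le> A * B" using L by (simp add: A_def B_def)
    hence "A * B \<le> A^2 + B^2" using sum_squares_bound[of A B] by linarith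
    hence "L * (A * B) \<le> L * (A^2 + B^2)" using L by (intro mult_left_mono) auto
    moreover have "L * (A * B) = \<bar>f v\<bar>" using L by (simp add: A_def B_def exp_minus)
    moreover have "A^2 = (f v)^2 * exp (- 2 * c * v)" by (simp add: A_def power_mult_distrib exp_double[symmetric])
    moreover have "L * B^2 = exp (2 * c * v) / L" using L by (simp add: B_def power_divide power2_eq_square exp_add[symmetric])
    ultimately show ?thesis by (simp add: w_def distrib_left)
  qed
  have "((\<lambda>v. exp (2 * c * v)) has_integral (exp (2 * c * u) / (2 * c) - exp (2 * c * a) / (2 * c))) {a..u}"
    using c a by (intro fundamental_theorem_of_calculus)
      (auto intro!: derivative_eq_intros simp: has_real_derivative_iff_has_vector_derivative[symmetric])
  hence w: "(w has_integral (L * integral {a..u} (\<lambda>v. (f v)^2 * exp (- 2 * c * v)) + (exp (2 * c * u) / (2 * c) - exp (2 * c * a) / (2 * c)) / L)) {a..u}"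
    unfolding w_def by (intro has_integral_add has_integral_mult_right has_integral_divide integrable_integral L2)
  have "norm (integral {a..u} f) \<le> integral {a..u} w"
    using w by (intro integral_norm_bound_integral[OF f] f_le) blast
  also have "... \<le> L * M + L"
  proof -
    have "exp (2 * c * u) / (2 * c) - exp (2 * c * a) / (2 * c) \<le> exp (2 * c * u) / (2 * c)" using c by simp
    also have "... \<le> exp (2 * c * u) / 1" using c by (intro divide_left_mono) auto
    also have "... = L * L" by (simp add: L_def exp_add[symmetric])
    finally have "(exp (2 * c * u) / (2 * c) - exp (2 * c * a) / (2 * c)) / L \<le> L" using L by (simp add: divide_le_eq)
    moreover have "L * integral {a..u} (\<lambda>v. (f v)^2 * exp (- 2 * c * v)) \<le> L * M" using L2(2) L by (intro mult_left_mono) auto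
    ultimately show ?thesis unfolding integral_unique[OF w] by linarith
  qed
  finally show ?thesis by (simp add: L_def algebra_simps)
qed

context sparse_zeros
begin

definition zero_sum_majorant :: "real \<Rightarrow> real" where
  "zero_sum_majorant u = (\<Sum>n. weight n / norm (z n) * exp (Re (z n) * u))"

lemma weight_div_norm_le: "weight n / norm (z n) \<le> 2 * weight n"
proof -
  have "norm (z n) \<ge> 1/2" using Re_z(1)[of n] complex_Re_le_cmod[of "z n"] c \<eta> by linarith
  hence "weight n / norm (z n) \<le> weight n / (1/2)" using z_nonzero[of n] by (intro divide_left_mono mult_pos_pos) auto
  thus ?thesis by (simp add: mult.commute)
qed

lemma summable_majorant: "summable (\<lambda>n. weight n / norm (z n) * exp (Re (z n) * u))"
proof (rule summable_comparison_test'[OF summable_mult2[OF summable_mult[OF summable_weight, of 2], of "exp \<bar>u\<bar>"]])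
  fix n
  have "Re (z n) * u \<le> Re (z n) * \<bar>u\<bar>" using Re_z(1)[of n] c \<eta> by (intro mult_left_mono) auto
  also have "... \<le> \<bar>u\<bar>" using Re_z[of n] c \<eta> by (intro mult_left_le_one_le) auto
  finally have "weight n / norm (z n) * exp (Re (z n) * u) \<le> 2 * weight n * exp \<bar>u\<bar>"
    by (intro mult_mono weight_div_norm_le) auto
  thus "norm (weight n / norm (z n) * exp (Re (z n) * u)) \<le> 2 * weight n * exp \<bar>u\<bar>" by simp
qed

lemma zero_sum_majorant_mono: "u \<le> v \<Longrightarrow> zero_sum_majorant u \<le> zero_sum_majorant v"
  unfolding zero_sum_majorant_def
  by (intro suminf_le summable_majorant mult_left_mono) (use Re_z(1) c \<eta> in \<open>auto intro!: mult_left_mono order_trans[OF _ Re_z(1)]\<close>)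

definition zero_sum_primitive :: "real \<Rightarrow> real" where
  "zero_sum_primitive v = (\<Sum>n. Re (zero_exp_term v (z n) / z n))"

lemma abs_primitive_term_le: "\<bar>Re (zero_exp_term v (z n) / z n)\<bar> \<le> weight n / norm (z n) * exp (Re (z n) * v)"
  using abs_Re_le_cmod[of "zero_exp_term v (z n) / z n"] by (simp add: zero_exp_term_def norm_divide norm_mult norm_exp_eq_Re)

lemma abs_zero_sum_primitive_le: "\<bar>zero_sum_primitive v\<bar> \<le> zero_sum_majorant v"
  unfolding zero_sum_primitive_def zero_sum_majorant_def real_norm_def[symmetric]
  by (rule norm_suminf_le[OF _ summable_majorant]) (simp only: real_norm_def abs_primitive_term_le)

lemma zero_exp_term_primitive:
  "((\<lambda>v. Re (zero_exp_term v (z n) / z n)) has_real_derivative Re (zero_exp_term x (z n))) (at x within S)"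
proof -
  have "((\<lambda>v. zero_exp_term v (z n) / z n) has_vector_derivative zero_exp_term x (z n)) (at x within S)"
    unfolding zero_exp_term_def
    by (rule has_vector_derivative_real_field[where f = "\<lambda>w. of_nat (zeta_zero_mult (z n)) * exp (z n * w) / z n / z n"])
       (use z_nonzero[of n] in \<open>auto intro!: derivative_eq_intros simp: field_simps\<close>)
  from bounded_linear.has_vector_derivative[OF bounded_linear_Re this] show ?thesis
    by (simp add: has_real_derivative_iff_has_vector_derivative)
qed

lemma zero_sum_primitive_has_derivative: "(zero_sum_primitive has_real_derivative Re (zero_sum x)) (at x)"
proof -
  define V where "V = \<bar>x\<bar> + 1"
  have "((\<lambda>v. \<Sum>n. Re (zero_exp_term v (z n) / z n)) has_real_derivative (\<Sum>n. Re (zero_exp_term x (z n)))) (at x)"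
  proof (rule has_field_derivative_series'(2)[of "{-V..V}"])
    show "uniformly_convergent_on {-V..V} (\<lambda>n v. \<Sum>i<n. Re (zero_exp_term v (z i)))"
    proof (rule Weierstrass_m_test'[OF _ summable_mult2[OF summable_weight, of "exp V"]])
      fix n v assume "v \<in> {-V..V}"
      hence "weight n * exp \<bar>v\<bar> \<le> weight n * exp V" by (intro mult_left_mono) auto
      thus "norm (Re (zero_exp_term v (z n))) \<le> weight n * exp V"
        using norm_zero_exp_term_le[of v n] abs_Re_le_cmod[of "zero_exp_term v (z n)"] by simp
    qed
    show "summable (\<lambda>n. Re (zero_exp_term x (z n) / z n))"
      by (rule summable_comparison_test'[OF summable_majorant[of x]]) (simp only: real_norm_def abs_primitive_term_le)
  qed (auto simp: V_def interior_atLeastAtMost_real intro: zero_exp_term_primitive)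
  moreover have "Re (zero_sum x) = (\<Sum>n. Re (zero_exp_term x (z n)))"
    unfolding zero_sum_def by (rule Re_suminf[OF summable_norm_cancel[OF summable_norm_zero_exp_term]])
  ultimately show ?thesis unfolding zero_sum_primitive_def[abs_def] by simp
qed

lemma zero_sum_integral_le:
  assumes u: "u \<ge> ln 2"
  shows "\<bar>integral {ln 2..u} (\<lambda>v. Re (zero_sum v) / v^2)\<bar> \<le> 12 * zero_sum_majorant u"
proof -
  have majorant: "\<bar>zero_sum_primitive v\<bar> \<le> zero_sum_majorant u" if "v \<in> {ln 2..u}" for v
    using that abs_zero_sum_primitive_le[of v] zero_sum_majorant_mono[of v u] by auto
  have "\<bar>integral {ln 2..u} (\<lambda>v. Re (zero_sum v) / v^2)\<bar> \<le> 3 * (zero_sum_majorant u / (ln 2)^2)"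
    by (rule abs_integral_div_square_le[OF ln2_pos(1) u _ majorant])
       (rule has_field_derivative_at_within[OF zero_sum_primitive_has_derivative])
  also have "zero_sum_majorant u / (ln 2)^2 \<le> zero_sum_majorant u / (1/2)^2"
    using ln2_pos majorant[of u] u by (intro divide_left_mono power_mono mult_pos_pos) auto
  finally show ?thesis by (simp add: power2_eq_square)
qed

lemma psi_error_square_integrable: "integrable lborel (\<lambda>v. (psi_error v)^2 * exp (- 2 * c * v))"
proof -
  obtain M where "(\<integral>\<^sup>+ v. ennreal ((psi_error v)^2 * exp (- 2 * c * v)) \<partial>lborel) \<le> ennreal M" using psi_error_L2 by blast
  thus ?thesis by (intro integrableI_bounded) (auto simp: le_less_trans[OF _ ennreal_less_top])
qed

lemma psi_error_integral_le:
  "\<exists>C\<ge>0. \<forall>u\<ge>ln 2. (\<lambda>v. psi_error v / v^2) integrable_on {ln 2..u} \<longrightarrow> \<bar>integral {ln 2..u} (\<lambda>v. psi_error v / v^2)\<bar> \<le> C * exp (c * u)"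
proof -
  define M where "M = (LINT v|lborel. 16 * ((psi_error v)^2 * exp (- 2 * c * v)))"
  have "\<bar>integral {ln 2..u} (\<lambda>v. psi_error v / v^2)\<bar> \<le> (M + 1) * exp (c * u)"
    if u: "u \<ge> ln 2" and integrable: "(\<lambda>v. psi_error v / v^2) integrable_on {ln 2..u}" for u
  proof -
    let ?f = "\<lambda>v. (psi_error v / v^2)^2 * exp (- 2 * c * v)"
    have f_le: "indicator {ln 2..u} v *\<^sub>R ?f v \<le> 16 * ((psi_error v)^2 * exp (- 2 * c * v))" for v
    proof (cases "v \<in> {ln 2..u}")
      case True
      hence v: "v \<ge> 1/2" using ln2_pos by auto
      hence "(1/2)^4 \<le> v^4" by (intro power_mono) auto
      hence "(psi_error v)^2 / v^4 \<le> (psi_error v)^2 / (1/2)^4" using v by (intro divide_left_mono) auto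
      hence "(psi_error v)^2 / v^4 * exp (- 2 * c * v) \<le> 16 * (psi_error v)^2 * exp (- 2 * c * v)"
        by (intro mult_right_mono) (simp_all add: power_divide)
      thus ?thesis using True by (simp add: power_divide mult.assoc)
    qed simp
    have dominating: "integrable lborel (\<lambda>v. 16 * ((psi_error v)^2 * exp (- 2 * c * v)))"
      by (rule integrable_mult_right[OF psi_error_square_integrable])
    have restricted: "integrable lborel (\<lambda>v. indicator {ln 2..u} v *\<^sub>R ?f v)"
      by (rule Bochner_Integration.integrable_bound[OF dominating]) (use f_le in \<open>auto simp: abs_mult\<close>)
    hence set_f: "set_integrable lborel {ln 2..u} ?f" by (simp add: set_integrable_def)
    have "integral {ln 2..u} ?f = (LINT v|lborel. indicator {ln 2..u} v *\<^sub>R ?f v)"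
      using set_borel_integral_eq_integral(2)[OF set_f] by (simp only: set_lebesgue_integral_def)
    also have "... \<le> M" unfolding M_def by (intro integral_mono restricted dominating f_le)
    finally show ?thesis
      using c \<eta> u by (intro abs_integral_le_weighted_L2[OF _ integrable set_borel_integral_eq_integral(1)[OF set_f]]) auto
  qed
  moreover have "M \<ge> 0" unfolding M_def by (intro integral_nonneg_AE) auto
  ultimately show ?thesis by (intro exI[of _ "M + 1"]) auto
qed

lemma psi_error_has_integral:
  assumes u: "u \<ge> ln 2"
  shows "((\<lambda>v. psi_error v / v^2) has_integral (riemann_Pi (exp u) - li (exp u) - (psi (exp u) - exp u) / u + (li 2 - 2 / ln 2)
      + integral {ln 2..u} (\<lambda>v. Re (zero_sum v) / v^2))) {ln 2..u}"
proof -
  have "continuous_on {ln 2..u} zero_sum" using zero_sum_isCont by (simp add: continuous_at_imp_continuous_on)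
  hence "(\<lambda>v. Re (zero_sum v) / v^2) integrable_on {ln 2..u}"
    using ln2_pos by (intro integrable_continuous_real continuous_intros) auto
  from has_integral_add[OF riemann_Pi_minus_li[OF u] integrable_integral[OF this]] show ?thesis
  proof (rule has_integral_eq[rotated])
    fix v assume "v \<in> {ln 2..u}"
    hence "v > 0" using ln2_pos by auto
    thus "(psi (exp v) - exp v) / v^2 + Re (zero_sum v) / v^2 = psi_error v / v^2" by (simp add: psi_error_def add_divide_distrib)
  qed
qed

lemma prime_pi_approx:
  "\<exists>C\<ge>0. \<forall>u\<ge>ln 2. \<bar>u * (real (prime_pi (exp u)) - li (exp u)) + Re (zero_sum u)\<bar>
     \<le> \<bar>psi_error u\<bar> + u * (C * (1 + u) * exp (c * u) + 12 * zero_sum_majorant u)"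
proof -
  obtain C where C: "C \<ge> 0" "\<And>u. u \<ge> ln 2 \<Longrightarrow> (\<lambda>v. psi_error v / v^2) integrable_on {ln 2..u} \<Longrightarrow>
      \<bar>integral {ln 2..u} (\<lambda>v. psi_error v / v^2)\<bar> \<le> C * exp (c * u)"
    using psi_error_integral_le by blast
  define r where "r = li 2 - 2 / ln 2"
  define D where "D = C + 2 + \<bar>r\<bar>"
  have "\<bar>u * (real (prime_pi (exp u)) - li (exp u)) + Re (zero_sum u)\<bar>
      \<le> \<bar>psi_error u\<bar> + u * (D * (1 + u) * exp (c * u) + 12 * zero_sum_majorant u)"
    if u: "u \<ge> ln 2" for u
  proof -
    have u_pos: "u > 0" using u ln2_pos by linarith
    define J where "J = riemann_Pi (exp u) - li (exp u) - (psi (exp u) - exp u) / u"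
    define q where "q = riemann_Pi (exp u) - real (prime_pi (exp u))"
    have "\<bar>J + r + integral {ln 2..u} (\<lambda>v. Re (zero_sum v) / v^2)\<bar> \<le> C * exp (c * u)"
      using C(2)[OF u] psi_error_has_integral[OF u] unfolding J_def r_def by (auto simp: integral_unique)
    hence J: "\<bar>J\<bar> \<le> C * exp (c * u) + \<bar>r\<bar> + 12 * zero_sum_majorant u" using zero_sum_integral_le[OF u] by linarith
    have q: "\<bar>q\<bar> \<le> 2 * u * exp (c * u)" unfolding q_def using c \<eta> by (intro riemann_Pi_minus_prime_pi_le[OF u]) auto
    have "\<bar>r\<bar> \<le> \<bar>r\<bar> * exp (c * u)" using mult_left_mono[of 1 "exp (c * u)" "\<bar>r\<bar>"] c \<eta> u_pos by simp
    hence "\<bar>J - q\<bar> \<le> (C + \<bar>r\<bar> + 2 * u) * exp (c * u) + 12 * zero_sum_majorant u"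
      using J q unfolding distrib_right by linarith
    also have "(C + \<bar>r\<bar> + 2 * u) * exp (c * u) \<le> D * (1 + u) * exp (c * u)"
      using C(1) u_pos by (intro mult_right_mono) (auto simp: D_def algebra_simps)
    finally have "\<bar>u * (J - q)\<bar> \<le> u * (D * (1 + u) * exp (c * u) + 12 * zero_sum_majorant u)"
      using u_pos by (simp add: abs_mult)
    moreover have "u * (real (prime_pi (exp u)) - li (exp u)) + Re (zero_sum u) = psi_error u + u * (J - q)"
    proof -
      have "psi (exp u) - exp u = psi_error u - Re (zero_sum u)" using u_pos by (simp add: psi_error_def)
      moreover have "u * ((psi (exp u) - exp u) / u) = psi (exp u) - exp u" using u_pos by simp
      ultimately show ?thesis unfolding J_def q_def by (simp add: right_diff_distrib distrib_left)
    qed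
    ultimately show ?thesis by linarith
  qed
  moreover have "D \<ge> 0" using C(1) by (simp add: D_def)
  ultimately show ?thesis by blast
qed

end

section \<open>Density estimates\<close>

definition dyadic_almost_all :: "(real \<Rightarrow> bool) \<Rightarrow> bool" where
  "dyadic_almost_all P \<longleftrightarrow> (\<forall>\<epsilon>>0. \<forall>\<^sub>F X in at_top. \<exists>B\<in>fmeasurable lborel.
     measure lborel B \<le> \<epsilon> * X \<and> (\<forall>x\<in>{X..2 * X} - B. P x))"

lemma dyadic_almost_all_conj:
  assumes P: "dyadic_almost_all P" and Q: "dyadic_almost_all Q"
  shows "dyadic_almost_all (\<lambda>x. P x \<and> Q x)"
  unfolding dyadic_almost_all_def
proof (intro allI impI)
  fix \<epsilon> :: real assume "\<epsilon> > 0"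
  hence half: "\<epsilon> / 2 > 0" by simp
  show "\<forall>\<^sub>F X in at_top. \<exists>B\<in>fmeasurable lborel. measure lborel B \<le> \<epsilon> * X \<and> (\<forall>x\<in>{X..2 * X} - B. P x \<and> Q x)"
    using P[unfolded dyadic_almost_all_def, rule_format, OF half] Q[unfolded dyadic_almost_all_def, rule_format, OF half]
  proof eventually_elim
    case (elim X)
    then obtain B C where B: "B \<in> fmeasurable lborel" "measure lborel B \<le> \<epsilon> / 2 * X" "\<forall>x\<in>{X..2 * X} - B. P x"
      and C: "C \<in> fmeasurable lborel" "measure lborel C \<le> \<epsilon> / 2 * X" "\<forall>x\<in>{X..2 * X} - C. Q x" by blast
    have "measure lborel (B \<union> C) \<le> measure lborel B + measure lborel C"
      using B(1) C(1) by (intro measure_Un_le) (auto simp: fmeasurable_def)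
    thus ?case using B C by (intro bexI[of _ "B \<union> C"]) (auto intro: fmeasurable.Un)
  qed
qed

lemma dyadic_almost_all_mono:
  assumes P: "dyadic_almost_all P" and "\<forall>\<^sub>F x in at_top. P x \<longrightarrow> Q x"
  shows "dyadic_almost_all Q"
  unfolding dyadic_almost_all_def
proof (intro allI impI)
  fix \<epsilon> :: real assume \<epsilon>: "\<epsilon> > 0"
  obtain x0 where x0: "\<And>x. x \<ge> x0 \<Longrightarrow> P x \<Longrightarrow> Q x" using assms(2) by (auto simp: eventually_at_top_linorder)
  show "\<forall>\<^sub>F X in at_top. \<exists>B\<in>fmeasurable lborel. measure lborel B \<le> \<epsilon> * X \<and> (\<forall>x\<in>{X..2 * X} - B. Q x)"
    using P[unfolded dyadic_almost_all_def, rule_format, OF \<epsilon>] eventually_ge_at_top[of x0]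
  proof eventually_elim
    case (elim X)
    then obtain B where B: "B \<in> fmeasurable lborel" "measure lborel B \<le> \<epsilon> * X" "\<And>x. x \<in> {X..2 * X} - B \<Longrightarrow> P x" by blast
    have "Q x" if "x \<in> {X..2 * X} - B" for x using B(3)[OF that] that elim(2) by (intro x0) auto
    thus ?case using B by blast
  qed
qed

lemma borel_Int_Icc_lmeasurable: "S \<in> sets borel \<Longrightarrow> S \<inter> {a..b::real} \<in> lmeasurable"
  by (rule fmeasurableI2[OF lmeasurable_interval(1)[of a b]]) (auto intro: sets_completionI_sets)

lemma measure_lebesgue_Icc_le_from_dyadic:
  fixes B :: "real set"
  assumes B: "B \<in> sets borel" and Z: "Z \<ge> 2" and \<epsilon>: "\<epsilon> \<ge> 0"
    and dyadic: "\<And>X. X \<ge> Z \<Longrightarrow> measure lebesgue (B \<inter> {X..2 * X}) \<le> \<epsilon> * X"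
    and X: "2 \<le> X" "X \<le> 2 ^ n * Z"
  shows "measure lebesgue (B \<inter> {2..X}) \<le> \<epsilon> * X + 2 * Z"
proof -
  note fm = borel_Int_Icc_lmeasurable[OF B]
  have short: "measure lebesgue (B \<inter> {2..X}) \<le> \<epsilon> * X + 2 * Z" if X: "2 \<le> X" "X \<le> 2 * Z" for X
  proof -
    have "measure lebesgue (B \<inter> {2..X}) \<le> measure lebesgue {2..X}"
      using fm[of 2 X] by (intro measure_mono_fmeasurable[OF _ _ lmeasurable_interval(1)]) (auto simp: fmeasurable_def)
    also have "... \<le> 2 * Z" using X by simp
    finally show ?thesis using \<epsilon> X mult_nonneg_nonneg[of \<epsilon> X] by linarith
  qed
  show ?thesis using X
  proof (induction n arbitrary: X)
    case 0
    thus ?case using Z by (intro short) auto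
  next
    case (Suc n)
    show ?case
    proof (cases "X \<le> 2 * Z")
      case True
      thus ?thesis by (rule short[OF Suc.prems(1)])
    next
      case False
      have "measure lebesgue (B \<inter> {2..X}) \<le> measure lebesgue ((B \<inter> {2..X / 2}) \<union> (B \<inter> {X / 2..2 * (X / 2)}))"
        using fm[of 2 X] fm by (intro measure_mono_fmeasurable fmeasurable.Un) (auto simp: fmeasurableD)
      also have "... \<le> measure lebesgue (B \<inter> {2..X / 2}) + measure lebesgue (B \<inter> {X / 2..2 * (X / 2)})"
        using fm by (intro measure_Un_le) (auto simp: fmeasurable_def)
      also have "measure lebesgue (B \<inter> {2..X / 2}) \<le> \<epsilon> * (X / 2) + 2 * Z"
        using Suc.prems False Z by (intro Suc.IH) auto
      also have "measure lebesgue (B \<inter> {X / 2..2 * (X / 2)}) \<le> \<epsilon> * (X / 2)"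
        using False by (intro dyadic) auto
      finally show ?thesis by (simp add: mult.commute)
    qed
  qed
qed

lemma density_zero_from_dyadic:
  assumes B: "B \<in> sets borel" and rare: "dyadic_almost_all (\<lambda>x. x \<notin> B)"
  shows "((\<lambda>X. measure lebesgue (B \<inter> {2..X}) / X) \<longlongrightarrow> 0) at_top"
proof (rule tendstoI)
  fix \<epsilon> :: real assume \<epsilon>: "\<epsilon> > 0"
  hence "\<forall>\<^sub>F X in at_top. \<exists>C\<in>fmeasurable lborel. measure lborel C \<le> \<epsilon> / 2 * X \<and> (\<forall>x\<in>{X..2 * X} - C. x \<notin> B)"
    using rare unfolding dyadic_almost_all_def by (meson half_gt_zero)
  hence "\<forall>\<^sub>F X in at_top. measure lebesgue (B \<inter> {X..2 * X}) \<le> \<epsilon> / 2 * X"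
  proof eventually_elim
    case (elim X)
    then obtain C where C: "C \<in> fmeasurable lborel" "measure lborel C \<le> \<epsilon> / 2 * X" "B \<inter> {X..2 * X} \<subseteq> C" by blast
    have "measure lebesgue (B \<inter> {X..2 * X}) = measure lborel (B \<inter> {X..2 * X})" using B by (simp add: measure_completion)
    also have "... \<le> measure lborel C" using B C by (intro measure_mono_fmeasurable) auto
    finally show ?case using C(2) by simp
  qed
  then obtain Z0 where "\<And>X. X \<ge> Z0 \<Longrightarrow> measure lebesgue (B \<inter> {X..2 * X}) \<le> \<epsilon> / 2 * X" by (auto simp: eventually_at_top_linorder)
  then obtain Z where Z: "Z \<ge> 2" "\<And>X. X \<ge> Z \<Longrightarrow> measure lebesgue (B \<inter> {X..2 * X}) \<le> \<epsilon> / 2 * X"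
    by (metis max.bounded_iff max.cobounded1)
  have "\<forall>\<^sub>F X in at_top. X > 4 * Z / \<epsilon> \<and> X \<ge> 2"
    by (intro eventually_conj eventually_gt_at_top eventually_ge_at_top)
  thus "\<forall>\<^sub>F X in at_top. dist (measure lebesgue (B \<inter> {2..X}) / X) 0 < \<epsilon>"
  proof eventually_elim
    case (elim X)
    obtain n where "X / Z < 2 ^ n" using real_arch_pow[of 2 "X / Z"] by auto
    hence "X \<le> 2 ^ n * Z" using Z by (simp add: divide_less_eq less_imp_le)
    hence "measure lebesgue (B \<inter> {2..X}) \<le> \<epsilon> / 2 * X + 2 * Z"
      using measure_lebesgue_Icc_le_from_dyadic[OF B Z(1) _ Z(2)] elim \<epsilon> by simp
    also have "2 * Z < \<epsilon> / 2 * X" using elim \<epsilon> by (simp add: field_simps)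
    finally have "measure lebesgue (B \<inter> {2..X}) < \<epsilon> * X" by (simp add: mult.commute)
    thus ?case using elim by (simp add: divide_less_eq)
  qed
qed

lemma density_zero_subset:
  assumes "A \<in> sets borel" "B \<in> sets borel" "A \<subseteq> B"
    and B: "((\<lambda>X. measure lebesgue (B \<inter> {2..X}) / X) \<longlongrightarrow> 0) at_top"
  shows "((\<lambda>X. measure lebesgue (A \<inter> {2..X}) / X) \<longlongrightarrow> 0) at_top"
proof (rule tendsto_sandwich[OF _ _ tendsto_const B])
  show "\<forall>\<^sub>F X in at_top. 0 \<le> measure lebesgue (A \<inter> {2..X}) / X"
    using eventually_gt_at_top[of 0] by eventually_elim simp
  show "\<forall>\<^sub>F X in at_top. measure lebesgue (A \<inter> {2..X}) / X \<le> measure lebesgue (B \<inter> {2..X}) / X"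
    using eventually_gt_at_top[of 0]
  proof eventually_elim
    case (elim X)
    have "measure lebesgue (A \<inter> {2..X}) \<le> measure lebesgue (B \<inter> {2..X})"
      using assms(1,3) by (intro measure_mono_fmeasurable borel_Int_Icc_lmeasurable assms(2)) (auto intro: sets_completionI_sets)
    thus ?case using elim by (intro divide_right_mono) auto
  qed
qed

lemma density_one_complement:
  assumes B: "B \<in> sets borel" and lim: "((\<lambda>X. measure lebesgue (B \<inter> {2..X}) / X) \<longlongrightarrow> 0) at_top"
  shows "((\<lambda>X. measure lebesgue (({2..} - B) \<inter> {2..X}) / X) \<longlongrightarrow> 1) at_top"
proof -
  have "\<forall>\<^sub>F X in at_top. (X - 2) / X - measure lebesgue (B \<inter> {2..X}) / X = measure lebesgue (({2..} - B) \<inter> {2..X}) / X"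
    using eventually_gt_at_top[of 2]
  proof eventually_elim
    case (elim X)
    have "({2..} - B) \<inter> {2..X} = {2..X} - B \<inter> {2..X}" by auto
    also have "measure lebesgue ... = measure lebesgue {2..X} - measure lebesgue (B \<inter> {2..X})"
      using borel_Int_Icc_lmeasurable[OF B]
        by (intro measurable_measure_Diff) (auto simp: lmeasurable_interval(1)[of 2 X, unfolded box_real])
    finally show ?case using elim by (simp add: diff_divide_distrib)
  qed
  moreover have "((\<lambda>X::real. (X - 2) / X) \<longlongrightarrow> 1) at_top" by real_asymp
  hence "((\<lambda>X. (X - 2) / X - measure lebesgue (B \<inter> {2..X}) / X) \<longlongrightarrow> 1 - 0) at_top" by (intro tendsto_diff lim)
  ultimately show ?thesis by (simp add: tendsto_cong)
qed

lemma sin_ge_half: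
  assumes "0 \<le> x" "x \<le> pi / 2"
  shows "sin x \<ge> x / 2"
proof -
  have "\<bar>sin x - x\<bar> \<le> x ^ 3 / 6"
    using Maclaurin_sin_bound[of x 3] assms by (simp add: numeral_3_eq_3 sin_coeff_def fact_numeral)
  moreover have "x ^ 2 \<le> (16 / 10) ^ 2" using assms pi_approx by (intro power_mono) auto
  hence "x * x ^ 2 \<le> x * 3" using assms by (intro mult_left_mono) (auto simp: power2_eq_square)
  hence "x ^ 3 \<le> 3 * x" by (simp add: power3_eq_cube power2_eq_square)
  ultimately show ?thesis by linarith
qed

lemma near_multiple_of_2pi:
  assumes "norm (cis t - 1) < \<tau>"
  shows "\<exists>n::int. \<bar>t - 2 * pi * of_int n\<bar> \<le> 2 * \<tau>"
proof -
  define n where "n = round (t / (2 * pi))"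
  define y where "y = t / 2 - pi * of_int n"
  have "\<bar>y\<bar> = \<bar>pi * (of_int n - t / (2 * pi))\<bar>" by (simp add: y_def right_diff_distrib abs_minus_commute)
  also have "... = pi * \<bar>of_int n - t / (2 * pi)\<bar>" by (simp add: abs_mult)
  also have "... \<le> pi * (1 / 2)" unfolding n_def by (intro mult_left_mono of_int_round_abs_le) auto
  finally have "\<bar>y\<bar> \<le> pi / 2" by simp
  hence "\<bar>y\<bar> / 2 \<le> \<bar>sin y\<bar>" using sin_ge_half[of "\<bar>y\<bar>"] by (cases "y \<ge> 0") auto
  also have "\<bar>sin y\<bar> = \<bar>sin (t / 2)\<bar>"
  proof -
    have "sin (pi * of_int n) = 0" by (simp add: sin_zero_iff_int2)
    moreover from this have "\<bar>cos (pi * of_int n)\<bar> = 1"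
      using sin_cos_squared_add[of "pi * of_int n"] by (simp add: power2_eq_1_iff)
    ultimately show ?thesis unfolding y_def sin_diff by (simp add: abs_mult)
  qed
  also have "... = norm (cis t - 1) / 2" by (simp add: cis_conv_exp dist_exp_i_1)
  finally show ?thesis using assms by (intro exI[of _ n]) (auto simp: y_def abs_le_iff)
qed

lemma measure_log_window_le:
  assumes X: "X > 0" and ab: "a \<le> b"
  shows "measure lborel {max X (exp a)..min (2 * X) (exp b)} \<le> 2 * X * (b - a)"
proof -
  define l r where "l = max X (exp a)" and "r = min (2 * X) (exp b)"
  have pos: "l > 0" "r > 0" using X by (auto simp: l_def r_def)
  show ?thesis unfolding l_def[symmetric] r_def[symmetric]
  proof (cases "l \<le> r")
    case True
    have "a \<le> ln l" using pos by (simp add: l_def ln_ge_iff)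
    moreover have "ln r \<le> ln (exp b)" using pos by (subst ln_le_cancel_iff) (auto simp: r_def)
    moreover have "ln (l / r) \<le> l / r - 1" using pos by (intro ln_le_minus_one) auto
    ultimately have "1 - l / r \<le> b - a" using pos by (simp add: ln_div)
    hence "r * (1 - l / r) \<le> 2 * X * (b - a)"
      using pos True X by (intro mult_mono) (auto simp: r_def divide_le_eq)
    thus "measure lborel {l..r} \<le> 2 * X * (b - a)" using pos True by (simp add: right_diff_distrib)
  qed (use X ab in auto)
qed

lemma resonance_subset_log_windows:
  fixes X \<gamma> \<tau> :: real
  assumes X: "X > 0" and \<gamma>: "\<gamma> > 0" and \<tau>: "\<tau> \<le> 1"
  shows "{x \<in> {X..2 * X}. norm (cis (\<gamma> * ln x) - 1) < \<tau>} \<subseteq> (\<Union>n\<in>{\<lfloor>\<gamma> * ln X / (2 * pi)\<rfloor>..\<lceil>\<gamma> * ln (2 * X) / (2 * pi)\<rceil>}.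
     {max X (exp ((2 * pi * of_int n - 2 * \<tau>) / \<gamma>))..min (2 * X) (exp ((2 * pi * of_int n + 2 * \<tau>) / \<gamma>))})"
    (is "_ \<subseteq> (\<Union>n\<in>?N. ?window n)")
proof
  fix x assume "x \<in> {x \<in> {X..2 * X}. norm (cis (\<gamma> * ln x) - 1) < \<tau>}"
  hence x: "X \<le> x" "x \<le> 2 * X" "norm (cis (\<gamma> * ln x) - 1) < \<tau>" by auto
  hence x0: "x > 0" using X by linarith
  obtain n :: int where n: "\<bar>\<gamma> * ln x - 2 * pi * of_int n\<bar> \<le> 2 * \<tau>" using near_multiple_of_2pi[OF x(3)] by blast
  have "(2 * pi * of_int n - 2 * \<tau>) / \<gamma> \<le> ln x" "ln x \<le> (2 * pi * of_int n + 2 * \<tau>) / \<gamma>"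
    using n \<gamma> by (auto simp: divide_le_eq le_divide_eq mult.commute abs_le_iff)
  hence "exp ((2 * pi * of_int n - 2 * \<tau>) / \<gamma>) \<le> x" "x \<le> exp ((2 * pi * of_int n + 2 * \<tau>) / \<gamma>)"
    using x0 by (metis exp_le_cancel_iff exp_ln)+
  hence "x \<in> ?window n" using x by auto
  moreover have "n \<in> ?N"
  proof -
    have "\<gamma> * ln X \<le> \<gamma> * ln x" "\<gamma> * ln x \<le> \<gamma> * ln (2 * X)" using x x0 X \<gamma> by (auto intro!: mult_left_mono)
    moreover have "2 < pi" using pi_gt3 by linarith
    ultimately have "\<gamma> * ln X - 2 * pi < 2 * pi * of_int n" "2 * pi * of_int n < \<gamma> * ln (2 * X) + 2 * pi"
      using n \<tau> by (auto simp: abs_le_iff)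
    hence "\<gamma> * ln X / (2 * pi) - 1 < of_int n" "of_int n < \<gamma> * ln (2 * X) / (2 * pi) + 1"
      by (simp_all add: field_simps)
    thus ?thesis unfolding atLeastAtMost_iff by linarith
  qed
  ultimately show "x \<in> (\<Union>n\<in>?N. ?window n)" by blast
qed

lemma card_log_window_indices_le:
  fixes X \<gamma> :: real
  assumes X: "X > 0" and \<gamma>: "\<gamma> \<ge> 1"
  shows "real (card {\<lfloor>\<gamma> * ln X / (2 * pi)\<rfloor>..\<lceil>\<gamma> * ln (2 * X) / (2 * pi)\<rceil>}) \<le> 4 * \<gamma>"
proof -
  have "\<gamma> * ln 2 / (2 * pi) \<le> \<gamma> * 1 / 1"
    using \<gamma> ln_2_less_1 pi_gt3 by (intro frac_le mult_left_mono) auto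
  moreover have "\<gamma> * ln (2 * X) / (2 * pi) = \<gamma> * ln X / (2 * pi) + \<gamma> * ln 2 / (2 * pi)"
    using X by (simp add: ln_mult ring_distribs add_divide_distrib)
  ultimately have "of_int (\<lceil>\<gamma> * ln (2 * X) / (2 * pi)\<rceil> - \<lfloor>\<gamma> * ln X / (2 * pi)\<rfloor> + 1) \<le> \<gamma> + 3" by linarith
  thus ?thesis using \<gamma> by simp
qed

lemma Icc_fmeasurable: "{a..b::real} \<in> fmeasurable lborel"
  by (rule fmeasurableI) (auto simp: emeasure_lborel_Icc_eq)

lemma resonance_fmeasurable:
  fixes X \<gamma> \<tau> :: real
  shows "{x \<in> {X..2 * X}. norm (cis (\<gamma> * ln x) - 1) < \<tau>} \<in> fmeasurable lborel"
proof (rule fmeasurableI2[OF Icc_fmeasurable[of X "2 * X"]])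
  have [measurable]: "(\<lambda>x. cis (\<gamma> * ln x)) \<in> borel_measurable borel"
    unfolding cis_conv_exp by measurable
  show "{x \<in> {X..2 * X}. norm (cis (\<gamma> * ln x) - 1) < \<tau>} \<in> sets lborel" by measurable
qed auto

lemma measure_resonance_le:
  fixes X \<gamma> \<tau> :: real
  assumes X: "X > 0" and \<gamma>: "\<gamma> \<ge> 1" and \<tau>: "\<tau> > 0"
  shows "measure lborel {x \<in> {X..2 * X}. norm (cis (\<gamma> * ln x) - 1) < \<tau>} \<le> 32 * \<tau> * X" (is "measure lborel ?S \<le> _")
proof (cases "\<tau> \<le> 1")
  case True
  let ?N = "{\<lfloor>\<gamma> * ln X / (2 * pi)\<rfloor>..\<lceil>\<gamma> * ln (2 * X) / (2 * pi)\<rceil>}"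
  let ?window = "\<lambda>n. {max X (exp ((2 * pi * of_int n - 2 * \<tau>) / \<gamma>))..min (2 * X) (exp ((2 * pi * of_int n + 2 * \<tau>) / \<gamma>))}"
  have length: "measure lborel (?window n) \<le> 8 * X * \<tau> / \<gamma>" for n
    using measure_log_window_le[OF X, of "(2 * pi * of_int n - 2 * \<tau>) / \<gamma>" "(2 * pi * of_int n + 2 * \<tau>) / \<gamma>"] \<gamma> \<tau>
    by (simp add: divide_right_mono diff_divide_distrib[symmetric])
  have "measure lborel ?S \<le> measure lborel (\<Union>n\<in>?N. ?window n)"
    using \<gamma> by (intro measure_mono_fmeasurable[OF resonance_subset_log_windows[OF X _ True]] fmeasurableD[OF resonance_fmeasurable]
      fmeasurable.finite_UN Icc_fmeasurable) auto
  also have "... \<le> (\<Sum>n\<in>?N. measure lborel (?window n))" by (rule measure_UNION_le) auto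
  also have "... \<le> (\<Sum>n\<in>?N. 8 * X * \<tau> / \<gamma>)" by (intro sum_mono length)
  also have "... = real (card ?N) * (8 * X * \<tau> / \<gamma>)" by simp
  also have "... \<le> 4 * \<gamma> * (8 * X * \<tau> / \<gamma>)"
    using X \<tau> \<gamma> by (intro mult_right_mono card_log_window_indices_le) auto
  also have "... = 32 * \<tau> * X" using \<gamma> by simp
  finally show ?thesis .
next
  case False
  have "measure lborel ?S \<le> measure lborel {X..2 * X}"
    by (rule measure_mono_fmeasurable[OF _ fmeasurableD[OF resonance_fmeasurable] Icc_fmeasurable]) auto
  also have "... \<le> 32 * \<tau> * X" using X False by simp
  finally show ?thesis .
qed

lemma markov_weighted_indicators:
  fixes a :: "'i \<Rightarrow> real" and S :: "'i \<Rightarrow> real set"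
  assumes "finite J" and a: "\<And>j. j \<in> J \<Longrightarrow> a j \<ge> 0" and S: "\<And>j. j \<in> J \<Longrightarrow> S j \<in> fmeasurable lborel"
    and \<mu>: "\<And>j. j \<in> J \<Longrightarrow> measure lborel (S j) \<le> \<mu>" and l: "l > 0"
  shows "{x. l \<le> (\<Sum>j\<in>J. a j * indicator (S j) x)} \<in> fmeasurable lborel"
    "measure lborel {x. l \<le> (\<Sum>j\<in>J. a j * indicator (S j) x)} \<le> \<mu> * (\<Sum>j\<in>J. a j) / l"
proof -
  define f where "f = (\<lambda>x. \<Sum>j\<in>J. a j * indicator (S j) x :: real)"
  have f_int: "integrable lborel f" unfolding f_def using S
    by (intro Bochner_Integration.integrable_sum integrable_mult_right) (auto simp: fmeasurable_def)
  have f_nonneg: "f x \<ge> 0" for x unfolding f_def using a by (intro sum_nonneg) auto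
  have "(LINT x|lborel. f x) = (\<Sum>j\<in>J. a j * measure lborel (S j))"
    unfolding f_def using S by (subst Bochner_Integration.integral_sum) (auto simp: fmeasurable_def)
  also have "... \<le> (\<Sum>j\<in>J. a j * \<mu>)" using a \<mu> by (intro sum_mono mult_left_mono) auto
  finally have f_mean: "(LINT x|lborel. f x) \<le> \<mu> * (\<Sum>j\<in>J. a j)" by (simp add: sum_distrib_left mult.commute)
  have "emeasure lborel {x \<in> space lborel. l \<le> f x} \<le> ennreal (1 / l * (LINT x|lborel. f x))"
    by (rule integral_Markov_inequality[OF f_int _ l]) (simp add: f_nonneg)
  also have "... \<le> ennreal (\<mu> * (\<Sum>j\<in>J. a j) / l)" using f_mean l by (intro ennreal_leI) (simp add: divide_right_mono)
  finally have bound: "emeasure lborel {x. l \<le> f x} \<le> ennreal (\<mu> * (\<Sum>j\<in>J. a j) / l)" by simp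
  moreover have "{x. l \<le> f x} \<in> sets lborel" using borel_measurable_integrable[OF f_int] by measurable
  ultimately show "{x. l \<le> (\<Sum>j\<in>J. a j * indicator (S j) x)} \<in> fmeasurable lborel"
    unfolding f_def by (intro fmeasurableI) (auto intro: le_less_trans)
  have "0 \<le> (LINT x|lborel. f x)" by (intro integral_nonneg_AE) (simp add: f_nonneg)
  hence "\<mu> * (\<Sum>j\<in>J. a j) / l \<ge> 0" using f_mean l by auto
  thus "measure lborel {x. l \<le> (\<Sum>j\<in>J. a j * indicator (S j) x)} \<le> \<mu> * (\<Sum>j\<in>J. a j) / l"
    using bound unfolding f_def measure_def by (intro enn2real_leI)
qed

section \<open>Blocks of zeros and Fejer kernels\<close>

definition fejer_sum :: "nat \<Rightarrow> real \<Rightarrow> complex" where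
  "fejer_sum K t = (\<Sum>k=1..K. of_real (real K + 1 - real k) * cis (real k * t))"

definition dirichlet_sum :: "nat \<Rightarrow> real \<Rightarrow> complex" where
  "dirichlet_sum K t = (\<Sum>k\<le>K. cis (real k * t))"

lemma dirichlet_sum_minus_1: "dirichlet_sum K t - 1 = (\<Sum>k=1..K. cis (real k * t))"
proof -
  have "{..K} = insert 0 {1..K}" by auto
  thus ?thesis by (simp add: dirichlet_sum_def)
qed

lemma fejer_sum_Suc: "fejer_sum (Suc K) t = fejer_sum K t + (dirichlet_sum (Suc K) t - 1)"
proof -
  have "fejer_sum (Suc K) t = (\<Sum>k=1..K. of_real (real (Suc K) + 1 - real k) * cis (real k * t)) + cis (real (Suc K) * t)"
    unfolding fejer_sum_def by simp
  also have "(\<Sum>k=1..K. of_real (real (Suc K) + 1 - real k) * cis (real k * t)) = fejer_sum K t + (\<Sum>k=1..K. cis (real k * t))"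
    unfolding fejer_sum_def sum.distrib[symmetric] by (intro sum.cong) (auto simp: algebra_simps)
  finally show ?thesis unfolding dirichlet_sum_minus_1 by simp
qed

lemma Re_dirichlet_sum_times_cnj_cis:
  "Re (dirichlet_sum K t * cnj (cis (real (Suc K) * t))) = Re (dirichlet_sum (Suc K) t - 1)"
proof -
  have "Re (dirichlet_sum K t * cnj (cis (real (Suc K) * t))) = (\<Sum>k\<le>K. cos (real k * t - real (Suc K) * t))"
    unfolding dirichlet_sum_def sum_distrib_right cis_cnj cis_mult by simp
  also have "... = (\<Sum>k\<le>K. cos (real (Suc K - k) * t))"
  proof (rule sum.cong[OF refl])
    fix k assume "k \<in> {..K}"
    hence "real k * t - real (Suc K) * t = - (real (Suc K - k) * t)" by (simp add: of_nat_diff algebra_simps)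
    thus "cos (real k * t - real (Suc K) * t) = cos (real (Suc K - k) * t)" by (simp only: cos_minus)
  qed
  also have "... = (\<Sum>k=1..Suc K. cos (real k * t))"
    by (rule sum.reindex_bij_witness[of _ "\<lambda>k. Suc K - k" "\<lambda>k. Suc K - k"]) auto
  finally show ?thesis unfolding dirichlet_sum_minus_1 by simp
qed

lemma norm_dirichlet_sum_sq: "(norm (dirichlet_sum K t))^2 = real K + 1 + 2 * Re (fejer_sum K t)"
proof (induction K)
  case 0
  thus ?case by (simp add: dirichlet_sum_def fejer_sum_def)
next
  case (Suc K)
  define w where "w = cis (real (Suc K) * t)"
  have "(norm (dirichlet_sum (Suc K) t))^2 = (norm (dirichlet_sum K t + w))^2" by (simp add: dirichlet_sum_def w_def)
  also have "... = (norm (dirichlet_sum K t))^2 + 1 + 2 * Re (dirichlet_sum K t * cnj w)"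
  proof -
    have "(Re w)^2 + (Im w)^2 = 1" using cmod_power2[of w] by (simp add: w_def)
    thus ?thesis unfolding cmod_power2 by (simp add: power2_eq_square algebra_simps)
  qed
  finally show ?case unfolding fejer_sum_Suc w_def Re_dirichlet_sum_times_cnj_cis using Suc.IH by simp
qed

lemma norm_dirichlet_sum_le:
  assumes "cis t \<noteq> 1"
  shows "norm (dirichlet_sum K t) \<le> 2 / norm (cis t - 1)"
proof -
  have "(cis t - 1) * dirichlet_sum K t = cis (real (Suc K) * t) - 1"
  proof (induction K)
    case (Suc K)
    have "(cis t - 1) * dirichlet_sum (Suc K) t = (cis (real (Suc K) * t) - 1) + (cis t - 1) * cis (real (Suc K) * t)"
      using Suc.IH by (simp add: dirichlet_sum_def algebra_simps)
    also have "(cis t - 1) * cis (real (Suc K) * t) = cis (real (Suc (Suc K)) * t) - cis (real (Suc K) * t)"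
      by (simp add: left_diff_distrib cis_mult algebra_simps)
    finally show ?case by simp
  qed (simp add: dirichlet_sum_def)
  hence "norm (cis t - 1) * norm (dirichlet_sum K t) = norm (cis (real (Suc K) * t) - 1)" by (metis norm_mult)
  also have "... \<le> 2" using norm_triangle_ineq4[of "cis (real (Suc K) * t)" 1] by simp
  finally show ?thesis using assms by (simp add: field_simps)
qed

lemma Re_fejer_sum_le:
  assumes "cis t \<noteq> 1"
  shows "2 * Re (fejer_sum K t) \<le> - (real K + 1) + 4 / (norm (cis t - 1))^2"
proof -
  have "(norm (dirichlet_sum K t))^2 \<le> (2 / norm (cis t - 1))^2" by (intro power_mono norm_dirichlet_sum_le assms) auto
  thus ?thesis unfolding norm_dirichlet_sum_sq by (simp add: power_divide)
qed

lemma norm_fejer_sum_le: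
  assumes "cis t \<noteq> 1"
  shows "norm (fejer_sum K t) \<le> 2 * real K / norm (cis t - 1)"
proof (induction K)
  case (Suc K)
  have "dirichlet_sum (Suc K) t - 1 = cis t * dirichlet_sum K t"
    unfolding dirichlet_sum_def by (subst sum.atMost_Suc_shift) (simp add: sum_distrib_left cis_mult algebra_simps)
  hence "norm (dirichlet_sum (Suc K) t - 1) \<le> 2 / norm (cis t - 1)"
    using norm_dirichlet_sum_le[OF assms, of K] by (simp add: norm_mult)
  hence "norm (fejer_sum (Suc K) t) \<le> 2 * real K / norm (cis t - 1) + 2 / norm (cis t - 1)"
    unfolding fejer_sum_Suc by (intro norm_triangle_le add_mono Suc.IH)
  also have "... = 2 * real (Suc K) / norm (cis t - 1)" by (simp add: add_divide_distrib algebra_simps)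
  finally show ?case .
qed (simp add: fejer_sum_def)

lemma norm_fejer_sum_le_square: "norm (fejer_sum K t) \<le> real K ^ 2"
proof -
  have "norm (fejer_sum K t) \<le> (\<Sum>k=1..K. real K)"
    unfolding fejer_sum_def by (rule sum_norm_le) (auto simp: norm_mult simp del: of_real_add of_real_diff)
  thus ?thesis by (simp add: power2_eq_square)
qed

lemma Re_rotated_fejer_sum_le:
  assumes \<phi>: "\<bar>\<phi>\<bar> \<le> 1" and t: "cis t \<noteq> 1" and K: "8 / (norm (cis t - 1))^2 \<le> real K"
  shows "2 * Re (cis \<phi> * fejer_sum K t) \<le> - real K / 4 + 4 * \<bar>\<phi>\<bar> * real K / norm (cis t - 1)"
proof -
  define D where "D = fejer_sum K t"
  have "2 * Re D \<le> - real K / 2" using Re_fejer_sum_le[OF t, of K] K unfolding D_def by (simp add: field_simps)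
  moreover have cos_ge: "cos \<phi> \<ge> 1/2"
  proof -
    have "cos (pi / 3) \<le> cos \<bar>\<phi>\<bar>" using \<phi> pi_gt3 by (intro cos_monotone_0_pi_le) auto
    thus ?thesis by (simp add: cos_60)
  qed
  ultimately have "cos \<phi> * (2 * Re D) \<le> cos \<phi> * (- real K / 2)" by (intro mult_left_mono) auto
  also have "... \<le> 1/2 * (- real K / 2)" using cos_ge by (intro mult_right_mono_neg) auto
  finally have "cos \<phi> * (2 * Re D) \<le> - real K / 4" by simp
  moreover have "\<bar>sin \<phi> * Im D\<bar> \<le> \<bar>\<phi>\<bar> * (2 * real K / norm (cis t - 1))"
    unfolding abs_mult using norm_fejer_sum_le[OF t, of K] abs_Im_le_cmod[of D]
    by (intro mult_mono abs_sin_x_le_abs_x) (auto simp: D_def)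
  hence "- 2 * (sin \<phi> * Im D) \<le> 4 * \<bar>\<phi>\<bar> * real K / norm (cis t - 1)" by (simp add: abs_le_iff)
  moreover have "2 * Re (cis \<phi> * D) = cos \<phi> * (2 * Re D) - 2 * (sin \<phi> * Im D)" by (simp add: algebra_simps)
  ultimately show ?thesis unfolding D_def by linarith
qed

lemma norm_inverse_diff_imaginary_le:
  fixes y \<beta> \<theta> :: real
  assumes y: "y \<ge> 10" and \<theta>: "\<bar>\<theta>\<bar> \<le> 3" and \<beta>: "0 < \<beta>" "\<beta> < 1"
  shows "norm (1 / Complex \<beta> (y + \<theta>) - 1 / (\<i> * of_real y)) \<le> 8 / y^2"
proof -
  define \<rho> where "\<rho> = Complex \<beta> (y + \<theta>)"
  have \<rho>_ge: "norm \<rho> \<ge> y / 2" using abs_Im_le_cmod[of \<rho>] \<theta> y by (simp add: \<rho>_def abs_le_iff)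
  have "\<rho> - \<i> * of_real y = Complex \<beta> \<theta>" by (simp add: \<rho>_def complex_eq_iff)
  hence "norm (\<i> * of_real y - \<rho>) \<le> \<bar>\<beta>\<bar> + \<bar>\<theta>\<bar>" using cmod_le[of "Complex \<beta> \<theta>"] by (simp add: norm_minus_commute)
  moreover have "1 / \<rho> - 1 / (\<i> * of_real y) = (\<i> * of_real y - \<rho>) / (\<rho> * (\<i> * of_real y))"
  proof -
    have "\<rho> \<noteq> 0" using \<rho>_ge y by auto
    thus ?thesis using y by (simp add: diff_frac_eq)
  qed
  ultimately have "norm (1 / \<rho> - 1 / (\<i> * of_real y)) \<le> 4 / (y / 2 * y)"
    using \<rho>_ge y \<beta> \<theta> by (simp only: norm_divide, intro frac_le) (auto simp: norm_mult)
  thus ?thesis by (simp add: \<rho>_def power2_eq_square)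
qed

lemma Re_exp_div_approx:
  fixes y \<beta> \<theta> u :: real
  assumes "y \<ge> 10" "\<bar>\<theta>\<bar> \<le> 3" "0 < \<beta>" "\<beta> < 1"
  defines "\<rho> \<equiv> Complex \<beta> (y + \<theta>)"
  shows "\<bar>Re (exp (\<rho> * of_real u) / \<rho>) - exp (\<beta> * u) / y * Im (cis (\<theta> * u) * cis (y * u))\<bar> \<le> 8 * exp (\<beta> * u) / y^2"
proof -
  define e where "e = exp (\<rho> * of_real u)"
  have "\<rho> * of_real u = of_real (\<beta> * u) + \<i> * of_real (\<theta> * u + y * u)"
    by (simp add: \<rho>_def complex_eq_iff algebra_simps)
  hence e: "e = of_real (exp (\<beta> * u)) * (cis (\<theta> * u) * cis (y * u))"
    by (simp only: e_def exp_add exp_of_real cis_mult) (simp only: cis_conv_exp)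
  have "exp (\<beta> * u) / y * Im (cis (\<theta> * u) * cis (y * u)) = Re (e / (\<i> * of_real y))"
    unfolding e by (simp add: Re_divide power2_eq_square)
  hence "\<bar>Re (e / \<rho>) - exp (\<beta> * u) / y * Im (cis (\<theta> * u) * cis (y * u))\<bar> = \<bar>Re (e * (1 / \<rho> - 1 / (\<i> * of_real y)))\<bar>"
    by (simp add: right_diff_distrib)
  also have "... \<le> norm e * norm (1 / \<rho> - 1 / (\<i> * of_real y))" unfolding norm_mult[symmetric] by (rule abs_Re_le_cmod)
  also have "... \<le> norm e * (8 / y^2)"
    unfolding \<rho>_def by (intro mult_left_mono norm_inverse_diff_imaginary_le assms) auto
  finally show ?thesis unfolding e_def[symmetric] by (simp add: e norm_mult mult.commute)
qed

lemma zero_block_approx: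
  fixes \<gamma> \<beta> \<theta> u :: real and K :: nat
  assumes \<gamma>: "\<gamma> \<ge> 10" and \<theta>: "\<bar>\<theta>\<bar> \<le> 3" and \<beta>: "0 < \<beta>" "\<beta> < 1"
  defines "\<rho> \<equiv> \<lambda>k. Complex \<beta> (real k * \<gamma> + \<theta>)"
  shows "\<bar>(\<Sum>k=1..K. 2 * Re (of_nat (k * (K + 1 - k)) * exp (\<rho> k * of_real u) / \<rho> k)) -
     2 * (exp (\<beta> * u) / \<gamma>) * Im (cis (\<theta> * u) * fejer_sum K (\<gamma> * u))\<bar> \<le> 16 * (exp (\<beta> * u) / \<gamma>) * (real K ^ 2 / \<gamma>)"
proof -
  define a where "a k = real K + 1 - real k" for k
  define E where "E k = Re (exp (\<rho> k * of_real u) / \<rho> k) - exp (\<beta> * u) / (real k * \<gamma>) * Im (cis (\<theta> * u) * cis (real k * \<gamma> * u))" for k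
  have "2 * Re (of_nat (k * (K + 1 - k)) * exp (\<rho> k * of_real u) / \<rho> k)
      = 2 * (real k * a k) * E k + 2 * (exp (\<beta> * u) / \<gamma>) * Im (cis (\<theta> * u) * (of_real (a k) * cis (real k * (\<gamma> * u))))" if k: "k \<in> {1..K}" for k
  proof -
    have "of_nat (k * (K + 1 - k)) * exp (\<rho> k * of_real u) / \<rho> k = of_real (real k * a k) * (exp (\<rho> k * of_real u) / \<rho> k)"
      using k by (simp add: a_def of_nat_diff)
    hence "Re (of_nat (k * (K + 1 - k)) * exp (\<rho> k * of_real u) / \<rho> k) = real k * a k * Re (exp (\<rho> k * of_real u) / \<rho> k)"
      by (simp only: Re_complex_of_real Im_complex_of_real times_complex.simps)
    moreover have "Im (cis (\<theta> * u) * (of_real (a k) * cis (real k * (\<gamma> * u)))) = a k * Im (cis (\<theta> * u) * cis (real k * \<gamma> * u))"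
      by (simp add: algebra_simps)
    ultimately show ?thesis using k \<gamma> by (simp add: E_def field_simps)
  qed
  hence "(\<Sum>k=1..K. 2 * Re (of_nat (k * (K + 1 - k)) * exp (\<rho> k * of_real u) / \<rho> k)) = (\<Sum>k=1..K. 2 * (real k * a k) * E k +
      2 * (exp (\<beta> * u) / \<gamma>) * Im (cis (\<theta> * u) * (of_real (a k) * cis (real k * (\<gamma> * u)))))" by (rule sum.cong[OF refl])
  hence "(\<Sum>k=1..K. 2 * Re (of_nat (k * (K + 1 - k)) * exp (\<rho> k * of_real u) / \<rho> k)) -
     2 * (exp (\<beta> * u) / \<gamma>) * Im (cis (\<theta> * u) * fejer_sum K (\<gamma> * u)) = (\<Sum>k=1..K. 2 * (real k * a k) * E k)"
    unfolding fejer_sum_def a_def sum_distrib_left Im_sum sum.distrib by simp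
  also have "\<bar>...\<bar> \<le> (\<Sum>k=1..K. 16 * exp (\<beta> * u) / \<gamma>^2 * real K)"
  proof (rule order_trans[OF sum_abs sum_mono])
    fix k assume k: "k \<in> {1..K}"
    have "10 \<le> real k * \<gamma>" using k \<gamma> mult_mono[of 1 "real k" 10 \<gamma>] by simp
    hence "\<bar>E k\<bar> \<le> 8 * exp (\<beta> * u) / (real k * \<gamma>)^2" unfolding E_def \<rho>_def by (rule Re_exp_div_approx[OF _ \<theta> \<beta>])
    hence "\<bar>2 * (real k * a k) * E k\<bar> \<le> 2 * (real k * a k) * (8 * exp (\<beta> * u) / (real k * \<gamma>)^2)"
      unfolding abs_mult using k by (intro mult_mono) (auto simp: a_def)
    also have "... = 16 * exp (\<beta> * u) / \<gamma>^2 * (a k / real k)" using k by (simp add: power2_eq_square mult_ac)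
    also have "... \<le> 16 * exp (\<beta> * u) / \<gamma>^2 * (real K / 1)"
      using k by (intro mult_left_mono frac_le) (auto simp: a_def)
    finally show "\<bar>2 * (real k * a k) * E k\<bar> \<le> 16 * exp (\<beta> * u) / \<gamma>^2 * real K" by simp
  qed
  also have "... = 16 * (exp (\<beta> * u) / \<gamma>) * (real K ^ 2 / \<gamma>)" by (simp add: power2_eq_square)
  finally show ?thesis .
qed

lemma power8_succ_le:
  assumes "Y \<ge> (1::real)"
  shows "(Y + 1) ^ 8 \<le> Y ^ 8 + 255 * Y ^ 7"
proof -
  have power_le: "Y ^ i \<le> Y ^ 7" if "i \<le> 7" for i using that assms by (rule power_increasing)
  have "(Y + 1) ^ 8 = Y^8 + 8 * Y^7 + 28 * Y^6 + 56 * Y^5 + 70 * Y^4 + 56 * Y^3 + 28 * Y^2 + 8 * Y^1 + Y^0"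
    by (simp add: eval_nat_numeral algebra_simps)
  thus ?thesis using power_le[of 6] power_le[of 5] power_le[of 4] power_le[of 3] power_le[of 2] power_le[of 1] power_le[of 0] by linarith
qed

lemma abs_power8_diff_ge:
  assumes "x \<ge> 0" "Y \<ge> (0::real)"
  shows "\<bar>x ^ 8 - Y ^ 8\<bar> \<ge> \<bar>x - Y\<bar> * Y ^ 7"
proof -
  have "x ^ 8 - Y ^ 8 = (x - Y) * (\<Sum>i<8. Y ^ (8 - Suc i) * x ^ i)" by (rule power_diff_sumr2)
  moreover have "(\<Sum>i\<in>{0}. Y ^ (8 - Suc i) * x ^ i) \<le> (\<Sum>i<8. Y ^ (8 - Suc i) * x ^ i)"
    using assms by (intro sum_mono2) auto
  ultimately show ?thesis using assms by (simp add: abs_mult mult_left_mono)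
qed

lemma inverse_power9_le_half:
  fixes x :: real
  assumes "x \<ge> 2"
  shows "1 / x ^ 8 - 1 / x ^ 9 \<ge> 1 / (2 * x ^ 8)"
proof -
  have "1 / x ^ 9 = 1 / x ^ 8 / x" using assms by (simp add: eval_nat_numeral)
  also have "... \<le> 1 / x ^ 8 / 2" using assms by (intro divide_left_mono) auto
  finally show ?thesis by simp
qed

lemma exponent_gap_near:
  fixes Y x :: real
  assumes Y: "Y \<ge> 10 ^ 6" and x: "Y / 2 \<le> x" "x \<le> 2 * Y" and far: "(x - Y)^2 \<ge> 250000 * Y"
  shows "Y ^ 16 * (1 / x ^ 8 - 1 / x ^ 9) + x ^ 8 \<ge> 2 * Y ^ 8 + 260 * Y ^ 7 + x"
proof -
  have pos: "Y > 0" "x > 0" using Y x by auto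
  have "x ^ 8 \<le> (2 * Y) ^ 8" using x pos by (intro power_mono) auto
  also have "... = 256 * Y ^ 8" by (simp add: power_mult_distrib)
  finally have x8: "x ^ 8 \<le> 256 * Y ^ 8" .
  have "Y ^ 9 / 512 = (Y / 2) ^ 9" by (simp add: power_divide)
  also have "... \<le> x ^ 9" using x pos by (intro power_mono) auto
  finally have x9: "Y ^ 9 / 512 \<le> x ^ 9" .
  have "976 * Y ^ 7 \<le> 250000 * Y * (Y ^ 7)^2 / (256 * Y ^ 8)" using pos by (simp add: eval_nat_numeral)
  also have "... \<le> (x ^ 8 - Y ^ 8)^2 / x ^ 8"
  proof (rule frac_le[OF _ _ _ x8])
    have "250000 * Y * (Y ^ 7)^2 \<le> (x - Y)^2 * (Y ^ 7)^2" by (intro mult_right_mono far) auto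
    also have "... = (\<bar>x - Y\<bar> * Y ^ 7)^2" by (simp add: power_mult_distrib)
    also have "... \<le> \<bar>x ^ 8 - Y ^ 8\<bar>^2" using pos by (intro power_mono abs_power8_diff_ge) auto
    finally show "250000 * Y * (Y ^ 7)^2 \<le> (x ^ 8 - Y ^ 8)^2" by simp
  qed (use pos in auto)
  also have "... = (Y ^ 8)^2 / x ^ 8 + x ^ 8 - 2 * Y ^ 8" using pos by (simp add: power2_eq_square field_simps)
  also have "(Y ^ 8)^2 = Y ^ 16" by (simp flip: power_mult)
  finally have "Y ^ 16 / x ^ 8 + x ^ 8 \<ge> 2 * Y ^ 8 + 976 * Y ^ 7" by simp
  moreover have "Y ^ 16 / x ^ 9 \<le> Y ^ 16 / (Y ^ 9 / 512)" using x9 pos by (intro divide_left_mono) auto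
  hence "Y ^ 16 / x ^ 9 \<le> 512 * Y ^ 7" using pos by (simp add: eval_nat_numeral)
  moreover have "Y ^ 1 \<le> Y ^ 7" using Y by (intro power_increasing) auto
  hence "x \<le> 204 * Y ^ 7" using x pos by simp
  ultimately show ?thesis by (simp add: right_diff_distrib)
qed

lemma exponent_gap_far:
  fixes Y x :: real
  assumes Y: "Y \<ge> 10 ^ 6" and x: "x \<ge> 2" "x \<le> Y / 2 \<or> x \<ge> 2 * Y"
  shows "Y ^ 16 * (1 / x ^ 8 - 1 / x ^ 9) + x ^ 8 \<ge> 2 * Y ^ 8 + 260 * Y ^ 7 + x"
proof -
  have pos: "Y > 0" using Y by simp
  have "10 ^ 6 * Y ^ 7 \<le> Y * Y ^ 7" using Y by (intro mult_right_mono) auto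
  hence Y8: "1000000 * Y ^ 7 \<le> Y ^ 8" by (simp add: power_Suc[symmetric])
  have "x * 2 \<le> x * x ^ 7" using x(1) power_increasing[of 1 7 x] by (intro mult_left_mono) auto
  hence x8: "x \<le> x ^ 8 / 2" by (simp add: power_Suc[symmetric])
  have Y16: "Y ^ 16 / Y ^ 8 = Y ^ 8" using power_diff[of Y 8 16] pos by simp
  from x(2) have "Y ^ 16 * (1 / (2 * x ^ 8)) + x ^ 8 / 2 \<ge> 128 * Y ^ 8"
  proof
    assume "x \<le> Y / 2"
    hence "x ^ 8 \<le> (Y / 2) ^ 8" using x(1) by (intro power_mono) auto
    hence "Y ^ 16 * (1 / (2 * (Y ^ 8 / 256))) \<le> Y ^ 16 * (1 / (2 * x ^ 8))"
      using x(1) pos by (intro mult_left_mono divide_left_mono) (auto simp: power_divide)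
    moreover have "Y ^ 16 * (1 / (2 * (Y ^ 8 / 256))) = 128 * (Y ^ 16 / Y ^ 8)" by simp
    ultimately show ?thesis using Y16 zero_le_power[of x 8] x(1) by linarith
  next
    assume "x \<ge> 2 * Y"
    hence "(2 * Y) ^ 8 \<le> x ^ 8" using pos by (intro power_mono) auto
    moreover have "(2 * Y) ^ 8 = 256 * Y ^ 8" by (simp add: power_mult_distrib)
    moreover have "0 \<le> Y ^ 16 * (1 / (2 * x ^ 8))" using pos x(1) by (intro mult_nonneg_nonneg) auto
    ultimately show ?thesis by linarith
  qed
  moreover have "Y ^ 16 * (1 / (2 * x ^ 8)) \<le> Y ^ 16 * (1 / x ^ 8 - 1 / x ^ 9)"
    using pos by (intro mult_left_mono inverse_power9_le_half x(1)) auto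
  moreover have "0 \<le> Y ^ 7" using pos by simp
  ultimately show ?thesis using x8 Y8 by linarith
qed

lemma abs_power_minus_1_le:
  fixes a :: real
  assumes "0 \<le> a" "a \<le> 2"
  shows "\<bar>a ^ n - 1\<bar> \<le> 2 ^ n * real n * \<bar>a - 1\<bar>"
proof -
  have "a ^ n - 1 = (a - 1) * (\<Sum>i<n. a ^ i)" by (rule power_diff_1_eq)
  moreover have "(\<Sum>i<n. a ^ i) \<le> (\<Sum>i<n. 2 ^ n)"
  proof (rule sum_mono)
    fix i assume "i \<in> {..<n}"
    hence "a ^ i \<le> 2 ^ i" "2 ^ i \<le> (2::real) ^ n" using assms by (auto intro: power_mono power_increasing)
    thus "a ^ i \<le> 2 ^ n" by linarith
  qed
  moreover have "(\<Sum>i<n. a ^ i) \<ge> 0" using assms by (intro sum_nonneg) auto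
  ultimately show ?thesis by (simp add: abs_mult mult_left_mono mult.commute)
qed

lemma near_square_bounds:
  fixes x z :: real
  assumes "z \<ge> 1000" "\<bar>x - z^2\<bar> \<le> 500 * z"
  shows "z^2 / 2 \<le> x" "x \<le> 2 * z^2" "z \<le> x"
proof -
  have "1000 * z \<le> z^2" using assms(1) by (simp add: power2_eq_square)
  thus "z^2 / 2 \<le> x" "x \<le> 2 * z^2" "z \<le> x" using assms by (auto simp: abs_le_iff)
qed

lemma ratio_power16_close:
  fixes x z u :: real
  assumes z: "z \<ge> 1000" and x: "\<bar>x - z^2\<bar> \<le> 500 * z" and u: "(z^2) ^ 16 \<le> u" "u \<le> (z^2) ^ 16 + 1"
  shows "\<bar>u / x ^ 16 - 1\<bar> \<le> 2 ^ 30 / z"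
proof -
  note x_bounds = near_square_bounds[OF z x]
  have x0: "x > 0" "z^2 > 0" using x_bounds(3) z by auto
  define a where "a = z^2 / x"
  have a: "0 \<le> a" "a \<le> 2" using x_bounds x0 by (auto simp: a_def divide_le_eq)
  have "\<bar>a - 1\<bar> = \<bar>x - z^2\<bar> / x" using x0 by (simp add: a_def field_simps abs_minus_commute)
  also have "... \<le> (500 * z) / (z^2 / 2)" using x x_bounds x0 by (intro frac_le) auto
  also have "... = 1000 / z" using z by (simp add: power2_eq_square)
  finally have "2 ^ 16 * real 16 * \<bar>a - 1\<bar> \<le> 2 ^ 16 * real 16 * (1000 / z)" by (intro mult_left_mono) auto
  hence "\<bar>a ^ 16 - 1\<bar> \<le> 2 ^ 20 * 1000 / z" using abs_power_minus_1_le[OF a, of 16] by simp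
  moreover have "\<bar>u / x ^ 16 - a ^ 16\<bar> \<le> 1 / z"
  proof -
    have "u / x ^ 16 - a ^ 16 = (u - (z^2) ^ 16) / x ^ 16" by (simp add: a_def power_divide diff_divide_distrib)
    hence "\<bar>u / x ^ 16 - a ^ 16\<bar> = (u - (z^2) ^ 16) / x ^ 16" using u x0 by simp
    also have "... \<le> 1 / x ^ 1" using u x0 x_bounds(3) z by (intro frac_le power_increasing) auto
    also have "... \<le> 1 / z" using x_bounds(3) z by (simp add: divide_left_mono)
    finally show ?thesis .
  qed
  ultimately have "\<bar>u / x ^ 16 - 1\<bar> \<le> 2 ^ 20 * 1000 / z + 1 / z" by linarith
  also have "... \<le> 2 ^ 30 / z" using z unfolding add_divide_distrib[symmetric] by (intro divide_right_mono) auto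
  finally show ?thesis .
qed

lemma ratio_power17_small:
  fixes x z u :: real
  assumes z: "z \<ge> 1000" and x: "\<bar>x - z^2\<bar> \<le> 500 * z" and u: "u \<le> (z^2) ^ 16 + 1"
  shows "u / x ^ 17 \<le> 2 ^ 18 / z"
proof -
  have z2: "z^2 \<ge> 1" "z \<le> z^2" using z by (auto simp: power2_eq_square intro: mult_mono[of 1 z 1 z, simplified])
  have "u / x ^ 17 \<le> (2 * (z^2) ^ 16) / (z^2 / 2) ^ 17"
  proof (intro frac_le)
    show "u \<le> 2 * (z^2) ^ 16" using u one_le_power[OF z2(1), of 16] by linarith
    show "(z^2 / 2) ^ 17 \<le> x ^ 17" using near_square_bounds(1)[OF z x] by (intro power_mono) auto
  qed (use z in auto)
  also have "... = 2 ^ 18 / z^2" using z by (simp add: power_divide eval_nat_numeral)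
  also have "... \<le> 2 ^ 18 / z" using z z2 by (intro divide_left_mono) auto
  finally show ?thesis .
qed

lemma eventually_const_mult_le:
  fixes f :: "real \<Rightarrow> real"
  assumes "(f \<longlongrightarrow> 0) F" "e > 0"
  shows "\<forall>\<^sub>F y in F. C * f y \<le> e"
proof -
  have "((\<lambda>y. C * f y) \<longlongrightarrow> C * 0) F" by (intro tendsto_intros assms)
  hence "\<forall>\<^sub>F y in F. C * f y < e" using assms(2) by (intro order_tendstoD(2)) auto
  thus ?thesis by (rule eventually_mono) simp
qed

lemma summable_power_exp: "summable (\<lambda>j. real j ^ n * exp (- real j))"
proof (rule summable_comparison_test_ev)
  have "\<forall>\<^sub>F j in sequentially. real j ^ n * exp (- real j) \<le> 1 / real j ^ 2" by real_asymp
  thus "\<forall>\<^sub>F j in sequentially. norm (real j ^ n * exp (- real j)) \<le> 1 / real j ^ 2" by (rule eventually_mono) simp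
  show "summable (\<lambda>j. 1 / real j ^ 2)" using inverse_power_summable[of 2, where ?'a = real] by (simp add: field_simps)
qed

section \<open>The race on almost all dyadic scales\<close>

locale race =
  fixes \<sigma> \<xi> :: real and \<gamma> d \<theta> :: "nat \<Rightarrow> real" and J :: nat
  assumes J: "J \<ge> 2" and \<sigma>: "1/2 < \<sigma>" "\<sigma> < 1" and \<xi>: "\<xi> = 0 \<or> \<xi> = pi"
    and \<gamma>: "\<And>j. j \<ge> J \<Longrightarrow> exp (real j ^ 8) \<le> \<gamma> j \<and> \<gamma> j \<le> 2 * exp (real j ^ 8)"
    and d: "\<And>j. j \<ge> J \<Longrightarrow> \<bar>d j - 1 / real j ^ 8\<bar> \<le> 1 / real j ^ 9"
    and \<theta>: "\<And>j. j \<ge> J \<Longrightarrow> \<bar>\<theta> j - (\<xi> - pi / 2) / real j ^ 16\<bar> \<le> 1 / real j ^ 17"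
    and d\<sigma>: "\<And>j. j \<ge> J \<Longrightarrow> d j < \<sigma> - 1/2"
begin

definition block_size :: "nat \<Rightarrow> real \<Rightarrow> real" where
  "block_size j u = exp ((\<sigma> - d j) * u) / \<gamma> j"

definition block_phase :: "nat \<Rightarrow> real \<Rightarrow> real" where
  "block_phase j u = \<theta> j * u - (\<xi> - pi / 2)"

definition block_kernel :: "nat \<Rightarrow> real \<Rightarrow> real" where
  "block_kernel j u = 2 * Re (cis (block_phase j u) * fejer_sum (j ^ 3) (\<gamma> j * u))"

definition block_bound :: "real \<Rightarrow> nat \<Rightarrow> real" where
  "block_bound u j = block_size j u * (block_kernel j u + (16 + 96 * u) * (real j ^ 6 / \<gamma> j))"

lemma xi_bound: "\<bar>\<xi> - pi / 2\<bar> \<le> 2"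
  using \<xi> pi_less_4 pi_gt_zero by (elim disjE) linarith+

lemma j_ge: "j \<ge> J \<Longrightarrow> real j \<ge> 2" using J by simp

lemma gamma_ge:
  assumes "j \<ge> J"
  shows "\<gamma> j \<ge> 100" "\<gamma> j > 0"
proof -
  have "(2::real) ^ 8 \<le> real j ^ 8" using j_ge[OF assms] by (intro power_mono) auto
  hence "256 \<le> real j ^ 8" by simp
  thus "\<gamma> j \<ge> 100" "\<gamma> j > 0" using \<gamma>[OF assms] exp_ge_add_one_self[of "real j ^ 8"] by linarith+
qed

lemma d_lower: "j \<ge> J \<Longrightarrow> d j \<ge> 1 / real j ^ 8 - 1 / real j ^ 9"
  using d[of j] by (auto simp: abs_le_iff)

lemma d_nonneg:
  assumes "j \<ge> J"
  shows "d j \<ge> 0"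
proof -
  have "0 \<le> 1 / (2 * real j ^ 8)" by simp
  thus ?thesis using d_lower[OF assms] inverse_power9_le_half[OF j_ge[OF assms]] by linarith
qed

lemma beta_bounds: "j \<ge> J \<Longrightarrow> \<sigma> - d j > 1/2" "j \<ge> J \<Longrightarrow> \<sigma> - d j < 1"
  using d\<sigma>[of j] d_nonneg[of j] \<sigma> by auto

lemma theta_bound:
  assumes "j \<ge> J"
  shows "\<bar>\<theta> j\<bar> \<le> 3"
proof -
  have pow: "1 \<le> real j ^ n" for n using j_ge[OF assms] by (auto intro: one_le_power)
  have "\<bar>(\<xi> - pi / 2) / real j ^ 16\<bar> \<le> 2 / 1"
    unfolding abs_divide using xi_bound pow[of 16] by (intro frac_le) auto
  moreover have "1 / real j ^ 17 \<le> 1 / 1" using pow[of 17] by (intro frac_le) auto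
  ultimately show ?thesis using \<theta>[OF assms] by linarith
qed

lemma block_size_pos: "j \<ge> J \<Longrightarrow> block_size j u > 0" using gamma_ge by (simp add: block_size_def)

lemma block_size_eq_exp: "j \<ge> J \<Longrightarrow> block_size j u = exp ((\<sigma> - d j) * u - ln (\<gamma> j))"
  using gamma_ge(2) by (simp add: block_size_def exp_diff)

lemma abs_block_kernel_le: "\<bar>block_kernel j u\<bar> \<le> 2 * real j ^ 6"
proof -
  have "\<bar>Re (cis (block_phase j u) * fejer_sum (j ^ 3) (\<gamma> j * u))\<bar> \<le> norm (cis (block_phase j u) * fejer_sum (j ^ 3) (\<gamma> j * u))"
    by (rule abs_Re_le_cmod)
  also have "... \<le> real (j ^ 3) ^ 2" using norm_fejer_sum_le_square[of "j ^ 3" "\<gamma> j * u"] by (simp add: norm_mult)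
  also have "... = real j ^ 6" by (simp flip: power_mult)
  finally show ?thesis by (simp add: block_kernel_def)
qed

lemma block_approx:
  assumes j: "j \<ge> J"
  shows "\<bar>(\<Sum>k=1..j^3. 2 * Re (of_nat (k * (j^3 + 1 - k)) * exp (rho \<sigma> \<gamma> d \<theta> j k * of_real u) / rho \<sigma> \<gamma> d \<theta> j k))
     + cos \<xi> * (block_size j u * block_kernel j u)\<bar> \<le> 16 * (block_size j u * (real j ^ 6 / \<gamma> j))"
proof -
  define D where "D = fejer_sum (j^3) (\<gamma> j * u)"
  have "cis (\<theta> j * u) = cis (block_phase j u) * cis (\<xi> - pi / 2)" by (simp add: cis_mult block_phase_def)
  moreover have "cis (\<xi> - pi / 2) = - of_real (cos \<xi>) * \<i>" using \<xi> by (auto simp: complex_eq_iff cos_diff sin_diff)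
  ultimately have "cis (\<theta> j * u) * D = - of_real (cos \<xi>) * \<i> * (cis (block_phase j u) * D)" by simp
  hence Im: "Im (cis (\<theta> j * u) * D) = - (cos \<xi> * block_kernel j u) / 2" by (simp add: block_kernel_def D_def)
  have "2 * (exp ((\<sigma> - d j) * u) / \<gamma> j) * Im (cis (\<theta> j * u) * D) = - (cos \<xi> * (block_size j u * block_kernel j u))"
    unfolding Im block_size_def by simp
  moreover have "16 * (exp ((\<sigma> - d j) * u) / \<gamma> j) * (real (j ^ 3) ^ 2 / \<gamma> j) = 16 * (block_size j u * (real j ^ 6 / \<gamma> j))"
    by (simp add: block_size_def flip: power_mult)
  ultimately show ?thesis
    using zero_block_approx[of "\<gamma> j" "\<theta> j" "\<sigma> - d j" "j^3" u] gamma_ge[OF j] theta_bound[OF j] beta_bounds[OF j]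
    unfolding D_def[symmetric] rho_def by linarith
qed

lemma d_times_log_le:
  assumes Y: "Y \<ge> 1" "Y \<le> real j" and j: "j \<ge> J" and u: "0 \<le> u" "u \<le> Y ^ 16 + 1"
  shows "d j * u \<le> Y ^ 8 + Y ^ 7 + 2"
proof -
  have "d j \<le> 1 / real j ^ 8 + 1 / real j ^ 9" using d[OF j] by (auto simp: abs_le_iff)
  also have "... \<le> 1 / Y ^ 8 + 1 / Y ^ 9" using Y by (intro add_mono divide_left_mono power_mono mult_pos_pos) auto
  finally have "d j * u \<le> (1 / Y ^ 8 + 1 / Y ^ 9) * (Y ^ 16 + 1)"
    using u Y d_nonneg[OF j] by (intro mult_mono) auto
  also have "... = Y ^ 16 / Y ^ 8 + Y ^ 16 / Y ^ 9 + 1 / Y ^ 8 + 1 / Y ^ 9" by (simp add: distrib_left distrib_right)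
  also have "... = Y ^ 8 + Y ^ 7 + 1 / Y ^ 8 + 1 / Y ^ 9" using power_diff[of Y 8 16] power_diff[of Y 9 16] Y by simp
  also have "... \<le> Y ^ 8 + Y ^ 7 + 2"
  proof -
    have "1 / Y ^ 8 \<le> 1 / 1" "1 / Y ^ 9 \<le> 1 / 1" using Y by (auto intro!: frac_le simp: one_le_power)
    thus ?thesis by linarith
  qed
  finally show ?thesis .
qed

lemma block_size_ceiling_ge:
  assumes Y: "Y \<ge> 1" and j: "j = nat \<lceil>Y\<rceil>" "j \<ge> J" and u: "Y ^ 16 \<le> u" "u \<le> Y ^ 16 + 1"
  shows "block_size j u \<ge> exp (\<sigma> * u - 2 * Y ^ 8 - 259 * Y ^ 7)"
proof -
  have jY: "Y \<le> real j" "real j \<le> Y + 1" using j Y by linarith+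
  have "0 \<le> Y ^ 16" using Y by simp
  hence "d j * u \<le> Y ^ 8 + Y ^ 7 + 2" using d_times_log_le[OF Y jY(1) j(2) _ u(2)] u(1) by linarith
  moreover have "ln (\<gamma> j) \<le> ln (2 * exp (real j ^ 8))" using \<gamma>[OF j(2)] gamma_ge(2)[OF j(2)] by (subst ln_le_cancel_iff) auto
  hence "ln (\<gamma> j) \<le> ln 2 + real j ^ 8" by (simp add: ln_mult)
  moreover have "real j ^ 8 \<le> (Y + 1) ^ 8" using jY Y by (intro power_mono) auto
  moreover have "1 \<le> Y ^ 7" using Y by (rule one_le_power)
  ultimately have "(\<sigma> - d j) * u - ln (\<gamma> j) \<ge> \<sigma> * u - 2 * Y ^ 8 - 259 * Y ^ 7"
    using power8_succ_le[OF Y] ln_2_less_1 by (simp add: left_diff_distrib)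
  thus ?thesis by (simp add: block_size_eq_exp[OF j(2)])
qed

lemma block_size_irrelevant_le:
  assumes z: "z \<ge> 1000" and j: "j \<ge> J" "\<bar>real j - z^2\<bar> > 500 * z" and u: "(z^2) ^ 16 \<le> u"
  shows "block_size j u \<le> exp (\<sigma> * u - 2 * (z^2) ^ 8 - 260 * (z^2) ^ 7 - real j)"
proof -
  define Y where "Y = z^2"
  have Y: "Y \<ge> 10 ^ 6" using z power_mono[of 1000 z 2] by (simp add: Y_def)
  have "(500 * z)^2 \<le> \<bar>real j - Y\<bar>^2" unfolding Y_def using j z by (intro power_mono) auto
  hence far: "(real j - Y)^2 \<ge> 250000 * Y" by (simp add: power_mult_distrib Y_def)
  have "ln (\<gamma> j) \<ge> real j ^ 8" using \<gamma>[OF j(1)] gamma_ge(2)[OF j(1)] by (metis exp_gt_zero ln_exp ln_le_cancel_iff)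
  moreover have "d j * u \<ge> Y ^ 16 * (1 / real j ^ 8 - 1 / real j ^ 9)"
  proof -
    have "d j * u \<ge> d j * Y ^ 16" using u d_nonneg[OF j(1)] by (intro mult_left_mono) (auto simp: Y_def)
    moreover have "(1 / real j ^ 8 - 1 / real j ^ 9) * Y ^ 16 \<le> d j * Y ^ 16"
      using d_lower[OF j(1)] by (intro mult_right_mono) (auto simp: Y_def)
    ultimately show ?thesis by (simp add: mult.commute)
  qed
  moreover have "Y ^ 16 * (1 / real j ^ 8 - 1 / real j ^ 9) + real j ^ 8 \<ge> 2 * Y ^ 8 + 260 * Y ^ 7 + real j"
    using exponent_gap_near[OF Y _ _ far] exponent_gap_far[OF Y j_ge[OF j(1)]] by linarith
  ultimately have "(\<sigma> - d j) * u - ln (\<gamma> j) \<le> \<sigma> * u - 2 * Y ^ 8 - 260 * Y ^ 7 - real j" by (simp add: left_diff_distrib)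
  thus ?thesis unfolding block_size_eq_exp[OF j(1)] Y_def by simp
qed

lemma abs_block_phase_le:
  assumes z: "z \<ge> 1000" and j: "j \<ge> J" "\<bar>real j - z^2\<bar> \<le> 500 * z" and u: "(z^2) ^ 16 \<le> u" "u \<le> (z^2) ^ 16 + 1"
  shows "\<bar>block_phase j u\<bar> \<le> 2 ^ 40 / z"
proof -
  have "0 \<le> (z^2) ^ 16" by simp
  hence u0: "u \<ge> 0" using u(1) by linarith
  have "block_phase j u = (\<theta> j - (\<xi> - pi / 2) / real j ^ 16) * u + (\<xi> - pi / 2) * (u / real j ^ 16 - 1)"
    by (simp add: block_phase_def algebra_simps)
  also have "\<bar>...\<bar> \<le> \<bar>\<theta> j - (\<xi> - pi / 2) / real j ^ 16\<bar> * u + \<bar>\<xi> - pi / 2\<bar> * \<bar>u / real j ^ 16 - 1\<bar>"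
    using u0 by (simp add: abs_mult order_trans[OF abs_triangle_ineq])
  also have "... \<le> 1 / real j ^ 17 * u + 2 * (2 ^ 30 / z)"
    using \<theta>[OF j(1)] xi_bound ratio_power16_close[OF z j(2) u] u0 z by (intro add_mono mult_mono) auto
  also have "... \<le> 2 ^ 18 / z + 2 * (2 ^ 30 / z)" using ratio_power17_small[OF z j(2) u(2)] by simp
  also have "... = (2 ^ 18 + 2 * 2 ^ 30) / z" by (simp add: add_divide_distrib)
  also have "... \<le> 2 ^ 40 / z" using z by (intro divide_right_mono) auto
  finally show ?thesis .
qed

definition relevant :: "real \<Rightarrow> nat set" where
  "relevant y = {j. \<bar>real j - y ^ 16\<bar> \<le> 500 * y ^ 8}"

definition relevant_mass :: "real \<Rightarrow> real \<Rightarrow> real" where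
  "relevant_mass y u = (\<Sum>j\<in>relevant y. block_size j u * real j ^ 3)"

definition resonant :: "real \<Rightarrow> real \<Rightarrow> nat \<Rightarrow> bool" where
  "resonant t u j \<longleftrightarrow> norm (cis (\<gamma> j * u) - 1) < t"

definition large_scale :: "real \<Rightarrow> bool" where
  "large_scale y \<longleftrightarrow> y \<ge> 2 ^ 49 \<and> 2 * real J \<le> y ^ 16 \<and>
     (112 + 96 * (y ^ 16) ^ 16) * (8 * (y ^ 16) ^ 3 * exp (- ((y ^ 16 / 2) ^ 8))) \<le> 1/64 \<and>
     (114 + 96 * (y ^ 16) ^ 16) * exp (- ((y ^ 16) ^ 7)) * (\<Sum>j. real j ^ 6 * exp (- real j)) \<le> 1/64"

lemma eventually_large_scale: "eventually large_scale at_top"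
proof -
  define S where "S = (\<Sum>j. real j ^ 6 * exp (- real j))"
  have "((\<lambda>y::real. (114 + 96 * (y ^ 16) ^ 16) * exp (- ((y ^ 16) ^ 7))) \<longlongrightarrow> 0) at_top" by real_asymp
  from eventually_const_mult_le[OF this, of "1/64" S]
  have "\<forall>\<^sub>F y::real in at_top. (114 + 96 * (y ^ 16) ^ 16) * exp (- ((y ^ 16) ^ 7)) * S \<le> 1/64" by (simp add: mult_ac)
  moreover have "\<forall>\<^sub>F y::real in at_top. y \<ge> 2 ^ 49" "\<forall>\<^sub>F y::real in at_top. 2 * real J \<le> y ^ 16"
    "\<forall>\<^sub>F y::real in at_top. (112 + 96 * (y ^ 16) ^ 16) * (8 * (y ^ 16) ^ 3 * exp (- ((y ^ 16 / 2) ^ 8))) \<le> 1/64"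
    by real_asymp+
  ultimately show ?thesis unfolding large_scale_def S_def by (intro eventually_conj)
qed

lemma large_scale_ge:
  assumes "large_scale y"
  shows "y \<ge> 2 ^ 49" "y > 0" "y ^ n \<ge> 1" "y ^ 8 \<ge> 1000" "y ^ 16 = (y ^ 8)^2"
proof -
  show y: "y \<ge> 2 ^ 49" using assms by (simp add: large_scale_def)
  thus "y > 0" "y ^ n \<ge> 1" by (auto intro!: one_le_power)
  have "y ^ 1 \<le> y ^ 8" using y by (intro power_increasing) auto
  thus "y ^ 8 \<ge> 1000" using y by simp
qed (simp flip: power_mult)

lemma relevant_bounds:
  assumes "large_scale y" "j \<in> relevant y"
  shows "y ^ 16 / 2 \<le> real j" "real j \<le> 2 * y ^ 16" "j \<ge> J"
proof -
  note ls = large_scale_ge[OF assms(1)]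
  have "\<bar>real j - (y ^ 8)^2\<bar> \<le> 500 * y ^ 8" using assms(2) unfolding relevant_def ls(5) by blast
  from near_square_bounds[OF ls(4) this] show "y ^ 16 / 2 \<le> real j" "real j \<le> 2 * y ^ 16" unfolding ls(5) by fast+
  moreover have "2 * real J \<le> y ^ 16" using assms(1) by (simp add: large_scale_def)
  ultimately show "j \<ge> J" by linarith
qed

lemma finite_relevant: "finite (relevant y)" (is ?finite)
  and card_relevant_le: "y \<ge> 1 \<Longrightarrow> real (card (relevant y)) \<le> 1000 * y ^ 8 + 1" (is "_ \<Longrightarrow> ?card")
proof -
  define lo hi where "lo = \<lceil>y ^ 16 - 500 * y ^ 8\<rceil>" and "hi = \<lfloor>y ^ 16 + 500 * y ^ 8\<rfloor>"
  have sub: "int ` relevant y \<subseteq> {lo..hi}"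
    by (auto simp: relevant_def lo_def hi_def abs_le_iff ceiling_le_iff le_floor_iff)
  have "finite (int ` relevant y)" using sub by (rule finite_subset) simp
  thus ?finite by (rule finite_imageD) (simp add: inj_on_def)
  assume "y \<ge> 1"
  have "card (relevant y) = card (int ` relevant y)" by (simp add: card_image inj_on_def)
  also have "... \<le> card {lo..hi}" using sub by (intro card_mono) auto
  finally have "real (card (relevant y)) \<le> real (nat (hi - lo + 1))" by simp
  also have "... \<le> 1000 * y ^ 8 + 1" using zero_le_power[of y 8] \<open>y \<ge> 1\<close> unfolding lo_def hi_def by linarith
  finally show ?card .
qed

lemma ceiling_relevant:
  assumes "large_scale y"
  shows "nat \<lceil>y ^ 16\<rceil> \<in> relevant y"
proof -
  have "\<bar>real (nat \<lceil>y ^ 16\<rceil>) - y ^ 16\<bar> \<le> 1" using large_scale_ge(3)[OF assms, of 16] by linarith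
  thus ?thesis using large_scale_ge(4)[OF assms] by (simp add: relevant_def)
qed

lemma relevant_mass_pos:
  assumes "large_scale y"
  shows "relevant_mass y u > 0"
  unfolding relevant_mass_def
proof (rule sum_pos)
  fix j assume "j \<in> relevant y"
  from relevant_bounds(3)[OF assms this] show "block_size j u * real j ^ 3 > 0" using block_size_pos J by simp
qed (use finite_relevant ceiling_relevant[OF assms] in auto)

lemma sums_relevant:
  fixes F :: "nat \<Rightarrow> real"
  assumes "large_scale y"
  shows "(\<lambda>i. if i + J \<in> relevant y then F (i + J) else 0) sums (\<Sum>j\<in>relevant y. F j)"
proof -
  have inj: "inj_on (\<lambda>i. i + J) {i. i + J \<in> relevant y}" by (auto simp: inj_on_def)
  have img: "(\<lambda>i. i + J) ` {i. i + J \<in> relevant y} = relevant y"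
    using relevant_bounds(3)[OF assms] by (auto simp: image_iff) (metis le_add_diff_inverse2)
  have "finite {i. i + J \<in> relevant y}" using finite_relevant inj img finite_imageD by metis
  from sums_If_finite_set[OF this, of "\<lambda>i. F (i + J)"] show ?thesis using sum.reindex[OF inj, of F] img by simp
qed

end

locale race_scale = race +
  fixes y u :: real
  assumes large: "large_scale y" and u: "(y ^ 16) ^ 16 \<le> u" "u \<le> (y ^ 16) ^ 16 + ln 2"
    and not_resonant: "\<And>j. j \<in> relevant y \<Longrightarrow> \<not> resonant (1 / y ^ 12) u j"
    and few_resonant: "(\<Sum>j\<in>relevant y. block_size j ((y ^ 16) ^ 16) * real j ^ 3 * of_bool (resonant (1 / y ^ 6) u j))
      \<le> relevant_mass y ((y ^ 16) ^ 16) / y ^ 5"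
begin

abbreviation Y :: real where "Y \<equiv> y ^ 16"

lemma u_bounds: "0 \<le> u" "u \<le> Y ^ 16 + 1"
proof -
  have "0 \<le> Y ^ 16" using large_scale_ge(2)[OF large] by simp
  thus "0 \<le> u" "u \<le> Y ^ 16 + 1" using u ln_2_less_1 by linarith+
qed

lemma abs_block_phase_relevant_le: "j \<in> relevant y \<Longrightarrow> \<bar>block_phase j u\<bar> \<le> 2 ^ 40 / y ^ 8"
  using u(1) u_bounds(2) relevant_bounds(3)[OF large] unfolding relevant_def large_scale_ge(5)[OF large]
  by (intro abs_block_phase_le[OF large_scale_ge(4)[OF large]]) auto

text \<open>Away from all multiples of \<open>2\<pi>\<close> the Fejer sum is so close to \<open>- (j\<^sup>3 + 1) / 2\<close> that the phase error,
  which is \<open>O(1 / y\<^sup>8)\<close>, only matters for the few \<open>j\<close> with a coarse resonance.\<close>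

lemma block_kernel_relevant_le:
  assumes j: "j \<in> relevant y"
  shows "block_kernel j u \<le> real j ^ 3 * (- 15/64 + 2 ^ 42 * y ^ 4 * of_bool (resonant (1 / y ^ 6) u j))"
proof -
  define q where "q = norm (cis (\<gamma> j * u) - 1)"
  note ls = large_scale_ge[OF large] and y0 = large_scale_ge(2)[OF large]
  have fine: "1 / y ^ 12 \<le> q" using not_resonant[OF j] by (simp add: resonant_def q_def)
  have "0 < 1 / y ^ 12" using y0 by simp
  hence q: "q > 0" "1 / q \<le> y ^ 12" using fine frac_le[OF _ order_refl _ fine, of 1] by (linarith, simp)
  have coarse: "1 / q \<le> y ^ 6 + y ^ 12 * of_bool (resonant (1 / y ^ 6) u j)"
  proof (cases "resonant (1 / y ^ 6) u j")
    case False
    hence "1 / y ^ 6 \<le> q" by (simp add: resonant_def q_def)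
    thus ?thesis using False frac_le[of 1 1 "1 / y ^ 6" q] y0 by simp
  qed (use q(2) y0 in \<open>simp add: add_increasing\<close>)
  have "8 / q^2 = 8 * (1 / q)^2" by (simp add: power_divide)
  also have "... \<le> 8 * (y ^ 12)^2" using q by (intro mult_left_mono power_mono) auto
  also have "... = 64 * y ^ 24 / 8" by (simp flip: power_mult)
  also have "... \<le> y ^ 24 * y ^ 24 / 8"
    using ls(4) power_increasing[of 8 24 y] ls(3)[of 1] y0 by (intro divide_right_mono mult_right_mono) auto
  also have "... = (Y / 2) ^ 3" by (simp add: power_divide flip: power_mult power_add)
  also have "... \<le> real j ^ 3" using relevant_bounds(1)[OF large j] y0 by (intro power_mono) auto
  finally have K: "8 / q^2 \<le> real (j ^ 3)" by simp
  have "\<bar>block_phase j u\<bar> \<le> 2 ^ 40 / y ^ 8" by (rule abs_block_phase_relevant_le[OF j])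
  also have "... \<le> 1" using power_mono[OF ls(1), of 8] y0 by (simp add: divide_le_eq)
  finally have "block_kernel j u \<le> - real (j ^ 3) / 4 + 4 * \<bar>block_phase j u\<bar> * real (j ^ 3) / q"
    unfolding block_kernel_def q_def using q(1) K by (intro Re_rotated_fejer_sum_le) (auto simp: q_def)
  also have "... = real j ^ 3 * (- 1/4 + 4 * (\<bar>block_phase j u\<bar> * (1 / q)))" by (simp add: algebra_simps)
  also have "... \<le> real j ^ 3 * (- 1/4 + 4 * (2 ^ 40 / y ^ 8 * (y ^ 6 + y ^ 12 * of_bool (resonant (1 / y ^ 6) u j))))"
    using coarse q(1) y0 by (intro mult_left_mono add_left_mono mult_mono abs_block_phase_relevant_le j) auto
  also have "4 * (2 ^ 40 / y ^ 8 * (y ^ 6 + y ^ 12 * of_bool (resonant (1 / y ^ 6) u j)))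
      = 2 ^ 42 / y ^ 2 + 2 ^ 42 * y ^ 4 * of_bool (resonant (1 / y ^ 6) u j)"
    using y0 power_diff[of y 6 8] power_diff[of y 8 12] by (simp add: field_simps flip: power_add)
  also have "2 ^ 42 / y ^ 2 \<le> 1/64" using power_mono[OF ls(1), of 2] y0 by (simp add: divide_le_eq)
  finally show ?thesis by (simp add: mult_left_mono)
qed

lemma correction_relevant_le:
  assumes j: "j \<in> relevant y"
  shows "(16 + 96 * u) * (real j ^ 6 / \<gamma> j) \<le> real j ^ 3 * (1/64)"
proof -
  have jJ: "j \<ge> J" by (rule relevant_bounds(3)[OF large j])
  have "(Y / 2) ^ 8 \<le> real j ^ 8" using relevant_bounds(1)[OF large j] large_scale_ge(2)[OF large] by (intro power_mono) auto
  hence "exp ((Y / 2) ^ 8) \<le> \<gamma> j" using \<gamma>[OF jJ] by (meson exp_le_cancel_iff order_trans)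
  hence "1 / \<gamma> j \<le> 1 / exp ((Y / 2) ^ 8)" using gamma_ge(2)[OF jJ] by (intro divide_left_mono mult_pos_pos) auto
  hence inv: "1 / \<gamma> j \<le> exp (- ((Y / 2) ^ 8))" by (simp only: exp_minus inverse_eq_divide)
  have "real j ^ 3 \<le> (2 * Y) ^ 3" using relevant_bounds(2)[OF large j] by (intro power_mono) auto
  also have "... = 8 * Y ^ 3" by (simp only: power_mult_distrib) simp
  finally have weight: "real j ^ 3 * (1 / \<gamma> j) \<le> 8 * Y ^ 3 * exp (- ((Y / 2) ^ 8))"
    by (rule mult_mono[OF _ inv]) (use gamma_ge(2)[OF jJ] large_scale_ge(2)[OF large] in auto)
  have "(16 + 96 * u) * (real j ^ 3 * (1 / \<gamma> j)) \<le> (112 + 96 * Y ^ 16) * (8 * Y ^ 3 * exp (- ((Y / 2) ^ 8)))"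
    by (rule mult_mono[OF _ weight]) (use u_bounds gamma_ge(2)[OF jJ] in auto)
  also have "... \<le> 1/64" using large unfolding large_scale_def by blast
  finally have "real j ^ 3 * ((16 + 96 * u) * (real j ^ 3 * (1 / \<gamma> j))) \<le> real j ^ 3 * (1/64)" by (rule mult_left_mono) simp
  moreover have "real j ^ 3 * ((16 + 96 * u) * (real j ^ 3 * (1 / \<gamma> j))) = (16 + 96 * u) * (real j ^ 6 / \<gamma> j)"
    by (simp add: mult.left_commute[of "real j ^ 3"] flip: power_add)
  ultimately show ?thesis by (simp only:)
qed

lemma block_bound_relevant_le:
  assumes "j \<in> relevant y"
  shows "block_bound u j \<le> block_size j u * real j ^ 3 * (- 7/32 + 2 ^ 42 * y ^ 4 * of_bool (resonant (1 / y ^ 6) u j))"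
proof -
  have "block_kernel j u + (16 + 96 * u) * (real j ^ 6 / \<gamma> j)
      \<le> real j ^ 3 * (- 15/64 + 2 ^ 42 * y ^ 4 * of_bool (resonant (1 / y ^ 6) u j)) + real j ^ 3 * (1/64)"
    by (intro add_mono block_kernel_relevant_le correction_relevant_le assms)
  also have "... = real j ^ 3 * (- 7/32 + 2 ^ 42 * y ^ 4 * of_bool (resonant (1 / y ^ 6) u j))" by (simp add: algebra_simps)
  finally show ?thesis unfolding block_bound_def mult.assoc[of "block_size j u"]
    by (intro mult_left_mono less_imp_le[OF block_size_pos] relevant_bounds(3)[OF large assms])
qed

lemma block_size_between:
  assumes j: "j \<in> relevant y"
  shows "block_size j (Y ^ 16) \<le> block_size j u" "block_size j u \<le> 2 * block_size j (Y ^ 16)"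
proof -
  have jJ: "j \<ge> J" by (rule relevant_bounds(3)[OF large j])
  note \<beta> = beta_bounds[OF jJ] and \<gamma>_pos = gamma_ge(2)[OF jJ]
  show "block_size j (Y ^ 16) \<le> block_size j u"
    unfolding block_size_def using u \<beta> \<gamma>_pos by (intro divide_right_mono) auto
  have "(\<sigma> - d j) * (u - Y ^ 16) \<le> 1 * ln 2" using u \<beta> by (intro mult_mono) auto
  hence "exp ((\<sigma> - d j) * u) \<le> exp ((\<sigma> - d j) * Y ^ 16 + ln 2)" by (simp add: algebra_simps)
  also have "... = 2 * exp ((\<sigma> - d j) * Y ^ 16)" by (simp add: exp_add)
  finally show "block_size j u \<le> 2 * block_size j (Y ^ 16)"
    unfolding block_size_def using \<gamma>_pos by (simp add: divide_right_mono)
qed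

lemma resonant_mass_le:
  "(\<Sum>j\<in>relevant y. block_size j u * real j ^ 3 * of_bool (resonant (1 / y ^ 6) u j)) \<le> 2 * (relevant_mass y u / y ^ 5)"
proof -
  have "(\<Sum>j\<in>relevant y. block_size j u * real j ^ 3 * of_bool (resonant (1 / y ^ 6) u j))
      \<le> (\<Sum>j\<in>relevant y. 2 * (block_size j (Y ^ 16) * real j ^ 3 * of_bool (resonant (1 / y ^ 6) u j)))"
    using block_size_between(2) by (intro sum_mono) (auto simp: of_bool_def mult.assoc[symmetric] intro!: mult_right_mono)
  also have "... \<le> 2 * (relevant_mass y (Y ^ 16) / y ^ 5)" using few_resonant by (simp flip: sum_distrib_left)
  also have "relevant_mass y (Y ^ 16) \<le> relevant_mass y u"
    unfolding relevant_mass_def using block_size_between(1) by (intro sum_mono mult_right_mono) auto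
  finally show ?thesis using large_scale_ge(2)[OF large] by (simp add: divide_right_mono)
qed

lemma sum_block_bound_relevant_le: "(\<Sum>j\<in>relevant y. block_bound u j) \<le> - (13/64) * relevant_mass y u"
proof -
  note y0 = large_scale_ge(2)[OF large]
  have "(\<Sum>j\<in>relevant y. block_bound u j)
      \<le> (\<Sum>j\<in>relevant y. block_size j u * real j ^ 3 * (- 7/32 + 2 ^ 42 * y ^ 4 * of_bool (resonant (1 / y ^ 6) u j)))"
    by (intro sum_mono block_bound_relevant_le)
  also have "... = - (7/32) * relevant_mass y u
      + 2 ^ 42 * y ^ 4 * (\<Sum>j\<in>relevant y. block_size j u * real j ^ 3 * of_bool (resonant (1 / y ^ 6) u j))"
    unfolding relevant_mass_def sum_distrib_left sum.distrib[symmetric] by (intro sum.cong) (auto simp: algebra_simps)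
  also have "... \<le> - (7/32) * relevant_mass y u + 2 ^ 42 * y ^ 4 * (2 * (relevant_mass y u / y ^ 5))"
    using y0 by (intro add_left_mono mult_left_mono resonant_mass_le) auto
  also have "2 ^ 42 * y ^ 4 * (2 * (relevant_mass y u / y ^ 5)) = 2 ^ 43 / y * relevant_mass y u"
    using y0 by (simp add: eval_nat_numeral)
  also have "... \<le> 1/64 * relevant_mass y u"
    using large_scale_ge(1)[OF large] y0 relevant_mass_pos[OF large, of u] by (intro mult_right_mono) (auto simp: divide_le_eq)
  finally show ?thesis by simp
qed

lemma abs_block_bound_irrelevant_le:
  assumes j: "j \<ge> J" "j \<notin> relevant y"
  shows "\<bar>block_bound u j\<bar> \<le> (18 + 96 * u) * exp (\<sigma> * u - 2 * Y ^ 8 - 260 * Y ^ 7) * (real j ^ 6 * exp (- real j))"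
proof -
  have "1 / \<gamma> j \<le> 1" using gamma_ge[OF j(1)] by simp
  hence "real j ^ 6 * (1 / \<gamma> j) \<le> real j ^ 6 * 1" by (intro mult_left_mono) auto
  hence "\<bar>(16 + 96 * u) * (real j ^ 6 / \<gamma> j)\<bar> \<le> (16 + 96 * u) * real j ^ 6"
    unfolding abs_mult using u_bounds(1) gamma_ge(2)[OF j(1)] by (intro mult_mono) auto
  hence "\<bar>block_kernel j u + (16 + 96 * u) * (real j ^ 6 / \<gamma> j)\<bar> \<le> (18 + 96 * u) * real j ^ 6"
    using abs_block_kernel_le[of j u] abs_triangle_ineq[of "block_kernel j u" "(16 + 96 * u) * (real j ^ 6 / \<gamma> j)"]
    by (simp add: distrib_right)
  moreover have "block_size j u \<le> exp (\<sigma> * u - 2 * Y ^ 8 - 260 * Y ^ 7) * exp (- real j)"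
    using j u(1) unfolding exp_add[symmetric] relevant_def large_scale_ge(5)[OF large]
    using block_size_irrelevant_le[OF large_scale_ge(4)[OF large]] by simp
  ultimately have "\<bar>block_bound u j\<bar> \<le> exp (\<sigma> * u - 2 * Y ^ 8 - 260 * Y ^ 7) * exp (- real j) * ((18 + 96 * u) * real j ^ 6)"
    unfolding block_bound_def abs_mult using block_size_pos[OF j(1), of u] by (intro mult_mono) auto
  thus ?thesis by (simp only: mult_ac)
qed

lemma relevant_mass_ge: "relevant_mass y u \<ge> exp (\<sigma> * u - 2 * Y ^ 8 - 259 * Y ^ 7)"
proof -
  define j where "j = nat \<lceil>Y\<rceil>"
  have j: "j \<in> relevant y" unfolding j_def by (rule ceiling_relevant[OF large])
  have jJ: "j \<ge> J" by (rule relevant_bounds(3)[OF large j])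
  have "1 \<le> real j ^ 3" using j_ge[OF jJ] by simp
  have "exp (\<sigma> * u - 2 * Y ^ 8 - 259 * Y ^ 7) \<le> block_size j u"
    by (rule block_size_ceiling_ge[OF large_scale_ge(3)[OF large] j_def jJ u(1) u_bounds(2)])
  also have "... \<le> block_size j u * real j ^ 3"
    using \<open>1 \<le> real j ^ 3\<close> block_size_pos[OF jJ, of u] mult_left_mono[of 1 "real j ^ 3" "block_size j u"] by simp
  also have "... \<le> relevant_mass y u" unfolding relevant_mass_def
    by (intro member_le_sum[OF j _ finite_relevant] mult_nonneg_nonneg less_imp_le[OF block_size_pos] relevant_bounds(3)[OF large]) auto
  finally show ?thesis .
qed

lemma irrelevant_blocks_small:
  "summable (\<lambda>i. if i + J \<in> relevant y then 0 else block_bound u (i + J))" (is "summable ?f")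
  "(\<Sum>i. if i + J \<in> relevant y then 0 else block_bound u (i + J)) \<le> 1/64 * relevant_mass y u"
proof -
  define Q where "Q = (18 + 96 * u) * exp (\<sigma> * u - 2 * Y ^ 8 - 260 * Y ^ 7)"
  have Q0: "Q \<ge> 0" using u_bounds(1) by (simp add: Q_def)
  define h where "h = (\<lambda>j. real j ^ 6 * exp (- real j))"
  have h: "summable h" "\<And>j. h j \<ge> 0" unfolding h_def by (auto intro: summable_power_exp)
  note tail = summable_ignore_initial_segment[OF h(1), of J]
  have term_le: "norm (?f i) \<le> Q * h (i + J)" for i
    using abs_block_bound_irrelevant_le[of "i + J"] Q0 h(2)[of "i + J"] by (auto simp: Q_def h_def)
  show "summable ?f" by (rule summable_comparison_test'[OF summable_mult[OF tail] term_le])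
  have "suminf ?f \<le> norm (suminf ?f)" by simp
  also have "... \<le> (\<Sum>i. Q * h (i + J))" by (rule norm_suminf_le[OF term_le summable_mult[OF tail]])
  also have "... = Q * (\<Sum>i. h (i + J))" by (rule suminf_mult[OF tail])
  also have "... \<le> Q * suminf h"
    using suminf_split_initial_segment[OF h(1), of J] h(2) Q0 by (intro mult_left_mono) (auto intro!: sum_nonneg)
  also have "... = (18 + 96 * u) * exp (- (Y ^ 7)) * suminf h * exp (\<sigma> * u - 2 * Y ^ 8 - 259 * Y ^ 7)"
  proof -
    have "exp (\<sigma> * u - 2 * Y ^ 8 - 260 * Y ^ 7) = exp (- (Y ^ 7)) * exp (\<sigma> * u - 2 * Y ^ 8 - 259 * Y ^ 7)"
      unfolding exp_add[symmetric] by simp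
    thus ?thesis by (simp only: Q_def mult_ac)
  qed
  also have "... \<le> (114 + 96 * Y ^ 16) * exp (- (Y ^ 7)) * suminf h * relevant_mass y u"
    using u_bounds h suminf_nonneg[OF h(1)] by (intro mult_mono relevant_mass_ge mult_nonneg_nonneg) auto
  also have "... \<le> 1/64 * relevant_mass y u"
    using large relevant_mass_pos[OF large, of u] by (intro mult_right_mono) (auto simp: large_scale_def h_def)
  finally show "suminf ?f \<le> 1/64 * relevant_mass y u" .
qed

lemma block_bounds_summable: "summable (\<lambda>i. block_bound u (i + J))"
  and suminf_block_bound_le: "(\<Sum>i. block_bound u (i + J)) \<le> - (3/16) * exp (\<sigma> * u - 2 * Y ^ 8 - 259 * Y ^ 7)"
proof -
  have "(\<lambda>i. (if i + J \<in> relevant y then block_bound u (i + J) else 0) + (if i + J \<in> relevant y then 0 else block_bound u (i + J)))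
      sums ((\<Sum>j\<in>relevant y. block_bound u j) + (\<Sum>i. if i + J \<in> relevant y then 0 else block_bound u (i + J)))"
    by (intro sums_add sums_relevant[OF large] summable_sums irrelevant_blocks_small(1))
  hence sums: "(\<lambda>i. block_bound u (i + J)) sums ((\<Sum>j\<in>relevant y. block_bound u j) + (\<Sum>i. if i + J \<in> relevant y then 0 else block_bound u (i + J)))"
    by (rule sums_cong[THEN iffD1, rotated]) simp
  thus "summable (\<lambda>i. block_bound u (i + J))" by (rule sums_summable)
  show "(\<Sum>i. block_bound u (i + J)) \<le> - (3/16) * exp (\<sigma> * u - 2 * Y ^ 8 - 259 * Y ^ 7)"
    unfolding sums_unique[OF sums, symmetric]
    using sum_block_bound_relevant_le irrelevant_blocks_small(2) relevant_mass_ge by linarith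
qed

lemma race_margin:
  assumes C: "C \<ge> 0" "c' \<le> \<sigma>"
    and small: "C * (2 + Y ^ 16) ^ 2 * exp (2 * Y ^ 8 + 259 * Y ^ 7 - (\<sigma> - c') * Y ^ 16) \<le> 1/64"
  shows "(\<Sum>i. block_bound u (i + J)) + C * (1 + u) ^ 2 * exp (c' * u) < 0"
proof -
  define W where "W = exp (\<sigma> * u - 2 * Y ^ 8 - 259 * Y ^ 7)"
  have "(\<sigma> - c') * Y ^ 16 \<le> (\<sigma> - c') * u" using C(2) u by (intro mult_left_mono) auto
  hence "exp (c' * u) \<le> exp (2 * Y ^ 8 + 259 * Y ^ 7 - (\<sigma> - c') * Y ^ 16) * W"
    unfolding W_def exp_add[symmetric] by (simp add: left_diff_distrib)
  moreover have "(1 + u) ^ 2 \<le> (2 + Y ^ 16) ^ 2" using u_bounds by (intro power_mono) auto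
  ultimately have "C * (1 + u) ^ 2 * exp (c' * u) \<le> C * (2 + Y ^ 16) ^ 2 * (exp (2 * Y ^ 8 + 259 * Y ^ 7 - (\<sigma> - c') * Y ^ 16) * W)"
    using C by (intro mult_mono) auto
  also have "... = C * (2 + Y ^ 16) ^ 2 * exp (2 * Y ^ 8 + 259 * Y ^ 7 - (\<sigma> - c') * Y ^ 16) * W" by simp
  also have "... \<le> 1/64 * W" using small by (intro mult_right_mono) (auto simp: W_def)
  finally have "C * (1 + u) ^ 2 * exp (c' * u) \<le> 1/64 * W" .
  moreover have "W > 0" by (simp add: W_def)
  ultimately show ?thesis using suminf_block_bound_le unfolding W_def[symmetric] by linarith
qed

end

context race
begin

definition exceptional_set :: "real \<Rightarrow> real \<Rightarrow> real set" where
  "exceptional_set y X = (\<Union>j\<in>relevant y. {x\<in>{X..2 * X}. resonant (1 / y ^ 12) (ln x) j}) \<union>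
     {x. relevant_mass y (ln X) / y ^ 5 \<le>
       (\<Sum>j\<in>relevant y. block_size j (ln X) * real j ^ 3 * indicator {x\<in>{X..2 * X}. resonant (1 / y ^ 6) (ln x) j} x)}"

lemma resonant_set_lmeasurable: "{x\<in>{X..2 * X}. resonant t (ln x) j} \<in> fmeasurable lborel"
  unfolding resonant_def by (rule resonance_fmeasurable)

lemma measure_resonant_set_le:
  "X > 0 \<Longrightarrow> t > 0 \<Longrightarrow> j \<ge> J \<Longrightarrow> measure lborel {x\<in>{X..2 * X}. resonant t (ln x) j} \<le> 32 * t * X"
  unfolding resonant_def using gamma_ge(1)[of j] by (intro measure_resonance_le) auto

lemma exceptional_set_small:
  assumes y: "large_scale y" and X: "X > 0"
  shows "exceptional_set y X \<in> fmeasurable lborel"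
    "measure lborel (exceptional_set y X) \<le> ((1000 * y ^ 8 + 1) * (32 / y ^ 12) + 32 / y) * X"
proof -
  define narrow where "narrow = (\<Union>j\<in>relevant y. {x\<in>{X..2 * X}. resonant (1 / y ^ 12) (ln x) j})"
  define wide where "wide = {x. relevant_mass y (ln X) / y ^ 5 \<le>
    (\<Sum>j\<in>relevant y. block_size j (ln X) * real j ^ 3 * indicator {x\<in>{X..2 * X}. resonant (1 / y ^ 6) (ln x) j} x)}"
  note y0 = large_scale_ge(2)[OF y] and mass = relevant_mass_pos[OF y, of "ln X"]
  have narrow_measurable: "narrow \<in> fmeasurable lborel"
    unfolding narrow_def by (rule fmeasurable.finite_UN[OF finite_relevant resonant_set_lmeasurable])
  have "measure lborel narrow \<le> (\<Sum>j\<in>relevant y. measure lborel {x\<in>{X..2 * X}. resonant (1 / y ^ 12) (ln x) j})"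
    unfolding narrow_def by (intro measure_UNION_le finite_relevant fmeasurableD resonant_set_lmeasurable)
  also have "... \<le> (\<Sum>j\<in>relevant y. 32 * (1 / y ^ 12) * X)"
    using y0 by (intro sum_mono measure_resonant_set_le X relevant_bounds(3)[OF y]) auto
  also have "... \<le> (1000 * y ^ 8 + 1) * (32 / y ^ 12) * X"
    using card_relevant_le[of y] large_scale_ge(3)[OF y, of 1] X y0 by (simp add: mult_right_mono divide_right_mono)
  finally have narrow_le: "measure lborel narrow \<le> (1000 * y ^ 8 + 1) * (32 / y ^ 12) * X" .
  have weight_nonneg: "0 \<le> block_size j (ln X) * real j ^ 3" if "j \<in> relevant y" for j
    using block_size_pos[OF relevant_bounds(3)[OF y that], of "ln X"] by simp
  have wide_window: "measure lborel {x\<in>{X..2 * X}. resonant (1 / y ^ 6) (ln x) j} \<le> 32 * (1 / y ^ 6) * X" if "j \<in> relevant y" for j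
    using relevant_bounds(3)[OF y that] y0 by (intro measure_resonant_set_le X) auto
  have "relevant_mass y (ln X) / y ^ 5 > 0" using mass y0 by simp
  note markov = markov_weighted_indicators[OF finite_relevant weight_nonneg resonant_set_lmeasurable wide_window this]
  have wide_measurable: "wide \<in> fmeasurable lborel" unfolding wide_def by (rule markov(1))
  have "measure lborel wide \<le> 32 * (1 / y ^ 6) * X * relevant_mass y (ln X) / (relevant_mass y (ln X) / y ^ 5)"
    using markov(2) unfolding wide_def relevant_mass_def .
  also have "... = 32 / y * X" using mass y0 by (simp add: eval_nat_numeral)
  finally have wide_le: "measure lborel wide \<le> 32 / y * X" .
  have split: "exceptional_set y X = narrow \<union> wide" unfolding exceptional_set_def narrow_def wide_def ..
  show "exceptional_set y X \<in> fmeasurable lborel" unfolding split by (rule fmeasurable.Un[OF narrow_measurable wide_measurable])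
  have "measure lborel (exceptional_set y X) \<le> measure lborel narrow + measure lborel wide"
    unfolding split by (rule measure_Un_le[OF fmeasurableD[OF narrow_measurable] fmeasurableD[OF wide_measurable]])
  thus "measure lborel (exceptional_set y X) \<le> ((1000 * y ^ 8 + 1) * (32 / y ^ 12) + 32 / y) * X"
    using narrow_le wide_le unfolding distrib_right by linarith
qed

lemma race_scale_off_exceptional_set:
  assumes y: "large_scale y" "(y ^ 16) ^ 16 = ln X" and X: "X > 0" and x: "x \<in> {X..2 * X} - exceptional_set y X"
  shows "race_scale \<sigma> \<xi> \<gamma> d \<theta> J y (ln x)"
proof unfold_locales
  have x_bounds: "X \<le> x" "x \<le> 2 * X" "x > 0" using x X by auto
  show "large_scale y" by (rule y)
  show "(y ^ 16) ^ 16 \<le> ln x" unfolding y(2) using x_bounds X by simp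
  have "ln x \<le> ln (2 * X)" using x_bounds X by simp
  thus "ln x \<le> (y ^ 16) ^ 16 + ln 2" unfolding y(2) using X by (simp add: ln_mult)
  show "\<not> resonant (1 / y ^ 12) (ln x) j" if "j \<in> relevant y" for j
    using x that by (auto simp: exceptional_set_def)
  have "(\<Sum>j\<in>relevant y. block_size j (ln X) * real j ^ 3 * of_bool (resonant (1 / y ^ 6) (ln x) j))
      = (\<Sum>j\<in>relevant y. block_size j (ln X) * real j ^ 3 * indicator {x\<in>{X..2 * X}. resonant (1 / y ^ 6) (ln x) j} x)"
    using x_bounds by (intro sum.cong) (auto simp: indicator_def)
  also have "... \<le> relevant_mass y (ln X) / y ^ 5" using x by (auto simp: exceptional_set_def)
  finally show "(\<Sum>j\<in>relevant y. block_size j ((y ^ 16) ^ 16) * real j ^ 3 * of_bool (resonant (1 / y ^ 6) (ln x) j))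
      \<le> relevant_mass y ((y ^ 16) ^ 16) / y ^ 5" unfolding y(2) .
qed

lemma race_errors_eventually_small:
  assumes "c' < \<sigma>" "\<epsilon> > 0"
  shows "\<forall>\<^sub>F y in at_top. C * (2 + (y ^ 16) ^ 16) ^ 2 * exp (2 * (y ^ 16) ^ 8 + 259 * (y ^ 16) ^ 7 - (\<sigma> - c') * (y ^ 16) ^ 16) \<le> 1/64"
    "\<forall>\<^sub>F y::real in at_top. (1000 * y ^ 8 + 1) * (32 / y ^ 12) + 32 / y \<le> \<epsilon>"
proof -
  define a where "a = \<sigma> - c'"
  have "a > 0" using assms by (simp add: a_def)
  hence "((\<lambda>y::real. (2 + (y ^ 16) ^ 16) ^ 2 * exp (2 * (y ^ 16) ^ 8 + 259 * (y ^ 16) ^ 7 - a * (y ^ 16) ^ 16)) \<longlongrightarrow> 0) at_top"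
    by real_asymp
  from eventually_const_mult_le[OF this, of "1/64" C]
  show "\<forall>\<^sub>F y in at_top. C * (2 + (y ^ 16) ^ 16) ^ 2 * exp (2 * (y ^ 16) ^ 8 + 259 * (y ^ 16) ^ 7 - (\<sigma> - c') * (y ^ 16) ^ 16) \<le> 1/64"
    unfolding a_def by (simp only: mult.assoc)
  have "((\<lambda>y::real. (1000 * y ^ 8 + 1) * (32 / y ^ 12) + 32 / y) \<longlongrightarrow> 0) at_top" by real_asymp
  from eventually_const_mult_le[OF this assms(2), of 1]
  show "\<forall>\<^sub>F y::real in at_top. (1000 * y ^ 8 + 1) * (32 / y ^ 12) + 32 / y \<le> \<epsilon>" by simp
qed

lemma dyadic_almost_all_race_margin:
  assumes C: "C \<ge> 0" "c' < \<sigma>"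
  shows "dyadic_almost_all (\<lambda>x. summable (\<lambda>i. block_bound (ln x) (i + J)) \<and>
    (\<Sum>i. block_bound (ln x) (i + J)) + C * (1 + ln x) ^ 2 * exp (c' * ln x) < 0)"
  unfolding dyadic_almost_all_def
proof (intro allI impI)
  fix \<epsilon> :: real assume \<epsilon>: "\<epsilon> > 0"
  define err where "err y = C * (2 + (y ^ 16) ^ 16) ^ 2 * exp (2 * (y ^ 16) ^ 8 + 259 * (y ^ 16) ^ 7 - (\<sigma> - c') * (y ^ 16) ^ 16)" for y :: real
  define meas where "meas y = (1000 * y ^ 8 + 1) * (32 / y ^ 12) + 32 / y" for y :: real
  have "\<forall>\<^sub>F y in at_top. large_scale y \<and> err y \<le> 1/64 \<and> meas y \<le> \<epsilon>"
    unfolding err_def meas_def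
    by (intro eventually_conj eventually_large_scale race_errors_eventually_small[OF C(2) \<epsilon>])
  moreover have "filterlim (\<lambda>X. root 256 (ln X)) at_top at_top"
    by (rule filterlim_compose[OF _ ln_at_top]) real_asymp
  ultimately have "\<forall>\<^sub>F X in at_top. large_scale (root 256 (ln X)) \<and> err (root 256 (ln X)) \<le> 1/64 \<and> meas (root 256 (ln X)) \<le> \<epsilon>"
    by (rule eventually_compose_filterlim)
  thus "\<forall>\<^sub>F X in at_top. \<exists>B\<in>fmeasurable lborel. measure lborel B \<le> \<epsilon> * X \<and> (\<forall>x\<in>{X..2 * X} - B. summable (\<lambda>i. block_bound (ln x) (i + J)) \<and>
      (\<Sum>i. block_bound (ln x) (i + J)) + C * (1 + ln x) ^ 2 * exp (c' * ln x) < 0)"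
    using eventually_gt_at_top[of 1]
  proof eventually_elim
    case (elim X)
    define y where "y = root 256 (ln X)"
    have "y ^ 256 = ln X" unfolding y_def using elim by (intro real_root_pow_pos2) auto
    hence y: "(y ^ 16) ^ 16 = ln X" by (simp flip: power_mult)
    have scale: "large_scale y" "err y \<le> 1/64" "meas y \<le> \<epsilon>" using elim by (simp_all add: y_def)
    have "measure lborel (exceptional_set y X) \<le> meas y * X" unfolding meas_def using elim scale(1) by (intro exceptional_set_small) auto
    also have "... \<le> \<epsilon> * X" using scale(3) elim by (intro mult_right_mono) auto
    finally have measure: "measure lborel (exceptional_set y X) \<le> \<epsilon> * X" .
    have margin: "summable (\<lambda>i. block_bound (ln x) (i + J)) \<and> (\<Sum>i. block_bound (ln x) (i + J)) + C * (1 + ln x) ^ 2 * exp (c' * ln x) < 0"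
      if "x \<in> {X..2 * X} - exceptional_set y X" for x
    proof -
      interpret race_scale \<sigma> \<xi> \<gamma> d \<theta> J y "ln x" by (rule race_scale_off_exceptional_set[OF scale(1) y _ that]) (use elim in simp)
      show ?thesis using block_bounds_summable race_margin[OF C(1) less_imp_le[OF C(2)]] scale(2) unfolding err_def by blast
    qed
    have "exceptional_set y X \<in> fmeasurable lborel" using elim scale(1) by (intro exceptional_set_small) auto
    thus ?case by (rule bexI[rotated]) (rule conjI[OF measure ballI[OF margin]])
  qed
qed

end

section \<open>The zeros of the configuration\<close>

lemma (in race) has_sum_imp_block_sums:
  fixes f :: "nat \<times> nat \<Rightarrow> real"
  assumes "(f has_sum a) (SIGMA j:{J..}. {1..j ^ 3})"
  shows "(\<lambda>i. \<Sum>k=1..(i + J) ^ 3. f (i + J, k)) sums a"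
proof -
  have "((\<lambda>j. \<Sum>k\<in>{1..j ^ 3}. f (j, k)) has_sum a) {J..}"
    by (rule has_sum_Sigma[OF isUCont_plus assms]) (auto intro: has_sum_finite)
  moreover have "bij_betw (\<lambda>i. i + J) UNIV {J..}" by (rule bij_betwI[where g = "\<lambda>j. j - J"]) auto
  ultimately have "((\<lambda>i. \<Sum>k\<in>{1..(i + J) ^ 3}. f (i + J, k)) has_sum a) UNIV"
    using has_sum_reindex_bij_betw[of "\<lambda>i. i + J" UNIV "{J..}" "\<lambda>j. \<Sum>k\<in>{1..j ^ 3}. f (j, k)"] by blast
  thus ?thesis by (rule has_sum_imp_sums)
qed

locale race_zeros = race +
  fixes c \<eta> :: real
  assumes c\<eta>: "c - \<eta> > 1/2" "0 < \<eta>" "\<eta> \<le> 1"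
    and above: "\<And>j. j \<ge> J \<Longrightarrow> c + \<eta> \<le> \<sigma> - d j"
    and zeros: "zeta_zeros (c - \<eta>) = case_prod (rho \<sigma> \<gamma> d \<theta>) ` (SIGMA j:{J..}. {1..j ^ 3}) \<union>
      cnj ` case_prod (rho \<sigma> \<gamma> d \<theta>) ` (SIGMA j:{J..}. {1..j ^ 3})"
    and multiplicity: "\<And>j k. j \<ge> J \<Longrightarrow> k \<in> {1..j ^ 3} \<Longrightarrow> zeta_zero_mult (rho \<sigma> \<gamma> d \<theta> j k) = k * (j ^ 3 + 1 - k)"
begin

abbreviation indices where "indices \<equiv> SIGMA j:{J..}. {1..j ^ 3}"
abbreviation zero where "zero \<equiv> rho \<sigma> \<gamma> d \<theta>"
abbreviation upper_zeros where "upper_zeros \<equiv> case_prod zero ` indices"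

lemma zero_simps: "Im (zero j k) = real k * \<gamma> j + \<theta> j" "Re (zero j k) = \<sigma> - d j" by (simp_all add: rho_def)

lemma height_lower:
  assumes "j \<ge> J" "k \<ge> 1"
  shows "Im (zero j k) \<ge> 97" "norm (zero j k) \<ge> real k * (\<gamma> j / 2)"
proof -
  have "1 * (\<gamma> j / 2) \<le> real k * (\<gamma> j / 2)" using assms gamma_ge[OF assms(1)] by (intro mult_right_mono) auto
  moreover have "real k * \<gamma> j = 2 * (real k * (\<gamma> j / 2))" by simp
  ultimately have "Im (zero j k) \<ge> real k * (\<gamma> j / 2)" "Im (zero j k) \<ge> 97"
    using theta_bound[OF assms(1)] gamma_ge(1)[OF assms(1)] unfolding zero_simps by linarith+
  thus "Im (zero j k) \<ge> 97" "norm (zero j k) \<ge> real k * (\<gamma> j / 2)"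
    using abs_Im_le_cmod[of "zero j k"] by linarith+
qed

lemma norm_zero_ge:
  assumes "j \<ge> J" "k \<ge> 1"
  shows "exp (real j ^ 8) / 2 \<le> norm (zero j k)"
proof -
  have "1 * (\<gamma> j / 2) \<le> real k * (\<gamma> j / 2)" using assms gamma_ge(2)[OF assms(1)] by (intro mult_right_mono) auto
  thus ?thesis using height_lower(2)[OF assms] \<gamma>[OF assms(1)] by linarith
qed

lemma exp_power8_dominates:
  assumes j: "j \<ge> J" "j < j'"
  shows "exp (real j ^ 8) * (2 * real j ^ 3 + 16) \<le> exp (real j' ^ 8)"
proof -
  have j_ge_2: "real j \<ge> 2" by (rule j_ge[OF j(1)])
  have powers: "8 \<le> real j ^ 3" "16 \<le> real j ^ 4" using power_mono[OF j_ge_2, of 3] power_mono[OF j_ge_2, of 4] by auto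
  hence "real j ^ 3 * 16 \<le> real j ^ 3 * real j ^ 4" by (intro mult_left_mono) auto
  also have "... = real j ^ 7" by (simp add: power_add[symmetric])
  finally have "2 * real j ^ 3 + 16 \<le> exp (real j ^ 7)" using powers exp_ge_add_one_self[of "real j ^ 7"] by linarith
  hence "exp (real j ^ 8) * (2 * real j ^ 3 + 16) \<le> exp (real j ^ 8) * exp (real j ^ 7)" by (intro mult_left_mono) auto
  also have "... = exp (real j ^ 8 + real j ^ 7)" by (simp add: exp_add)
  also have "real j ^ 8 + real j ^ 7 = (real j + 1) * real j ^ 7" by (simp add: power_Suc[symmetric] distrib_right)
  also have "... \<le> (real j + 1) * (real j + 1) ^ 7" using j_ge_2 by (intro mult_left_mono power_mono) auto
  also have "... = (real j + 1) ^ 8" by (simp add: power_Suc[symmetric])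
  also have "... \<le> real j' ^ 8" using j by (intro power_mono) auto
  finally show ?thesis by simp
qed

lemma heights_separated_blocks:
  assumes j: "j \<ge> J" "k \<in> {1..j ^ 3}" "j < j'" "k' \<ge> 1"
  shows "Im (zero j' k') - Im (zero j k) \<ge> 10"
proof -
  have j': "j' \<ge> J" using j by simp
  have "real k * \<gamma> j \<le> real j ^ 3 * (2 * exp (real j ^ 8))"
    using j(2) \<gamma>[OF j(1)] gamma_ge(2)[OF j(1)] by (intro mult_mono) (auto simp flip: of_nat_power)
  moreover have "1 * \<gamma> j' \<le> real k' * \<gamma> j'" using j gamma_ge(2)[OF j'] by (intro mult_right_mono) auto
  moreover have "exp (real j ^ 8) * (2 * real j ^ 3 + 16) = real j ^ 3 * (2 * exp (real j ^ 8)) + 16 * exp (real j ^ 8)"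
    by (simp add: algebra_simps)
  moreover have "1 \<le> exp (real j ^ 8)" by simp
  ultimately show ?thesis
    using exp_power8_dominates[OF j(1,3)] \<gamma>[OF j'] theta_bound[OF j(1)] theta_bound[OF j'] unfolding zero_simps by linarith
qed

lemma heights_separated:
  assumes "p \<in> indices" "q \<in> indices" "p \<noteq> q"
  shows "\<bar>Im (case_prod zero p) - Im (case_prod zero q)\<bar> \<ge> 10"
proof -
  obtain j k j' k' where pq: "p = (j, k)" "q = (j', k')" by fastforce
  have jk: "j \<ge> J" "k \<in> {1..j ^ 3}" "j' \<ge> J" "k' \<in> {1..j' ^ 3}" using assms pq by auto
  consider (less) "j < j'" | (greater) "j' < j" | (same) "j = j'" "k \<noteq> k'" using assms pq by fastforce
  thus ?thesis
  proof cases
    case less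
    thus ?thesis using heights_separated_blocks[of j k j' k'] jk pq by auto
  next
    case greater
    thus ?thesis using heights_separated_blocks[of j' k' j k] jk pq by auto
  next
    case same
    have "\<bar>real k - real k'\<bar> \<ge> 1" using same by linarith
    hence "1 * \<gamma> j \<le> \<bar>real k - real k'\<bar> * \<gamma> j" using gamma_ge(2)[OF jk(1)] by (intro mult_right_mono) auto
    also have "... = \<bar>(real k - real k') * \<gamma> j\<bar>" using gamma_ge(2)[OF jk(1)] by (simp add: abs_mult)
    also have "(real k - real k') * \<gamma> j = Im (zero j k) - Im (zero j' k')" using same by (simp add: zero_simps left_diff_distrib)
    finally show ?thesis using gamma_ge(1)[OF jk(1)] pq by simp
  qed
qed

lemma inj_zero: "inj_on (case_prod zero) indices"
  using heights_separated by (intro inj_onI) fastforce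

lemma height_upper_zero: "p \<in> indices \<Longrightarrow> Im (case_prod zero p) \<ge> 97"
  using height_lower(1) by auto

lemma upper_zeros_disjoint: "upper_zeros \<inter> cnj ` upper_zeros = {}"
proof -
  have "case_prod zero p \<noteq> cnj (case_prod zero q)" if "p \<in> indices" "q \<in> indices" for p q
  proof
    assume "case_prod zero p = cnj (case_prod zero q)"
    hence "Im (case_prod zero p) = - Im (case_prod zero q)" by (metis cnj.sel(2))
    thus False using height_upper_zero[OF that(1)] height_upper_zero[OF that(2)] by linarith
  qed
  thus ?thesis by blast
qed

lemma zeros_separated:
  assumes w: "w \<in> zeta_zeros (c - \<eta>)" "w' \<in> zeta_zeros (c - \<eta>)" "w \<noteq> w'"
  shows "dist w w' \<ge> 10"
proof -
  have index: "\<exists>p\<in>indices. v = case_prod zero p \<or> v = cnj (case_prod zero p)" if "v \<in> zeta_zeros (c - \<eta>)" for v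
    using that unfolding zeros by blast
  obtain p q where p: "p \<in> indices" "w = case_prod zero p \<or> w = cnj (case_prod zero p)"
    and q: "q \<in> indices" "w' = case_prod zero q \<or> w' = cnj (case_prod zero q)"
    using index[OF w(1)] index[OF w(2)] by blast
  have heights: "Im (case_prod zero p) \<ge> 97" "Im (case_prod zero q) \<ge> 97" using p(1) q(1) height_upper_zero by blast+
  have "\<bar>Im w - Im w'\<bar> \<ge> 10"
  proof (cases "p = q")
    case True
    thus ?thesis using p(2) q(2) w(3) heights by auto
  next
    case False
    thus ?thesis using heights_separated[OF p(1) q(1)] p(2) q(2) heights by auto
  qed
  thus ?thesis using abs_Im_le_cmod[of "w - w'"] by (simp add: dist_norm)
qed

lemma multiplicity_le: "j \<ge> J \<Longrightarrow> k \<in> {1..j ^ 3} \<Longrightarrow> real (zeta_zero_mult (zero j k)) \<le> real k * real j ^ 3"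
  unfolding multiplicity of_nat_mult of_nat_power[symmetric] by (intro mult_left_mono) auto

lemma multiplicity_le_power6:
  assumes jk: "j \<ge> J" "k \<in> {1..j ^ 3}"
  shows "real (zeta_zero_mult (zero j k)) \<le> real j ^ 6"
proof -
  have "real k * real j ^ 3 \<le> real j ^ 3 * real j ^ 3"
    using jk by (intro mult_right_mono) (auto simp flip: of_nat_power)
  also have "... = real j ^ 6" by (simp add: power_add[symmetric])
  finally show ?thesis using multiplicity_le[OF jk] by linarith
qed

lemma multiplicity_le_ln:
  assumes "w \<in> zeta_zeros (c - \<eta>)"
  shows "real (zeta_zero_mult w) \<le> 1 * ln (norm w)"
proof -
  have "real (zeta_zero_mult (zero j k)) \<le> ln (norm (zero j k))" if jk: "j \<ge> J" "k \<in> {1..j ^ 3}" for j k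
  proof -
    have j_ge_2: "real j \<ge> 2" by (rule j_ge[OF jk(1)])
    have "exp (real j ^ 8) / 2 \<le> norm (zero j k)" using norm_zero_ge[OF jk(1)] jk(2) by simp
    hence "ln (exp (real j ^ 8) / 2) \<le> ln (norm (zero j k))"
      by (subst ln_le_cancel_iff) (auto intro: less_le_trans[OF _ \<open>_ \<le> norm _\<close>])
    hence "real j ^ 8 - ln 2 \<le> ln (norm (zero j k))" by (simp add: ln_div)
    moreover have "4 * real j ^ 6 \<le> real j ^ 2 * real j ^ 6" using power_mono[OF j_ge_2, of 2] by (intro mult_right_mono) auto
    moreover have "real j ^ 2 * real j ^ 6 = real j ^ 8" by (simp add: power_add[symmetric])
    moreover have "1 \<le> real j ^ 6" using j_ge_2 by (intro one_le_power) auto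
    ultimately show ?thesis using multiplicity_le_power6[OF jk] ln_2_less_1 by linarith
  qed
  thus ?thesis using assms unfolding zeros by (auto simp: zeta_zero_mult_cnj)
qed

abbreviation zero_weight :: "complex \<Rightarrow> real" where
  "zero_weight w \<equiv> real (zeta_zero_mult w) / norm w"

lemma zero_weight_le:
  assumes jk: "j \<ge> J" "k \<in> {1..j ^ 3}"
  shows "zero_weight (zero j k) \<le> real j ^ 6 * (2 * exp (- real j))"
proof -
  have "real j ^ 1 \<le> real j ^ 8" using j_ge[OF jk(1)] by (intro power_increasing) auto
  hence "exp (real j) \<le> exp (real j ^ 8)" by simp
  moreover have "exp (real j ^ 8) / 2 \<le> norm (zero j k)" using norm_zero_ge[OF jk(1)] jk(2) by simp
  ultimately have "exp (real j) / 2 \<le> norm (zero j k)" by linarith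
  hence "zero_weight (zero j k) \<le> real j ^ 6 / (exp (real j) / 2)"
    using multiplicity_le_power6[OF jk] by (intro frac_le) auto
  thus ?thesis by (simp add: exp_minus field_simps)
qed

lemma summable_zero_weight: "zero_weight summable_on zeta_zeros (c - \<eta>)"
proof -
  have "(\<lambda>p. norm (zero_weight (case_prod zero p))) summable_on indices"
    unfolding Infinite_Sum.abs_summable_on_Sigma_iff
  proof (intro conjI ballI)
    have "(\<lambda>j. 2 * (real j ^ 9 * exp (- real j))) summable_on {J..}"
      using summable_mult[OF summable_power_exp, of 2 9]
      by (intro summable_on_subset_banach[OF summable_nonneg_imp_summable_on, of _ "{J..}"]) auto
    thus "(\<lambda>j. norm (\<Sum>\<^sub>\<infinity>k\<in>{1..j ^ 3}. norm (zero_weight (case_prod zero (j, k))))) summable_on {J..}"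
    proof (rule summable_on_comparison_test)
      fix j assume j: "j \<in> {J..}"
      have "(\<Sum>k\<in>{1..j ^ 3}. zero_weight (zero j k)) \<le> (\<Sum>k\<in>{1..j ^ 3}. real j ^ 6 * (2 * exp (- real j)))"
        using j by (intro sum_mono zero_weight_le) auto
      also have "... = 2 * (real j ^ 9 * exp (- real j))" by (simp add: power_add[symmetric])
      finally show "norm (\<Sum>\<^sub>\<infinity>k\<in>{1..j ^ 3}. norm (zero_weight (case_prod zero (j, k)))) \<le> 2 * (real j ^ 9 * exp (- real j))"
        by (simp add: sum_nonneg)
    qed auto
  qed auto
  hence "(zero_weight \<circ> case_prod zero) summable_on indices" unfolding o_def by (rule abs_summable_summable)
  hence upper: "zero_weight summable_on upper_zeros" unfolding summable_on_reindex[OF inj_zero] .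
  moreover have "zero_weight summable_on cnj ` upper_zeros"
    by (subst summable_on_reindex) (use upper in \<open>auto intro: inj_onI simp: o_def zeta_zero_mult_cnj\<close>)
  ultimately show ?thesis unfolding zeros by (intro summable_on_Un_disjoint upper_zeros_disjoint)
qed

definition zero_enum where "zero_enum = from_nat_into (zeta_zeros (c - \<eta>))"

lemma bij_zero_enum: "bij_betw zero_enum UNIV (zeta_zeros (c - \<eta>))"
  unfolding zero_enum_def
proof (rule bij_betw_from_nat_into)
  show "countable (zeta_zeros (c - \<eta>))" unfolding zeros by auto
  have "(\<lambda>j. (j, 1)) ` {J..} \<subseteq> indices" using J by auto
  moreover have "infinite ((\<lambda>j::nat. (j, 1::nat)) ` {J..})" using infinite_Ici[of J] by (subst finite_image_iff) (auto intro: inj_onI)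
  ultimately have "infinite indices" using finite_subset by blast
  hence "infinite upper_zeros" using finite_image_iff[OF inj_zero] by blast
  thus "infinite (zeta_zeros (c - \<eta>))" unfolding zeros by simp
qed

sublocale sparse: sparse_zeros c \<eta> 1 zero_enum
proof
  show "c < 1" using above[of J] beta_bounds(2)[of J] c\<eta> by auto
  show "c + \<eta> \<le> Re w \<and> Re w < 1" if "w \<in> zeta_zeros (c - \<eta>)" for w
    using that above beta_bounds(2) unfolding zeros by (auto simp: zero_simps)
  show "inj zero_enum" "range zero_enum = zeta_zeros (c - \<eta>)" using bij_zero_enum by (auto simp: bij_betw_def)
  have "(\<lambda>n. zero_weight (zero_enum n)) summable_on UNIV"
    using summable_zero_weight unfolding summable_on_reindex_bij_betw[OF bij_zero_enum, of zero_weight] .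
  thus "summable (\<lambda>n. zero_weight (zero_enum n))" by (rule summable_on_imp_summable)
qed (use c\<eta> zeros_separated multiplicity_le_ln in auto)

lemma has_sum_zeros_imp_block_sums:
  fixes F :: "complex \<Rightarrow> complex"
  assumes F: "(F has_sum S) (zeta_zeros (c - \<eta>))" and cnj_F: "\<And>w. F (cnj w) = cnj (F w)"
  shows "(\<lambda>i. \<Sum>k=1..(i + J) ^ 3. 2 * Re (F (zero (i + J) k))) sums Re S"
proof -
  have "F summable_on upper_zeros" using summable_on_subset_banach[OF has_sum_imp_summable[OF F]] zeros by blast
  then obtain a where a: "(F has_sum a) upper_zeros" by (auto simp: summable_on_def)
  hence "((F \<circ> cnj) has_sum cnj a) upper_zeros" by (simp add: o_def cnj_F)
  hence "(F has_sum cnj a) (cnj ` upper_zeros)" by (subst has_sum_reindex) (simp_all add: inj_on_def)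
  from has_sum_Un_disjoint[OF a this upper_zeros_disjoint] have "S = a + cnj a" using F zeros has_sum_unique by metis
  hence "Re S = 2 * Re a" by simp
  moreover have "((F \<circ> case_prod zero) has_sum a) indices" using a unfolding has_sum_reindex[OF inj_zero] .
  hence "((\<lambda>p. Re (F (case_prod zero p))) has_sum Re a) indices" using has_sum_Re by (auto simp: o_def)
  hence "((\<lambda>p. 2 * Re (F (case_prod zero p))) has_sum 2 * Re a) indices" by (rule has_sum_cmult_right)
  ultimately show ?thesis using has_sum_imp_block_sums[of "\<lambda>p. 2 * Re (F (case_prod zero p))"] by simp
qed

definition majorant_term :: "real \<Rightarrow> complex \<Rightarrow> real" where
  "majorant_term v w = zero_weight w / norm w * exp (Re w * v)"

lemma majorant_block_sums: "(\<lambda>i. \<Sum>k=1..(i + J) ^ 3. 2 * majorant_term v (zero (i + J) k)) sums sparse.zero_sum_majorant v"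
proof -
  have "((\<lambda>n. majorant_term v (zero_enum n)) has_sum sparse.zero_sum_majorant v) UNIV"
    unfolding majorant_term_def sparse.zero_sum_majorant_def by (intro sums_nonneg_imp_has_sum summable_sums sparse.summable_majorant) auto
  hence "(majorant_term v has_sum sparse.zero_sum_majorant v) (zeta_zeros (c - \<eta>))"
    unfolding has_sum_reindex_bij_betw[OF bij_zero_enum] .
  hence "((\<lambda>w. complex_of_real (majorant_term v w)) has_sum of_real (sparse.zero_sum_majorant v)) (zeta_zeros (c - \<eta>))"
    by (rule has_sum_of_real)
  from has_sum_zeros_imp_block_sums[OF this] show ?thesis by (simp add: majorant_term_def zeta_zero_mult_cnj)
qed

lemma majorant_block_le:
  assumes j: "j \<ge> J"
  shows "(\<Sum>k=1..j ^ 3. 2 * majorant_term v (zero j k)) \<le> 8 * (block_size j v * (real j ^ 6 / \<gamma> j))"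
proof -
  define e where "e = exp ((\<sigma> - d j) * v)"
  have \<gamma>_pos: "\<gamma> j > 0" by (rule gamma_ge(2)[OF j])
  have "(\<Sum>k=1..j ^ 3. 2 * majorant_term v (zero j k)) \<le> (\<Sum>k=1..j ^ 3. 8 * real j ^ 3 / (\<gamma> j * \<gamma> j) * e)"
  proof (rule sum_mono)
    fix k assume k: "k \<in> {1..j ^ 3}"
    have "zero_weight (zero j k) / norm (zero j k) \<le> real k * real j ^ 3 / (real k * (\<gamma> j / 2)) / (real k * (\<gamma> j / 2))"
      using multiplicity_le[OF j k] height_lower(2)[OF j, of k] k \<gamma>_pos by (intro frac_le) auto
    also have "... = 4 * real j ^ 3 / (\<gamma> j * \<gamma> j) / real k" using k \<gamma>_pos by (simp add: field_simps)
    also have "... \<le> 4 * real j ^ 3 / (\<gamma> j * \<gamma> j) / 1" using k \<gamma>_pos by (intro divide_left_mono) auto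
    finally have "zero_weight (zero j k) / norm (zero j k) * e \<le> 4 * real j ^ 3 / (\<gamma> j * \<gamma> j) * e"
      by (intro mult_right_mono) (auto simp: e_def)
    thus "2 * majorant_term v (zero j k) \<le> 8 * real j ^ 3 / (\<gamma> j * \<gamma> j) * e" by (simp add: majorant_term_def zero_simps e_def)
  qed
  also have "... = 8 * (block_size j v * (real j ^ 6 / \<gamma> j))"
    by (simp add: block_size_def e_def)
  finally show ?thesis .
qed

lemma cos_xi: "cos \<xi> = 1 \<or> cos \<xi> = -1"
  using \<xi> by auto

lemma zero_block_le:
  assumes j: "j \<ge> J" and u: "u \<ge> 0"
  shows "- cos \<xi> * (\<Sum>k=1..j ^ 3. 2 * Re (sparse.zero_exp_term u (zero j k))) + 12 * u * (\<Sum>k=1..j ^ 3. 2 * majorant_term u (zero j k))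
     \<le> block_bound u j"
proof -
  define T where "T = block_size j u * (real j ^ 6 / \<gamma> j)"
  define S where "S = (\<Sum>k=1..j ^ 3. 2 * Re (sparse.zero_exp_term u (zero j k)))"
  have "S = (\<Sum>k=1..j^3. 2 * Re (of_nat (k * (j^3 + 1 - k)) * exp (zero j k * of_real u) / zero j k))"
    unfolding S_def sparse.zero_exp_term_def by (intro sum.cong) (auto simp: multiplicity[OF j])
  hence "\<bar>S + cos \<xi> * (block_size j u * block_kernel j u)\<bar> \<le> 16 * T" using block_approx[OF j, of u] unfolding T_def by simp
  hence "- cos \<xi> * S \<le> block_size j u * block_kernel j u + 16 * T" using cos_xi by auto
  moreover have "12 * u * (\<Sum>k=1..j ^ 3. 2 * majorant_term u (zero j k)) \<le> 12 * u * (8 * T)"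
    using u majorant_block_le[OF j] unfolding T_def by (intro mult_left_mono) auto
  moreover have "block_bound u j = block_size j u * block_kernel j u + 16 * T + 12 * u * (8 * T)"
    unfolding block_bound_def T_def by (simp add: algebra_simps)
  ultimately show ?thesis unfolding S_def by linarith
qed

lemma race_inequality:
  "\<exists>C\<ge>0. \<forall>u\<ge>ln 2. summable (\<lambda>i. block_bound u (i + J)) \<longrightarrow>
     cos \<xi> * (u * (real (prime_pi (exp u)) - li (exp u)))
       \<le> (\<Sum>i. block_bound u (i + J)) + \<bar>sparse.psi_error u\<bar> + u * (C * (1 + u) * exp (c * u))"
proof -
  obtain C where C: "C \<ge> 0" "\<And>u. u \<ge> ln 2 \<Longrightarrow> \<bar>u * (real (prime_pi (exp u)) - li (exp u)) + Re (sparse.zero_sum u)\<bar>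
      \<le> \<bar>sparse.psi_error u\<bar> + u * (C * (1 + u) * exp (c * u) + 12 * sparse.zero_sum_majorant u)"
    using sparse.prime_pi_approx by blast
  have "cos \<xi> * (u * (real (prime_pi (exp u)) - li (exp u)))
      \<le> (\<Sum>i. block_bound u (i + J)) + \<bar>sparse.psi_error u\<bar> + u * (C * (1 + u) * exp (c * u))"
    if u: "u \<ge> ln 2" and summable: "summable (\<lambda>i. block_bound u (i + J))" for u
  proof -
    have u_nonneg: "u \<ge> 0" using u ln2_pos by linarith
    have zero_blocks: "(\<lambda>i. \<Sum>k=1..(i + J) ^ 3. 2 * Re (sparse.zero_exp_term u (zero (i + J) k))) sums Re (sparse.zero_sum u)"
      by (rule has_sum_zeros_imp_block_sums[OF sparse.zero_sum_has_sum]) (simp add: sparse.zero_exp_term_def zeta_zero_mult_cnj exp_cnj)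
    have "- cos \<xi> * Re (sparse.zero_sum u) + 12 * u * sparse.zero_sum_majorant u \<le> (\<Sum>i. block_bound u (i + J))"
      by (rule sums_le[OF zero_block_le sums_add[OF sums_mult[OF zero_blocks] sums_mult[OF majorant_block_sums]] summable_sums[OF summable]])
         (use u_nonneg in auto)
    moreover have "cos \<xi> * x \<le> - cos \<xi> * y + \<bar>x + y\<bar>" for x y using cos_xi by auto
    note this[of "u * (real (prime_pi (exp u)) - li (exp u))" "Re (sparse.zero_sum u)"]
    ultimately show ?thesis using C(2)[OF u] by (simp add: distrib_left)
  qed
  thus ?thesis using C(1) by blast
qed

end

lemma emeasure_exceeds_le:
  fixes f :: "real \<Rightarrow> real"
  assumes [measurable]: "f \<in> borel_measurable borel" and c: "c < c'" and X: "X > 1"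
  shows "emeasure lborel ({x. \<bar>f (ln x)\<bar> > exp (c' * ln x)} \<inter> {X..2 * X}) \<le>
    ennreal (2 * X * exp (- 2 * (c' - c) * ln X)) * (\<integral>\<^sup>+ v. ennreal ((f v)^2 * exp (- 2 * c * v)) \<partial>lborel)"
proof -
  define E where "E = {x. \<bar>f (ln x)\<bar> > exp (c' * ln x)}"
  define a where "a = c' - c"
  have [measurable]: "E \<in> sets borel" unfolding E_def by measurable
  have "emeasure lborel (E \<inter> {X..2 * X}) = (\<integral>\<^sup>+ x. indicator E x * indicator {exp (ln X)..exp (ln (2 * X))} x \<partial>lborel)"
    using X by (simp add: indicator_inter_arith[symmetric])
  also have "... = (\<integral>\<^sup>+ v. indicator E (exp v) * ennreal (exp v) * indicator {ln X..ln (2 * X)} v \<partial>lborel)"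
    using X by (intro nn_integral_substitution_aux) (auto intro!: derivative_eq_intros continuous_intros)
  also have "... \<le> (\<integral>\<^sup>+ v. ennreal (2 * X * exp (- 2 * a * ln X)) * ennreal ((f v)^2 * exp (- 2 * c * v)) \<partial>lborel)"
  proof (intro nn_integral_mono)
    fix v
    show "indicator E (exp v) * ennreal (exp v) * indicator {ln X..ln (2 * X)} v
       \<le> ennreal (2 * X * exp (- 2 * a * ln X)) * ennreal ((f v)^2 * exp (- 2 * c * v))"
    proof (cases "exp v \<in> E \<and> v \<in> {ln X..ln (2 * X)}")
      case True
      hence v: "exp (c' * v) < \<bar>f v\<bar>" "ln X \<le> v" "v \<le> ln (2 * X)" by (auto simp: E_def)
      have "0 \<le> 2 * (a * (v - ln X))" using c v(2) by (simp add: a_def)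
      hence "1 \<le> exp (2 * (a * (v - ln X)))" by (simp only: one_le_exp_iff)
      also have "... = exp (- 2 * a * ln X) * ((exp (c' * v))^2 * exp (- 2 * c * v))"
        by (simp add: a_def power2_eq_square exp_add[symmetric] algebra_simps)
      also have "... \<le> exp (- 2 * a * ln X) * ((f v)^2 * exp (- 2 * c * v))"
        using v(1) by (intro mult_left_mono mult_right_mono) (auto simp: abs_le_square_iff[symmetric])
      finally have "1 \<le> exp (- 2 * a * ln X) * ((f v)^2 * exp (- 2 * c * v))" .
      moreover have "exp v \<le> 2 * X" using v(3) X by (metis exp_le_cancel_iff exp_ln mult_pos_pos zero_less_numeral less_trans zero_less_one)
      ultimately have "exp v * 1 \<le> 2 * X * (exp (- 2 * a * ln X) * ((f v)^2 * exp (- 2 * c * v)))"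
        using X by (intro mult_mono) auto
      thus ?thesis using True X by (simp add: ennreal_mult[symmetric] mult.assoc ennreal_leI)
    qed auto
  qed
  also have "... = ennreal (2 * X * exp (- 2 * a * ln X)) * (\<integral>\<^sup>+ v. ennreal ((f v)^2 * exp (- 2 * c * v)) \<partial>lborel)"
    by (rule nn_integral_cmult) measurable
  finally show ?thesis unfolding E_def a_def .
qed

lemma (in sparse_zeros) dyadic_almost_all_psi_error:
  assumes c': "c < c'"
  shows "dyadic_almost_all (\<lambda>x. \<bar>psi_error (ln x)\<bar> \<le> exp (c' * ln x))"
  unfolding dyadic_almost_all_def
proof (intro allI impI)
  fix e :: real assume e: "e > 0"
  define E where "E = {x. \<bar>psi_error (ln x)\<bar> > exp (c' * ln x)}"
  define M where "M = (LINT v|lborel. (psi_error v)^2 * exp (- 2 * c * v))"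
  have M: "(\<integral>\<^sup>+ v. ennreal ((psi_error v)^2 * exp (- 2 * c * v)) \<partial>lborel) = ennreal M" "M \<ge> 0"
    unfolding M_def by (intro nn_integral_eq_integral psi_error_square_integrable integral_nonneg_AE; simp)+
  have "((\<lambda>X. exp (- 2 * (c' - c) * ln X)) \<longlongrightarrow> 0) at_top" using c' by real_asymp
  hence "\<forall>\<^sub>F X in at_top. 2 * M * exp (- 2 * (c' - c) * ln X) \<le> e \<and> X > 1"
    by (intro eventually_conj eventually_gt_at_top eventually_const_mult_le e)
  thus "\<forall>\<^sub>F X in at_top. \<exists>B\<in>fmeasurable lborel. measure lborel B \<le> e * X \<and> (\<forall>x\<in>{X..2 * X} - B. \<bar>psi_error (ln x)\<bar> \<le> exp (c' * ln x))"
  proof eventually_elim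
    case (elim X)
    have "emeasure lborel (E \<inter> {X..2 * X}) \<le> ennreal (2 * X * exp (- 2 * (c' - c) * ln X)) * ennreal M"
      unfolding E_def M(1)[symmetric] using elim by (intro emeasure_exceeds_le psi_error_measurable c') simp
    also have "... = ennreal (2 * M * exp (- 2 * (c' - c) * ln X) * X)" using elim M(2) by (simp add: ennreal_mult[symmetric] mult_ac)
    also have "... \<le> ennreal (e * X)" using elim by (intro ennreal_leI mult_right_mono) auto
    finally have emeasure_le: "emeasure lborel (E \<inter> {X..2 * X}) \<le> ennreal (e * X)" .
    have "E \<in> sets borel" unfolding E_def by measurable
    hence "E \<inter> {X..2 * X} \<in> fmeasurable lborel" using emeasure_le by (intro fmeasurableI) (auto intro: le_less_trans)
    moreover have "measure lborel (E \<inter> {X..2 * X}) \<le> e * X" unfolding measure_def using emeasure_le e elim by (intro enn2real_leI) auto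
    ultimately show ?case by (intro bexI[of _ "E \<inter> {X..2 * X}"]) (auto simp: E_def not_less)
  qed
qed

lemma borel_measurable_prime_pi [measurable]: "(\<lambda>x. real (prime_pi x)) \<in> borel_measurable borel"
proof (intro borel_measurable_mono monoI)
  fix x y :: real assume "x \<le> y"
  moreover have "finite {p::nat. prime p \<and> real p \<le> y}" by (rule finite_subset[of _ "{..nat \<lfloor>y\<rfloor>}"]) (auto simp: le_nat_floor)
  ultimately show "real (prime_pi x) \<le> real (prime_pi y)" unfolding prime_pi_def by (intro of_nat_mono card_mono) auto
qed

lemma borel_measurable_li_max [measurable]: "(\<lambda>x. li (max 2 x)) \<in> borel_measurable borel"
proof (rule borel_measurable_continuous_onI)
  have "isCont (\<lambda>x. li (max 2 x)) x" for x
  proof -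
    have "continuous_on {2..\<bar>x\<bar> + 3} li"
      using li_has_derivative[of _ "\<bar>x\<bar> + 3"] by (auto simp: continuous_on_eq_continuous_within intro!: DERIV_continuous)
    hence "continuous_on {..<\<bar>x\<bar> + 3} (\<lambda>x. li (max 2 x))"
      by (rule continuous_on_compose2) (auto intro!: continuous_intros)
    thus ?thesis by (rule continuous_on_interior) (auto simp: interior_open)
  qed
  thus "continuous_on UNIV (\<lambda>x. li (max 2 x))" by (simp add: continuous_at_imp_continuous_on)
qed

definition race_losses :: "real \<Rightarrow> real set" where
  "race_losses s = {x. x \<ge> 2 \<and> s * (real (prime_pi x) - li x) \<ge> 0}"

lemma race_losses_borel: "race_losses s \<in> sets borel"
proof -
  have "race_losses s = {x. x \<ge> 2 \<and> s * (real (prime_pi x) - li (max 2 x)) \<ge> 0}"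
    by (auto simp: race_losses_def max_def)
  also have "... \<in> sets borel" by measurable
  finally show ?thesis .
qed

lemma P1_eq: "P1 = {2..} - race_losses (- 1)"
  by (auto simp: P1_def race_losses_def)

context race_zeros
begin

lemma race_losses_density: "((\<lambda>X. measure lebesgue (race_losses (cos \<xi>) \<inter> {2..X}) / X) \<longlongrightarrow> 0) at_top"
proof (rule density_zero_from_dyadic[OF race_losses_borel])
  define c' where "c' = c + \<eta> / 2"
  have "d J \<ge> 0" by (rule d_nonneg) simp
  hence c': "c < c'" "c' < \<sigma>" using above[of J] c\<eta> by (auto simp: c'_def)
  obtain C where C: "C \<ge> 0" "\<And>u. u \<ge> ln 2 \<Longrightarrow> summable (\<lambda>i. block_bound u (i + J)) \<Longrightarrow>
     cos \<xi> * (u * (real (prime_pi (exp u)) - li (exp u)))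
       \<le> (\<Sum>i. block_bound u (i + J)) + \<bar>sparse.psi_error u\<bar> + u * (C * (1 + u) * exp (c * u))"
    using race_inequality by blast
  have "dyadic_almost_all (\<lambda>x. (summable (\<lambda>i. block_bound (ln x) (i + J)) \<and>
      (\<Sum>i. block_bound (ln x) (i + J)) + (C + 1) * (1 + ln x) ^ 2 * exp (c' * ln x) < 0) \<and> \<bar>sparse.psi_error (ln x)\<bar> \<le> exp (c' * ln x))"
    using C(1) c' by (intro dyadic_almost_all_conj dyadic_almost_all_race_margin sparse.dyadic_almost_all_psi_error) auto
  thus "dyadic_almost_all (\<lambda>x. x \<notin> race_losses (cos \<xi>))"
  proof (rule dyadic_almost_all_mono, intro eventually_mono[OF eventually_ge_at_top[of 2]] impI)
    fix x :: real assume x: "x \<ge> 2" and margin: "(summable (\<lambda>i. block_bound (ln x) (i + J)) \<and>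
      (\<Sum>i. block_bound (ln x) (i + J)) + (C + 1) * (1 + ln x) ^ 2 * exp (c' * ln x) < 0) \<and> \<bar>sparse.psi_error (ln x)\<bar> \<le> exp (c' * ln x)"
    define u where "u = ln x"
    have u: "u \<ge> ln 2" "u > 0" "exp u = x" using x ln2_pos by (simp_all add: u_def)
    have "u * (C * (1 + u) * exp (c * u)) \<le> (1 + u) * (C * (1 + u) * exp (c' * u))"
      using u C(1) c' by (intro mult_mono) (auto intro!: mult_nonneg_nonneg)
    moreover have "1 * exp (c' * u) \<le> (1 + u) ^ 2 * exp (c' * u)" using u by (intro mult_right_mono one_le_power) auto
    moreover have "(C + 1) * (1 + u) ^ 2 * exp (c' * u) = (1 + u) * (C * (1 + u) * exp (c' * u)) + (1 + u) ^ 2 * exp (c' * u)"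
      by (simp add: power2_eq_square algebra_simps)
    ultimately have "cos \<xi> * (u * (real (prime_pi x) - li x)) < 0"
      using C(2)[OF u(1)] margin[folded u_def] unfolding u(3) by linarith
    hence "u * (cos \<xi> * (real (prime_pi x) - li x)) < 0" by (simp only: mult.left_commute)
    hence "cos \<xi> * (real (prime_pi x) - li x) < 0" using u(2) by (metis mult_less_cancel_left_pos mult_zero_right)
    thus "x \<notin> race_losses (cos \<xi>)" by (simp add: race_losses_def)
  qed
qed

lemma P1_density: "((\<lambda>X. measure lebesgue (P1 \<inter> {2..X}) / X) \<longlongrightarrow> (if \<xi> = 0 then 0 else 1)) at_top"
proof (cases "\<xi> = 0")
  case True
  have "P1 \<in> sets borel" unfolding P1_eq using race_losses_borel by (intro sets.Diff) auto
  moreover have "P1 \<subseteq> race_losses (cos \<xi>)" using True by (auto simp: P1_def race_losses_def)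
  ultimately show ?thesis using True density_zero_subset[OF _ race_losses_borel _ race_losses_density] by simp
next
  case False
  hence "cos \<xi> = - 1" using \<xi> by auto
  thus ?thesis using False density_one_complement[OF race_losses_borel race_losses_density] by (simp add: P1_eq)
qed

end

lemma zeta_zero_mult_pos_iff: "zeta_zero_mult w > 0 \<longleftrightarrow> w \<noteq> 1 \<and> zeta w = 0"
proof -
  have "zorder zeta w > 0" if w: "w \<noteq> 1" "zeta w = 0"
  proof -
    note connected_Diff_one
    moreover have "open (UNIV - {1::complex})" by (intro open_Diff) auto
    moreover have "\<exists>s\<in>UNIV - {1}. zeta s \<noteq> 0" by (rule zeta_not_identically_zero)
    ultimately show ?thesis using zorder_exist_zero[OF zeta_holomorphic, of w] w by auto
  qed
  thus ?thesis by (auto simp: zeta_zero_mult_def)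
qed

context
  fixes d :: "nat \<Rightarrow> real"
  assumes d: "\<And>j. j \<ge> 1 \<Longrightarrow> \<bar>d j - 1 / real j ^ 8\<bar> \<le> 1 / real j ^ 9"
begin

lemma offset_bounds:
  assumes "j \<ge> 1"
  shows "1 / real j ^ 8 * (1 - 1 / real j) \<le> d j" "d j \<le> 1 / real j ^ 8 * (1 + 1 / real j)"
proof -
  have "1 / real j ^ 9 = 1 / real j ^ 8 * (1 / real j)" by (simp add: power_Suc2[symmetric])
  thus "1 / real j ^ 8 * (1 - 1 / real j) \<le> d j" "d j \<le> 1 / real j ^ 8 * (1 + 1 / real j)"
    using d[OF assms] unfolding right_diff_distrib distrib_left by linarith+
qed

lemma offset_pos:
  assumes "j \<ge> 2"
  shows "d j > 0"
proof -
  have "0 < 1 / real j ^ 8 * (1 - 1 / real j)" using assms by (intro mult_pos_pos) auto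
  also have "... \<le> d j" using assms by (intro offset_bounds) simp
  finally show ?thesis .
qed

lemma offset_Suc_less:
  assumes j: "j \<ge> 2"
  shows "d (Suc j) < d j"
proof -
  define x where "x = 1 / real j"
  have x: "0 < x" "x \<le> 1/2" using j by (auto simp: x_def field_simps)
  have "1 + 1 / real (Suc j) \<le> 1 + x" unfolding x_def using j by (intro add_left_mono divide_left_mono) auto
  also have "... < (1 - x) * (1 + 8 * x)"
  proof -
    have "0 < 2 * x * (3 - 4 * x)" using x by (intro mult_pos_pos) auto
    thus ?thesis by (simp add: algebra_simps)
  qed
  also have "... \<le> (1 - x) * (1 + x) ^ 8"
    using x Bernoulli_inequality[of x 8] by (intro mult_left_mono) auto
  finally have less: "1 + 1 / real (Suc j) < (1 - x) * (1 + x) ^ 8" .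
  have "(1 + x) * real j = real (Suc j)" using j by (simp add: x_def field_simps)
  hence power: "real (Suc j) ^ 8 = (1 + x) ^ 8 * real j ^ 8" by (simp add: power_mult_distrib[symmetric])
  have "d (Suc j) \<le> 1 / real (Suc j) ^ 8 * (1 + 1 / real (Suc j))" by (rule offset_bounds) simp
  also have "... < 1 / real (Suc j) ^ 8 * ((1 - x) * (1 + x) ^ 8)" using less by (intro mult_strict_left_mono) auto
  also have "... = 1 / real j ^ 8 * (1 - x)" unfolding power using x by simp
  also have "... \<le> d j" unfolding x_def using j by (intro offset_bounds) auto
  finally show ?thesis .
qed

lemma offset_less: "2 \<le> i \<Longrightarrow> i < j \<Longrightarrow> d j < d i"
  by (rotate_tac 1, induction rule: less_Suc_induct) (auto intro: offset_Suc_less less_trans)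

lemma offset_le_inverse: "j \<ge> 1 \<Longrightarrow> d j \<le> 2 / real j"
proof -
  assume j: "j \<ge> 1"
  have "1 / real j ^ 8 * (1 + 1 / real j) \<le> 1 / real j ^ 1 * (1 + 1 / 1)"
    using j by (intro mult_mono divide_left_mono add_left_mono power_increasing) auto
  thus ?thesis using offset_bounds(2)[OF j] by simp
qed

lemma offset_cutoff:
  assumes j0: "j0 \<ge> 1" "j0 = 1 \<Longrightarrow> d 1 > 0" and \<delta>: "\<delta> > 0"
  obtains i where "i \<ge> 2" "i \<ge> j0" "d i \<le> \<delta>" "\<And>j. j \<ge> j0 \<Longrightarrow> d j < d i \<longleftrightarrow> j > i"
proof -
  define e where "e = (if j0 = 1 then min \<delta> (d 1) else \<delta>)"
  have e: "e > 0" "e \<le> \<delta>" "j0 = 1 \<Longrightarrow> e \<le> d 1" using \<delta> j0 by (auto simp: e_def)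
  obtain N :: nat where N: "real N > 2 / e" using reals_Archimedean2 by blast
  define i where "i = max N (max 2 j0)"
  have i: "i \<ge> 2" "i \<ge> j0" "real i > 2 / e" using N by (auto simp: i_def)
  have "2 / real i \<le> e" using i e(1) by (simp add: field_simps)
  hence d_i: "d i \<le> e" using offset_le_inverse[of i] i by simp
  have "d j < d i \<longleftrightarrow> j > i" if j: "j \<ge> j0" for j
  proof (cases "j = 1")
    case True
    thus ?thesis using j j0 e(3) d_i i by auto
  next
    case False
    thus ?thesis using offset_less[of i j] offset_less[of j i] i j j0 by (cases i j rule: linorder_cases) auto
  qed
  thus thesis using that i(1,2) d_i e(2) by (meson order_trans)
qed

end

lemma (in race) B_mult_rho:
  assumes J_ge: "J \<ge> j0" and cutoff: "\<And>j. j \<ge> j0 \<Longrightarrow> d j < d i \<longleftrightarrow> j \<ge> J"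
    and decreasing: "\<And>j j'. J \<le> j \<Longrightarrow> j < j' \<Longrightarrow> d j' < d j" and jk: "j \<ge> J" "k \<in> {1..j ^ 3}"
  shows "B_mult \<sigma> \<gamma> d \<theta> j0 (rho \<sigma> \<gamma> d \<theta> j k) = k * (j ^ 3 + 1 - k)"
proof -
  have "j' = j \<and> k' = k" if "j' \<ge> j0" "rho \<sigma> \<gamma> d \<theta> j' k' = rho \<sigma> \<gamma> d \<theta> j k" for j' k'
  proof -
    have equal_parts: "d j' = d j" "real k' * \<gamma> j' + \<theta> j' = real k * \<gamma> j + \<theta> j" using that(2) by (auto simp: rho_def)
    hence "j' \<ge> J" using cutoff[of j] cutoff[OF that(1)] jk J_ge by simp
    hence "j' = j" using equal_parts(1) decreasing[of j j'] decreasing[of j' j] jk by (cases j j' rule: linorder_cases) auto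
    thus ?thesis using equal_parts(2) gamma_ge(2)[OF jk(1)] by simp
  qed
  hence "{(j', k'). j' \<ge> j0 \<and> 1 \<le> k' \<and> k' \<le> j' ^ 3 \<and> rho \<sigma> \<gamma> d \<theta> j' k' = rho \<sigma> \<gamma> d \<theta> j k} = {(j, k)}"
    using jk J_ge by auto
  thus ?thesis by (simp add: B_mult_def)
qed

lemma conjugate_closed_eq:
  assumes "\<And>w. w \<in> Z \<Longrightarrow> cnj w \<in> Z" "P \<subseteq> Z" "\<And>w. w \<in> Z \<Longrightarrow> Im w \<ge> 0 \<Longrightarrow> w \<in> P"
  shows "Z = P \<union> cnj ` P"
proof (intro equalityI subsetI)
  fix w assume w: "w \<in> Z"
  show "w \<in> P \<union> cnj ` P"
  proof (cases "Im w \<ge> 0")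
    case False
    hence "cnj w \<in> P" using assms(1,3) w by simp
    hence "cnj (cnj w) \<in> cnj ` P" by (rule imageI)
    thus ?thesis by simp
  qed (use assms(3) w in blast)
qed (use assms(1,2) in auto)

lemma race_zerosI:
  assumes "race \<sigma> \<xi> \<gamma> d \<theta> J" and J_ge: "J \<ge> j0" and cutoff: "\<And>j. j \<ge> j0 \<Longrightarrow> d j < d i \<longleftrightarrow> j \<ge> J"
    and decreasing: "\<And>j j'. J \<le> j \<Longrightarrow> j < j' \<Longrightarrow> d j' < d j" and c\<eta>: "1/2 < c - \<eta>" "0 < \<eta>" "\<eta> \<le> 1"
    and above: "\<And>j. j \<ge> J \<Longrightarrow> c + \<eta> \<le> \<sigma> - d j" and below: "\<sigma> - d i < c - \<eta>"
    and B_le: "\<And>w. B_mult \<sigma> \<gamma> d \<theta> j0 w \<le> zeta_zero_mult w"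
    and B_ge: "\<And>w. Re w > c - \<eta> \<Longrightarrow> Im w \<ge> 0 \<Longrightarrow> zeta_zero_mult w \<le> B_mult \<sigma> \<gamma> d \<theta> j0 w"
  shows "race_zeros \<sigma> \<xi> \<gamma> d \<theta> J c \<eta>"
proof -
  interpret race \<sigma> \<xi> \<gamma> d \<theta> J by fact
  let ?P = "case_prod (rho \<sigma> \<gamma> d \<theta>) ` (SIGMA j:{J..}. {1..j ^ 3})"
  have zero: "rho \<sigma> \<gamma> d \<theta> j k \<in> zeta_zeros (c - \<eta>)" "zeta_zero_mult (rho \<sigma> \<gamma> d \<theta> j k) = k * (j ^ 3 + 1 - k)"
    if jk: "j \<ge> J" "k \<in> {1..j ^ 3}" for j k
  proof -
    have B: "B_mult \<sigma> \<gamma> d \<theta> j0 (rho \<sigma> \<gamma> d \<theta> j k) = k * (j ^ 3 + 1 - k)" by (rule B_mult_rho[OF J_ge cutoff decreasing jk])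
    have Re: "Re (rho \<sigma> \<gamma> d \<theta> j k) > c - \<eta>" using above[OF jk(1)] c\<eta> by (simp add: rho_def)
    have "1 * \<gamma> j \<le> real k * \<gamma> j" using jk gamma_ge(2)[of j] by (intro mult_right_mono) auto
    hence "0 \<le> real k * \<gamma> j + \<theta> j" using theta_bound[OF jk(1)] gamma_ge(1)[OF jk(1)] by linarith
    hence "Im (rho \<sigma> \<gamma> d \<theta> j k) \<ge> 0" by (simp add: rho_def)
    thus mult: "zeta_zero_mult (rho \<sigma> \<gamma> d \<theta> j k) = k * (j ^ 3 + 1 - k)" using B_ge[OF Re] B_le B by (metis le_antisym)
    have "zeta_zero_mult (rho \<sigma> \<gamma> d \<theta> j k) > 0" unfolding mult using jk(2) by auto
    thus "rho \<sigma> \<gamma> d \<theta> j k \<in> zeta_zeros (c - \<eta>)" using Re by (auto simp: zeta_zero_mult_pos_iff zeta_zeros_def)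
  qed
  have upper: "w \<in> ?P" if w: "w \<in> zeta_zeros (c - \<eta>)" "Im w \<ge> 0" for w
  proof -
    have Re: "Re w > c - \<eta>" and "zeta_zero_mult w > 0" using w(1) by (auto simp: zeta_zero_mult_pos_iff zeta_zeros_def)
    hence "B_mult \<sigma> \<gamma> d \<theta> j0 w \<noteq> 0" using B_ge[OF Re w(2)] by linarith
    hence "{(j, k). j \<ge> j0 \<and> 1 \<le> k \<and> k \<le> j ^ 3 \<and> rho \<sigma> \<gamma> d \<theta> j k = w} \<noteq> {}"
      unfolding B_mult_def by (rule contrapos_nn) (simp only: sum.empty)
    then obtain j k where jk: "j \<ge> j0" "1 \<le> k" "k \<le> j ^ 3" "w = rho \<sigma> \<gamma> d \<theta> j k" by auto
    hence "j \<ge> J" using Re below cutoff[OF jk(1)] by (simp add: rho_def)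
    thus ?thesis using jk by (auto intro!: image_eqI[of _ _ "(j, k)"])
  qed
  have "zeta_zeros (c - \<eta>) = ?P \<union> cnj ` ?P"
    by (rule conjugate_closed_eq[OF _ _ upper]) (use zero(1) in \<open>auto simp: zeta_zeros_def zeta_cnj\<close>)
  thus ?thesis by unfold_locales (use c\<eta> above zero(2) in auto)
qed

lemma race_zeros_exist:
  fixes \<sigma> \<delta> \<xi> :: real
  assumes \<sigma>: "1 / 2 < \<sigma>" "\<sigma> < 1" and \<delta>: "0 < \<delta>" "\<delta> < \<sigma> - 1 / 2" and \<xi>: "\<xi> = 0 \<or> \<xi> = pi"
    and params: "admissible_params \<xi> \<gamma> d \<theta>" and j0: "j0 \<ge> 1" and d_le: "\<And>j. j \<ge> j0 \<Longrightarrow> d j \<le> \<delta>"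
    and B_le: "\<And>w. B_mult \<sigma> \<gamma> d \<theta> j0 w \<le> zeta_zero_mult w"
    and B_ge: "\<And>w. Re w \<ge> \<sigma> - \<delta> \<Longrightarrow> Im w \<ge> 0 \<Longrightarrow> zeta_zero_mult w \<le> B_mult \<sigma> \<gamma> d \<theta> j0 w"
    and first: "j0 = 1 \<Longrightarrow> d 1 > 0"
  shows "\<exists>J c \<eta>. race_zeros \<sigma> \<xi> \<gamma> d \<theta> J c \<eta>"
proof -
  have d: "\<bar>d j - 1 / real j ^ 8\<bar> \<le> 1 / real j ^ 9" if "j \<ge> 1" for j using params that by (simp add: admissible_params_def)
  obtain i where i: "i \<ge> 2" "i \<ge> j0" "d i \<le> \<delta>" "\<And>j. j \<ge> j0 \<Longrightarrow> d j < d i \<longleftrightarrow> j > i"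
    using offset_cutoff[OF d j0 first \<delta>(1)] by metis
  define J where "J = Suc i"
  define c \<eta> where "c = \<sigma> - (d i + d J) / 2" and "\<eta> = (d i - d J) / 4"
  have J: "J \<ge> 2" "J \<ge> j0" "d J < d i" "d J > 0"
    using i offset_Suc_less[OF d i(1)] offset_pos[OF d, of J] by (auto simp: J_def)
  have d_J: "d j \<le> d J" if "j \<ge> J" for j
    using offset_less[OF d, of J j] J(1) that by (cases "j = J") auto
  have "d j < \<sigma> - 1 / 2" if "j \<ge> J" for j using d_le[of j] that J \<delta> by simp
  hence "race \<sigma> \<xi> \<gamma> d \<theta> J" by unfold_locales (use J \<sigma> \<xi> params in \<open>auto simp: admissible_params_def\<close>)
  moreover have "\<sigma> - d i < c - \<eta>" "\<sigma> - \<delta> \<le> c - \<eta>" "1/2 < c - \<eta>" "0 < \<eta>" "\<eta> \<le> 1"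
    unfolding c_def \<eta>_def using J i(3) \<delta> \<sigma> by (simp_all add: field_simps)
  moreover have "c + \<eta> \<le> \<sigma> - d j" if "j \<ge> J" for j
    using d_J[OF that] J(3) unfolding c_def \<eta>_def by (simp add: field_simps)
  moreover have "d j < d i \<longleftrightarrow> j \<ge> J" if "j \<ge> j0" for j using i(4)[OF that] by (auto simp: J_def)
  moreover have "d j' < d j" if "J \<le> j" "j < j'" for j j' using offset_less[OF d, of j j'] that J(1) by simp
  ultimately have "race_zeros \<sigma> \<xi> \<gamma> d \<theta> J c \<eta>"
    using B_le B_ge by (intro race_zerosI[of \<sigma> \<xi> \<gamma> d \<theta> J j0 i c \<eta>] J(2)) auto
  thus ?thesis by blast
qed

section \<open>Zeros of small height\<close>

definition euler_maclaurin_main :: "nat \<Rightarrow> complex \<Rightarrow> complex" where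
  "euler_maclaurin_main n s = of_nat n powr (1 - s) / (s - 1) + of_nat n powr (- s) / 2 + s * of_nat n powr (- s - 1) / 12"

definition euler_maclaurin_error :: "nat \<Rightarrow> complex \<Rightarrow> complex" where
  "euler_maclaurin_error n s = of_nat n powr (- s) + euler_maclaurin_main (Suc n) s - euler_maclaurin_main n s"

lemma bernoulli3_bound:
  fixes y :: real
  assumes "0 \<le> y" "y \<le> 1"
  shows "\<bar>y ^ 3 - 3 / 2 * y^2 + y / 2\<bar> \<le> 1 / 20"
proof -
  have half_bound: "w / 4 - w ^ 3 \<le> 1 / 20" if "w \<ge> 0" for w :: real
  proof -
    have "w ^ 3 - w / 4 + 1 / 20 = (w - 29/100)^2 * (w + 58/100) + 23/10000 * w + 611/500000"
      by (simp add: power2_eq_square power3_eq_cube field_simps)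
    moreover have "0 \<le> (w - 29/100)^2 * (w + 58/100)" using that by (intro mult_nonneg_nonneg) auto
    ultimately show ?thesis using that by linarith
  qed
  define w where "w = y - 1 / 2"
  have centred: "y ^ 3 - 3 / 2 * y^2 + y / 2 = w ^ 3 - w / 4" by (simp add: w_def power2_eq_square power3_eq_cube field_simps)
  have "\<bar>w\<bar> \<le> 1 / 2" using assms unfolding w_def by linarith
  hence "w^2 \<le> (1 / 2)^2" by (metis abs_ge_zero power2_abs power_mono)
  hence "0 \<le> \<bar>w\<bar> * (1 / 4 - w^2)" by (intro mult_nonneg_nonneg) (auto simp: power_divide)
  hence "\<bar>w\<bar> ^ 3 \<le> \<bar>w\<bar> / 4" by (simp add: power2_eq_square power3_eq_cube algebra_simps)
  moreover have "\<bar>w ^ 3 - w / 4\<bar> = \<bar>\<bar>w\<bar> ^ 3 - \<bar>w\<bar> / 4\<bar>" by (cases "w \<ge> 0") (auto simp: power3_eq_cube)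
  ultimately show ?thesis unfolding centred using half_bound[of "\<bar>w\<bar>"] by linarith
qed

text \<open>Integrating \<open>w powr (- s)\<close> by parts three times against the first three Bernoulli polynomials,
  shifted to \<open>[N, N + 1]\<close>, gives this combination; only the term of the cubic polynomial survives
  differentiation.\<close>

definition euler_maclaurin_primitive :: "complex \<Rightarrow> complex \<Rightarrow> complex \<Rightarrow> complex" where
  "euler_maclaurin_primitive N s w = (w - N - 1/2) * w powr (- s) + ((w - N)^2 - (w - N) + 1/6) / 2 * (s * w powr (- s - 1))
     + ((w - N)^3 - 3/2 * (w - N)^2 + (w - N) / 2) / 6 * (s * (s + 1) * w powr (- s - 2)) - w powr (1 - s) / (1 - s)"

definition bernoulli3_kernel :: "complex \<Rightarrow> complex \<Rightarrow> complex \<Rightarrow> complex" where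
  "bernoulli3_kernel N s w = - (((w - N)^3 - 3/2 * (w - N)^2 + (w - N) / 2) / 6 * (s * (s + 1) * (s + 2) * w powr (- s - 3)))"

lemma euler_maclaurin_primitive_has_derivative:
  fixes x :: real
  assumes x: "x > 0" and s: "s \<noteq> 1"
  shows "((\<lambda>x. euler_maclaurin_primitive N s (of_real x)) has_vector_derivative bernoulli3_kernel N s (of_real x)) (at x)"
proof -
  define w where "w = (of_real x :: complex)"
  have "w \<notin> \<real>\<^sub>\<le>\<^sub>0" using x by (auto simp: w_def complex_nonpos_Reals_iff)
  hence powr: "((\<lambda>w. w powr a) has_field_derivative a * w powr (a - 1)) (at w)" for a
    using has_field_derivative_powr[of w a] by simp
  have powr_1: "((\<lambda>w. w powr (- s - 1)) has_field_derivative (- s - 1) * w powr (- s - 2)) (at w)"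
    and powr_2: "((\<lambda>w. w powr (- s - 2)) has_field_derivative (- s - 2) * w powr (- s - 3)) (at w)"
    using powr[of "- s - 1"] powr[of "- s - 2"] by (simp_all add: algebra_simps)
  have powr_0: "((\<lambda>w. w powr (1 - s) / (1 - s)) has_field_derivative w powr (- s)) (at w)"
    using DERIV_cdivide[OF powr[of "1 - s"], of "1 - s"] s by simp
  have term_1: "((\<lambda>w. (w - N - 1/2) * w powr (- s)) has_field_derivative 1 * w powr (- s) + - s * w powr (- s - 1) * (w - N - 1/2)) (at w)"
    by (rule DERIV_mult[OF _ powr]) (auto intro!: derivative_eq_intros)
  have term_2: "((\<lambda>w. ((w - N)^2 - (w - N) + 1/6) / 2 * (s * w powr (- s - 1))) has_field_derivative
      (2 * (w - N) - 1) / 2 * (s * w powr (- s - 1)) + s * ((- s - 1) * w powr (- s - 2)) * (((w - N)^2 - (w - N) + 1/6) / 2)) (at w)"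
    by (rule DERIV_mult[OF _ DERIV_cmult[OF powr_1]]) (auto intro!: derivative_eq_intros)
  have term_3: "((\<lambda>w. ((w - N)^3 - 3/2 * (w - N)^2 + (w - N) / 2) / 6 * (s * (s + 1) * w powr (- s - 2))) has_field_derivative
      (3 * (w - N)^2 - 3 * (w - N) + 1/2) / 6 * (s * (s + 1) * w powr (- s - 2)) + s * (s + 1) * ((- s - 2) * w powr (- s - 3)) * (((w - N)^3 - 3/2 * (w - N)^2 + (w - N) / 2) / 6)) (at w)"
    by (rule DERIV_mult[OF _ DERIV_cmult[OF powr_2]]) (auto intro!: derivative_eq_intros, simp add: field_simps)
  have telescope: "1 * p0 + - s * p1 * (y - 1/2) + ((2 * y - 1) / 2 * (s * p1) + s * ((- s - 1) * p2) * ((y^2 - y + 1/6) / 2))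
      + ((3 * y^2 - 3 * y + 1/2) / 6 * (s * (s + 1) * p2) + s * (s + 1) * ((- s - 2) * p3) * ((y^3 - 3/2 * y^2 + y / 2) / 6)) - p0
      = - ((y^3 - 3/2 * y^2 + y / 2) / 6 * (s * (s + 1) * (s + 2) * p3))" for p0 p1 p2 p3 y
    by (simp add: field_simps power2_eq_square power3_eq_cube)
  have "(euler_maclaurin_primitive N s has_field_derivative bernoulli3_kernel N s w) (at w)"
    using DERIV_diff[OF DERIV_add[OF DERIV_add[OF term_1 term_2] term_3] powr_0]
    unfolding euler_maclaurin_primitive_def[abs_def] bernoulli3_kernel_def telescope .
  thus ?thesis unfolding w_def by (rule has_vector_derivative_real_field)
qed

lemma norm_bernoulli3_kernel_le:
  assumes x: "real n \<le> x" "x \<le> real (Suc n)" "x > 0"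
  shows "norm (bernoulli3_kernel (of_nat n) s (of_real x)) \<le> norm (s * (s + 1) * (s + 2)) / 120 * x powr (- Re s - 3)"
proof -
  define y where "y = x - real n"
  have y: "0 \<le> y" "y \<le> 1" using x by (auto simp: y_def)
  have "bernoulli3_kernel (of_nat n) s (of_real x)
      = - (of_real (y ^ 3 - 3 / 2 * y^2 + y / 2) / 6 * (s * (s + 1) * (s + 2) * of_real x powr (- s - 3)))"
    by (simp add: bernoulli3_kernel_def y_def)
  also have "norm ... = \<bar>y ^ 3 - 3 / 2 * y^2 + y / 2\<bar> / 6 * (norm (s * (s + 1) * (s + 2)) * x powr (- Re s - 3))"
    using x(3) norm_powr_real_powr[of "of_real x" "- s - 3"] by (simp only: norm_minus_cancel norm_mult norm_divide norm_of_real) simp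
  also have "... \<le> (1 / 20) / 6 * (norm (s * (s + 1) * (s + 2)) * x powr (- Re s - 3))"
    by (intro mult_right_mono divide_right_mono bernoulli3_bound[OF y]) auto
  finally show ?thesis by simp
qed

lemma norm_euler_maclaurin_error_le:
  assumes n: "n \<ge> 1" and s: "Re s > 0" "s \<noteq> 1"
  shows "norm (euler_maclaurin_error n s)
      \<le> norm (s * (s + 1) * (s + 2)) / (120 * (Re s + 2)) * (real n powr (- Re s - 2) - real (Suc n) powr (- Re s - 2))"
proof -
  define c where "c = norm (s * (s + 1) * (s + 2)) / 120"
  let ?K = "\<lambda>x. euler_maclaurin_primitive (of_nat n) s (of_real x)"
  let ?\<phi> = "\<lambda>x. - (c / (Re s + 2)) * x powr (- Re s - 2)"
  have \<phi>: "(?\<phi> has_real_derivative c * x powr (- Re s - 3)) (at x)" if "x > 0" for x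
  proof -
    have "- (c / (Re s + 2)) * ((- Re s - 2) * x powr (- Re s - 2 - 1))
        = c / (Re s + 2) * (Re s + 2) * x powr (- Re s - 3)" by (simp add: algebra_simps add_divide_distrib)
    also have "... = c * x powr (- Re s - 3)" using s by simp
    finally show ?thesis using DERIV_cmult[OF has_real_derivative_powr[OF that, of "- Re s - 2"], of "- (c / (Re s + 2))"] by simp
  qed
  have "norm (?K (real (Suc n)) - ?K (real n)) \<le> ?\<phi> (real (Suc n)) - ?\<phi> (real n)"
  proof (rule differentiable_bound_general[where f' = "\<lambda>x. bernoulli3_kernel (of_nat n) s (of_real x)"
    and \<phi>' = "\<lambda>x. c * x powr (- Re s - 3)"])
    show "continuous_on {real n..real (Suc n)} ?K"
      using n s by (intro continuous_at_imp_continuous_on ballI has_vector_derivative_continuous[OF euler_maclaurin_primitive_has_derivative]) auto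
    show "continuous_on {real n..real (Suc n)} ?\<phi>" using n by (intro continuous_intros) auto
    fix x assume x: "real n < x" "x < real (Suc n)"
    hence x_pos: "x > 0" using n by linarith
    show "(?K has_vector_derivative bernoulli3_kernel (of_nat n) s (of_real x)) (at x)"
      by (rule euler_maclaurin_primitive_has_derivative[OF x_pos s(2)])
    show "(?\<phi> has_vector_derivative c * x powr (- Re s - 3)) (at x)"
      using \<phi>[OF x_pos] by (simp add: has_real_derivative_iff_has_vector_derivative)
    show "norm (bernoulli3_kernel (of_nat n) s (of_real x)) \<le> c * x powr (- Re s - 3)"
      unfolding c_def using x x_pos by (intro norm_bernoulli3_kernel_le) auto
  qed simp
  also have "?K (real (Suc n)) - ?K (real n) = euler_maclaurin_error n s"
    using s by (simp add: euler_maclaurin_primitive_def euler_maclaurin_error_def euler_maclaurin_main_def divide_simps) (simp add: algebra_simps)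
  also have "c / (Re s + 2) = norm (s * (s + 1) * (s + 2)) / (120 * (Re s + 2))" by (simp add: c_def)
  finally show ?thesis unfolding right_diff_distrib by linarith
qed

lemma euler_maclaurin_error_summable:
  assumes N: "N \<ge> 1" and s: "Re s > 0" "s \<noteq> 1"
  shows "summable (\<lambda>i. euler_maclaurin_error (i + N) s)"
    "norm (\<Sum>i. euler_maclaurin_error (i + N) s) \<le> norm (s * (s + 1) * (s + 2)) / (120 * (Re s + 2)) * real N powr (- Re s - 2)"
proof -
  define f where "f = (\<lambda>i. real (i + N) powr (- Re s - 2))"
  define c where "c = norm (s * (s + 1) * (s + 2)) / (120 * (Re s + 2))"
  have "f \<longlonglongrightarrow> 0" unfolding f_def using s
    by (intro tendsto_neg_powr filterlim_compose[OF filterlim_real_sequentially] filterlim_add_const_nat_at_top) auto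
  hence "(\<lambda>i. f i - f (Suc i)) sums (f 0 - 0)" by (rule telescope_sums')
  hence majorant: "(\<lambda>i. c * (f i - f (Suc i))) sums (c * f 0)" using sums_mult by fastforce
  have term_le: "norm (euler_maclaurin_error (i + N) s) \<le> c * (f i - f (Suc i))" for i
    using norm_euler_maclaurin_error_le[of "i + N" s] N s by (simp add: f_def c_def add_ac)
  show "summable (\<lambda>i. euler_maclaurin_error (i + N) s)" using term_le
    by (intro summable_comparison_test'[OF sums_summable[OF majorant]]) auto
  have "norm (\<Sum>i. euler_maclaurin_error (i + N) s) \<le> (\<Sum>i. c * (f i - f (Suc i)))"
    by (rule norm_suminf_le[OF term_le sums_summable[OF majorant]])
  also have "... = c * f 0" using majorant by (simp add: sums_iff)
  finally show "norm (\<Sum>i. euler_maclaurin_error (i + N) s) \<le> norm (s * (s + 1) * (s + 2)) / (120 * (Re s + 2)) * real N powr (- Re s - 2)"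
    by (simp add: c_def f_def)
qed

lemma norm_euler_maclaurin_error_le_square:
  assumes s: "Re s > 0" "s \<noteq> 1" "norm s \<le> r"
  shows "norm (euler_maclaurin_error (n + 1) s) \<le> (r + 2) ^ 3 / 240 * real (n + 1) powr (- 2)"
proof -
  have r: "r \<ge> 0" using s(3) norm_ge_zero order_trans by blast
  have "norm (s * (s + 1) * (s + 2)) \<le> (r + 2) * (r + 2) * (r + 2)"
    unfolding norm_mult using s(3) r norm_triangle_ineq[of s 1] norm_triangle_ineq[of s 2] by (intro mult_mono) auto
  hence coefficient: "norm (s * (s + 1) * (s + 2)) / (120 * (Re s + 2)) \<le> (r + 2) ^ 3 / 240"
    unfolding power3_eq_cube using s r by (intro frac_le) auto
  have "real (n + 1) powr (- Re s - 2) \<le> real (n + 1) powr (- 2)" using s by (intro powr_mono) auto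
  moreover have "real (Suc (n + 1)) powr (- Re s - 2) \<ge> 0" by simp
  ultimately have difference: "real (n + 1) powr (- Re s - 2) - real (Suc (n + 1)) powr (- Re s - 2) \<le> real (n + 1) powr (- 2)" by linarith
  have "real (Suc (n + 1)) powr (- Re s - 2) \<le> real (n + 1) powr (- Re s - 2)" using s by (intro powr_mono2') auto
  hence "norm (s * (s + 1) * (s + 2)) / (120 * (Re s + 2)) * (real (n + 1) powr (- Re s - 2) - real (Suc (n + 1)) powr (- Re s - 2))
      \<le> (r + 2) ^ 3 / 240 * real (n + 1) powr (- 2)"
    using r by (intro mult_mono[OF coefficient difference]) auto
  thus ?thesis using norm_euler_maclaurin_error_le[of "n + 1" s] s by (meson le_add2 order_trans)
qed

definition upper_right :: "complex set" where
  "upper_right = {s. Re s > 0} \<inter> {s. Im s > 0}"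

lemma euler_maclaurin_holomorphic: "(\<lambda>s. euler_maclaurin_main 1 s + (\<Sum>i. euler_maclaurin_error (i + 1) s)) holomorphic_on upper_right"
proof -
  have "open upper_right" unfolding upper_right_def by (intro open_Int open_halfspace_Re_gt open_halfspace_Im_gt)
  have main: "euler_maclaurin_main n holomorphic_on upper_right" if "n \<ge> 1" for n
    unfolding euler_maclaurin_main_def using that by (intro holomorphic_intros) (auto simp: upper_right_def)
  have error: "euler_maclaurin_error (n + 1) holomorphic_on upper_right" for n
    unfolding euler_maclaurin_error_def by (intro holomorphic_intros main) auto
  have "(\<lambda>s. \<Sum>i. euler_maclaurin_error (i + 1) s) holomorphic_on upper_right"
  proof (rule holomorphic_on_suminf[OF \<open>open upper_right\<close> error])
    fix x assume "x \<in> upper_right"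
    then obtain d where d: "d > 0" "ball x d \<subseteq> upper_right" using \<open>open upper_right\<close> open_contains_ball by blast
    have "norm (euler_maclaurin_error (n + 1) y) \<le> (norm x + d + 2) ^ 3 / 240 * real (n + 1) powr (- 2)" if y: "y \<in> ball x d" for n y
    proof (rule norm_euler_maclaurin_error_le_square)
      show "Re y > 0" "y \<noteq> 1" using y d by (auto simp: upper_right_def)
      show "norm y \<le> norm x + d" using y norm_triangle_ineq2[of y x] by (auto simp: dist_norm norm_minus_commute)
    qed
    moreover have "summable (\<lambda>n. (norm x + d + 2) ^ 3 / 240 * real (n + 1) powr (- 2))" by (intro summable_mult summable_shift_powr) auto
    ultimately show "\<exists>d>0. \<exists>M. summable M \<and> (\<forall>n. \<forall>y\<in>ball x d. norm (euler_maclaurin_error (n + 1) y) \<le> M n)" using d(1) by blast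
  qed
  thus ?thesis by (intro holomorphic_intros main) auto
qed

lemma zeta_euler_maclaurin_convergent:
  assumes s: "Re s > 1"
  shows "zeta s = euler_maclaurin_main 1 s + (\<Sum>i. euler_maclaurin_error (i + 1) s)"
proof -
  have s_ne_1: "s \<noteq> 1" using s by auto
  have "(\<lambda>n. of_nat (n + 1) powr (- (s - 1)) / (s - 1) + of_nat (n + 1) powr (- s) / 2 + s * of_nat (n + 1) powr (- (s + 1)) / 12) \<longlonglongrightarrow> 0 / (s - 1) + 0 / 2 + s * 0 / 12"
    using s s_ne_1 by (intro tendsto_intros tendsto_neg_powr_complex_of_nat filterlim_add_const_nat_at_top) auto
  hence "(\<lambda>n. euler_maclaurin_main (n + 1) s) \<longlonglongrightarrow> 0" by (simp add: euler_maclaurin_main_def)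
  hence "(\<lambda>n. euler_maclaurin_main (n + 1) s - euler_maclaurin_main (Suc n + 1) s) sums (euler_maclaurin_main (0 + 1) s - 0)" by (rule telescope_sums')
  hence "(\<lambda>n. euler_maclaurin_main (n + 1) s - euler_maclaurin_main (Suc n + 1) s + euler_maclaurin_error (n + 1) s)
      sums (euler_maclaurin_main (0 + 1) s - 0 + (\<Sum>i. euler_maclaurin_error (i + 1) s))"
    using s s_ne_1 by (intro sums_add summable_sums euler_maclaurin_error_summable(1)) auto
  hence "(\<lambda>n. 1 / of_nat (Suc n) powr s) sums (euler_maclaurin_main 1 s + (\<Sum>i. euler_maclaurin_error (i + 1) s))"
    by (simp add: euler_maclaurin_error_def powr_minus_divide)
  thus ?thesis using zeta_sums[OF s] sums_unique2 by blast
qed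

lemma zeta_euler_maclaurin:
  assumes s: "Re s > 0" "Im s > 0"
  shows "zeta s = euler_maclaurin_main 1 s + (\<Sum>i. euler_maclaurin_error (i + 1) s)"
    and "zeta s = 1 + euler_maclaurin_main 2 s + (\<Sum>i. euler_maclaurin_error (i + 2) s)"
proof -
  show first: "zeta s = euler_maclaurin_main 1 s + (\<Sum>i. euler_maclaurin_error (i + 1) s)"
  proof (rule analytic_continuation_open[where s = "{s. Re s > 1} \<inter> {s. Im s > 0}" and s' = upper_right and f = zeta])
    have "Complex 2 1 \<in> {s. Re s > 1} \<inter> {s. Im s > 0}" by simp
    thus "{s. Re s > 1} \<inter> {s. Im s > 0} \<noteq> {}" by blast
    have "convex upper_right" unfolding upper_right_def by (intro convex_Int convex_halfspace_Re_gt convex_halfspace_Im_gt)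
    thus "connected upper_right" by (rule convex_connected)
    show "zeta holomorphic_on upper_right" by (intro holomorphic_on_subset[OF zeta_holomorphic]) (auto simp: upper_right_def)
    show "(\<lambda>s. euler_maclaurin_main 1 s + (\<Sum>i. euler_maclaurin_error (i + 1) s)) holomorphic_on upper_right"
      by (rule euler_maclaurin_holomorphic)
    show "open ({s. Re s > 1} \<inter> {s. Im s > 0})" "open upper_right"
      unfolding upper_right_def by (intro open_Int open_halfspace_Re_gt open_halfspace_Im_gt)+
    show "{s. Re s > 1} \<inter> {s. Im s > 0} \<subseteq> upper_right" "s \<in> upper_right" using s by (auto simp: upper_right_def)
  qed (simp add: zeta_euler_maclaurin_convergent)
  have "s \<noteq> 1" using s by auto
  hence "(\<Sum>i. euler_maclaurin_error (i + 1) s) = (\<Sum>i. euler_maclaurin_error (Suc i + 1) s) + euler_maclaurin_error (0 + 1) s"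
    using suminf_split_head[OF euler_maclaurin_error_summable(1)[of 1 s]] s by simp
  thus "zeta s = 1 + euler_maclaurin_main 2 s + (\<Sum>i. euler_maclaurin_error (i + 2) s)"
    unfolding first by (simp add: euler_maclaurin_error_def numeral_2_eq_2)
qed

lemma cmod_shift_le:
  assumes "0 \<le> Re s" "Re s \<le> 1" "\<bar>Im s\<bar> \<le> T" "0 \<le> a" "(1 + a)^2 + T^2 \<le> b^2" "0 \<le> b"
  shows "norm (s + of_real a) \<le> b"
proof -
  have "(norm (s + of_real a))^2 = (Re s + a)^2 + (Im s)^2" by (simp add: cmod_power2)
  also have "(Im s)^2 \<le> T^2" using assms by (simp add: abs_le_square_iff[symmetric])
  also have "(Re s + a)^2 \<le> (1 + a)^2" using assms by (intro power_mono) auto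
  finally have "(norm (s + of_real a))^2 \<le> b^2" using assms by linarith
  thus ?thesis by (rule power2_le_imp_le) (use assms in auto)
qed

lemma cubic_le:
  assumes s: "0 \<le> Re s" "Re s \<le> 1" "\<bar>Im s\<bar> \<le> T"
    and b: "1 + T^2 \<le> b0^2" "4 + T^2 \<le> b1^2" "9 + T^2 \<le> b2^2" "0 \<le> b0" "0 \<le> b1" "0 \<le> b2"
  shows "norm (s * (s + 1) * (s + 2)) \<le> b0 * b1 * b2"
  unfolding norm_mult
  using cmod_shift_le[OF s, of 0 b0] cmod_shift_le[OF s, of 1 b1] cmod_shift_le[OF s, of 2 b2] b by (intro mult_mono) auto

locale low_zero =
  fixes s :: complex
  assumes Re_s: "1 / 2 < Re s" "Re s < 1" and Im_s: "14 / 100 \<le> Im s" "Im s \<le> 802 / 100" and zero: "zeta s = 0"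
begin

abbreviation cubic_norm :: real where "cubic_norm \<equiv> norm (s * (s + 1) * (s + 2))"

definition dist_sq :: real where "dist_sq = (1 - Re s)^2 + (Im s)^2"

lemma cubic_norm_le:
  assumes "Im s \<le> T" "1 + T^2 \<le> b0^2" "4 + T^2 \<le> b1^2" "9 + T^2 \<le> b2^2" "0 \<le> b0" "0 \<le> b1" "0 \<le> b2"
  shows "cubic_norm \<le> b0 * b1 * b2"
  using assms Re_s Im_s by (intro cubic_le[of s T]) auto

lemma dist_sq_pos: "dist_sq > 0" unfolding dist_sq_def using Im_s by (simp add: add_nonneg_pos)

lemma dist_sq_le:
  assumes "Im s \<le> T"
  shows "dist_sq \<le> 1 / 4 + T^2"
proof -
  have "(Im s)^2 \<le> T^2" "(1 - Re s)^2 \<le> (1/2)^2" using assms Re_s Im_s by (auto intro: power_mono)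
  thus ?thesis unfolding dist_sq_def power_divide by simp
qed

lemma inverse_parts: "Re (1 / (s - 1)) = - ((1 - Re s) / dist_sq)" "Im (1 / (s - 1)) = - (Im s / dist_sq)"
proof -
  have norm_sq: "(Re (s - 1))^2 + (Im (s - 1))^2 = dist_sq" by (simp add: dist_sq_def power2_commute)
  have "Re (1 / (s - 1)) = Re (s - 1) / dist_sq" "Im (1 / (s - 1)) = - Im (s - 1) / dist_sq"
    unfolding Re_divide Im_divide norm_sq by simp_all
  moreover have "Re (s - 1) = - (1 - Re s)" by simp
  ultimately show "Re (1 / (s - 1)) = - ((1 - Re s) / dist_sq)" "Im (1 / (s - 1)) = - (Im s / dist_sq)"
    by (simp_all only: divide_minus_left) simp
qed

lemma error_sum_le:
  assumes N: "N \<ge> 1"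
  shows "norm (\<Sum>i. euler_maclaurin_error (i + N) s) \<le> cubic_norm / 300 * real N powr (- Re s - 2)"
proof -
  have "cubic_norm / (120 * (Re s + 2)) \<le> cubic_norm / 300" using Re_s by (intro divide_left_mono) auto
  hence "cubic_norm / (120 * (Re s + 2)) * real N powr (- Re s - 2) \<le> cubic_norm / 300 * real N powr (- Re s - 2)"
    by (intro mult_right_mono) auto
  moreover have "Re s > 0" "s \<noteq> 1" using Re_s by auto
  ultimately show ?thesis using euler_maclaurin_error_summable(2)[OF N] order_trans by blast
qed

lemma Im_main_term_le: "Im s * (1 / dist_sq - 1 / 12) \<le> cubic_norm / 300"
proof -
  have "(\<Sum>i. euler_maclaurin_error (i + 1) s) = - (1 / (s - 1) + 1 / 2 + s / 12)"
    using zeta_euler_maclaurin(1)[of s] zero Re_s Im_s by (simp add: euler_maclaurin_main_def add_eq_0_iff)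
  hence "norm (1 / (s - 1) + 1 / 2 + s / 12) \<le> cubic_norm / 300" using error_sum_le[of 1] by (simp only: norm_minus_cancel) simp
  hence "\<bar>Im (1 / (s - 1) + 1 / 2 + s / 12)\<bar> \<le> cubic_norm / 300"
    using abs_Im_le_cmod[of "1 / (s - 1) + 1 / 2 + s / 12"] by linarith
  hence "\<bar>- (Im s / dist_sq) + Im s / 12\<bar> \<le> cubic_norm / 300" using inverse_parts(2) by simp
  moreover have "Im s * (1 / dist_sq - 1 / 12) = Im s / dist_sq - Im s / 12" by (simp add: right_diff_distrib)
  ultimately show ?thesis by linarith
qed

lemma height_gt_2: "Im s > 2"
proof (rule ccontr)
  assume "\<not> Im s > 2"
  then consider (low) "Im s \<le> 1" | (middle) "1 \<le> Im s" "Im s \<le> 2" by linarith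
  thus False
  proof cases
    case low
    have "1 / (5/4) \<le> 1 / dist_sq" using dist_sq_le[OF low] dist_sq_pos by (intro divide_left_mono) auto
    hence "14/100 * (7/10) \<le> Im s * (1 / dist_sq - 1 / 12)" using Im_s by (intro mult_mono) auto
    moreover have "cubic_norm \<le> 1415/1000 * (2237/1000) * (3163/1000)" by (rule cubic_norm_le[OF low]) (auto simp: power2_eq_square)
    ultimately show False using Im_main_term_le by simp
  next
    case middle
    have "1 / (17/4) \<le> 1 / dist_sq" using dist_sq_le[OF middle(2)] dist_sq_pos by (intro divide_left_mono) auto
    hence "1 * (15/100) \<le> Im s * (1 / dist_sq - 1 / 12)" using middle by (intro mult_mono) auto
    moreover have "cubic_norm \<le> 2237/1000 * (2829/1000) * (3606/1000)" by (rule cubic_norm_le[OF middle(2)]) (auto simp: power2_eq_square)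
    ultimately show False using Im_main_term_le by simp
  qed
qed

definition main_factor :: complex where "main_factor = 2 * (1 / (s - 1)) + 1 / 2 + s / 24"

lemma two_powr_Re_le: "2 powr (- Re s) \<le> 7072/10000"
proof -
  have "2 powr (- Re s) \<le> 2 powr (- (1/2))" using Re_s by (intro powr_mono) auto
  also have "... = 1 / sqrt 2" by (simp add: powr_minus_divide powr_half_sqrt)
  also have "... \<le> 7072/10000"
  proof -
    have "10000/7072 \<le> sqrt 2" by (rule real_le_rsqrt) (simp add: power2_eq_square)
    thus ?thesis by (simp add: field_simps)
  qed
  finally show ?thesis .
qed

lemma main_term_2_ge: "norm main_factor + cubic_norm / 1200 \<ge> 10000/7072"
proof -
  define k where "k = (2::real) powr (- Re s)"
  have "2 powr (1 - s) = 2 * 2 powr (- s)" "2 powr (- s - 1) = 2 powr (- s) / (2::complex)"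
    by (simp_all add: powr_diff powr_minus divide_simps)
  hence "euler_maclaurin_main 2 s = 2 powr (- s) * main_factor" by (simp add: euler_maclaurin_main_def main_factor_def algebra_simps)
  hence "(\<Sum>i. euler_maclaurin_error (i + 2) s) = - (1 + 2 powr (- s) * main_factor)"
    using zeta_euler_maclaurin(2)[of s] zero Re_s Im_s by (simp add: add_eq_0_iff)
  hence "norm (1 + 2 powr (- s) * main_factor) \<le> cubic_norm / 300 * 2 powr (- Re s - 2)" using error_sum_le[of 2]
    by (simp only: norm_minus_cancel) simp
  moreover have "(2::real) powr (- Re s - 2) = k / 4" by (simp add: k_def powr_diff)
  moreover have "norm (1 + 2 powr (- s) * main_factor) \<ge> 1 - k * norm main_factor"
  proof -
    have "norm (2 powr (- s) * main_factor) = k * norm main_factor" using norm_powr_real_powr[of 2 "- s"] by (simp add: norm_mult k_def)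
    thus ?thesis using norm_triangle_ineq2[of 1 "- (2 powr (- s) * main_factor)"] by simp
  qed
  ultimately have "1 \<le> k * (norm main_factor + cubic_norm / 1200)" by (simp add: algebra_simps)
  also have "... \<le> 7072/10000 * (norm main_factor + cubic_norm / 1200)" using two_powr_Re_le by (intro mult_right_mono) (auto simp: k_def)
  finally show ?thesis by simp
qed

lemma abs_Re_main_factor_le: "\<bar>Re main_factor\<bar> \<le> 542/1000"
proof -
  have "dist_sq \<ge> 4" using height_gt_2 power_mono[of 2 "Im s" 2] by (simp add: dist_sq_def add_increasing)
  hence "0 \<le> (1 - Re s) / dist_sq" "(1 - Re s) / dist_sq \<le> (1/2) / 4" using Re_s by (auto intro!: divide_nonneg_pos frac_le)
  moreover have "Re (2 * (1 / (s - 1))) = 2 * Re (1 / (s - 1))" by (simp only: times_complex.sel) simp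
  hence "Re main_factor = 1 / 2 + Re s / 24 + 2 * Re (1 / (s - 1))" unfolding main_factor_def plus_complex.sel by simp
  ultimately show ?thesis using inverse_parts(1) Re_s by linarith
qed

lemma Im_main_factor_bounds: "Im s / 24 - 2 / Im s \<le> Im main_factor" "Im main_factor \<le> Im s / 24"
proof -
  have "Im s / dist_sq \<le> Im s / (Im s)^2" using dist_sq_pos Im_s by (intro divide_left_mono mult_pos_pos) (auto simp: dist_sq_def)
  hence "Im s / dist_sq \<le> 1 / Im s" using Im_s by (simp add: power2_eq_square)
  moreover have "0 \<le> Im s / dist_sq" using Im_s dist_sq_pos by simp
  moreover have "Im (2 * (1 / (s - 1))) = 2 * Im (1 / (s - 1))" by (simp only: times_complex.sel) simp
  hence "Im main_factor = Im s / 24 + 2 * Im (1 / (s - 1))" unfolding main_factor_def plus_complex.sel by simp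
  ultimately show "Im s / 24 - 2 / Im s \<le> Im main_factor" "Im main_factor \<le> Im s / 24" using inverse_parts(2) by linarith+
qed

lemma norm_main_factor_le:
  assumes "\<bar>Im main_factor\<bar> \<le> a" "(542/1000)^2 + a^2 \<le> b^2" "0 \<le> b"
  shows "norm main_factor \<le> b"
proof -
  have "(norm main_factor)^2 = (Re main_factor)^2 + (Im main_factor)^2" by (simp add: cmod_power2)
  also have "... \<le> (542/1000)^2 + a^2" using abs_Re_main_factor_le assms(1) by (intro add_mono) (auto simp: abs_le_square_iff[symmetric])
  finally have "(norm main_factor)^2 \<le> b^2" using assms(2) by linarith
  thus ?thesis by (rule power2_le_imp_le[OF _ assms(3)])
qed

lemma low_zero_impossible: False
proof (cases "Im s \<le> 4")
  case True
  have "2 / Im s \<le> 2 / 2" using height_gt_2 by (intro divide_left_mono) auto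
  hence "\<bar>Im main_factor\<bar> \<le> 1" using Im_main_factor_bounds height_gt_2 True by linarith
  hence "norm main_factor \<le> 114/100" by (rule norm_main_factor_le) (auto simp: power2_eq_square)
  moreover have "cubic_norm \<le> 4124/1000 * (4473/1000) * 5" by (rule cubic_norm_le[OF True]) (auto simp: power2_eq_square)
  ultimately show False using main_term_2_ge by simp
next
  case False
  have "2 / Im s \<le> 2 / 4" using False by (intro divide_left_mono) auto
  hence "\<bar>Im main_factor\<bar> \<le> 1/2" using Im_main_factor_bounds Im_s False by linarith
  hence "norm main_factor \<le> 74/100" by (rule norm_main_factor_le) (auto simp: power2_eq_square)
  moreover have "cubic_norm \<le> 8083/1000 * (8266/1000) * (8563/1000)" by (rule cubic_norm_le[OF Im_s(2)]) (auto simp: power2_eq_square)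
  ultimately show False using main_term_2_ge by simp
qed

end

lemma zeta_nonzero_low:
  assumes "1 / 2 < Re s" "Re s < 1" "14 / 100 \<le> Im s" "Im s \<le> 802 / 100"
  shows "zeta s \<noteq> 0"
  using low_zero.low_zero_impossible[of s] assms by (auto simp: low_zero_def)

lemma first_zero_off_line:
  assumes \<sigma>: "1 / 2 < \<sigma>" "\<sigma> < 1" and \<xi>: "\<xi> = 0 \<or> \<xi> = pi" and params: "admissible_params \<xi> \<gamma> d \<theta>"
    and B_le: "\<And>w. B_mult \<sigma> \<gamma> d \<theta> 1 w \<le> zeta_zero_mult w"
  shows "d 1 > 0"
proof (rule ccontr)
  assume "\<not> d 1 > 0"
  have first: "exp 1 \<le> \<gamma> 1" "\<gamma> 1 \<le> 2 * exp 1" "\<bar>d 1 - 1\<bar> \<le> 1" "\<bar>\<theta> 1 - (\<xi> - pi / 2)\<bar> \<le> 1"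
    using params by (auto simp: admissible_params_def)
  define w where "w = rho \<sigma> \<gamma> d \<theta> 1 1"
  have w: "Re w = \<sigma>" "Im w = \<gamma> 1 + \<theta> 1" using first(3) \<open>\<not> d 1 > 0\<close> by (simp_all add: w_def rho_def)
  have "(1, 1) \<in> {(j, k). 1 \<le> j \<and> 1 \<le> k \<and> k \<le> j ^ 3 \<and> rho \<sigma> \<gamma> d \<theta> j k = w}" by (simp add: w_def)
  hence "(case (1, 1) of (j, k) \<Rightarrow> k * (j ^ 3 + 1 - k)) \<le> B_mult \<sigma> \<gamma> d \<theta> 1 w"
    unfolding B_mult_def by (intro member_le_sum finite_rho_fibre[OF params]) auto
  hence "zeta_zero_mult w > 0" using B_le[of w] by simp
  hence "zeta w = 0" by (simp add: zeta_zero_mult_pos_iff)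
  moreover have "14 / 100 \<le> Im w \<and> Im w \<le> 802 / 100"
  proof -
    have "inverse (2 ^ 32) \<le> (1 / 1000 :: real)" by simp
    hence "2717 / 1000 \<le> exp (1::real)" "exp (1::real) \<le> 272 / 100" using e_approx_32 by linarith+
    moreover have "3141 / 1000 \<le> pi" "pi \<le> 3142 / 1000" using pi_approx by simp_all
    ultimately show ?thesis using \<xi> first(1,2,4) w(2) by (elim disjE) linarith+
  qed
  ultimately show False using zeta_nonzero_low[of w] \<sigma> w by simp
qed

theorem theorem1p2:
  fixes \<sigma> \<delta> A :: real
  assumes "1 / 2 < \<sigma>" and "\<sigma> < 1"
    and "0 < \<delta>" and "\<delta> < \<sigma> - 1 / 2"
    and "A > 0"
  shows "(\<forall>B. is_B 0 \<sigma> \<delta> A B \<and>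
              (\<forall>\<rho>. B \<rho> \<le> zeta_zero_mult \<rho>) \<and>
              (\<forall>s. Re s \<ge> \<sigma> - \<delta> \<and> Im s \<ge> 0 \<longrightarrow> zeta_zero_mult s \<le> B s)
            \<longrightarrow> ((\<lambda>X. measure lebesgue (P1 \<inter> {2..X}) / X) \<longlongrightarrow> 0) at_top)
       \<and> (\<forall>B. is_B pi \<sigma> \<delta> A B \<and>
              (\<forall>\<rho>. B \<rho> \<le> zeta_zero_mult \<rho>) \<and>
              (\<forall>s. Re s \<ge> \<sigma> - \<delta> \<and> Im s \<ge> 0 \<longrightarrow> zeta_zero_mult s \<le> B s)
            \<longrightarrow> ((\<lambda>X. measure lebesgue (P1 \<inter> {2..X}) / X) \<longlongrightarrow> 1) at_top)"
proof -
  have "((\<lambda>X. measure lebesgue (P1 \<inter> {2..X}) / X) \<longlongrightarrow> (if \<xi> = 0 then 0 else 1)) at_top"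
    if \<xi>: "\<xi> = 0 \<or> \<xi> = pi" and B: "is_B \<xi> \<sigma> \<delta> A B" "\<forall>\<rho>. B \<rho> \<le> zeta_zero_mult \<rho>"
      "\<forall>s. Re s \<ge> \<sigma> - \<delta> \<and> Im s \<ge> 0 \<longrightarrow> zeta_zero_mult s \<le> B s" for \<xi> :: real and B
  proof -
    obtain \<gamma> d \<theta> j0 where params: "admissible_params \<xi> \<gamma> d \<theta>" "j0 \<ge> 1" "\<forall>j\<ge>j0. \<gamma> j > A \<and> d j \<le> \<delta>" "B = B_mult \<sigma> \<gamma> d \<theta> j0"
      using B(1) unfolding is_B_def by blast
    have "d 1 > 0" if "j0 = 1"
      using assms \<xi> params B that by (intro first_zero_off_line[of \<sigma> \<xi> \<gamma> d \<theta>]) auto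
    hence "\<exists>J c \<eta>. race_zeros \<sigma> \<xi> \<gamma> d \<theta> J c \<eta>"
      using assms \<xi> params B by (intro race_zeros_exist[of \<sigma> \<delta> \<xi> \<gamma> d \<theta> j0]) auto
    thus ?thesis using race_zeros.P1_density by blast
  qed
  from this[of 0] this[of pi] show ?thesis by auto
qed

end
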